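(* Let $G=\langle x_1,\dots,x_n\mid r\rangle$ be a group defined by a single relator $r\in\Gamma_2\mathbf{F}_n$, where $\mathbf{F}_n$ is the free group on $x_1,\dots,x_n$. Denote by $\overline r\in\mathbf{L}^2(y_1,\dots,y_n)$ the class of $r$ modulo $\Gamma_3\mathbf{F}_n$, and assume that $\overline r\not\equiv0$ modulo $p$ for every prime $p$. If $G$ is $1$-formal, then $$\operatorname{gr}(G/G'')=\mathbf{L}(y_1,\dots,y_n)\big/\big(\text{ideal}(\overline r)+\mathbf{L}''(y_1,\dots,y_n)\big)$$ as graded $\mathbb{Z}$-Lie algebras. Moreover, $\operatorname{gr}(G/G'')$ is torsion-free as a graded abelian group, and its Hilbert series $\sum_{k\ge1}\theta_kt^k$, with $\theta_k=\operatorname{rank}\operatorname{gr}_k(G/G'')$, is $$\operatorname{Hilb}(\operatorname{gr}(G/G''),t)=1+nt-\frac{1-nt+t^2}{(1-t)^n}.$$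
   Context: For a group $G$: $\Gamma_1G=G$, $\Gamma_{k+1}G=(\Gamma_kG,G)$; $G'=(G,G)$, $G''=(G',G')$; $\operatorname{gr}(G)=\bigoplus_{k\ge1}\Gamma_kG/\Gamma_{k+1}G$ with bracket induced by the commutator $(x,y)=xyx^{-1}y^{-1}$. $\mathbf{L}(y_1,\dots,y_n)$ is the free $\mathbb{Z}$-Lie algebra on $y_1,\dots,y_n$ in degree $1$, graded by bracket length; $\operatorname{gr}(\mathbf{F}_n)=\mathbf{L}(y_1,\dots,y_n)$, with $y_i$ the class of $x_i$, so $\Gamma_2\mathbf{F}_n/\Gamma_3\mathbf{F}_n=\mathbf{L}^2(y_1,\dots,y_n)$, a free abelian group. $\mathbf{L}''$ is the second derived subalgebra of $\mathbf{L}$. $1$-formality: for $G$ finitely presented, $\mathfrak{H}(G;\mathbb{Q})=\mathbf{L}^*(H_1(G;\mathbb{Q}))/\text{ideal}(\operatorname{im}\partial)$, where $\mathbf{L}^*$ is the free Lie algebra (generators in degree $1$) and $\partial\colon H_2(G;\mathbb{Q})\to\bigwedge^2H_1(G;\mathbb{Q})=\mathbf{L}^2(H_1(G;\mathbb{Q}))$ is dual to the cup product $\bigwedge^2H^1(G;\mathbb{Q})\to H^2(G;\mathbb{Q})$. Let $M_G$ be the Malcev Lie algebra of $G$, i.e. the filtered Lie algebra of primitive elements of the completed Hopf algebra $\widehat{\mathbb{Q}G}=\varprojlim_r\mathbb{Q}G/I^r$, $I$ the augmentation ideal, $\Delta(g)=g\otimes g$. $G$ is $1$-formal if $M_G$ is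 isomorphic, as a filtered Lie algebra, to the completion of $\mathfrak{H}(G;\mathbb{Q})$ with respect to bracket length. *)

theory Defs
  imports
    "HOL-Algebra.Algebra"
    "HOL-Algebra.Algebraic_Closure_Type"
    "HOL-Library.Poly_Mapping"
    "HOL-Computational_Algebra.Formal_Power_Series"
begin

section \<open>Groups\<close>

text \<open>The free group on \<open>S\<close> consists of the reduced words in letters \<open>(x, b)\<close>; the letter
  \<open>(x, True)\<close> stands for \<open>x\<close> and \<open>(x, False)\<close> for its inverse.\<close>

fun reduced :: "('v \<times> bool) list \<Rightarrow> bool" where
  "reduced (a # b # w) \<longleftrightarrow> \<not> (fst a = fst b \<and> snd a \<noteq> snd b) \<and> reduced (b # w)"
| "reduced _ \<longleftrightarrow> True"

fun cancel_Cons :: "'v \<times> bool \<Rightarrow> ('v \<times> bool) list \<Rightarrow> ('v \<times> bool) list" where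
  "cancel_Cons a [] = [a]"
| "cancel_Cons a (b # w) = (if fst a = fst b \<and> snd a \<noteq> snd b then w else a # b # w)"

definition free_group :: "'v set \<Rightarrow> ('v \<times> bool) list monoid" where
  "free_group S =
    \<lparr>carrier = {w. reduced w \<and> fst ` set w \<subseteq> S}, monoid.mult = foldr cancel_Cons, one = []\<rparr>"

definition free_gen :: "'v \<Rightarrow> ('v \<times> bool) list" where
  "free_gen x = [(x, True)]"

definition normal_closure :: "('g, 'm) monoid_scheme \<Rightarrow> 'g set \<Rightarrow> 'g set" where
  "normal_closure G S = \<Inter>{N. N \<lhd> G \<and> S \<subseteq> N}"

definition one_relator_group :: "nat \<Rightarrow> (nat \<times> bool) list \<Rightarrow> (nat \<times> bool) list set monoid" where
  "one_relator_group n r = free_group {1..n} Mod normal_closure (free_group {1..n}) {r}"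

definition one_relator_gen ::
  "nat \<Rightarrow> (nat \<times> bool) list \<Rightarrow> nat \<Rightarrow> (nat \<times> bool) list set" where
  "one_relator_gen n r i =
    normal_closure (free_group {1..n}) {r} #>\<^bsub>free_group {1..n}\<^esub> free_gen i"

definition commutator :: "('g, 'm) monoid_scheme \<Rightarrow> 'g \<Rightarrow> 'g \<Rightarrow> 'g" where
  "commutator G x y = x \<otimes>\<^bsub>G\<^esub> y \<otimes>\<^bsub>G\<^esub> inv\<^bsub>G\<^esub> x \<otimes>\<^bsub>G\<^esub> inv\<^bsub>G\<^esub> y"

text \<open>\<open>lower_central G k\<close> is \<open>\<Gamma>\<^sub>k G\<close> for \<open>k \<ge> 1\<close>.\<close>

fun lower_central :: "('g, 'm) monoid_scheme \<Rightarrow> nat \<Rightarrow> 'g set" where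
  "lower_central G 0 = carrier G"
| "lower_central G (Suc 0) = carrier G"
| "lower_central G (Suc (Suc k)) =
    generate G {commutator G x y | x y. x \<in> lower_central G (Suc k) \<and> y \<in> carrier G}"

definition second_derived :: "('g, 'm) monoid_scheme \<Rightarrow> 'g set" where
  "second_derived G = derived G (derived G (carrier G))"

definition torsion_free_group :: "('g, 'm) monoid_scheme \<Rightarrow> bool" where
  "torsion_free_group A \<longleftrightarrow>
    (\<forall>a\<in>carrier A. \<forall>m::nat. 0 < m \<longrightarrow> a [^]\<^bsub>A\<^esub> m = \<one>\<^bsub>A\<^esub> \<longrightarrow> a = \<one>\<^bsub>A\<^esub>)"

definition int_independent :: "('g, 'm) monoid_scheme \<Rightarrow> 'g set \<Rightarrow> bool" where
  "int_independent A B \<longleftrightarrow> finite B \<and> B \<subseteq> carrier A \<and>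
    (\<forall>c :: 'g \<Rightarrow> int. finprod A (\<lambda>b. b [^]\<^bsub>A\<^esub> c b) B = \<one>\<^bsub>A\<^esub> \<longrightarrow> (\<forall>b\<in>B. c b = 0))"

text \<open>Meaningful for abelian groups of finite rank.\<close>

definition ab_rank :: "('g, 'm) monoid_scheme \<Rightarrow> nat" where
  "ab_rank A = Sup (card ` {B. int_independent A B})"


section \<open>Algebras\<close>

text \<open>A (not necessarily associative) algebra over the commutative ring \<open>'r\<close> is a \<^typ>\<open>('r, 'a) module\<close>
  record whose \<open>mult\<close> field is the bilinear product. For a Lie algebra, \<open>mult\<close> is the Lie bracket;
  its \<open>one\<close> field, like the \<open>mult\<close> and \<open>one\<close> fields of a bare module, has no meaning.\<close>

definition lin_span :: "('r::comm_ring_1, 'a) module \<Rightarrow> 'a set \<Rightarrow> 'a set" where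
  "lin_span A S = \<Inter>{H. submodule H ring_of_type_algebra A \<and> S \<subseteq> H}"

definition alg_ideal :: "('r::comm_ring_1, 'a) module \<Rightarrow> 'a set \<Rightarrow> 'a set" where
  "alg_ideal A S = \<Inter>{J. submodule J ring_of_type_algebra A \<and>
     (\<forall>a\<in>carrier A. \<forall>x\<in>J. a \<otimes>\<^bsub>A\<^esub> x \<in> J \<and> x \<otimes>\<^bsub>A\<^esub> a \<in> J) \<and> S \<subseteq> J}"

definition alg_quot :: "('r, 'a) module \<Rightarrow> 'a set \<Rightarrow> ('r, 'a set) module" where
  "alg_quot A J = ring.extend (A Quot J)
     (module.fields (\<lambda>c B. \<Union>x\<in>B. J +>\<^bsub>A\<^esub> (c \<odot>\<^bsub>A\<^esub> x)))"

definition alg_hom :: "('r, 'a) module \<Rightarrow> ('r, 'b) module \<Rightarrow> ('a \<Rightarrow> 'b) set" where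
  "alg_hom A B = {f \<in> carrier A \<rightarrow> carrier B.
     (\<forall>x\<in>carrier A. \<forall>y\<in>carrier A. f (x \<oplus>\<^bsub>A\<^esub> y) = f x \<oplus>\<^bsub>B\<^esub> f y) \<and>
     (\<forall>c. \<forall>x\<in>carrier A. f (c \<odot>\<^bsub>A\<^esub> x) = c \<odot>\<^bsub>B\<^esub> f x) \<and>
     (\<forall>x\<in>carrier A. \<forall>y\<in>carrier A. f (x \<otimes>\<^bsub>A\<^esub> y) = f x \<otimes>\<^bsub>B\<^esub> f y)}"

definition alg_iso :: "('r, 'a) module \<Rightarrow> ('r, 'b) module \<Rightarrow> ('a \<Rightarrow> 'b) set" where
  "alg_iso A B = {f \<in> alg_hom A B. bij_betw f (carrier A) (carrier B)}"

definition alg_derived :: "('r::comm_ring_1, 'a) module \<Rightarrow> 'a set \<Rightarrow> 'a set" where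
  "alg_derived A S = lin_span A {a \<otimes>\<^bsub>A\<^esub> b | a b. a \<in> S \<and> b \<in> S}"

text \<open>Products of \<open>k\<close> elements of \<open>Y\<close> in all arrangements of brackets.\<close>

inductive_set monomials :: "('r, 'a) module \<Rightarrow> 'a set \<Rightarrow> (nat \<times> 'a) set"
  for A Y where
  gen: "y \<in> Y \<Longrightarrow> (1, y) \<in> monomials A Y"
| mult: "(i, a) \<in> monomials A Y \<Longrightarrow> (j, b) \<in> monomials A Y \<Longrightarrow>
    (i + j, a \<otimes>\<^bsub>A\<^esub> b) \<in> monomials A Y"

definition length_part :: "('r::comm_ring_1, 'a) module \<Rightarrow> 'a set \<Rightarrow> nat \<Rightarrow> 'a set" where
  "length_part A Y k = lin_span A {a. (k, a) \<in> monomials A Y}"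

definition length_filtration :: "('r::comm_ring_1, 'a) module \<Rightarrow> 'a set \<Rightarrow> nat \<Rightarrow> 'a set" where
  "length_filtration A Y k = lin_span A {a. \<exists>j\<ge>k. (j, a) \<in> monomials A Y}"

text \<open>The completion of \<open>A\<close> with respect to a descending filtration \<open>F\<close> by ideals is the inverse
  limit of the algebras \<open>A/F\<^sub>r\<close>; a compatible sequence of cosets is a descending one.
  It is filtered by the kernels of the projections to \<open>A/F\<^sub>k\<close>.\<close>

definition completion :: "('r, 'a) module \<Rightarrow> (nat \<Rightarrow> 'a set) \<Rightarrow> ('r, nat \<Rightarrow> 'a set) module" where
  "completion A F =
    \<lparr>carrier = {s. \<forall>r. s r \<in> carrier (alg_quot A (F r)) \<and> s (Suc r) \<subseteq> s r},
     monoid.mult = (\<lambda>s t r. s r \<otimes>\<^bsub>alg_quot A (F r)\<^esub> t r),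
     one = (\<lambda>r. \<one>\<^bsub>alg_quot A (F r)\<^esub>),
     ring.zero = (\<lambda>r. \<zero>\<^bsub>alg_quot A (F r)\<^esub>),
     ring.add = (\<lambda>s t r. s r \<oplus>\<^bsub>alg_quot A (F r)\<^esub> t r),
     module.smult = (\<lambda>c s r. c \<odot>\<^bsub>alg_quot A (F r)\<^esub> s r)\<rparr>"

definition completion_filtration ::
  "('r, 'a) module \<Rightarrow> (nat \<Rightarrow> 'a set) \<Rightarrow> nat \<Rightarrow> (nat \<Rightarrow> 'a set) set" where
  "completion_filtration A F k =
    {s \<in> carrier (completion A F). s k = \<zero>\<^bsub>alg_quot A (F k)\<^esub>}"

definition filtered_alg_isomorphic ::
  "('r, 'a) module \<Rightarrow> (nat \<Rightarrow> 'a set) \<Rightarrow> ('r, 'b) module \<Rightarrow> (nat \<Rightarrow> 'b set) \<Rightarrow> bool" where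
  "filtered_alg_isomorphic A F B F' \<longleftrightarrow> (\<exists>f\<in>alg_iso A B. \<forall>k. f ` F k = F' k)"


section \<open>Free Lie algebras\<close>

datatype (dead 'r, gens: 'v) lie_term =
  Gen 'v
| Zero
| Add "('r, 'v) lie_term" "('r, 'v) lie_term"
| Smult 'r "('r, 'v) lie_term"
| Bracket "('r, 'v) lie_term" "('r, 'v) lie_term"

definition lie_terms :: "'v set \<Rightarrow> ('r, 'v) lie_term set" where
  "lie_terms S = {t. gens t \<subseteq> S}"

text \<open>The least congruence on terms over \<open>S\<close> that contains the relations \<open>E\<close> and whose quotient is a
  Lie algebra.\<close>

inductive lie_cong ::
  "'v set \<Rightarrow> (('r::comm_ring_1, 'v) lie_term \<times> ('r, 'v) lie_term) set \<Rightarrow>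
   ('r, 'v) lie_term \<Rightarrow> ('r, 'v) lie_term \<Rightarrow> bool"
  for S E where
  rel: "(s, t) \<in> E \<Longrightarrow> s \<in> lie_terms S \<Longrightarrow> t \<in> lie_terms S \<Longrightarrow> lie_cong S E s t"
| refl: "s \<in> lie_terms S \<Longrightarrow> lie_cong S E s s"
| sym: "lie_cong S E s t \<Longrightarrow> lie_cong S E t s"
| trans: "lie_cong S E s t \<Longrightarrow> lie_cong S E t u \<Longrightarrow> lie_cong S E s u"
| cong_Add: "lie_cong S E s s' \<Longrightarrow> lie_cong S E t t' \<Longrightarrow> lie_cong S E (Add s t) (Add s' t')"
| cong_Smult: "lie_cong S E s s' \<Longrightarrow> lie_cong S E (Smult c s) (Smult c s')"
| cong_Bracket: "lie_cong S E s s' \<Longrightarrow> lie_cong S E t t' \<Longrightarrow>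
    lie_cong S E (Bracket s t) (Bracket s' t')"
| Add_assoc: "s \<in> lie_terms S \<Longrightarrow> t \<in> lie_terms S \<Longrightarrow> u \<in> lie_terms S \<Longrightarrow>
    lie_cong S E (Add (Add s t) u) (Add s (Add t u))"
| Add_comm: "s \<in> lie_terms S \<Longrightarrow> t \<in> lie_terms S \<Longrightarrow> lie_cong S E (Add s t) (Add t s)"
| Add_Zero: "s \<in> lie_terms S \<Longrightarrow> lie_cong S E (Add s Zero) s"
| Smult_zero: "s \<in> lie_terms S \<Longrightarrow> lie_cong S E (Smult 0 s) Zero"
| Smult_one: "s \<in> lie_terms S \<Longrightarrow> lie_cong S E (Smult 1 s) s"
| Smult_mult: "s \<in> lie_terms S \<Longrightarrow> lie_cong S E (Smult (c * d) s) (Smult c (Smult d s))"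
| Smult_add: "s \<in> lie_terms S \<Longrightarrow> lie_cong S E (Smult (c + d) s) (Add (Smult c s) (Smult d s))"
| Smult_Add: "s \<in> lie_terms S \<Longrightarrow> t \<in> lie_terms S \<Longrightarrow>
    lie_cong S E (Smult c (Add s t)) (Add (Smult c s) (Smult c t))"
| Bracket_Add_left: "s \<in> lie_terms S \<Longrightarrow> t \<in> lie_terms S \<Longrightarrow> u \<in> lie_terms S \<Longrightarrow>
    lie_cong S E (Bracket (Add s t) u) (Add (Bracket s u) (Bracket t u))"
| Bracket_Add_right: "s \<in> lie_terms S \<Longrightarrow> t \<in> lie_terms S \<Longrightarrow> u \<in> lie_terms S \<Longrightarrow>
    lie_cong S E (Bracket s (Add t u)) (Add (Bracket s t) (Bracket s u))"
| Bracket_Smult_left: "s \<in> lie_terms S \<Longrightarrow> t \<in> lie_terms S \<Longrightarrow>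
    lie_cong S E (Bracket (Smult c s) t) (Smult c (Bracket s t))"
| Bracket_Smult_right: "s \<in> lie_terms S \<Longrightarrow> t \<in> lie_terms S \<Longrightarrow>
    lie_cong S E (Bracket s (Smult c t)) (Smult c (Bracket s t))"
| alternating: "s \<in> lie_terms S \<Longrightarrow> lie_cong S E (Bracket s s) Zero"
| jacobi: "s \<in> lie_terms S \<Longrightarrow> t \<in> lie_terms S \<Longrightarrow> u \<in> lie_terms S \<Longrightarrow>
    lie_cong S E
      (Add (Add (Bracket s (Bracket t u)) (Bracket t (Bracket u s))) (Bracket u (Bracket s t))) Zero"

definition lie_class ::
  "'v set \<Rightarrow> (('r::comm_ring_1, 'v) lie_term \<times> ('r, 'v) lie_term) set \<Rightarrow>
   ('r, 'v) lie_term \<Rightarrow> ('r, 'v) lie_term set" where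
  "lie_class S E t = {s. lie_cong S E t s}"

definition presented_lie ::
  "'v set \<Rightarrow> (('r::comm_ring_1, 'v) lie_term \<times> ('r, 'v) lie_term) set \<Rightarrow>
   ('r, ('r, 'v) lie_term set) module" where
  "presented_lie S E =
    \<lparr>carrier = lie_class S E ` lie_terms S,
     monoid.mult = (\<lambda>a b. \<Union>s\<in>a. \<Union>t\<in>b. lie_class S E (Bracket s t)),
     one = lie_class S E Zero,
     ring.zero = lie_class S E Zero,
     ring.add = (\<lambda>a b. \<Union>s\<in>a. \<Union>t\<in>b. lie_class S E (Add s t)),
     module.smult = (\<lambda>c a. \<Union>s\<in>a. lie_class S E (Smult c s))\<rparr>"

definition free_lie :: "'v set \<Rightarrow> ('r::comm_ring_1, ('r, 'v) lie_term set) module" where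
  "free_lie S = presented_lie S {}"

definition free_lie_gen :: "'v set \<Rightarrow> 'v \<Rightarrow> ('r::comm_ring_1, 'v) lie_term set" where
  "free_lie_gen S x = lie_class S {} (Gen x)"

text \<open>\<open>\<^bold>L\<^sup>*(V)\<close>: the generators are the vectors of \<open>V\<close>, and the relations make the
  inclusion of \<open>V\<close> linear.\<close>

definition linear_relations ::
  "('r::comm_ring_1, 'v) module \<Rightarrow> (('r, 'v) lie_term \<times> ('r, 'v) lie_term) set" where
  "linear_relations V =
    {(Gen (v \<oplus>\<^bsub>V\<^esub> w), Add (Gen v) (Gen w)) | v w. v \<in> carrier V \<and> w \<in> carrier V} \<union>
    {(Gen (c \<odot>\<^bsub>V\<^esub> v), Smult c (Gen v)) | c v. v \<in> carrier V}"

definition free_lie_on ::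
  "('r::comm_ring_1, 'v) module \<Rightarrow> ('r, ('r, 'v) lie_term set) module" where
  "free_lie_on V = presented_lie (carrier V) (linear_relations V)"

definition free_lie_on_vec ::
  "('r::comm_ring_1, 'v) module \<Rightarrow> 'v \<Rightarrow> ('r, 'v) lie_term set" where
  "free_lie_on_vec V v = lie_class (carrier V) (linear_relations V) (Gen v)"

primrec lie_eval :: "('r, 'a) module \<Rightarrow> ('v \<Rightarrow> 'a) \<Rightarrow> ('r, 'v) lie_term \<Rightarrow> 'a" where
  "lie_eval L g (Gen v) = g v"
| "lie_eval L g Zero = \<zero>\<^bsub>L\<^esub>"
| "lie_eval L g (Add s t) = lie_eval L g s \<oplus>\<^bsub>L\<^esub> lie_eval L g t"
| "lie_eval L g (Smult c s) = c \<odot>\<^bsub>L\<^esub> lie_eval L g s"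
| "lie_eval L g (Bracket s t) = lie_eval L g s \<otimes>\<^bsub>L\<^esub> lie_eval L g t"

text \<open>For a Lie algebra \<open>L\<close> and \<open>g\<close> mapping \<open>S\<close> into \<open>L\<close>, the value below does not depend on the
  representative, and this is the unique homomorphism from \<^term>\<open>free_lie S\<close> to \<open>L\<close>
  extending \<open>g\<close>.\<close>

definition free_lie_lift ::
  "('r, 'a) module \<Rightarrow> ('v \<Rightarrow> 'a) \<Rightarrow> ('r, 'v) lie_term set \<Rightarrow> 'a" where
  "free_lie_lift L g a = lie_eval L g (SOME t. t \<in> a)"


section \<open>The associated graded Lie ring of a group\<close>

definition gr_part :: "('g, 'm) monoid_scheme \<Rightarrow> nat \<Rightarrow> 'g set monoid" where
  "gr_part G k = G\<lparr>carrier := lower_central G k\<rparr> Mod lower_central G (Suc k)"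

definition gr_sum :: "('g, 'm) monoid_scheme \<Rightarrow> (nat \<Rightarrow> 'g set) monoid" where
  "gr_sum G = sum_group {1..} (gr_part G)"

definition gr_bracket ::
  "('g, 'm) monoid_scheme \<Rightarrow> nat \<Rightarrow> nat \<Rightarrow> 'g set \<Rightarrow> 'g set \<Rightarrow> 'g set" where
  "gr_bracket G i j a b =
    (\<Union>x\<in>a. \<Union>y\<in>b. lower_central G (Suc (i + j)) #>\<^bsub>G\<^esub> commutator G x y)"

definition gr :: "('g, 'm) monoid_scheme \<Rightarrow> (int, nat \<Rightarrow> 'g set) module" where
  "gr G =
    \<lparr>carrier = carrier (gr_sum G),
     monoid.mult = (\<lambda>s t. \<lambda>k\<in>{1..}.
       finprod (gr_part G k) (\<lambda>i. gr_bracket G i (k - i) (s i) (t (k - i))) {1..<k}),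
     one = \<one>\<^bsub>gr_sum G\<^esub>,
     ring.zero = \<one>\<^bsub>gr_sum G\<^esub>,
     ring.add = (\<lambda>s t. s \<otimes>\<^bsub>gr_sum G\<^esub> t),
     module.smult = (\<lambda>c s. s [^]\<^bsub>gr_sum G\<^esub> c)\<rparr>"

definition gr_degree :: "('g, 'm) monoid_scheme \<Rightarrow> nat \<Rightarrow> (nat \<Rightarrow> 'g set) set" where
  "gr_degree G k = {s \<in> carrier (gr G). \<forall>i\<ge>1. i \<noteq> k \<longrightarrow> s i = \<one>\<^bsub>gr_part G i\<^esub>}"

definition gr_class :: "('g, 'm) monoid_scheme \<Rightarrow> nat \<Rightarrow> 'g \<Rightarrow> nat \<Rightarrow> 'g set" where
  "gr_class G k x =
    (\<lambda>i\<in>{1..}. if i = k then lower_central G (Suc k) #>\<^bsub>G\<^esub> x else \<one>\<^bsub>gr_part G i\<^esub>)"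

definition hilbert_series :: "('g, 'm) monoid_scheme \<Rightarrow> rat fps" where
  "hilbert_series G = Abs_fps (\<lambda>k. if k = 0 then 0 else of_nat (ab_rank (gr_part G k)))"


section \<open>Rational homology in degrees one and two\<close>

definition pm_scale :: "rat \<Rightarrow> ('a \<Rightarrow>\<^sub>0 rat) \<Rightarrow> ('a \<Rightarrow>\<^sub>0 rat)" where
  "pm_scale c = Poly_Mapping.map ((*) c)"

definition pm_extend :: "('a \<Rightarrow> 'b \<Rightarrow>\<^sub>0 rat) \<Rightarrow> ('a \<Rightarrow>\<^sub>0 rat) \<Rightarrow> ('b \<Rightarrow>\<^sub>0 rat)" where
  "pm_extend \<phi> c = (\<Sum>x\<in>Poly_Mapping.keys c. pm_scale (Poly_Mapping.lookup c x) (\<phi> x))"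

definition basis_vec :: "'a \<Rightarrow> 'a \<Rightarrow>\<^sub>0 rat" where
  "basis_vec x = Poly_Mapping.single x 1"

definition free_module :: "'a set \<Rightarrow> (rat, 'a \<Rightarrow>\<^sub>0 rat) module" where
  "free_module S =
    \<lparr>carrier = {c. Poly_Mapping.keys c \<subseteq> S}, monoid.mult = (\<lambda>_ _. 0), one = 0,
     ring.zero = 0, ring.add = (+), module.smult = pm_scale\<rparr>"

text \<open>The inhomogeneous bar complex with trivial coefficients \<open>\<rat>\<close>; the differential from degree
  one to degree zero vanishes.\<close>

definition bar2 :: "('g, 'm) monoid_scheme \<Rightarrow> ('g \<times> 'g \<Rightarrow>\<^sub>0 rat) \<Rightarrow> ('g \<Rightarrow>\<^sub>0 rat)" where
  "bar2 G = pm_extend (\<lambda>(g, h). basis_vec h - basis_vec (g \<otimes>\<^bsub>G\<^esub> h) + basis_vec g)"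

definition bar3 :: "('g, 'm) monoid_scheme \<Rightarrow> ('g \<times> 'g \<times> 'g \<Rightarrow>\<^sub>0 rat) \<Rightarrow> ('g \<times> 'g \<Rightarrow>\<^sub>0 rat)" where
  "bar3 G = pm_extend (\<lambda>(g, h, k).
     basis_vec (h, k) - basis_vec (g \<otimes>\<^bsub>G\<^esub> h, k) + basis_vec (g, h \<otimes>\<^bsub>G\<^esub> k) - basis_vec (g, h))"

definition H1 :: "('g, 'm) monoid_scheme \<Rightarrow> (rat, ('g \<Rightarrow>\<^sub>0 rat) set) module" where
  "H1 G = alg_quot (free_module (carrier G))
     (bar2 G ` carrier (free_module (carrier G \<times> carrier G)))"

definition H2 :: "('g, 'm) monoid_scheme \<Rightarrow> (rat, ('g \<times> 'g \<Rightarrow>\<^sub>0 rat) set) module" where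
  "H2 G = alg_quot
     ((free_module (carrier G \<times> carrier G))
        \<lparr>carrier := {c \<in> carrier (free_module (carrier G \<times> carrier G)). bar2 G c = 0}\<rparr>)
     (bar3 G ` carrier (free_module (carrier G \<times> carrier G \<times> carrier G)))"

text \<open>The 1-coboundaries vanish, so \<open>H\<^sup>1\<close> consists of the 1-cocycles.\<close>

definition coH1 :: "('g, 'm) monoid_scheme \<Rightarrow> ('g \<Rightarrow> rat) set" where
  "coH1 G = {\<alpha> \<in> extensional (carrier G).
     \<forall>g\<in>carrier G. \<forall>h\<in>carrier G. \<alpha> (g \<otimes>\<^bsub>G\<^esub> h) = \<alpha> g + \<alpha> h}"

definition cup :: "('g \<Rightarrow> rat) \<Rightarrow> ('g \<Rightarrow> rat) \<Rightarrow> 'g \<times> 'g \<Rightarrow> rat" where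
  "cup \<alpha> \<beta> = (\<lambda>(g, h). \<alpha> g * \<beta> h)"

text \<open>The Kronecker pairing of the class of the cocycle \<open>f\<close> with the homology class \<open>z\<close>.\<close>

definition kronecker :: "('a \<Rightarrow> rat) \<Rightarrow> ('a \<Rightarrow>\<^sub>0 rat) set \<Rightarrow> rat" where
  "kronecker f z =
    (let c = (SOME c. c \<in> z) in \<Sum>x\<in>Poly_Mapping.keys c. Poly_Mapping.lookup c x * f x)"

text \<open>For linear forms \<open>\<alpha>\<close>, \<open>\<beta>\<close> on \<open>V\<close>, the form \<open>\<alpha> \<and> \<beta>\<close> on \<open>\<^bold>L\<^sup>2(V) = \<Lambda>\<^sup>2 V\<close> sends
  \<open>[v, w]\<close> to \<open>\<alpha>(v) \<beta>(w) - \<alpha>(w) \<beta>(v)\<close>. It is extended by zero to the other degrees of \<open>\<^bold>L\<^sup>*(V)\<close>.\<close>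

primrec linear_part :: "('v \<Rightarrow> rat) \<Rightarrow> (rat, 'v) lie_term \<Rightarrow> rat" where
  "linear_part \<alpha> (Gen v) = \<alpha> v"
| "linear_part \<alpha> Zero = 0"
| "linear_part \<alpha> (Add s t) = linear_part \<alpha> s + linear_part \<alpha> t"
| "linear_part \<alpha> (Smult c s) = c * linear_part \<alpha> s"
| "linear_part \<alpha> (Bracket s t) = 0"

primrec wedge_part :: "('v \<Rightarrow> rat) \<Rightarrow> ('v \<Rightarrow> rat) \<Rightarrow> (rat, 'v) lie_term \<Rightarrow> rat" where
  "wedge_part \<alpha> \<beta> (Gen v) = 0"
| "wedge_part \<alpha> \<beta> Zero = 0"
| "wedge_part \<alpha> \<beta> (Add s t) = wedge_part \<alpha> \<beta> s + wedge_part \<alpha> \<beta> t"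
| "wedge_part \<alpha> \<beta> (Smult c s) = c * wedge_part \<alpha> \<beta> s"
| "wedge_part \<alpha> \<beta> (Bracket s t) =
    linear_part \<alpha> s * linear_part \<beta> t - linear_part \<alpha> t * linear_part \<beta> s"

definition wedge :: "('v \<Rightarrow> rat) \<Rightarrow> ('v \<Rightarrow> rat) \<Rightarrow> (rat, 'v) lie_term set \<Rightarrow> rat" where
  "wedge \<alpha> \<beta> w = wedge_part \<alpha> \<beta> (SOME t. t \<in> w)"

text \<open>The transpose of the cup product, for \<open>H\<^sub>1(G; \<rat>)\<close> of finite dimension.\<close>

definition cup_dual ::
  "('g, 'm) monoid_scheme \<Rightarrow> ('g \<times> 'g \<Rightarrow>\<^sub>0 rat) set \<Rightarrow> (rat, ('g \<Rightarrow>\<^sub>0 rat) set) lie_term set" where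
  "cup_dual G z = (THE w.
     w \<in> length_part (free_lie_on (H1 G)) (free_lie_on_vec (H1 G) ` carrier (H1 G)) 2 \<and>
     (\<forall>\<alpha>\<in>coH1 G. \<forall>\<beta>\<in>coH1 G. wedge (kronecker \<alpha>) (kronecker \<beta>) w = kronecker (cup \<alpha> \<beta>) z))"


section \<open>1-formality\<close>

definition holonomy_ideal ::
  "('g, 'm) monoid_scheme \<Rightarrow> (rat, ('g \<Rightarrow>\<^sub>0 rat) set) lie_term set set" where
  "holonomy_ideal G = alg_ideal (free_lie_on (H1 G)) (cup_dual G ` carrier (H2 G))"

definition holonomy ::
  "('g, 'm) monoid_scheme \<Rightarrow> (rat, (rat, ('g \<Rightarrow>\<^sub>0 rat) set) lie_term set set) module" where
  "holonomy G = alg_quot (free_lie_on (H1 G)) (holonomy_ideal G)"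

definition holonomy_filtration ::
  "('g, 'm) monoid_scheme \<Rightarrow> nat \<Rightarrow> (rat, ('g \<Rightarrow>\<^sub>0 rat) set) lie_term set set set" where
  "holonomy_filtration G = length_filtration (holonomy G)
     ((\<lambda>v. holonomy_ideal G +>\<^bsub>free_lie_on (H1 G)\<^esub> free_lie_on_vec (H1 G) v) ` carrier (H1 G))"

definition group_algebra :: "('g, 'm) monoid_scheme \<Rightarrow> (rat, 'g \<Rightarrow>\<^sub>0 rat) module" where
  "group_algebra G = (free_module (carrier G))
    \<lparr>monoid.mult := (\<lambda>a b. pm_extend (\<lambda>g. pm_extend (\<lambda>h. basis_vec (g \<otimes>\<^bsub>G\<^esub> h)) b) a),
     one := basis_vec \<one>\<^bsub>G\<^esub>\<rparr>"

definition augmentation_ideal :: "('g, 'm) monoid_scheme \<Rightarrow> ('g \<Rightarrow>\<^sub>0 rat) set" where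
  "augmentation_ideal G =
    {a \<in> carrier (group_algebra G). (\<Sum>g\<in>Poly_Mapping.keys a. Poly_Mapping.lookup a g) = 0}"

primrec augmentation_power :: "('g, 'm) monoid_scheme \<Rightarrow> nat \<Rightarrow> ('g \<Rightarrow>\<^sub>0 rat) set" where
  "augmentation_power G 0 = carrier (group_algebra G)"
| "augmentation_power G (Suc r) = lin_span (group_algebra G)
    {a \<otimes>\<^bsub>group_algebra G\<^esub> b | a b. a \<in> augmentation_power G r \<and> b \<in> augmentation_ideal G}"

text \<open>\<open>\<rat>G \<otimes> \<rat>G\<close> is realised as \<open>\<rat>[G \<times> G]\<close>, with \<open>g \<otimes> h\<close> the basis vector \<open>(g, h)\<close>. The
  completed tensor product of the completion of \<open>\<rat>G\<close> with itself is the completion of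
  \<open>\<rat>G \<otimes> \<rat>G\<close> with respect to the filtration by the \<open>\<Sum>\<^bsub>i+j=r\<^esub> I\<^sup>i \<otimes> I\<^sup>j\<close>.\<close>

definition tensor :: "('a \<Rightarrow>\<^sub>0 rat) \<Rightarrow> ('b \<Rightarrow>\<^sub>0 rat) \<Rightarrow> ('a \<times> 'b \<Rightarrow>\<^sub>0 rat)" where
  "tensor a b = pm_extend (\<lambda>g. pm_extend (\<lambda>h. basis_vec (g, h)) b) a"

definition tensor_filtration :: "('g, 'm) monoid_scheme \<Rightarrow> nat \<Rightarrow> ('g \<times> 'g \<Rightarrow>\<^sub>0 rat) set" where
  "tensor_filtration G r = lin_span (group_algebra (G \<times>\<times> G))
    {tensor a b | a b i j.
       a \<in> augmentation_power G i \<and> b \<in> augmentation_power G j \<and> i + j = r}"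

abbreviation completed_group_algebra ::
  "('g, 'm) monoid_scheme \<Rightarrow> (rat, nat \<Rightarrow> ('g \<Rightarrow>\<^sub>0 rat) set) module" where
  "completed_group_algebra G \<equiv> completion (group_algebra G) (augmentation_power G)"

abbreviation completed_tensor_square ::
  "('g, 'm) monoid_scheme \<Rightarrow> (rat, nat \<Rightarrow> ('g \<times> 'g \<Rightarrow>\<^sub>0 rat) set) module" where
  "completed_tensor_square G \<equiv> completion (group_algebra (G \<times>\<times> G)) (tensor_filtration G)"

definition completed_tensor ::
  "('g, 'm) monoid_scheme \<Rightarrow> (nat \<Rightarrow> ('g \<Rightarrow>\<^sub>0 rat) set) \<Rightarrow> (nat \<Rightarrow> ('g \<Rightarrow>\<^sub>0 rat) set) \<Rightarrow>
   nat \<Rightarrow> ('g \<times> 'g \<Rightarrow>\<^sub>0 rat) set" where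
  "completed_tensor G s t = (\<lambda>r. \<Union>a\<in>s r. \<Union>b\<in>t r.
     tensor_filtration G r +>\<^bsub>group_algebra (G \<times>\<times> G)\<^esub> tensor a b)"

definition completed_coproduct ::
  "('g, 'm) monoid_scheme \<Rightarrow> (nat \<Rightarrow> ('g \<Rightarrow>\<^sub>0 rat) set) \<Rightarrow> nat \<Rightarrow> ('g \<times> 'g \<Rightarrow>\<^sub>0 rat) set" where
  "completed_coproduct G s = (\<lambda>r. \<Union>a\<in>s r.
     tensor_filtration G r +>\<^bsub>group_algebra (G \<times>\<times> G)\<^esub> pm_extend (\<lambda>g. basis_vec (g, g)) a)"

definition primitives :: "('g, 'm) monoid_scheme \<Rightarrow> (nat \<Rightarrow> ('g \<Rightarrow>\<^sub>0 rat) set) set" where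
  "primitives G = {s \<in> carrier (completed_group_algebra G).
     completed_coproduct G s =
       completed_tensor G s \<one>\<^bsub>completed_group_algebra G\<^esub>
         \<oplus>\<^bsub>completed_tensor_square G\<^esub> completed_tensor G \<one>\<^bsub>completed_group_algebra G\<^esub> s}"

definition malcev :: "('g, 'm) monoid_scheme \<Rightarrow> (rat, nat \<Rightarrow> ('g \<Rightarrow>\<^sub>0 rat) set) module" where
  "malcev G = (completed_group_algebra G)
    \<lparr>carrier := primitives G,
     monoid.mult := (\<lambda>s t. (s \<otimes>\<^bsub>completed_group_algebra G\<^esub> t)
                      \<ominus>\<^bsub>completed_group_algebra G\<^esub> (t \<otimes>\<^bsub>completed_group_algebra G\<^esub> s))\<rparr>"

definition malcev_filtration ::
  "('g, 'm) monoid_scheme \<Rightarrow> nat \<Rightarrow> (nat \<Rightarrow> ('g \<Rightarrow>\<^sub>0 rat) set) set" where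
  "malcev_filtration G k =
    primitives G \<inter> completion_filtration (group_algebra G) (augmentation_power G) k"

text \<open>Used for finitely presented \<open>G\<close> only.\<close>

definition one_formal :: "('g, 'm) monoid_scheme \<Rightarrow> bool" where
  "one_formal G \<longleftrightarrow> filtered_alg_isomorphic
     (malcev G) (malcev_filtration G)
     (completion (holonomy G) (holonomy_filtration G))
     (completion_filtration (holonomy G) (holonomy_filtration G))"

end

theory Submission
  imports Defs "HOL-Library.Multiset_Order"
begin

text \<open>Let \<open>U : F \<rightarrow> \<int>[y\<^sub>1, \<dots>, y\<^sub>n][[X]]\<close> be the abelianized Magnus expansion,
  \<open>U x\<^sub>i = 1 + y\<^sub>i X\<close>, and \<open>D\<^sub>j\<close> the abelianized Fox derivatives. The kernel of \<open>F \<rightarrow> G/G''\<close>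
  lies in the group of all \<open>g\<close> with \<open>U g = 1\<close> whose Fox vector is a multiple of that of \<open>r\<close>.
  The leading term of the Fox vector of an element of \<open>\<Gamma>\<^sub>k F\<close> is the value of a Lie analogue of the
  Fox calculus, which is injective on the free metabelian Lie ring. Since polynomial rings are
  domains, an element of \<open>\<Gamma>\<^sub>k F\<close> that falls into \<open>\<Gamma>\<^bsub>k+1\<^esub>(G/G'')\<close> has a leading term \<open>c \<rho>\<close>, where
  \<open>\<rho>\<close> is the leading term of \<open>r\<close>, and therefore its Lie class lies in
  \<open>ideal(r) + L''\<close>. By Gauss's lemma the multiples of a primitive vector \<open>\<rho>\<close> form a saturated sublattice, hence the torsion-freeness,
  and counting monomials gives the ranks.\<close>

section \<open>Commutators and the lower central series\<close>

text \<open>The computation is a sandwich. From above, a word whose class dies in gr(G/G'') has Fox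
  leading term \<open>c * rho\<close>. From below, ideal(r) + L'' dies there, because r maps to 1
  and G/G'' is metabelian. The bounds meet because each polynomial multiple of \<open>rho\<close> is
  the Fox vector of some element of ideal(r), and because the Lie Fox vector separates the points of
  L/L''. The difficulty is the passage between the two sides: elements of L are classes of terms,
  those of gr are families of cosets, and a product in gr collects all splittings of a degree. The
  bridge is a relation between a term and a word in a single degree that records at once the class
  in gr F, the class in gr(G/G'') and the leading Fox vector; structural induction on terms supplies
  such words. Nonvanishing of the relator modulo primes acts twice. One prime already makes
  \<open>rho\<close> nonzero, so that it can be cancelled when low coefficients are compared and
  when relations are counted. All primes together make \<open>rho\<close> primitive, which is what
  Gauss's lemma needs.\<close>

lemma derived_eq_lower_central: "derived G (carrier G) = lower_central G 2"
  by (simp add: derived_def numeral_2_eq_2 lower_central.simps(3) commutator_def)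
    (rule arg_cong[of _ _ "generate G"], blast)

lemma (in group) inv_mult_cancel_left [simp]:
  "x \<in> carrier G \<Longrightarrow> y \<in> carrier G \<Longrightarrow> inv x \<otimes> (x \<otimes> y) = y"
  "x \<in> carrier G \<Longrightarrow> y \<in> carrier G \<Longrightarrow> x \<otimes> (inv x \<otimes> y) = y"
  by (simp_all flip: m_assoc)

lemma (in group) commutator_closed [simp]:
  "x \<in> carrier G \<Longrightarrow> y \<in> carrier G \<Longrightarrow> commutator G x y \<in> carrier G"
  by (simp add: commutator_def)

lemma (in group) inv_commutator:
  "x \<in> carrier G \<Longrightarrow> y \<in> carrier G \<Longrightarrow> inv (commutator G x y) = commutator G y x"
  by (simp add: commutator_def inv_mult_group m_assoc)

lemma (in group) commutator_mult_left:
  "x \<in> carrier G \<Longrightarrow> y \<in> carrier G \<Longrightarrow> z \<in> carrier G \<Longrightarrow>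
    commutator G (x \<otimes> y) z = x \<otimes> commutator G y z \<otimes> inv x \<otimes> commutator G x z"
  by (simp add: commutator_def inv_mult_group m_assoc)

lemma (in group) commutator_mult_right:
  "x \<in> carrier G \<Longrightarrow> y \<in> carrier G \<Longrightarrow> z \<in> carrier G \<Longrightarrow>
    commutator G x (y \<otimes> z) = commutator G x y \<otimes> (y \<otimes> commutator G x z \<otimes> inv y)"
  by (simp add: commutator_def inv_mult_group m_assoc)

lemma (in group) commutator_inv_left:
  "x \<in> carrier G \<Longrightarrow> z \<in> carrier G \<Longrightarrow>
    commutator G (inv x) z = inv x \<otimes> inv (commutator G x z) \<otimes> x"
  by (simp add: commutator_def inv_mult_group m_assoc)

lemma (in group) conj_commutator:
  "x \<in> carrier G \<Longrightarrow> y \<in> carrier G \<Longrightarrow> g \<in> carrier G \<Longrightarrow>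
    g \<otimes> commutator G x y \<otimes> inv g = commutator G (g \<otimes> x \<otimes> inv g) (g \<otimes> y \<otimes> inv g)"
  by (simp add: commutator_def inv_mult_group m_assoc)

text \<open>The Hall-Witt identity. The conjugations sit in the second entries because of the
  convention \<open>x y x^-1 y^-1\<close>; after expansion all letters cancel.\<close>

lemma (in group) hall_witt:
  assumes "x \<in> carrier G" "y \<in> carrier G" "z \<in> carrier G"
  shows "commutator G (commutator G x y) (y \<otimes> z \<otimes> inv y) \<otimes>
     commutator G (commutator G y z) (z \<otimes> x \<otimes> inv z) \<otimes>
     commutator G (commutator G z x) (x \<otimes> y \<otimes> inv x) = \<one>"
  using assms by (simp add: commutator_def inv_mult_group m_assoc)

declare lower_central.simps(3) [simp del]

text \<open>Conjugation is an automorphism and maps generating commutators to generating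
  commutators, so the subgroup they generate is normal.\<close>

lemma (in group) lower_central_normal: "lower_central G k \<lhd> G"
proof -
  \<comment> \<open>Index 0 only repeats the whole group, so the induction runs over
    \<open>Suc k\<close> and carries index 0 along.\<close>
  have "lower_central G 0 \<lhd> G \<and> lower_central G (Suc k) \<lhd> G" for k
  proof (induction k)
    case 0
    then show ?case using normal_self by simp
  next
    case (Suc k)
    then interpret N: normal "lower_central G (Suc k)" G by simp
    have "generate G {commutator G x y | x y. x \<in> lower_central G (Suc k) \<and> y \<in> carrier G} \<lhd> G"
    proof (rule normal_generateI)
      show "{commutator G x y | x y. x \<in> lower_central G (Suc k) \<and> y \<in> carrier G} \<subseteq> carrier G"
        using N.subset by auto
    next
      fix h g
      assume "h \<in> {commutator G x y | x y. x \<in> lower_central G (Suc k) \<and> y \<in> carrier G}"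
        and g: "g \<in> carrier G"
      then obtain x y where h: "h = commutator G x y" "x \<in> lower_central G (Suc k)" "y \<in> carrier G"
        by auto
      have "g \<otimes> h \<otimes> inv g = commutator G (g \<otimes> x \<otimes> inv g) (g \<otimes> y \<otimes> inv g)"
        using h g N.subset by (auto intro!: conj_commutator)
      moreover have "g \<otimes> x \<otimes> inv g \<in> lower_central G (Suc k)"
        using h g N.inv_op_closed2 by simp
      ultimately show "g \<otimes> h \<otimes> inv g \<in>
          {commutator G x y | x y. x \<in> lower_central G (Suc k) \<and> y \<in> carrier G}"
        using h g by blast
    qed
    with Suc show ?case by (simp add: lower_central.simps(3))
  qed
  then show ?thesis by (cases k) auto
qed

lemma (in group) lower_central_subgroup: "subgroup (lower_central G k) G"
  using lower_central_normal normal_imp_subgroup by blast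

lemma (in group) lower_central_in_carrier: "x \<in> lower_central G k \<Longrightarrow> x \<in> carrier G"
  using subgroup.mem_carrier[OF lower_central_subgroup] .

lemma (in group) lower_central_mult [simp]:
  "x \<in> lower_central G k \<Longrightarrow> y \<in> lower_central G k \<Longrightarrow> x \<otimes> y \<in> lower_central G k"
  using subgroup.m_closed[OF lower_central_subgroup] .

lemma (in group) lower_central_inv [simp]:
  "x \<in> lower_central G k \<Longrightarrow> inv x \<in> lower_central G k"
  using subgroup.m_inv_closed[OF lower_central_subgroup] .

lemma (in group) lower_central_one [simp]: "\<one> \<in> lower_central G k"
  using subgroup.one_closed[OF lower_central_subgroup] .

lemma (in group) lower_central_conj [simp]:
  "x \<in> lower_central G k \<Longrightarrow> g \<in> carrier G \<Longrightarrow> g \<otimes> x \<otimes> inv g \<in> lower_central G k"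
  "x \<in> lower_central G k \<Longrightarrow> g \<in> carrier G \<Longrightarrow> inv g \<otimes> x \<otimes> g \<in> lower_central G k"
  using normal.inv_op_closed2[OF lower_central_normal] normal.inv_op_closed1[OF lower_central_normal]
  by blast+

lemma (in group) commutator_carrier_lower_central:
  assumes "1 \<le> k" "x \<in> lower_central G k" "y \<in> carrier G"
  shows "commutator G x y \<in> lower_central G (Suc k)"
proof -
  obtain l where k: "k = Suc l" using assms by (cases k) auto
  show ?thesis unfolding k lower_central.simps
    by (rule generate.incl) (use assms k in auto)
qed

lemma (in group) lower_central_Suc: "lower_central G (Suc k) \<subseteq> lower_central G k"
proof (cases k)
  case (Suc l)
  have "generate G {commutator G x y | x y. x \<in> lower_central G (Suc l) \<and> y \<in> carrier G}
      \<subseteq> lower_central G (Suc l)"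
  proof (rule generate_subgroup_incl)
    show "{commutator G x y | x y. x \<in> lower_central G (Suc l) \<and> y \<in> carrier G}
        \<subseteq> lower_central G (Suc l)"
    proof clarify
      fix x y assume xy: "x \<in> lower_central G (Suc l)" "y \<in> carrier G"
      then have "commutator G x y = x \<otimes> (y \<otimes> inv x \<otimes> inv y)"
        using lower_central_in_carrier[OF xy(1)] by (simp add: commutator_def m_assoc)
      then show "commutator G x y \<in> lower_central G (Suc l)"
        using xy by simp
    qed
  qed (rule lower_central_subgroup)
  then show ?thesis by (simp add: Suc lower_central.simps(3))
qed auto

lemma (in group) lower_central_mono: "i \<le> j \<Longrightarrow> lower_central G j \<subseteq> lower_central G i"
  by (rule lift_Suc_antimono_le[of "lower_central G"]) (rule lower_central_Suc)

text \<open>These are the elements commuting with z modulo N, the preimage of a centralizer in G/N.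
  Being a subgroup, it contains a generated subgroup as soon as it contains the generators.\<close>

lemma (in group) commutator_left_subgroup:
  assumes "N \<lhd> G" "z \<in> carrier G"
  shows "subgroup {x \<in> carrier G. commutator G x z \<in> N} G"
proof (rule subgroupI)
  interpret N: normal N G by (rule assms)
  show "{x \<in> carrier G. commutator G x z \<in> N} \<noteq> {}"
    using assms by (auto intro!: exI[of _ \<one>] simp: commutator_def)
  show "inv a \<in> {x \<in> carrier G. commutator G x z \<in> N}"
    if "a \<in> {x \<in> carrier G. commutator G x z \<in> N}" for a
    using that assms by (auto simp: commutator_inv_left N.inv_op_closed1)
  show "a \<otimes> b \<in> {x \<in> carrier G. commutator G x z \<in> N}"
    if "a \<in> {x \<in> carrier G. commutator G x z \<in> N}" "b \<in> {x \<in> carrier G. commutator G x z \<in> N}" for a b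
    using that assms by (auto simp: commutator_mult_left intro!: N.m_closed N.inv_op_closed2)
qed auto

lemma (in group) commutator_swap_mem:
  assumes "subgroup N G" "commutator G x y \<in> N" "x \<in> carrier G" "y \<in> carrier G"
  shows "commutator G y x \<in> N"
  using assms subgroup.m_inv_closed inv_commutator by metis

text \<open>The induction step is the three subgroups lemma.\<close>

lemma (in group) commutator_lower_central:
  assumes "1 \<le> i" "1 \<le> j" "x \<in> lower_central G i" "z \<in> lower_central G j"
  shows "commutator G x z \<in> lower_central G (i + j)"
  using assms
proof (induction i arbitrary: j x z rule: dec_induct)
  case base
  then have "commutator G z x \<in> lower_central G (Suc j)"
    by (intro commutator_carrier_lower_central) auto
  then show ?case
    using base commutator_swap_mem[OF lower_central_subgroup] lower_central_in_carrier[of z j] by auto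
next
  case (step i)
  let ?N = "lower_central G (Suc i + j)"
  obtain l where i: "i = Suc l" using step by (cases i) auto
  have z: "z \<in> carrier G" using step.prems lower_central_in_carrier by blast
  have "{commutator G x y | x y. x \<in> lower_central G i \<and> y \<in> carrier G}
      \<subseteq> {x \<in> carrier G. commutator G x z \<in> ?N}"
  proof clarify
    fix a b assume h: "a \<in> lower_central G i" "b \<in> carrier G"
    \<comment> \<open>Writing z as a conjugate of w by b makes
      \<open>commutator G (commutator G a b) z\<close> the first factor of the Hall-Witt identity
      for a, b, w; the other two factors are covered by the induction hypothesis.\<close>
    define w where "w = inv b \<otimes> z \<otimes> b"
    have w: "w \<in> lower_central G j"
      using step.prems h by (simp add: w_def)
    then have wc: "w \<in> carrier G" by (rule lower_central_in_carrier)
    have a: "a \<in> carrier G" using h lower_central_in_carrier by blast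
    have z_eq: "z = b \<otimes> w \<otimes> inv b"
      using z h by (simp add: w_def m_assoc)
    have "commutator G a w \<in> lower_central G (i + j)"
      using step.IH step.prems h w by auto
    then have "commutator G w a \<in> lower_central G (i + j)"
      using commutator_swap_mem[OF lower_central_subgroup] a wc by blast
    then have 1: "commutator G (commutator G w a) (a \<otimes> b \<otimes> inv a) \<in> ?N"
      using commutator_carrier_lower_central[of "i + j"] a h step.prems by auto
    have "commutator G w b \<in> lower_central G (Suc j)"
      using w h step.prems by (intro commutator_carrier_lower_central) auto
    then have "commutator G b w \<in> lower_central G (Suc j)"
      using commutator_swap_mem[OF lower_central_subgroup] h wc by blast
    then have "commutator G (w \<otimes> a \<otimes> inv w) (commutator G b w) \<in> lower_central G (i + Suc j)"
      using step.IH[of "Suc j" "w \<otimes> a \<otimes> inv w" "commutator G b w"] h wc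
      by simp
    then have 2: "commutator G (commutator G b w) (w \<otimes> a \<otimes> inv w) \<in> ?N"
      using commutator_swap_mem[OF lower_central_subgroup] h wc a by simp
    have "commutator G (commutator G a b) z \<otimes> (commutator G (commutator G b w) (w \<otimes> a \<otimes> inv w) \<otimes>
        commutator G (commutator G w a) (a \<otimes> b \<otimes> inv a)) = \<one>"
      using hall_witt[of a b w] a wc h by (simp add: z_eq m_assoc)
    then have "commutator G (commutator G a b) z =
        inv (commutator G (commutator G b w) (w \<otimes> a \<otimes> inv w) \<otimes>
          commutator G (commutator G w a) (a \<otimes> b \<otimes> inv a))"
      using a wc h z by (intro inv_equality[symmetric]) auto
    then show "commutator G a b \<in> carrier G \<and> commutator G (commutator G a b) z \<in> ?N"
      using 1 2 a h by simp
  qed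
  then have "generate G {commutator G x y | x y. x \<in> lower_central G i \<and> y \<in> carrier G}
      \<subseteq> {x \<in> carrier G. commutator G x z \<in> ?N}"
    by (rule generate_subgroup_incl) (intro commutator_left_subgroup lower_central_normal z)
  then show ?case using step.prems by (auto simp: i lower_central.simps(3))
qed

section \<open>The associated graded Lie ring\<close>

text \<open>Cosets are formed for every x of the group, also outside Gamma_k, so that products can
  be rearranged under carrier conditions alone.\<close>

definition coset_class :: "('g, 'm) monoid_scheme \<Rightarrow> nat \<Rightarrow> 'g \<Rightarrow> 'g set" where
  "coset_class G k x = lower_central G (Suc k) #>\<^bsub>G\<^esub> x"

lemma (in group) coset_class_eq_iff:
  assumes "x \<in> carrier G" "y \<in> carrier G"
  shows "coset_class G k x = coset_class G k y \<longleftrightarrow> x \<otimes> inv y \<in> lower_central G (Suc k)"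
proof
  assume "coset_class G k x = coset_class G k y"
  then have "x \<in> lower_central G (Suc k) #> y"
    unfolding coset_class_def using rcos_self[OF assms(1) lower_central_subgroup] by blast
  then obtain h where "h \<in> lower_central G (Suc k)" "x = h \<otimes> y"
    by (auto simp: r_coset_def)
  then show "x \<otimes> inv y \<in> lower_central G (Suc k)"
    using assms lower_central_in_carrier by (simp add: m_assoc)
next
  assume h: "x \<otimes> inv y \<in> lower_central G (Suc k)"
  have "x = (x \<otimes> inv y) \<otimes> y" using assms by (simp add: m_assoc)
  then have "x \<in> lower_central G (Suc k) #> y"
    using h by (auto simp: r_coset_def)
  then show "coset_class G k x = coset_class G k y"
    unfolding coset_class_def using repr_independence[OF _ assms(2) lower_central_subgroup] by simp
qed

lemma (in group) coset_class_eq_one_iff: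
  "x \<in> carrier G \<Longrightarrow> coset_class G k x = coset_class G k \<one> \<longleftrightarrow> x \<in> lower_central G (Suc k)"
  by (simp add: coset_class_eq_iff)

lemma (in group) coset_class_one: "coset_class G k \<one> = lower_central G (Suc k)"
  unfolding coset_class_def by (rule coset_mult_one[OF subgroup.subset[OF lower_central_subgroup]])

lemma (in group) mem_coset_classE:
  assumes "y \<in> coset_class G k x" "x \<in> carrier G"
  shows "y \<in> carrier G" "coset_class G k y = coset_class G k x"
proof -
  show "y \<in> carrier G"
    using assms lower_central_in_carrier unfolding coset_class_def r_coset_def by blast
  show "coset_class G k y = coset_class G k x"
    using assms repr_independence[OF _ _ lower_central_subgroup] unfolding coset_class_def by metis
qed

lemma (in group) coset_class_self: "x \<in> carrier G \<Longrightarrow> x \<in> coset_class G k x"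
  unfolding coset_class_def using rcos_self[OF _ lower_central_subgroup] .

lemma (in group) coset_class_mult:
  assumes "x \<in> carrier G" "y \<in> carrier G"
  shows "coset_class G k x <#> coset_class G k y = coset_class G k (x \<otimes> y)"
  unfolding coset_class_def using normal.rcos_sum[OF lower_central_normal] assms by blast

lemma (in group) coset_class_cong:
  assumes "x \<in> carrier G" "y \<in> carrier G" "x' \<in> carrier G" "y' \<in> carrier G"
    "coset_class G k x = coset_class G k x'" "coset_class G k y = coset_class G k y'"
  shows "coset_class G k (x \<otimes> y) = coset_class G k (x' \<otimes> y')"
  using assms by (simp flip: coset_class_mult)

text \<open>Gamma_k is central modulo Gamma_(k+1), so conjugation acts trivially on the
  quotient.\<close>

lemma (in group) coset_class_conj:
  assumes "1 \<le> k" "c \<in> lower_central G k" "g \<in> carrier G"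
  shows "coset_class G k (g \<otimes> c \<otimes> inv g) = coset_class G k c"
proof -
  have c: "c \<in> carrier G" using assms lower_central_in_carrier by blast
  have "commutator G c g \<in> lower_central G (Suc k)"
    using assms by (intro commutator_carrier_lower_central)
  then have "commutator G g c \<in> lower_central G (Suc k)"
    using commutator_swap_mem[OF lower_central_subgroup] c assms by blast
  then show ?thesis using c assms by (simp add: coset_class_eq_iff commutator_def m_assoc)
qed

lemma (in group) coset_class_commute:
  assumes "1 \<le> k" "x \<in> lower_central G k" "y \<in> carrier G"
  shows "coset_class G k (x \<otimes> y) = coset_class G k (y \<otimes> x)"
proof -
  have c: "x \<in> carrier G" using assms lower_central_in_carrier by blast
  have "commutator G x y \<in> lower_central G (Suc k)"
    using assms by (intro commutator_carrier_lower_central)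
  then show ?thesis using c assms by (simp add: coset_class_eq_iff commutator_def inv_mult_group m_assoc)
qed

lemma (in group) lower_central_normal_in:
  "lower_central G (Suc k) \<lhd> G\<lparr>carrier := lower_central G k\<rparr>"
  by (rule normal_restrict_supergroup[OF lower_central_subgroup lower_central_normal lower_central_Suc])

lemma (in group) carrier_gr_part: "carrier (gr_part G k) = coset_class G k ` lower_central G k"
  unfolding gr_part_def FactGroup_def RCOSETS_def
  by (auto simp: coset_class_def)

lemma set_mult_update: "A <#>\<^bsub>G\<lparr>carrier := K\<rparr>\<^esub> B = A <#>\<^bsub>G\<^esub> B"
  by (simp add: set_mult_def)

lemma (in group) mult_gr_part:
  "x \<in> lower_central G k \<Longrightarrow> y \<in> lower_central G k \<Longrightarrow>
   coset_class G k x \<otimes>\<^bsub>gr_part G k\<^esub> coset_class G k y = coset_class G k (x \<otimes> y)"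
  using coset_class_mult[OF lower_central_in_carrier lower_central_in_carrier, of x k y k k]
  by (simp add: gr_part_def FactGroup_def set_mult_update)

lemma (in group) one_gr_part: "\<one>\<^bsub>gr_part G k\<^esub> = coset_class G k \<one>"
  unfolding gr_part_def FactGroup_def by (simp add: coset_class_one)

lemma (in group) gr_part_comm_group:
  assumes "1 \<le> k" shows "comm_group (gr_part G k)"
proof -
  have "group (gr_part G k)"
    unfolding gr_part_def by (rule normal.factorgroup_is_group[OF lower_central_normal_in])
  then show ?thesis
  proof (rule group.group_comm_groupI)
    fix a b assume "a \<in> carrier (gr_part G k)" "b \<in> carrier (gr_part G k)"
    then obtain x y where "a = coset_class G k x" "b = coset_class G k y"
      "x \<in> lower_central G k" "y \<in> lower_central G k"
      by (auto simp: carrier_gr_part)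
    then show "a \<otimes>\<^bsub>gr_part G k\<^esub> b = b \<otimes>\<^bsub>gr_part G k\<^esub> a"
      using assms coset_class_commute[of k x y] lower_central_in_carrier[of y k] by (simp add: mult_gr_part)
  qed
qed

lemma (in group) inv_gr_part:
  assumes "1 \<le> k" "x \<in> lower_central G k"
  shows "inv\<^bsub>gr_part G k\<^esub> coset_class G k x = coset_class G k (inv x)"
proof -
  interpret A: comm_group "gr_part G k" by (rule gr_part_comm_group) fact
  show ?thesis
    by (rule A.inv_equality)
      (use assms lower_central_in_carrier[OF assms(2)] in \<open>auto simp: mult_gr_part one_gr_part carrier_gr_part\<close>)
qed

lemma (in group) nat_pow_gr_part:
  assumes "1 \<le> k" "x \<in> lower_central G k"
  shows "coset_class G k x [^]\<^bsub>gr_part G k\<^esub> (m::nat) = coset_class G k (x [^] m)"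
proof -
  interpret A: comm_group "gr_part G k" by (rule gr_part_comm_group) fact
  have "x [^] m \<in> lower_central G k" for m :: nat
    by (induction m) (use assms in auto)
  then show ?thesis
    by (induction m) (use assms in \<open>auto simp: mult_gr_part one_gr_part\<close>)
qed

lemma (in group) lower_central_int_pow [simp]:
  "x \<in> lower_central G k \<Longrightarrow> x [^] (c::int) \<in> lower_central G k"
  using subgroup_int_pow_closed[OF lower_central_subgroup] .

lemma (in group) int_pow_gr_part:
  assumes "1 \<le> k" "x \<in> lower_central G k"
  shows "coset_class G k x [^]\<^bsub>gr_part G k\<^esub> (c::int) = coset_class G k (x [^] c)"
proof -
  interpret A: comm_group "gr_part G k" by (rule gr_part_comm_group) fact
  have m: "x [^] m \<in> lower_central G k" for m :: nat
    by (induction m) (use assms in auto)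
  show ?thesis
    unfolding int_pow_def2 nat_pow_gr_part[OF assms] inv_gr_part[OF assms(1) m] by simp
qed

text \<open>The exact formula for the commutator of a product differs from additivity by one
  conjugation and the order of the factors; both disappear modulo Gamma_(i+j+1).\<close>

lemma (in group) coset_class_commutator_mult_left:
  assumes "1 \<le> i" "1 \<le> j" "x \<in> lower_central G i" "x' \<in> lower_central G i" "y \<in> lower_central G j"
  shows "coset_class G (i + j) (commutator G (x \<otimes> x') y) =
    coset_class G (i + j) (commutator G x y \<otimes> commutator G x' y)"
proof -
  have c: "x \<in> carrier G" "x' \<in> carrier G" "y \<in> carrier G" using assms lower_central_in_carrier by blast+
  have m: "commutator G x y \<in> lower_central G (i + j)" "commutator G x' y \<in> lower_central G (i + j)"
    using assms commutator_lower_central by auto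
  have "coset_class G (i + j) (commutator G (x \<otimes> x') y) =
      coset_class G (i + j) (commutator G x' y \<otimes> commutator G x y)"
    unfolding commutator_mult_left[OF c]
    by (rule coset_class_cong) (use c m assms in \<open>auto simp: coset_class_conj\<close>)
  also have "\<dots> = coset_class G (i + j) (commutator G x y \<otimes> commutator G x' y)"
    by (rule coset_class_commute) (use m c assms in auto)
  finally show ?thesis .
qed

lemma (in group) coset_class_commutator_mult_right:
  assumes "1 \<le> i" "1 \<le> j" "x \<in> lower_central G i" "y \<in> lower_central G j" "y' \<in> lower_central G j"
  shows "coset_class G (i + j) (commutator G x (y \<otimes> y')) =
    coset_class G (i + j) (commutator G x y \<otimes> commutator G x y')"
proof -
  have c: "x \<in> carrier G" "y' \<in> carrier G" "y \<in> carrier G" using assms lower_central_in_carrier by blast+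
  have m: "commutator G x y \<in> lower_central G (i + j)" "commutator G x y' \<in> lower_central G (i + j)"
    using assms commutator_lower_central by auto
  show ?thesis
    unfolding commutator_mult_right[OF c(1,3,2)]
    by (rule coset_class_cong) (use c m assms in \<open>auto simp: coset_class_conj\<close>)
qed

text \<open>This makes the bracket of gr well defined. Write x = u x' and y = v y' with u, v one
  step deeper in the series; by biadditivity the difference consists of commutators with u or v, and
  these lie in Gamma_(i+j+1).\<close>

lemma (in group) coset_class_commutator_cong:
  assumes "1 \<le> i" "1 \<le> j" "x \<in> lower_central G i" "x' \<in> lower_central G i"
    "y \<in> lower_central G j" "y' \<in> lower_central G j"
    "coset_class G i x = coset_class G i x'" "coset_class G j y = coset_class G j y'"
  shows "coset_class G (i + j) (commutator G x y) = coset_class G (i + j) (commutator G x' y')"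
proof -
  have c: "x \<in> carrier G" "x' \<in> carrier G" "y \<in> carrier G" "y' \<in> carrier G" using assms lower_central_in_carrier by blast+
  have u: "x \<otimes> inv x' \<in> lower_central G (Suc i)" and v: "y \<otimes> inv y' \<in> lower_central G (Suc j)"
    using assms c by (auto simp: coset_class_eq_iff)
  have u': "x \<otimes> inv x' \<in> lower_central G i" and v': "y \<otimes> inv y' \<in> lower_central G j"
    using u v lower_central_Suc by blast+
  have "commutator G (x \<otimes> inv x') y \<in> lower_central G (Suc (i + j))"
    using commutator_lower_central[of "Suc i" j] u assms by simp
  then have ub: "coset_class G (i + j) (commutator G (x \<otimes> inv x') y) = coset_class G (i + j) \<one>"
    using c by (simp add: coset_class_eq_one_iff)
  have "commutator G x' (y \<otimes> inv y') \<in> lower_central G (Suc (i + j))"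
    using commutator_lower_central[of i "Suc j" x'] v assms by simp
  then have vb: "coset_class G (i + j) (commutator G x' (y \<otimes> inv y')) = coset_class G (i + j) \<one>"
    using c by (simp add: coset_class_eq_one_iff)
  have "coset_class G (i + j) (commutator G x y) =
      coset_class G (i + j) (commutator G ((x \<otimes> inv x') \<otimes> x') y)"
    using c by (simp add: m_assoc)
  also have "\<dots> = coset_class G (i + j) (commutator G (x \<otimes> inv x') y \<otimes> commutator G x' y)"
    by (rule coset_class_commutator_mult_left) (use assms u' in auto)
  also have "\<dots> = coset_class G (i + j) (\<one> \<otimes> commutator G x' y)"
    by (rule coset_class_cong) (use ub c in auto)
  also have "\<dots> = coset_class G (i + j) (commutator G x' ((y \<otimes> inv y') \<otimes> y'))"
    using c by (simp add: m_assoc)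
  also have "\<dots> = coset_class G (i + j) (commutator G x' (y \<otimes> inv y') \<otimes> commutator G x' y')"
    by (rule coset_class_commutator_mult_right) (use assms v' in auto)
  also have "\<dots> = coset_class G (i + j) (\<one> \<otimes> commutator G x' y')"
    by (rule coset_class_cong) (use vb c in auto)
  finally show ?thesis using c by simp
qed

lemma (in group) gr_bracket_coset_class:
  assumes "1 \<le> i" "1 \<le> j" "x \<in> lower_central G i" "y \<in> lower_central G j"
  shows "gr_bracket G i j (coset_class G i x) (coset_class G j y) =
    coset_class G (i + j) (commutator G x y)"
proof -
  have c: "x \<in> carrier G" "y \<in> carrier G" using assms lower_central_in_carrier by blast+
  have eq: "coset_class G (i + j) (commutator G x' y') = coset_class G (i + j) (commutator G x y)"
    if "x' \<in> coset_class G i x" "y' \<in> coset_class G j y" for x' y'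
  proof (rule coset_class_commutator_cong)
    show "x' \<in> lower_central G i"
      using that(1) assms(3) lower_central_Suc[of i]
      by (auto simp: coset_class_def r_coset_def)
    show "y' \<in> lower_central G j"
      using that(2) assms(4) lower_central_Suc[of j]
      by (auto simp: coset_class_def r_coset_def)
    show "coset_class G i x' = coset_class G i x" "coset_class G j y' = coset_class G j y"
      using mem_coset_classE(2)[OF that(1) c(1)] mem_coset_classE(2)[OF that(2) c(2)] by simp_all
  qed (fact assms)+
  have "gr_bracket G i j (coset_class G i x) (coset_class G j y) =
      (\<Union>x'\<in>coset_class G i x. \<Union>y'\<in>coset_class G j y. coset_class G (i + j) (commutator G x y))"
    unfolding gr_bracket_def coset_class_def[of G "i + j", symmetric] by (intro SUP_cong eq) simp_all
  moreover have "coset_class G i x \<noteq> {}" "coset_class G j y \<noteq> {}"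
    using c coset_class_self by blast+
  ultimately show ?thesis by simp
qed

text \<open>The Hall-Witt identity modulo Gamma_(i+j+k+1), where its conjugations have no
  effect.\<close>

lemma (in group) coset_class_jacobi:
  assumes "1 \<le> i" "1 \<le> j" "1 \<le> k" "x \<in> lower_central G i" "y \<in> lower_central G j" "z \<in> lower_central G k"
  shows "coset_class G (i + j + k) (commutator G x (commutator G y z) \<otimes>
    commutator G y (commutator G z x) \<otimes> commutator G z (commutator G x y)) =
    coset_class G (i + j + k) \<one>"
proof -
  have c: "x \<in> carrier G" "y \<in> carrier G" "z \<in> carrier G" using assms lower_central_in_carrier by blast+
  have m: "commutator G x y \<in> lower_central G (i + j)" "commutator G y z \<in> lower_central G (j + k)"
      "commutator G z x \<in> lower_central G (k + i)"
    using assms commutator_lower_central by auto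
  have n: "commutator G x (commutator G y z) \<in> lower_central G (i + j + k)"
    "commutator G y (commutator G z x) \<in> lower_central G (i + j + k)"
    "commutator G z (commutator G x y) \<in> lower_central G (i + j + k)"
    using commutator_lower_central[of i "j + k" x "commutator G y z"]
      commutator_lower_central[of j "k + i" y "commutator G z x"]
      commutator_lower_central[of k "i + j" z "commutator G x y"] assms m
    by (auto simp: ac_simps)
  \<comment> \<open>Reversing the outer commutator inverts it, so Hall-Witt first yields the
    inverses of the three Jacobi terms.\<close>
  have inv_class: "coset_class G (i + j + k) (inv (commutator G u v)) =
      coset_class G (i + j + k) (commutator G v (w \<otimes> u \<otimes> inv w))"
    if "1 \<le> p" "1 \<le> q" "p + q = i + j + k" "u \<in> lower_central G p" "v \<in> lower_central G q" "w \<in> carrier G"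
    for u v w p q
  proof -
    have uv: "u \<in> carrier G" "v \<in> carrier G" using that lower_central_in_carrier by blast+
    have "coset_class G (q + p) (commutator G v (w \<otimes> u \<otimes> inv w)) = coset_class G (q + p) (commutator G v u)"
      by (rule coset_class_commutator_cong) (use that in \<open>auto simp: coset_class_conj\<close>)
    then show ?thesis using that uv by (simp add: inv_commutator ac_simps)
  qed
  let ?A = "commutator G x (commutator G y z)" and ?B = "commutator G y (commutator G z x)"
    and ?C = "commutator G z (commutator G x y)"
  have "coset_class G (i + j + k) (inv ?C \<otimes> inv ?A \<otimes> inv ?B) = coset_class G (i + j + k)
     (commutator G (commutator G x y) (y \<otimes> z \<otimes> inv y) \<otimes>
     commutator G (commutator G y z) (z \<otimes> x \<otimes> inv z) \<otimes>
     commutator G (commutator G z x) (x \<otimes> y \<otimes> inv x))"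
    by (intro coset_class_cong inv_class[of i "j + k"] inv_class[of j "k + i"] inv_class[of k "i + j"])
      (use c m assms in auto)
  also have "\<dots> = coset_class G (i + j + k) \<one>"
    using hall_witt[OF c] by simp
  finally have "inv ?C \<otimes> inv ?A \<otimes> inv ?B \<in> lower_central G (Suc (i + j + k))"
    using c by (simp add: coset_class_eq_one_iff)
  then have "inv (inv ?C \<otimes> inv ?A \<otimes> inv ?B) \<in> lower_central G (Suc (i + j + k))"
    by (rule lower_central_inv)
  then have "coset_class G (i + j + k) (?B \<otimes> ?A \<otimes> ?C) = coset_class G (i + j + k) \<one>"
    using c by (simp add: coset_class_eq_one_iff inv_mult_group m_assoc)
  moreover have "coset_class G (i + j + k) (?A \<otimes> ?B \<otimes> ?C) = coset_class G (i + j + k) (?B \<otimes> ?A \<otimes> ?C)"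
    by (rule coset_class_cong) (use c n assms coset_class_commute[OF _ n(1) lower_central_in_carrier[OF n(2)]] in auto)
  ultimately show ?thesis by simp
qed

section \<open>Lie algebras\<close>

lemma ring_of_type_algebra_simps [simp]:
  "carrier ring_of_type_algebra = UNIV"
  "x \<oplus>\<^bsub>ring_of_type_algebra\<^esub> y = x + y"
  "x \<otimes>\<^bsub>ring_of_type_algebra\<^esub> y = x * y"
  "\<one>\<^bsub>ring_of_type_algebra\<^esub> = 1"
  "\<zero>\<^bsub>ring_of_type_algebra\<^esub> = 0"
  by (simp_all add: ring_of_type_algebra_def)

locale lie_algebra = module "ring_of_type_algebra :: 'r ring" L
  for L :: "('r::comm_ring_1, 'a) module" (structure) +
  assumes bracket_closed [simp]: "x \<in> carrier L \<Longrightarrow> y \<in> carrier L \<Longrightarrow> x \<otimes> y \<in> carrier L"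
    and bracket_add_left: "x \<in> carrier L \<Longrightarrow> y \<in> carrier L \<Longrightarrow> z \<in> carrier L \<Longrightarrow>
      (x \<oplus> y) \<otimes> z = x \<otimes> z \<oplus> y \<otimes> z"
    and bracket_add_right: "x \<in> carrier L \<Longrightarrow> y \<in> carrier L \<Longrightarrow> z \<in> carrier L \<Longrightarrow>
      x \<otimes> (y \<oplus> z) = x \<otimes> y \<oplus> x \<otimes> z"
    and bracket_smult_left: "x \<in> carrier L \<Longrightarrow> y \<in> carrier L \<Longrightarrow> (c \<odot> x) \<otimes> y = c \<odot> (x \<otimes> y)"
    and bracket_smult_right: "x \<in> carrier L \<Longrightarrow> y \<in> carrier L \<Longrightarrow> x \<otimes> (c \<odot> y) = c \<odot> (x \<otimes> y)"
    and bracket_alternating: "x \<in> carrier L \<Longrightarrow> x \<otimes> x = \<zero>"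
    and bracket_jacobi: "x \<in> carrier L \<Longrightarrow> y \<in> carrier L \<Longrightarrow> z \<in> carrier L \<Longrightarrow>
      x \<otimes> (y \<otimes> z) \<oplus> y \<otimes> (z \<otimes> x) \<oplus> z \<otimes> (x \<otimes> y) = \<zero>"
begin

lemma type_smult_closed [simp]: "x \<in> carrier L \<Longrightarrow> c \<odot> x \<in> carrier L"
  using smult_closed[of c x] by simp

lemma type_smult_zero [simp]: "c \<odot> \<zero> = \<zero>"
  using smult_r_null[of c] by simp

lemma type_zero_smult [simp]: "x \<in> carrier L \<Longrightarrow> 0 \<odot> x = \<zero>"
  using smult_l_null[of x] by simp

lemma type_smult_simps:
  "x \<in> carrier L \<Longrightarrow> 1 \<odot> x = x"
  "x \<in> carrier L \<Longrightarrow> (c * d) \<odot> x = c \<odot> (d \<odot> x)"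
  "x \<in> carrier L \<Longrightarrow> (c + d) \<odot> x = c \<odot> x \<oplus> d \<odot> x"
  "x \<in> carrier L \<Longrightarrow> y \<in> carrier L \<Longrightarrow> c \<odot> (x \<oplus> y) = c \<odot> x \<oplus> c \<odot> y"
  using smult_one[of x] smult_assoc1[of c d x] smult_l_distr[of c d x] smult_r_distr[of c x y] by simp_all

lemma type_minus_smult: "x \<in> carrier L \<Longrightarrow> (- 1) \<odot> x = \<ominus> x"
proof -
  assume x: "x \<in> carrier L"
  have "(- 1) \<odot> x \<oplus> 1 \<odot> x = \<zero>"
    using x type_smult_simps(3)[of x "-1" 1] by simp
  then show ?thesis
    using x type_smult_simps(1)[OF x] M.minus_equality[of "(- 1) \<odot> x" x] by simp
qed

lemma type_submoduleI:
  assumes "H \<subseteq> carrier L" "\<zero> \<in> H" "\<And>a b. a \<in> H \<Longrightarrow> b \<in> H \<Longrightarrow> a \<oplus> b \<in> H"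
    "\<And>c a. a \<in> H \<Longrightarrow> c \<odot> a \<in> H"
  shows "submodule H ring_of_type_algebra L"
proof (rule submoduleI)
  show "\<ominus> a \<in> H" if "a \<in> H" for a
    using assms(1) assms(4)[OF that, of "- 1"] type_minus_smult[of a] that by auto
qed (use assms in auto)

lemma type_submoduleD:
  assumes "submodule H ring_of_type_algebra L"
  shows "H \<subseteq> carrier L" "\<zero> \<in> H" "a \<in> H \<Longrightarrow> b \<in> H \<Longrightarrow> a \<oplus> b \<in> H" "a \<in> H \<Longrightarrow> c \<odot> a \<in> H"
    "a \<in> H \<Longrightarrow> \<ominus> a \<in> H"
proof -
  interpret H: submodule H ring_of_type_algebra L by (rule assms)
  show "H \<subseteq> carrier L" "\<zero> \<in> H" "a \<in> H \<Longrightarrow> b \<in> H \<Longrightarrow> a \<oplus> b \<in> H"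
    using H.subset H.one_closed H.m_closed by auto
  show "a \<in> H \<Longrightarrow> c \<odot> a \<in> H" using H.smult_closed by simp
  show "a \<in> H \<Longrightarrow> \<ominus> a \<in> H" using submoduleE(3)[OF assms] .
qed

lemma lin_span_least: "submodule H ring_of_type_algebra L \<Longrightarrow> S \<subseteq> H \<Longrightarrow> lin_span L S \<subseteq> H"
  unfolding lin_span_def by blast

lemma lin_span_incl: "S \<subseteq> lin_span L S"
  unfolding lin_span_def by blast

lemma lin_span_submodule:
  assumes "S \<subseteq> carrier L"
  shows "submodule (lin_span L S) ring_of_type_algebra L"
proof (rule type_submoduleI)
  show "lin_span L S \<subseteq> carrier L"
    using assms carrier_is_submodule by (rule_tac lin_span_least)
qed (auto simp: lin_span_def intro: type_submoduleD)

lemma lin_span_mono: "S \<subseteq> T \<Longrightarrow> lin_span L S \<subseteq> lin_span L T"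
  unfolding lin_span_def by blast

lemma lie_eval_closed [simp]:
  "g ` S \<subseteq> carrier L \<Longrightarrow> t \<in> lie_terms S \<Longrightarrow> lie_eval L g t \<in> carrier L"
  by (induction t) (auto simp: lie_terms_def)

end

lemma lie_terms_simps [simp]:
  "Gen x \<in> lie_terms S \<longleftrightarrow> x \<in> S"
  "Zero \<in> lie_terms S"
  "Add s t \<in> lie_terms S \<longleftrightarrow> s \<in> lie_terms S \<and> t \<in> lie_terms S"
  "Smult c s \<in> lie_terms S \<longleftrightarrow> s \<in> lie_terms S"
  "Bracket s t \<in> lie_terms S \<longleftrightarrow> s \<in> lie_terms S \<and> t \<in> lie_terms S"
  by (auto simp: lie_terms_def)

lemma lie_cong_terms: "lie_cong S E s t \<Longrightarrow> s \<in> lie_terms S \<and> t \<in> lie_terms S"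
  by (induction rule: lie_cong.induct) simp_all

text \<open>Apart from \<open>rel\<close>, each rule of the congruence is a closure property of
  equality or an axiom of Lie algebras. This is the universal property of a presented Lie
  algebra.\<close>

lemma (in lie_algebra) lie_eval_cong:
  assumes "lie_cong S E s t" "g ` S \<subseteq> carrier L"
    and "\<And>s t. (s, t) \<in> E \<Longrightarrow> s \<in> lie_terms S \<Longrightarrow> t \<in> lie_terms S \<Longrightarrow> lie_eval L g s = lie_eval L g t"
  shows "lie_eval L g s = lie_eval L g t"
  using assms(1)
proof (induction rule: lie_cong.induct)
  case (rel s t)
  then show ?case using assms(3) by simp
next
  case (Add_assoc s t u)
  then show ?case using assms(2) by (simp add: M.a_assoc)
next
  case (Add_comm s t)
  then show ?case using assms(2) by (simp add: M.a_comm)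
qed (use assms(2) in \<open>simp_all add: type_smult_simps bracket_add_left bracket_add_right
      bracket_smult_left bracket_smult_right bracket_alternating bracket_jacobi\<close>)

subsection \<open>The Lie ring of a group\<close>

context group
begin

lemma gr_part_group: "k \<in> {1..} \<Longrightarrow> group (gr_part G k)"
  using gr_part_comm_group[of k] comm_group.axioms(2) by auto

lemma gr_sum_carrier:
  "carrier (gr_sum G) =
    {s \<in> \<Pi>\<^sub>E k\<in>{1..}. carrier (gr_part G k). finite {k \<in> {1..}. s k \<noteq> \<one>\<^bsub>gr_part G k\<^esub>}}"
  unfolding gr_sum_def by (rule carrier_sum_group) (rule gr_part_group)

lemma gr_sum_mult: "s \<otimes>\<^bsub>gr_sum G\<^esub> t = (\<lambda>k\<in>{1..}. s k \<otimes>\<^bsub>gr_part G k\<^esub> t k)"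
  by (simp add: gr_sum_def)

lemma gr_sum_comm_group: "comm_group (gr_sum G)"
proof (rule group.group_comm_groupI)
  show "group (gr_sum G)"
    unfolding gr_sum_def by (rule sum_group) (rule gr_part_group)
  fix s t assume st: "s \<in> carrier (gr_sum G)" "t \<in> carrier (gr_sum G)"
  have "s k \<otimes>\<^bsub>gr_part G k\<^esub> t k = t k \<otimes>\<^bsub>gr_part G k\<^esub> s k" if "1 \<le> k" for k
    using st that comm_group.axioms(1)[OF gr_part_comm_group[OF that]]
    by (intro comm_monoid.m_comm) (auto simp: gr_sum_carrier PiE_iff)
  then show "s \<otimes>\<^bsub>gr_sum G\<^esub> t = t \<otimes>\<^bsub>gr_sum G\<^esub> s"
    unfolding gr_sum_def by (auto simp: fun_eq_iff)
qed

lemma gr_carrier: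
  "carrier (gr G) =
    {s \<in> \<Pi>\<^sub>E k\<in>{1..}. carrier (gr_part G k). finite {k \<in> {1..}. s k \<noteq> \<one>\<^bsub>gr_part G k\<^esub>}}"
  by (simp add: gr_def gr_sum_carrier)

lemma gr_add: "s \<oplus>\<^bsub>gr G\<^esub> t = (\<lambda>k\<in>{1..}. s k \<otimes>\<^bsub>gr_part G k\<^esub> t k)"
  by (simp add: gr_def gr_sum_def)

lemma gr_zero: "\<zero>\<^bsub>gr G\<^esub> = (\<lambda>k\<in>{1..}. \<one>\<^bsub>gr_part G k\<^esub>)"
  by (simp add: gr_def gr_sum_def)

lemma gr_smult: "c \<odot>\<^bsub>gr G\<^esub> s = s [^]\<^bsub>gr_sum G\<^esub> c"
  by (simp add: gr_def)

lemma gr_mult: "s \<otimes>\<^bsub>gr G\<^esub> t = (\<lambda>k\<in>{1..}.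
    finprod (gr_part G k) (\<lambda>i. gr_bracket G i (k - i) (s i) (t (k - i))) {1..<k})"
  by (simp add: gr_def)

lemma gr_module: "module ring_of_type_algebra (gr G)"
proof -
  interpret A: comm_group "gr_sum G" by (rule gr_sum_comm_group)
  show ?thesis
  proof (rule moduleI)
    show "cring (ring_of_type_algebra :: int ring)" by (rule cring_from_type_algebra)
    show "abelian_group (gr G)"
    proof (rule abelian_groupI)
      show "\<exists>y\<in>carrier (gr G). y \<oplus>\<^bsub>gr G\<^esub> x = \<zero>\<^bsub>gr G\<^esub>" if "x \<in> carrier (gr G)" for x
        using that A.inv_closed A.l_inv by (auto simp: gr_def)
    qed (auto simp: gr_def A.m_assoc intro: A.m_comm)
  qed (auto simp: gr_def A.int_pow_mult A.int_pow_pow A.int_pow_distrib mult.commute)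
qed

lemma gr_carrierD:
  assumes "s \<in> carrier (gr G)" "1 \<le> k"
  shows "\<exists>x\<in>lower_central G k. s k = coset_class G k x"
  using assms by (auto simp: gr_carrier PiE_iff carrier_gr_part)

lemma gr_eqI:
  assumes "s \<in> carrier (gr G)" "t \<in> carrier (gr G)" "\<And>k. 1 \<le> k \<Longrightarrow> s k = t k"
  shows "s = t"
  using assms by (auto simp: gr_carrier intro: PiE_ext)

lemma gr_smult_nth:
  assumes "s \<in> carrier (gr G)" "1 \<le> k"
  shows "(c \<odot>\<^bsub>gr G\<^esub> s) k = s k [^]\<^bsub>gr_part G k\<^esub> c"
  unfolding gr_smult
proof (rule hom_int_pow[of "\<lambda>s. s k"])
  show "(\<lambda>s. s k) \<in> hom (gr_sum G) (gr_part G k)"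
    using assms(2) by (auto simp: hom_def gr_sum_carrier gr_sum_mult PiE_iff)
qed (use assms gr_part_group gr_sum_comm_group comm_group.axioms(2) in \<open>auto simp: gr_def\<close>)

lemma gr_class_nth:
  "1 \<le> j \<Longrightarrow> gr_class G k x j = (if j = k then coset_class G k x else coset_class G j \<one>)"
  by (simp add: gr_class_def coset_class_def one_gr_part)

lemma gr_class_closed:
  assumes "1 \<le> k" "x \<in> lower_central G k"
  shows "gr_class G k x \<in> carrier (gr G)"
proof -
  have "finite {j \<in> {1..}. gr_class G k x j \<noteq> \<one>\<^bsub>gr_part G j\<^esub>}"
    by (rule finite_subset[of _ "{k}"]) (auto simp: gr_class_nth one_gr_part)
  moreover have "gr_class G k x j \<in> carrier (gr_part G j)" if "1 \<le> j" for j
    using that assms by (auto simp: gr_class_nth carrier_gr_part)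
  ultimately show ?thesis
    by (auto simp: gr_carrier PiE_iff gr_class_def)
qed

lemma gr_add_nth:
  assumes "1 \<le> k" "x \<in> lower_central G k" "y \<in> lower_central G k"
    "s k = coset_class G k x" "t k = coset_class G k y"
  shows "(s \<oplus>\<^bsub>gr G\<^esub> t) k = coset_class G k (x \<otimes> y)"
  using assms by (simp add: gr_add mult_gr_part)

lemma gr_class_one: "gr_class G k \<one> = \<zero>\<^bsub>gr G\<^esub>"
  by (auto simp: gr_class_def gr_zero one_gr_part coset_class_def fun_eq_iff)

lemma gr_class_mult:
  assumes "1 \<le> k" "x \<in> lower_central G k" "y \<in> lower_central G k"
  shows "gr_class G k (x \<otimes> y) = gr_class G k x \<oplus>\<^bsub>gr G\<^esub> gr_class G k y"
proof -
  interpret M: module ring_of_type_algebra "gr G" by (rule gr_module)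
  show ?thesis
  proof (rule gr_eqI)
    fix j :: nat assume j: "1 \<le> j"
    show "gr_class G k (x \<otimes> y) j = (gr_class G k x \<oplus>\<^bsub>gr G\<^esub> gr_class G k y) j"
      using gr_add_nth[OF j, of "if j = k then x else \<one>" "if j = k then y else \<one>"] assms j
      by (auto simp: gr_class_nth)
  qed (use assms in \<open>auto simp: gr_class_closed\<close>)
qed

lemma gr_class_inv:
  assumes "1 \<le> k" "x \<in> lower_central G k"
  shows "gr_class G k (inv x) = \<ominus>\<^bsub>gr G\<^esub> gr_class G k x"
proof -
  interpret M: module ring_of_type_algebra "gr G" by (rule gr_module)
  have "gr_class G k (inv x) \<oplus>\<^bsub>gr G\<^esub> gr_class G k x = \<zero>\<^bsub>gr G\<^esub>"
    using assms lower_central_in_carrier[OF assms(2)] by (simp add: gr_class_one flip: gr_class_mult)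
  then show ?thesis using M.M.minus_equality assms gr_class_closed by simp
qed

text \<open>gr is a direct sum, so an element is a finite sum of homogeneous classes. An additive
  identity therefore needs checking only on classes of single group elements.\<close>

lemma gr_induct [consumes 1, case_names zero hom add]:
  assumes s: "s \<in> carrier (gr G)"
    and zero: "P \<zero>\<^bsub>gr G\<^esub>"
    and cls: "\<And>k x. 1 \<le> k \<Longrightarrow> x \<in> lower_central G k \<Longrightarrow> P (gr_class G k x)"
    and add: "\<And>s t. s \<in> carrier (gr G) \<Longrightarrow> t \<in> carrier (gr G) \<Longrightarrow> P s \<Longrightarrow> P t \<Longrightarrow> P (s \<oplus>\<^bsub>gr G\<^esub> t)"
  shows "P s"
proof -
  \<comment> \<open>K is any finite set containing the support; enlarging K by one degree splits off
    one homogeneous class.\<close>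
  have "P s" if "finite K" "s \<in> carrier (gr G)" "{k \<in> {1..}. s k \<noteq> \<one>\<^bsub>gr_part G k\<^esub>} \<subseteq> K" for K s
    using that
  proof (induction K arbitrary: s rule: finite_induct)
    case empty
    then have "s = \<zero>\<^bsub>gr G\<^esub>"
      by (auto simp: gr_zero gr_carrier PiE_iff extensional_def fun_eq_iff)
    then show ?case using zero by simp
  next
    case (insert k K)
    show ?case
    proof (cases "1 \<le> k")
      case False
      then have "{k \<in> {1..}. s k \<noteq> \<one>\<^bsub>gr_part G k\<^esub>} \<subseteq> K" using insert.prems by auto
      then show ?thesis using insert by blast
    next
      case True
      then obtain x where x: "x \<in> lower_central G k" "s k = coset_class G k x"
        using gr_carrierD insert.prems by blast
      define s' where "s' = s(k := \<one>\<^bsub>gr_part G k\<^esub>)"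
      have supp: "{k \<in> {1..}. s' k \<noteq> \<one>\<^bsub>gr_part G k\<^esub>} \<subseteq> K"
        using insert.prems by (auto simp: s'_def)
      have s': "s' \<in> carrier (gr G)"
        using insert.prems(1) True finite_subset[OF supp insert(1)]
        by (auto simp: gr_carrier PiE_iff s'_def extensional_def one_gr_part carrier_gr_part)
      interpret M: module ring_of_type_algebra "gr G" by (rule gr_module)
      have "s = gr_class G k x \<oplus>\<^bsub>gr G\<^esub> s'"
      proof (rule gr_eqI)
        fix j :: nat assume j: "1 \<le> j"
        obtain y where y: "y \<in> lower_central G j" "s j = coset_class G j y"
          using gr_carrierD[OF insert.prems(1) j] by blast
        show "s j = (gr_class G k x \<oplus>\<^bsub>gr G\<^esub> s') j"
          using gr_add_nth[OF j, of "if j = k then x else \<one>" "if j = k then \<one> else y" "gr_class G k x" s']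
            lower_central_in_carrier[OF y(1)] lower_central_in_carrier[OF x(1)] x y j
          by (auto simp: gr_class_nth s'_def one_gr_part split: if_splits)
      qed (use insert.prems s' True x gr_class_closed in auto)
      then show ?thesis
        using add gr_class_closed True x s' cls insert.IH[OF s' supp] by metis
    qed
  qed
  then show ?thesis using s by (auto simp: gr_carrier)
qed

lemma gr_bracket_closed:
  assumes "1 \<le> i" "1 \<le> j" "a \<in> carrier (gr_part G i)" "b \<in> carrier (gr_part G j)"
  shows "gr_bracket G i j a b \<in> carrier (gr_part G (i + j))"
  using assms by (auto simp: carrier_gr_part gr_bracket_coset_class intro!: imageI commutator_lower_central)

lemma gr_bracket_mult_left:
  assumes "1 \<le> i" "1 \<le> j" "a \<in> carrier (gr_part G i)" "a' \<in> carrier (gr_part G i)"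
    "b \<in> carrier (gr_part G j)"
  shows "gr_bracket G i j (a \<otimes>\<^bsub>gr_part G i\<^esub> a') b =
    gr_bracket G i j a b \<otimes>\<^bsub>gr_part G (i + j)\<^esub> gr_bracket G i j a' b"
  using assms coset_class_commutator_mult_left
  by (auto simp: carrier_gr_part gr_bracket_coset_class mult_gr_part commutator_lower_central)

lemma gr_bracket_mult_right:
  assumes "1 \<le> i" "1 \<le> j" "a \<in> carrier (gr_part G i)" "b \<in> carrier (gr_part G j)"
    "b' \<in> carrier (gr_part G j)"
  shows "gr_bracket G i j a (b \<otimes>\<^bsub>gr_part G j\<^esub> b') =
    gr_bracket G i j a b \<otimes>\<^bsub>gr_part G (i + j)\<^esub> gr_bracket G i j a b'"
  using assms coset_class_commutator_mult_right
  by (auto simp: carrier_gr_part gr_bracket_coset_class mult_gr_part commutator_lower_central)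

lemma gr_bracket_one:
  assumes "1 \<le> i" "1 \<le> j"
  shows "a \<in> carrier (gr_part G i) \<Longrightarrow> gr_bracket G i j a \<one>\<^bsub>gr_part G j\<^esub> = \<one>\<^bsub>gr_part G (i + j)\<^esub>"
    "b \<in> carrier (gr_part G j) \<Longrightarrow> gr_bracket G i j \<one>\<^bsub>gr_part G i\<^esub> b = \<one>\<^bsub>gr_part G (i + j)\<^esub>"
  using assms lower_central_in_carrier
  by (auto simp: carrier_gr_part one_gr_part gr_bracket_coset_class commutator_def)

lemma gr_nth_closed: "s \<in> carrier (gr G) \<Longrightarrow> 1 \<le> k \<Longrightarrow> s k \<in> carrier (gr_part G k)"
  by (auto simp: gr_carrier PiE_iff)

lemma gr_bracket_nth_closed:
  assumes "s \<in> carrier (gr G)" "t \<in> carrier (gr G)" "i \<in> {1..<k}"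
  shows "gr_bracket G i (k - i) (s i) (t (k - i)) \<in> carrier (gr_part G k)"
  using gr_bracket_closed[of i "k - i" "s i" "t (k - i)"] assms gr_nth_closed by auto

text \<open>Only finiteness of the support needs an argument: if s vanishes beyond M and t beyond N,
  then for k > M + N each splitting of k has i > M or k - i > N.\<close>

lemma gr_mult_closed:
  assumes "s \<in> carrier (gr G)" "t \<in> carrier (gr G)"
  shows "s \<otimes>\<^bsub>gr G\<^esub> t \<in> carrier (gr G)"
proof -
  obtain M where M: "\<And>k. 1 \<le> k \<Longrightarrow> M < k \<Longrightarrow> s k = \<one>\<^bsub>gr_part G k\<^esub>"
  proof -
    have "finite {k \<in> {1..}. s k \<noteq> \<one>\<^bsub>gr_part G k\<^esub>}" using assms by (auto simp: gr_carrier)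
    then have "\<exists>m. \<forall>k\<in>{k \<in> {1..}. s k \<noteq> \<one>\<^bsub>gr_part G k\<^esub>}. k \<le> m" by (simp add: finite_nat_set_iff_bounded_le)
    then show ?thesis using that by (metis (mono_tags, lifting) atLeast_iff leD mem_Collect_eq)
  qed
  obtain N where N: "\<And>k. 1 \<le> k \<Longrightarrow> N < k \<Longrightarrow> t k = \<one>\<^bsub>gr_part G k\<^esub>"
  proof -
    have "finite {k \<in> {1..}. t k \<noteq> \<one>\<^bsub>gr_part G k\<^esub>}" using assms by (auto simp: gr_carrier)
    then have "\<exists>m. \<forall>k\<in>{k \<in> {1..}. t k \<noteq> \<one>\<^bsub>gr_part G k\<^esub>}. k \<le> m" by (simp add: finite_nat_set_iff_bounded_le)
    then show ?thesis using that by (metis (mono_tags, lifting) atLeast_iff leD mem_Collect_eq)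
  qed
  have cl: "(s \<otimes>\<^bsub>gr G\<^esub> t) k \<in> carrier (gr_part G k)" if "1 \<le> k" for k
  proof -
    interpret A: comm_group "gr_part G k" by (rule gr_part_comm_group[OF that])
    show ?thesis
      using that assms gr_bracket_nth_closed by (auto simp: gr_mult intro!: A.finprod_closed)
  qed
  have "(s \<otimes>\<^bsub>gr G\<^esub> t) k = \<one>\<^bsub>gr_part G k\<^esub>" if "1 \<le> k" "M + N < k" for k
  proof -
    interpret A: comm_group "gr_part G k" by (rule gr_part_comm_group[OF that(1)])
    have eq: "gr_bracket G i (k - i) (s i) (t (k - i)) = \<one>\<^bsub>gr_part G k\<^esub>" if i: "i \<in> {1..<k}" for i
    proof (cases "M < i")
      case True
      then show ?thesis
        using M[of i] gr_bracket_one(2)[of i "k - i" "t (k - i)"] i gr_nth_closed[OF assms(2), of "k - i"] by auto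
    next
      case False
      then have "t (k - i) = \<one>\<^bsub>gr_part G (k - i)\<^esub>"
        using i \<open>M + N < k\<close> by (intro N) auto
      then show ?thesis
        using gr_bracket_one(1)[of i "k - i" "s i"] i gr_nth_closed[OF assms(1), of i] by auto
    qed
    have "finprod (gr_part G k) (\<lambda>i. gr_bracket G i (k - i) (s i) (t (k - i))) {1..<k} = \<one>\<^bsub>gr_part G k\<^esub>"
      by (rule A.finprod_one_eqI) (rule eq)
    then show ?thesis using that by (simp add: gr_mult)
  qed
  then have "{k \<in> {1..}. (s \<otimes>\<^bsub>gr G\<^esub> t) k \<noteq> \<one>\<^bsub>gr_part G k\<^esub>} \<subseteq> {..M + N}"
    by (auto simp: not_less[symmetric])
  then have fin: "finite {k \<in> {1..}. (s \<otimes>\<^bsub>gr G\<^esub> t) k \<noteq> \<one>\<^bsub>gr_part G k\<^esub>}"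
    by (rule finite_subset) simp
  have "s \<otimes>\<^bsub>gr G\<^esub> t \<in> extensional {1..}"
    by (simp add: gr_mult)
  then show ?thesis
    unfolding gr_carrier PiE_iff mem_Collect_eq using cl fin by simp
qed

lemma gr_mult_add_left:
  assumes "s \<in> carrier (gr G)" "s' \<in> carrier (gr G)" "t \<in> carrier (gr G)"
  shows "(s \<oplus>\<^bsub>gr G\<^esub> s') \<otimes>\<^bsub>gr G\<^esub> t = s \<otimes>\<^bsub>gr G\<^esub> t \<oplus>\<^bsub>gr G\<^esub> s' \<otimes>\<^bsub>gr G\<^esub> t"
proof -
  interpret M: module ring_of_type_algebra "gr G" by (rule gr_module)
  show ?thesis
  proof (rule gr_eqI)
    fix k :: nat assume k: "1 \<le> k"
    interpret A: comm_group "gr_part G k" by (rule gr_part_comm_group[OF k])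
    have "finprod (gr_part G k) (\<lambda>i. gr_bracket G i (k - i) ((s \<oplus>\<^bsub>gr G\<^esub> s') i) (t (k - i))) {1..<k} =
      finprod (gr_part G k) (\<lambda>i. gr_bracket G i (k - i) (s i) (t (k - i)) \<otimes>\<^bsub>gr_part G k\<^esub>
        gr_bracket G i (k - i) (s' i) (t (k - i))) {1..<k}"
    proof (rule A.finprod_cong')
      fix i assume i: "i \<in> {1..<k}"
      then show "gr_bracket G i (k - i) ((s \<oplus>\<^bsub>gr G\<^esub> s') i) (t (k - i)) =
         gr_bracket G i (k - i) (s i) (t (k - i)) \<otimes>\<^bsub>gr_part G k\<^esub> gr_bracket G i (k - i) (s' i) (t (k - i))"
        using gr_bracket_mult_left[of i "k - i" "s i" "s' i" "t (k - i)"] assms gr_nth_closed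
          less_imp_le_nat[of i k] zero_less_diff[of k i]
        by (auto simp: gr_add Suc_le_eq)
    qed (use assms gr_bracket_nth_closed in auto)
    also have "\<dots> = finprod (gr_part G k) (\<lambda>i. gr_bracket G i (k - i) (s i) (t (k - i))) {1..<k} \<otimes>\<^bsub>gr_part G k\<^esub>
        finprod (gr_part G k) (\<lambda>i. gr_bracket G i (k - i) (s' i) (t (k - i))) {1..<k}"
      using assms gr_bracket_nth_closed by (intro A.finprod_multf) auto
    finally show "((s \<oplus>\<^bsub>gr G\<^esub> s') \<otimes>\<^bsub>gr G\<^esub> t) k = (s \<otimes>\<^bsub>gr G\<^esub> t \<oplus>\<^bsub>gr G\<^esub> s' \<otimes>\<^bsub>gr G\<^esub> t) k"
      using k by (simp add: gr_mult gr_add[of "restrict _ _"])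
  qed (use assms in \<open>auto intro!: gr_mult_closed\<close>)
qed

lemma gr_mult_add_right:
  assumes "s \<in> carrier (gr G)" "t \<in> carrier (gr G)" "t' \<in> carrier (gr G)"
  shows "s \<otimes>\<^bsub>gr G\<^esub> (t \<oplus>\<^bsub>gr G\<^esub> t') = s \<otimes>\<^bsub>gr G\<^esub> t \<oplus>\<^bsub>gr G\<^esub> s \<otimes>\<^bsub>gr G\<^esub> t'"
proof -
  interpret M: module ring_of_type_algebra "gr G" by (rule gr_module)
  show ?thesis
  proof (rule gr_eqI)
    fix k :: nat assume k: "1 \<le> k"
    interpret A: comm_group "gr_part G k" by (rule gr_part_comm_group[OF k])
    have "finprod (gr_part G k) (\<lambda>i. gr_bracket G i (k - i) (s i) ((t \<oplus>\<^bsub>gr G\<^esub> t') (k - i))) {1..<k} =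
      finprod (gr_part G k) (\<lambda>i. gr_bracket G i (k - i) (s i) (t (k - i)) \<otimes>\<^bsub>gr_part G k\<^esub>
        gr_bracket G i (k - i) (s i) (t' (k - i))) {1..<k}"
    proof (rule A.finprod_cong')
      fix i assume i: "i \<in> {1..<k}"
      then show "gr_bracket G i (k - i) (s i) ((t \<oplus>\<^bsub>gr G\<^esub> t') (k - i)) =
         gr_bracket G i (k - i) (s i) (t (k - i)) \<otimes>\<^bsub>gr_part G k\<^esub> gr_bracket G i (k - i) (s i) (t' (k - i))"
        using gr_bracket_mult_right[of i "k - i" "s i" "t (k - i)" "t' (k - i)"] assms gr_nth_closed
          less_imp_le_nat[of i k] zero_less_diff[of k i]
        by (auto simp: gr_add Suc_le_eq)
    qed (use assms gr_bracket_nth_closed in auto)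
    also have "\<dots> = finprod (gr_part G k) (\<lambda>i. gr_bracket G i (k - i) (s i) (t (k - i))) {1..<k} \<otimes>\<^bsub>gr_part G k\<^esub>
        finprod (gr_part G k) (\<lambda>i. gr_bracket G i (k - i) (s i) (t' (k - i))) {1..<k}"
      using assms gr_bracket_nth_closed by (intro A.finprod_multf) auto
    finally show "(s \<otimes>\<^bsub>gr G\<^esub> (t \<oplus>\<^bsub>gr G\<^esub> t')) k = (s \<otimes>\<^bsub>gr G\<^esub> t \<oplus>\<^bsub>gr G\<^esub> s \<otimes>\<^bsub>gr G\<^esub> t') k"
      using k by (simp add: gr_mult gr_add[of "restrict _ _"])
  qed (use assms in \<open>auto intro!: gr_mult_closed\<close>)
qed

lemma gr_class_commutator:
  assumes "1 \<le> i" "1 \<le> j" "x \<in> lower_central G i" "y \<in> lower_central G j"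
  shows "gr_class G i x \<otimes>\<^bsub>gr G\<^esub> gr_class G j y = gr_class G (i + j) (commutator G x y)"
proof (rule gr_eqI)
  have m: "commutator G x y \<in> lower_central G (i + j)"
    using assms by (rule commutator_lower_central)
  show "gr_class G i x \<otimes>\<^bsub>gr G\<^esub> gr_class G j y \<in> carrier (gr G)"
    "gr_class G (i + j) (commutator G x y) \<in> carrier (gr G)"
    using assms m by (auto intro!: gr_mult_closed gr_class_closed)
  fix k :: nat assume k: "1 \<le> k"
  interpret A: comm_group "gr_part G k" by (rule gr_part_comm_group[OF k])
  have eq: "gr_bracket G i' (k - i') (gr_class G i x i') (gr_class G j y (k - i')) =
      (if i' = i \<and> k = i + j then coset_class G k (commutator G x y) else \<one>\<^bsub>gr_part G k\<^esub>)"
    if i': "i' \<in> {1..<k}" for i'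
  proof -
    have "gr_bracket G i' (k - i') (gr_class G i x i') (gr_class G j y (k - i')) =
        coset_class G (i' + (k - i')) (commutator G (if i' = i then x else \<one>) (if k - i' = j then y else \<one>))"
      using i' assms by (subst gr_bracket_coset_class[symmetric]) (auto simp: gr_class_nth)
    then show ?thesis
      using i' assms lower_central_in_carrier[OF assms(3)] lower_central_in_carrier[OF assms(4)]
      by (auto simp: one_gr_part commutator_def)
  qed
  have "(gr_class G i x \<otimes>\<^bsub>gr G\<^esub> gr_class G j y) k = finprod (gr_part G k)
      (\<lambda>i'. if i' = i \<and> k = i + j then coset_class G k (commutator G x y) else \<one>\<^bsub>gr_part G k\<^esub>) {1..<k}"
    unfolding gr_mult restrict_apply
    using k by (simp del: One_nat_def, intro A.finprod_cong'[OF HOL.refl _ eq])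
      (use m in \<open>auto simp: carrier_gr_part one_gr_part\<close>)
  also have "\<dots> = gr_class G (i + j) (commutator G x y) k"
  proof (cases "k = i + j")
    case True
    then show ?thesis
      using A.finprod_singleton_swap[of i "{1..<k}" "\<lambda>_. coset_class G k (commutator G x y)"] assms m
      by (simp add: gr_class_nth carrier_gr_part)
  next
    case False
    then show ?thesis using k by (simp add: gr_class_nth flip: one_gr_part)
  qed
  finally show "(gr_class G i x \<otimes>\<^bsub>gr G\<^esub> gr_class G j y) k = gr_class G (i + j) (commutator G x y) k" .
qed

lemma gr_mult_zero:
  assumes "s \<in> carrier (gr G)"
  shows "s \<otimes>\<^bsub>gr G\<^esub> \<zero>\<^bsub>gr G\<^esub> = \<zero>\<^bsub>gr G\<^esub>" "\<zero>\<^bsub>gr G\<^esub> \<otimes>\<^bsub>gr G\<^esub> s = \<zero>\<^bsub>gr G\<^esub>"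
proof -
  interpret M: module ring_of_type_algebra "gr G" by (rule gr_module)
  show "s \<otimes>\<^bsub>gr G\<^esub> \<zero>\<^bsub>gr G\<^esub> = \<zero>\<^bsub>gr G\<^esub>"
    using gr_mult_add_right[of s "\<zero>\<^bsub>gr G\<^esub>" "\<zero>\<^bsub>gr G\<^esub>"] assms gr_mult_closed[of s "\<zero>\<^bsub>gr G\<^esub>"]
      M.M.add.r_cancel_one' by auto
  show "\<zero>\<^bsub>gr G\<^esub> \<otimes>\<^bsub>gr G\<^esub> s = \<zero>\<^bsub>gr G\<^esub>"
    using gr_mult_add_left[of "\<zero>\<^bsub>gr G\<^esub>" "\<zero>\<^bsub>gr G\<^esub>" s] assms gr_mult_closed[of "\<zero>\<^bsub>gr G\<^esub>" s]
      M.M.add.r_cancel_one' by auto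
qed

text \<open>Proved before the alternating law, since additive induction for
  \<open>gr_mult_self\<close> leaves exactly these cross terms.\<close>

lemma gr_mult_swap:
  assumes "s \<in> carrier (gr G)" "t \<in> carrier (gr G)"
  shows "s \<otimes>\<^bsub>gr G\<^esub> t \<oplus>\<^bsub>gr G\<^esub> t \<otimes>\<^bsub>gr G\<^esub> s = \<zero>\<^bsub>gr G\<^esub>"
proof -
  interpret M: module ring_of_type_algebra "gr G" by (rule gr_module)
  note ac = M.M.a_ac
  show ?thesis using assms(1)
  proof (induction s rule: gr_induct)
    case zero
    then show ?case using assms gr_mult_zero by simp
  next
    case (hom k x)
    show ?case using assms(2)
    proof (induction t rule: gr_induct)
      case zero
      then show ?case using hom gr_class_closed gr_mult_zero by simp
    next
      case (hom j y)
      have c: "x \<in> carrier G" "y \<in> carrier G"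
        using hom \<open>x \<in> lower_central G k\<close> lower_central_in_carrier by auto
      have "gr_class G (k + j) (commutator G x y) \<oplus>\<^bsub>gr G\<^esub> gr_class G (k + j) (commutator G y x) =
          gr_class G (k + j) (commutator G x y \<otimes> commutator G y x)"
        using \<open>1 \<le> k\<close> hom commutator_lower_central[OF _ _ \<open>x \<in> lower_central G k\<close> hom(2)]
          commutator_lower_central[OF _ _ hom(2) \<open>x \<in> lower_central G k\<close>]
        by (intro gr_class_mult[symmetric]) (auto simp: add.commute)
      also have "\<dots> = \<zero>\<^bsub>gr G\<^esub>"
        using c by (simp flip: inv_commutator[of x y] add: gr_class_one)
      finally show ?case
        using gr_class_commutator[OF \<open>1 \<le> k\<close> hom(1) \<open>x \<in> lower_central G k\<close> hom(2)]
          gr_class_commutator[OF hom(1) \<open>1 \<le> k\<close> hom(2) \<open>x \<in> lower_central G k\<close>]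
        by (simp add: add.commute)
    next
      case (add t t')
      have x: "gr_class G k x \<in> carrier (gr G)" using hom gr_class_closed by simp
      have "(gr_class G k x \<otimes>\<^bsub>gr G\<^esub> t \<oplus>\<^bsub>gr G\<^esub> t \<otimes>\<^bsub>gr G\<^esub> gr_class G k x) \<oplus>\<^bsub>gr G\<^esub>
        (gr_class G k x \<otimes>\<^bsub>gr G\<^esub> t' \<oplus>\<^bsub>gr G\<^esub> t' \<otimes>\<^bsub>gr G\<^esub> gr_class G k x) = \<zero>\<^bsub>gr G\<^esub>"
        using add by simp
      then show ?case
        using add.hyps x by (simp add: gr_mult_add_left gr_mult_add_right gr_mult_closed ac)
    qed
  next
    case (add s s')
    have "(s \<otimes>\<^bsub>gr G\<^esub> t \<oplus>\<^bsub>gr G\<^esub> t \<otimes>\<^bsub>gr G\<^esub> s) \<oplus>\<^bsub>gr G\<^esub>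
      (s' \<otimes>\<^bsub>gr G\<^esub> t \<oplus>\<^bsub>gr G\<^esub> t \<otimes>\<^bsub>gr G\<^esub> s') = \<zero>\<^bsub>gr G\<^esub>"
      using add by simp
    then show ?case
      using add.hyps assms(2) by (simp add: gr_mult_add_left gr_mult_add_right gr_mult_closed ac)
  qed
qed

lemma gr_mult_self:
  assumes "s \<in> carrier (gr G)"
  shows "s \<otimes>\<^bsub>gr G\<^esub> s = \<zero>\<^bsub>gr G\<^esub>"
proof -
  interpret M: module ring_of_type_algebra "gr G" by (rule gr_module)
  show ?thesis using assms
  proof (induction s rule: gr_induct)
    case zero
    then show ?case using gr_mult_zero by simp
  next
    case (hom k x)
    then show ?case
      using gr_class_commutator[of k k x x] lower_central_in_carrier[of x k]
      by (simp add: commutator_def m_assoc gr_class_one)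
  next
    case (add s t)
    have "(s \<oplus>\<^bsub>gr G\<^esub> t) \<otimes>\<^bsub>gr G\<^esub> (s \<oplus>\<^bsub>gr G\<^esub> t) = s \<otimes>\<^bsub>gr G\<^esub> t \<oplus>\<^bsub>gr G\<^esub> t \<otimes>\<^bsub>gr G\<^esub> s"
      using add by (simp add: gr_mult_add_left gr_mult_add_right gr_mult_closed M.M.a_ac)
    then show ?case using add gr_mult_swap by simp
  qed
qed

text \<open>Naming the Jacobi sum exposes its cyclic symmetry: additivity in the first argument
  together with rotation gives additivity in each.\<close>

definition gr_jacobi where
  "gr_jacobi s t u = s \<otimes>\<^bsub>gr G\<^esub> (t \<otimes>\<^bsub>gr G\<^esub> u) \<oplus>\<^bsub>gr G\<^esub> t \<otimes>\<^bsub>gr G\<^esub> (u \<otimes>\<^bsub>gr G\<^esub> s) \<oplus>\<^bsub>gr G\<^esub>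
    u \<otimes>\<^bsub>gr G\<^esub> (s \<otimes>\<^bsub>gr G\<^esub> t)"

lemma gr_jacobi_add:
  assumes "s \<in> carrier (gr G)" "s' \<in> carrier (gr G)" "t \<in> carrier (gr G)" "u \<in> carrier (gr G)"
  shows "gr_jacobi (s \<oplus>\<^bsub>gr G\<^esub> s') t u = gr_jacobi s t u \<oplus>\<^bsub>gr G\<^esub> gr_jacobi s' t u"
proof -
  interpret M: module ring_of_type_algebra "gr G" by (rule gr_module)
  show ?thesis
    using assms unfolding gr_jacobi_def
    by (simp add: gr_mult_add_left gr_mult_add_right gr_mult_closed M.M.a_ac)
qed

lemma gr_jacobi_rotate:
  assumes "s \<in> carrier (gr G)" "t \<in> carrier (gr G)" "u \<in> carrier (gr G)"
  shows "gr_jacobi t u s = gr_jacobi s t u"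
proof -
  interpret M: module ring_of_type_algebra "gr G" by (rule gr_module)
  show ?thesis
    using assms unfolding gr_jacobi_def by (simp add: gr_mult_closed M.M.a_ac)
qed

lemma gr_jacobi_zero: "t \<in> carrier (gr G) \<Longrightarrow> u \<in> carrier (gr G) \<Longrightarrow> gr_jacobi \<zero>\<^bsub>gr G\<^esub> t u = \<zero>\<^bsub>gr G\<^esub>"
proof -
  interpret M: module ring_of_type_algebra "gr G" by (rule gr_module)
  show "t \<in> carrier (gr G) \<Longrightarrow> u \<in> carrier (gr G) \<Longrightarrow> ?thesis"
    unfolding gr_jacobi_def by (simp add: gr_mult_closed gr_mult_zero)
qed

lemma gr_jacobi_class:
  assumes "1 \<le> i" "1 \<le> j" "1 \<le> k" "x \<in> lower_central G i" "y \<in> lower_central G j" "z \<in> lower_central G k"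
  shows "gr_jacobi (gr_class G i x) (gr_class G j y) (gr_class G k z) = \<zero>\<^bsub>gr G\<^esub>"
proof -
  have m: "commutator G x y \<in> lower_central G (i + j)" "commutator G y z \<in> lower_central G (j + k)"
      "commutator G z x \<in> lower_central G (k + i)"
    using assms commutator_lower_central by auto
  have n: "commutator G x (commutator G y z) \<in> lower_central G (i + j + k)"
    "commutator G y (commutator G z x) \<in> lower_central G (i + j + k)"
    "commutator G z (commutator G x y) \<in> lower_central G (i + j + k)"
    using commutator_lower_central[of i "j + k" x "commutator G y z"]
      commutator_lower_central[of j "k + i" y "commutator G z x"]
      commutator_lower_central[of k "i + j" z "commutator G x y"] assms m
    by (auto simp: ac_simps)
  have "gr_jacobi (gr_class G i x) (gr_class G j y) (gr_class G k z) =
    gr_class G (i + j + k) (commutator G x (commutator G y z)) \<oplus>\<^bsub>gr G\<^esub>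
    gr_class G (j + (k + i)) (commutator G y (commutator G z x)) \<oplus>\<^bsub>gr G\<^esub>
    gr_class G (k + (i + j)) (commutator G z (commutator G x y))"
    using assms m unfolding gr_jacobi_def by (simp add: gr_class_commutator add.assoc)
  also have "\<dots> = gr_class G (i + j + k) (commutator G x (commutator G y z) \<otimes>
    commutator G y (commutator G z x) \<otimes> commutator G z (commutator G x y))"
    using assms n by (simp add: gr_class_mult ac_simps)
  also have "\<dots> = gr_class G (i + j + k) \<one>"
    using coset_class_jacobi[OF assms] by (simp add: gr_class_def coset_class_def cong: if_cong)
  finally show ?thesis by (simp add: gr_class_one)
qed

lemma gr_jacobi_extend:
  assumes "s \<in> carrier (gr G)" "t \<in> carrier (gr G)" "u \<in> carrier (gr G)"
    and "\<And>k x. 1 \<le> k \<Longrightarrow> x \<in> lower_central G k \<Longrightarrow> gr_jacobi (gr_class G k x) t u = \<zero>\<^bsub>gr G\<^esub>"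
  shows "gr_jacobi s t u = \<zero>\<^bsub>gr G\<^esub>"
proof -
  interpret M: module ring_of_type_algebra "gr G" by (rule gr_module)
  show ?thesis using assms(1)
  proof (induction s rule: gr_induct)
    case zero
    show ?case using assms gr_jacobi_zero by simp
  next
    case (hom k x)
    then show ?case using assms(4) by simp
  next
    case (add s s')
    then show ?case using assms gr_jacobi_add by simp
  qed
qed

text \<open>Rotation brings each argument in turn to the first place, where
  \<open>gr_jacobi_extend\<close> reduces it to a class.\<close>

lemma gr_jacobi_eq_zero:
  assumes "s \<in> carrier (gr G)" "t \<in> carrier (gr G)" "u \<in> carrier (gr G)"
  shows "gr_jacobi s t u = \<zero>\<^bsub>gr G\<^esub>"
proof -
  have 1: "gr_jacobi s (gr_class G j y) (gr_class G k z) = \<zero>\<^bsub>gr G\<^esub>"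
    if "s \<in> carrier (gr G)" "1 \<le> j" "1 \<le> k" "y \<in> lower_central G j" "z \<in> lower_central G k" for s j k y z
    by (rule gr_jacobi_extend) (use that in \<open>auto intro!: gr_jacobi_class gr_class_closed\<close>)
  have 2: "gr_jacobi s t (gr_class G k z) = \<zero>\<^bsub>gr G\<^esub>"
    if "s \<in> carrier (gr G)" "t \<in> carrier (gr G)" "1 \<le> k" "z \<in> lower_central G k" for s t k z
  proof -
    have z: "gr_class G k z \<in> carrier (gr G)" using that gr_class_closed by simp
    have "gr_jacobi t (gr_class G k z) s = \<zero>\<^bsub>gr G\<^esub>"
    proof (rule gr_jacobi_extend[OF that(2) z that(1)])
      fix j y assume "1 \<le> j" "y \<in> lower_central G j"
      then show "gr_jacobi (gr_class G j y) (gr_class G k z) s = \<zero>\<^bsub>gr G\<^esub>"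
        using 1[OF that(1) _ that(3) _ that(4)] gr_jacobi_rotate[OF that(1) gr_class_closed z, of j y] by simp
    qed
    then show ?thesis using gr_jacobi_rotate[OF that(1,2) z] by simp
  qed
  have "gr_jacobi u s t = \<zero>\<^bsub>gr G\<^esub>"
  proof (rule gr_jacobi_extend[OF assms(3,1,2)])
    fix k x assume "1 \<le> k" "x \<in> lower_central G k"
    then show "gr_jacobi (gr_class G k x) s t = \<zero>\<^bsub>gr G\<^esub>"
      using 2[OF assms(1,2)] gr_jacobi_rotate[OF gr_class_closed assms(1,2), of k x] by simp
  qed
  then show ?thesis using gr_jacobi_rotate[OF assms(3,1,2)] by simp
qed

theorem gr_lie_algebra: "lie_algebra (gr G)"
proof -
  interpret M: module ring_of_type_algebra "gr G" by (rule gr_module)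
  have g: "group (gr_sum G)" using gr_sum_comm_group comm_group.axioms(2) by blast
  show ?thesis
  proof (rule lie_algebra.intro[OF gr_module], unfold_locales)
    fix x y z :: "nat \<Rightarrow> 'a set" and c :: int
    assume x: "x \<in> carrier (gr G)" and y: "y \<in> carrier (gr G)"
    show "x \<otimes>\<^bsub>gr G\<^esub> y \<in> carrier (gr G)" using x y by (rule gr_mult_closed)
    have "(\<lambda>s. s \<otimes>\<^bsub>gr G\<^esub> y) \<in> hom (gr_sum G) (gr_sum G)"
      using y gr_mult_add_left gr_mult_closed by (auto simp: hom_def gr_def)
    then show "(c \<odot>\<^bsub>gr G\<^esub> x) \<otimes>\<^bsub>gr G\<^esub> y = c \<odot>\<^bsub>gr G\<^esub> (x \<otimes>\<^bsub>gr G\<^esub> y)"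
      unfolding gr_smult using hom_int_pow[OF _ _ g g, of "\<lambda>s. s \<otimes>\<^bsub>gr G\<^esub> y" x c] x by (simp add: gr_def)
    have "(\<lambda>s. x \<otimes>\<^bsub>gr G\<^esub> s) \<in> hom (gr_sum G) (gr_sum G)"
      using x gr_mult_add_right gr_mult_closed by (auto simp: hom_def gr_def)
    then show "x \<otimes>\<^bsub>gr G\<^esub> (c \<odot>\<^bsub>gr G\<^esub> y) = c \<odot>\<^bsub>gr G\<^esub> (x \<otimes>\<^bsub>gr G\<^esub> y)"
      unfolding gr_smult using hom_int_pow[OF _ _ g g, of "\<lambda>s. x \<otimes>\<^bsub>gr G\<^esub> s" y c] y by (simp add: gr_def)
  next
    fix x y z :: "nat \<Rightarrow> 'a set"
    assume "x \<in> carrier (gr G)" "y \<in> carrier (gr G)" "z \<in> carrier (gr G)"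
    then show "x \<otimes>\<^bsub>gr G\<^esub> (y \<otimes>\<^bsub>gr G\<^esub> z) \<oplus>\<^bsub>gr G\<^esub> y \<otimes>\<^bsub>gr G\<^esub> (z \<otimes>\<^bsub>gr G\<^esub> x) \<oplus>\<^bsub>gr G\<^esub>
        z \<otimes>\<^bsub>gr G\<^esub> (x \<otimes>\<^bsub>gr G\<^esub> y) = \<zero>\<^bsub>gr G\<^esub>"
      using gr_jacobi_eq_zero unfolding gr_jacobi_def by blast
  qed (auto intro: gr_mult_add_left gr_mult_add_right gr_mult_self)
qed

end

section \<open>The free group and its Fox derivatives\<close>

lemma reduced_Cons: "reduced (a # w) \<Longrightarrow> reduced w"
  by (cases w) auto

lemma reduced_cancel_Cons: "reduced w \<Longrightarrow> reduced (cancel_Cons a w)"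
  by (cases w) (auto dest: reduced_Cons)

lemma reduced_foldr: "reduced w \<Longrightarrow> reduced (foldr cancel_Cons v w)"
  by (induction v) (auto intro: reduced_cancel_Cons)

lemma cancel_Cons_reduced: "reduced (a # w) \<Longrightarrow> cancel_Cons a w = a # w"
  by (cases w) auto

lemma foldr_cancel_Cons_Nil: "reduced w \<Longrightarrow> foldr cancel_Cons w [] = w"
proof (induction w)
  case (Cons a w)
  then show ?case using reduced_Cons[of a w] by (simp add: cancel_Cons_reduced)
qed simp

lemma set_cancel_Cons: "set (cancel_Cons a w) \<subseteq> insert a (set w)"
  by (cases w) auto

lemma set_foldr_cancel_Cons: "set (foldr cancel_Cons v w) \<subseteq> set v \<union> set w"
  by (induction v) (use set_cancel_Cons in fastforce)+

text \<open>Van der Waerden's argument: every letter permutes the reduced words, with the inverse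
  letter as inverse permutation. The product of words is the composed action, and associativity is
  inherited from composition.\<close>

lemma cancel_Cons_inverse:
  assumes "reduced w" "fst a = fst b" "snd a \<noteq> snd b"
  shows "cancel_Cons a (cancel_Cons b w) = w"
proof (cases w)
  case (Cons c w')
  show ?thesis
  proof (cases "fst b = fst c \<and> snd b \<noteq> snd c")
    case True
    then have "a = c" using assms by (auto simp: prod_eq_iff)
    then show ?thesis using True Cons assms by (simp add: cancel_Cons_reduced)
  qed (use Cons assms in auto)
qed (use assms in auto)

lemma foldr_cancel_Cons:
  "reduced w \<Longrightarrow> foldr cancel_Cons (cancel_Cons a v) w = cancel_Cons a (foldr cancel_Cons v w)"
  by (cases v) (auto simp: cancel_Cons_inverse reduced_foldr)

lemma foldr_cancel_assoc:
  "reduced w \<Longrightarrow> foldr cancel_Cons (foldr cancel_Cons u v) w = foldr cancel_Cons u (foldr cancel_Cons v w)"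
  by (induction u) (auto simp: foldr_cancel_Cons)

definition word_inv :: "('v \<times> bool) list \<Rightarrow> ('v \<times> bool) list" where
  "word_inv w = rev (map (\<lambda>(x, b). (x, \<not> b)) w)"

lemma foldr_word_inv:
  "reduced w \<Longrightarrow> foldr cancel_Cons (word_inv u) (foldr cancel_Cons u w) = w"
  by (induction u) (auto simp: word_inv_def cancel_Cons_inverse reduced_foldr)

lemma free_group_simps:
  "w \<in> carrier (free_group S) \<longleftrightarrow> reduced w \<and> fst ` set w \<subseteq> S"
  "v \<otimes>\<^bsub>free_group S\<^esub> w = foldr cancel_Cons v w"
  "\<one>\<^bsub>free_group S\<^esub> = []"
  by (simp_all add: free_group_def)

lemma free_group_group: "group (free_group S)"
proof (rule groupI)
  show "v \<otimes>\<^bsub>free_group S\<^esub> w \<in> carrier (free_group S)"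
    if "v \<in> carrier (free_group S)" "w \<in> carrier (free_group S)" for v w
    using that image_mono[OF set_foldr_cancel_Cons[of v w], of fst]
    by (simp add: free_group_simps reduced_foldr image_Un) blast
  show "\<exists>v\<in>carrier (free_group S). v \<otimes>\<^bsub>free_group S\<^esub> w = \<one>\<^bsub>free_group S\<^esub>"
    if w: "w \<in> carrier (free_group S)" for w
  proof
    \<comment> \<open>Acting on the empty word replaces \<open>word_inv w\<close> by a reduced word
      with the same action.\<close>
    let ?v = "foldr cancel_Cons (word_inv w) []"
    have "fst ` set (word_inv w) = fst ` set w"
      by (force simp: word_inv_def image_iff)
    then show "?v \<in> carrier (free_group S)"
      using w image_mono[OF set_foldr_cancel_Cons[of "word_inv w" "[]"], of fst]
      by (simp add: free_group_simps reduced_foldr) blast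
    have "foldr cancel_Cons ?v w = foldr cancel_Cons (word_inv w) (foldr cancel_Cons w [])"
      using w by (simp add: free_group_simps foldr_cancel_assoc foldr_cancel_Cons_Nil)
    then show "?v \<otimes>\<^bsub>free_group S\<^esub> w = \<one>\<^bsub>free_group S\<^esub>"
      by (simp add: free_group_simps foldr_word_inv)
  qed
qed (auto simp: free_group_simps foldr_cancel_assoc)

lemma free_gen_closed [simp]: "x \<in> S \<Longrightarrow> free_gen x \<in> carrier (free_group S)"
  by (simp add: free_group_simps free_gen_def)

lemma inv_free_gen: "x \<in> S \<Longrightarrow> inv\<^bsub>free_group S\<^esub> free_gen x = [(x, False)]"
  by (rule group.inv_equality[OF free_group_group]) (auto simp: free_group_simps free_gen_def)

lemma free_group_Cons:
  assumes "(x, b) # w \<in> carrier (free_group S)"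
  shows "w \<in> carrier (free_group S)" "x \<in> S"
    "(x, b) # w = (if b then free_gen x else inv\<^bsub>free_group S\<^esub> free_gen x) \<otimes>\<^bsub>free_group S\<^esub> w"
proof -
  show *: "w \<in> carrier (free_group S)" "x \<in> S"
    using assms by (auto simp: free_group_simps dest: reduced_Cons)
  have "(x, b) # w = cancel_Cons (x, b) w"
    using assms by (simp add: free_group_simps cancel_Cons_reduced)
  then show "(x, b) # w = (if b then free_gen x else inv\<^bsub>free_group S\<^esub> free_gen x) \<otimes>\<^bsub>free_group S\<^esub> w"
    using inv_free_gen[OF *(2)] by (simp add: free_group_simps(2)) (simp add: free_gen_def)
qed

lemma free_group_generate: "generate (free_group S) (free_gen ` S) = carrier (free_group S)"
proof
  interpret F: group "free_group S" by (rule free_group_group)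
  show "generate (free_group S) (free_gen ` S) \<subseteq> carrier (free_group S)"
    by (rule F.generate_incl) auto
  show "carrier (free_group S) \<subseteq> generate (free_group S) (free_gen ` S)"
  proof
    fix w assume "w \<in> carrier (free_group S)"
    then show "w \<in> generate (free_group S) (free_gen ` S)"
    proof (induction w)
      case Nil
      then show ?case using generate.one[of "free_group S"] by (simp add: free_group_simps)
    next
      case (Cons a w)
      then have a: "w \<in> carrier (free_group S)" "fst a \<in> S"
          "a # w = (if snd a then free_gen (fst a) else inv\<^bsub>free_group S\<^esub> free_gen (fst a)) \<otimes>\<^bsub>free_group S\<^esub> w"
        using free_group_Cons[of "fst a" "snd a" w S] by simp_all
      show ?case
        unfolding a(3) using Cons.IH a(1,2)
        by (intro generate.eng) (auto intro: generate.incl generate.inv)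
    qed
  qed
qed

section \<open>Integer polynomials with multisets as monomials, graded series and the Magnus
  expansion\<close>

type_synonym mpoly = "nat multiset \<Rightarrow>\<^sub>0 int"

definition mvar :: "nat \<Rightarrow> mpoly" where
  "mvar i = Poly_Mapping.single {#i#} 1"

definition homogeneous :: "nat set \<Rightarrow> nat \<Rightarrow> mpoly \<Rightarrow> bool" where
  "homogeneous S d p \<longleftrightarrow> (\<forall>m\<in>Poly_Mapping.keys p. size m = d \<and> set_mset m \<subseteq> S)"

lemma homogeneous_zero [simp]: "homogeneous S d 0"
  by (simp add: homogeneous_def)

lemma homogeneous_one [simp]: "homogeneous S 0 1"
  by (simp add: homogeneous_def)

lemma homogeneous_mvar [simp]: "i \<in> S \<Longrightarrow> homogeneous S (Suc 0) (mvar i)"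
  by (simp add: homogeneous_def mvar_def)

lemma homogeneous_add: "homogeneous S d p \<Longrightarrow> homogeneous S d q \<Longrightarrow> homogeneous S d (p + q)"
  using Poly_Mapping.keys_add[of p q] by (auto simp: homogeneous_def)

lemma homogeneous_uminus: "homogeneous S d p \<Longrightarrow> homogeneous S d (- p)"
  by (simp add: homogeneous_def)

lemma homogeneous_diff: "homogeneous S d p \<Longrightarrow> homogeneous S d q \<Longrightarrow> homogeneous S d (p - q)"
  using homogeneous_add[of S d p "- q"] homogeneous_uminus[of S d q] by simp

lemma homogeneous_mult: "homogeneous S d p \<Longrightarrow> homogeneous S e q \<Longrightarrow> homogeneous S (d + e) (p * q)"
  using Poly_Mapping.keys_mult[of p q] by (fastforce simp: homogeneous_def)

lemma homogeneous_sum: "(\<And>i. i \<in> I \<Longrightarrow> homogeneous S d (p i)) \<Longrightarrow> homogeneous S d (sum p I)"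
  by (induction I rule: infinite_finite_induct) (auto intro: homogeneous_add)

lemma homogeneous_power: "homogeneous S d p \<Longrightarrow> homogeneous S (k * d) (p ^ k)"
  by (induction k) (auto intro: homogeneous_mult)

text \<open>The power of X repeats the polynomial degree, so graded series model the completed
  polynomial ring and the coefficient at X^k is its homogeneous component of degree k.\<close>

definition graded :: "nat set \<Rightarrow> mpoly fps \<Rightarrow> bool" where
  "graded S f \<longleftrightarrow> (\<forall>d. homogeneous S d (f $ d))"

lemma graded_zero [simp]: "graded S 0"
  by (simp add: graded_def)

lemma graded_one [simp]: "graded S 1"
  by (simp add: graded_def)

lemma graded_add: "graded S f \<Longrightarrow> graded S g \<Longrightarrow> graded S (f + g)"
  by (simp add: graded_def homogeneous_add)

lemma graded_uminus: "graded S f \<Longrightarrow> graded S (- f)"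
  by (simp add: graded_def homogeneous_uminus)

lemma graded_diff: "graded S f \<Longrightarrow> graded S g \<Longrightarrow> graded S (f - g)"
  using graded_add[of S f "- g"] graded_uminus[of S g] by simp

lemma graded_mult: "graded S f \<Longrightarrow> graded S g \<Longrightarrow> graded S (f * g)"
  unfolding graded_def fps_mult_nth
  by (intro allI homogeneous_sum) (metis homogeneous_mult atLeastAtMost_iff le_add_diff_inverse)

text \<open>An inverse letter receives the geometric series, the inverse of
  \<open>1 + y X\<close>.\<close>

definition magnus :: "nat \<times> bool \<Rightarrow> mpoly fps" where
  "magnus a = (if snd a then 1 + fps_const (mvar (fst a)) * fps_X else Abs_fps (\<lambda>k. (- mvar (fst a)) ^ k))"

lemma magnus_inverse:
  assumes "fst a = fst b" "snd a \<noteq> snd b"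
  shows "magnus a * magnus b = 1"
proof -
  have "(1 + fps_const c * fps_X) * Abs_fps (\<lambda>k. (- c) ^ k) = 1" for c :: mpoly
  proof (rule fps_ext)
    fix k
    have "((1 + fps_const c * fps_X) * Abs_fps (\<lambda>k. (- c) ^ k)) $ k =
      (- c) ^ k + c * (fps_X * Abs_fps (\<lambda>k. (- c) ^ k)) $ k"
      by (simp add: distrib_right mult.assoc)
    then show "((1 + fps_const c * fps_X) * Abs_fps (\<lambda>k. (- c) ^ k)) $ k = 1 $ k"
      by (cases k) auto
  qed
  then show ?thesis using assms by (auto simp: magnus_def mult.commute)
qed

lemma graded_magnus: "fst a \<in> S \<Longrightarrow> graded S (magnus a)"
proof -
  assume a: "fst a \<in> S"
  have "homogeneous S d ((1 + fps_const (mvar (fst a)) * fps_X) $ d)" for d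
    using a by (cases d) (auto simp: fps_X_def)
  moreover have "homogeneous S d ((- mvar (fst a)) ^ d)" for d
    using homogeneous_power[OF homogeneous_uminus[OF homogeneous_mvar[OF a]], of d] by simp
  ultimately show ?thesis by (simp add: graded_def magnus_def)
qed

text \<open>\<open>U\<close> and the \<open>D\<^sub>j\<close>; the variable \<open>X\<close> records the degree.\<close>

primrec fox_unit :: "(nat \<times> bool) list \<Rightarrow> mpoly fps" where
  "fox_unit [] = 1"
| "fox_unit (a # w) = magnus a * fox_unit w"

text \<open>The recursion is the crossed-derivation rule D(vw) = D(v) + U(v) D(w). The value at an
  inverse letter is forced by applying D to the trivial product of the letter and its
  inverse.\<close>

primrec fox_deriv :: "(nat \<times> bool) list \<Rightarrow> nat \<Rightarrow> mpoly fps" where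
  "fox_deriv [] j = 0"
| "fox_deriv (a # w) j =
    (if fst a = j then if snd a then 1 else - magnus a else 0) + magnus a * fox_deriv w j"

text \<open>Cancelling pairs contribute nothing, so both recursions are compatible with the product
  of reduced words.\<close>

lemma fox_cancel_Cons:
  "fox_unit (cancel_Cons a w) = magnus a * fox_unit w"
  "fox_deriv (cancel_Cons a w) j = fox_deriv (a # w) j"
proof -
  have *: "magnus a * (magnus b * x) = x" if "fst a = fst b" "snd a \<noteq> snd b" for b x
    using magnus_inverse[OF that] by (simp flip: mult.assoc)
  show "fox_unit (cancel_Cons a w) = magnus a * fox_unit w"
    by (cases w) (auto simp: *)
  show "fox_deriv (cancel_Cons a w) j = fox_deriv (a # w) j"
    by (cases w) (auto simp: * distrib_left magnus_inverse)
qed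

section \<open>Abelianized Fox calculus along the lower central series of the free group\<close>

locale fox =
  fixes S :: "nat set"
begin

abbreviation "F \<equiv> free_group S"

sublocale F: group F by (rule free_group_group)

lemma fox_unit_mult: "fox_unit (v \<otimes>\<^bsub>F\<^esub> w) = fox_unit v * fox_unit w"
  unfolding free_group_simps by (induction v) (auto simp: fox_cancel_Cons mult.assoc)

lemma fox_deriv_mult: "fox_deriv (v \<otimes>\<^bsub>F\<^esub> w) j = fox_deriv v j + fox_unit v * fox_deriv w j"
  unfolding free_group_simps by (induction v) (auto simp: fox_cancel_Cons algebra_simps)

lemma fox_one [simp]: "fox_unit \<one>\<^bsub>F\<^esub> = 1" "fox_deriv \<one>\<^bsub>F\<^esub> j = 0"
  by (simp_all add: free_group_simps)

lemma fox_unit_inv: "g \<in> carrier F \<Longrightarrow> fox_unit (inv\<^bsub>F\<^esub> g) * fox_unit g = 1"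
  by (simp flip: fox_unit_mult)

lemma fox_deriv_inv:
  assumes "g \<in> carrier F"
  shows "fox_deriv (inv\<^bsub>F\<^esub> g) j = - fox_unit (inv\<^bsub>F\<^esub> g) * fox_deriv g j"
  using fox_deriv_mult[of "inv\<^bsub>F\<^esub> g" g j] assms by (simp add: eq_neg_iff_add_eq_0)

lemma fox_unit_commutator:
  assumes "g \<in> carrier F" "h \<in> carrier F"
  shows "fox_unit (commutator F g h) = 1"
proof -
  have "fox_unit (commutator F g h) =
      (fox_unit (inv\<^bsub>F\<^esub> g) * fox_unit g) * (fox_unit (inv\<^bsub>F\<^esub> h) * fox_unit h)"
    by (simp add: commutator_def fox_unit_mult)
  then show ?thesis using assms by (simp add: fox_unit_inv)
qed

text \<open>The values of U commute, so U of a conjugate equals U of the element, and only the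
  factors U - 1 remain.\<close>

lemma fox_deriv_commutator:
  assumes "g \<in> carrier F" "h \<in> carrier F"
  shows "fox_deriv (commutator F g h) j =
    (fox_unit g - 1) * fox_deriv h j - (fox_unit h - 1) * fox_deriv g j"
proof -
  have "fox_deriv (commutator F g h) j =
     fox_deriv g j + fox_unit g * fox_deriv h j -
     fox_unit h * (fox_unit (inv\<^bsub>F\<^esub> g) * fox_unit g) * fox_deriv g j -
     (fox_unit (inv\<^bsub>F\<^esub> g) * fox_unit g) * (fox_unit (inv\<^bsub>F\<^esub> h) * fox_unit h) * fox_deriv h j"
    using assms by (simp add: commutator_def fox_unit_mult fox_deriv_mult fox_deriv_inv algebra_simps)
  then show ?thesis
    unfolding fox_unit_inv[OF assms(1)] fox_unit_inv[OF assms(2)] by (simp add: algebra_simps)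
qed

lemma fox_unit_nth_0: "fox_unit w $ 0 = 1"
  by (induction w) (auto simp: magnus_def)

lemma graded_fox:
  assumes "fst ` set w \<subseteq> S"
  shows "graded S (fox_unit w)" "graded S (fox_deriv w j)"
  using assms by (induction w)
    (auto intro!: graded_mult graded_add graded_diff graded_magnus)

lemma fox_deriv_outside: "fst ` set w \<subseteq> S \<Longrightarrow> j \<notin> S \<Longrightarrow> fox_deriv w j = 0"
  by (induction w) auto

text \<open>U is multiplicative with commuting values, so it is trivial on the derived subgroup,
  which contains all Gamma_i with i at least 2.\<close>

lemma fox_unit_lower_central:
  assumes "g \<in> lower_central F (Suc (Suc k))"
  shows "fox_unit g = 1"
proof -
  have "g \<in> lower_central F 2"
    using assms F.lower_central_mono[of 2 "Suc (Suc k)"] by auto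
  then have "g \<in> generate F {commutator F x y | x y. x \<in> carrier F \<and> y \<in> carrier F}"
    by (simp add: numeral_2_eq_2 lower_central.simps(3))
  then show ?thesis
  proof (induction rule: generate.induct)
    case (incl h)
    then show ?case using fox_unit_commutator by auto
  next
    case (inv h)
    then have "h \<in> carrier F" "fox_unit h = 1" using fox_unit_commutator by auto
    then show ?case using fox_unit_inv[of h] by simp
  qed (auto simp: fox_unit_mult)
qed

definition vanishes :: "nat \<Rightarrow> mpoly fps \<Rightarrow> bool" where
  "vanishes k f \<longleftrightarrow> (\<forall>j<k. f $ j = 0)"

text \<open>Orders in X add up, and the coefficients at the two orders multiply.\<close>

lemma vanishes_mult:
  assumes "vanishes k f" "vanishes l g"
  shows "vanishes (k + l) (f * g)" "(f * g) $ (k + l) = f $ k * g $ l"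
proof -
  show "vanishes (k + l) (f * g)"
    unfolding vanishes_def fps_mult_nth
  proof (intro allI impI sum.neutral ballI)
    fix j i assume "j < k + l" "i \<in> {0..j}"
    then have "i < k \<or> j - i < l" by auto
    then show "f $ i * g $ (j - i) = 0" using assms by (auto simp: vanishes_def)
  qed
  have "(f * g) $ (k + l) = (\<Sum>i\<in>{k}. f $ i * g $ (k + l - i))"
    unfolding fps_mult_nth
  proof (rule sum.mono_neutral_right)
    show "\<forall>i\<in>{0..k + l} - {k}. f $ i * g $ (k + l - i) = 0"
    proof
      fix i assume "i \<in> {0..k + l} - {k}"
      then have "i < k \<or> k + l - i < l" by auto
      then show "f $ i * g $ (k + l - i) = 0" using assms by (auto simp: vanishes_def)
    qed
  qed auto
  then show "(f * g) $ (k + l) = f $ k * g $ l" by simp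
qed

lemma vanishes_simps:
  "vanishes k 0" "vanishes 0 f"
  "vanishes k f \<Longrightarrow> vanishes k g \<Longrightarrow> vanishes k (f + g)"
  "vanishes k f \<Longrightarrow> vanishes k g \<Longrightarrow> vanishes k (f - g)"
  "vanishes k f \<Longrightarrow> vanishes k (- f)"
  "vanishes k f \<Longrightarrow> vanishes k (g * f)"
  using vanishes_mult(1)[of 0 g k f] by (auto simp: vanishes_def)

lemma vanishes_fox_unit: "vanishes (Suc 0) (fox_unit w - 1)"
  by (simp add: vanishes_def fox_unit_nth_0)

text \<open>In a commutator of x from Gamma_(k+1) with y, the factor U(y) - 1 raises the order of
  D(x) by one. The other summand is zero for k > 0, as U(x) = 1 then, and has order at least one for
  k = 0. Note the shift: Gamma_(k+1) starts at X^k.\<close>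

lemma vanishes_fox_deriv: "g \<in> lower_central F (Suc k) \<Longrightarrow> vanishes k (fox_deriv g j)"
proof (induction k arbitrary: g)
  case (Suc k)
  have comm: "vanishes (Suc k) (fox_deriv (commutator F x y) j)"
    if "x \<in> lower_central F (Suc k)" "y \<in> carrier F" for x y
  proof -
    have x: "x \<in> carrier F" using that F.lower_central_in_carrier by blast
    have 1: "vanishes (Suc k) ((fox_unit y - 1) * fox_deriv x j)"
      using vanishes_mult(1)[OF vanishes_fox_unit Suc.IH[OF that(1)]] by simp
    have 2: "vanishes (Suc k) ((fox_unit x - 1) * fox_deriv y j)"
    proof (cases k)
      case 0
      then show ?thesis
        using vanishes_mult(1)[OF vanishes_fox_unit vanishes_simps(2)] by simp
    next
      case (Suc l)
      then show ?thesis using fox_unit_lower_central that by (simp add: vanishes_simps)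
    qed
    show ?thesis
      unfolding fox_deriv_commutator[OF x that(2)] using 1 2 by (simp add: vanishes_simps)
  qed
  have "g \<in> generate F {commutator F x y | x y. x \<in> lower_central F (Suc k) \<and> y \<in> carrier F}"
    using Suc.prems by (simp add: lower_central.simps(3))
  then show ?case
  proof (induction rule: generate.induct)
    case (incl h)
    then show ?case using comm by auto
  next
    case (inv h)
    then have "h \<in> carrier F" "vanishes (Suc k) (fox_deriv h j)"
      using comm F.lower_central_in_carrier by auto
    then show ?case by (simp add: fox_deriv_inv vanishes_simps)
  qed (auto simp: fox_deriv_mult vanishes_simps)
qed (simp add: vanishes_simps)

text \<open>U(g) has constant term 1 and does not affect the lowest coefficient of D(h). Hence the
  leading vector is additive on Gamma_(k+1).\<close>

lemma fox_lead_mult: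
  assumes "h \<in> lower_central F (Suc k)"
  shows "fox_deriv (g \<otimes>\<^bsub>F\<^esub> h) j $ k = fox_deriv g j $ k + fox_deriv h j $ k"
  using vanishes_mult(2)[OF vanishes_simps(2)[of "fox_unit g"] vanishes_fox_deriv[OF assms, of j]]
  by (simp add: fox_deriv_mult fox_unit_nth_0)

lemma fox_unit_lead_mult: "fox_unit (g \<otimes>\<^bsub>F\<^esub> h) $ 1 = fox_unit g $ 1 + fox_unit h $ 1"
  by (simp add: fox_unit_mult fps_mult_nth fox_unit_nth_0)

text \<open>The \<open>of_bool\<close> factors express that U is trivial beyond degree one: a factor
  from Gamma_2 acts trivially, so commutators of two such elements have leading vector zero.\<close>

lemma fox_lead_commutator:
  assumes "g \<in> lower_central F (Suc k)" "h \<in> lower_central F (Suc l)"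
  shows "fox_deriv (commutator F g h) j $ (Suc (k + l)) =
    fox_unit g $ 1 * fox_deriv h j $ l * of_bool (k = 0) - fox_unit h $ 1 * fox_deriv g j $ k * of_bool (l = 0)"
proof -
  have 1: "((fox_unit g - 1) * fox_deriv h j) $ (Suc (k + l)) = fox_unit g $ 1 * fox_deriv h j $ l * of_bool (k = 0)"
  proof (cases k)
    case 0
    then show ?thesis
      using vanishes_mult(2)[OF vanishes_fox_unit[of g] vanishes_fox_deriv[OF assms(2), of j]] by simp
  next
    case (Suc m)
    then show ?thesis using fox_unit_lower_central assms by simp
  qed
  have 2: "((fox_unit h - 1) * fox_deriv g j) $ (Suc (k + l)) = fox_unit h $ 1 * fox_deriv g j $ k * of_bool (l = 0)"
  proof (cases l)
    case 0
    then show ?thesis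
      using vanishes_mult(2)[OF vanishes_fox_unit[of h] vanishes_fox_deriv[OF assms(1), of j]] by simp
  next
    case (Suc m)
    then show ?thesis using fox_unit_lower_central assms by simp
  qed
  show ?thesis
    using assms 1 2 fox_deriv_commutator[OF F.lower_central_in_carrier F.lower_central_in_carrier, of g "Suc k" h "Suc l" j]
    by simp
qed

text \<open>Contains the kernel of the projection from \<open>F\<close> to \<open>G/G''\<close>, where \<open>G = F/\<langle>\<langle>r\<rangle>\<rangle>\<close>.\<close>

definition relator_kernel :: "(nat \<times> bool) list \<Rightarrow> (nat \<times> bool) list set" where
  "relator_kernel r = {g \<in> carrier F. fox_unit g = 1 \<and>
     (\<exists>c. graded S c \<and> (\<forall>j. fox_deriv g j = c * fox_deriv r j))}"

text \<open>As U(h) = 1, conjugating h by x multiplies its Fox vector by U(x), and a product of two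
  elements adds their multipliers.\<close>

lemma relator_kernel_normal: "relator_kernel r \<lhd> F"
proof (rule F.normal_invI)
  show "subgroup (relator_kernel r) F"
  proof (rule F.subgroupI)
    show "relator_kernel r \<noteq> {}"
      by (auto simp: relator_kernel_def intro!: exI[of _ "\<one>\<^bsub>F\<^esub>"] exI[of _ 0])
    fix a assume a: "a \<in> relator_kernel r"
    then have u: "fox_unit (inv\<^bsub>F\<^esub> a) = 1" "a \<in> carrier F"
      using fox_unit_inv[of a] by (auto simp: relator_kernel_def)
    obtain c where c: "graded S c" "\<forall>j. fox_deriv a j = c * fox_deriv r j"
      using a by (auto simp: relator_kernel_def)
    then show "inv\<^bsub>F\<^esub> a \<in> relator_kernel r"
      using u by (auto simp: relator_kernel_def fox_deriv_inv intro!: exI[of _ "- c"] graded_uminus)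
    fix b assume b: "b \<in> relator_kernel r"
    then obtain d where d: "graded S d" "\<forall>j. fox_deriv b j = d * fox_deriv r j"
      by (auto simp: relator_kernel_def)
    show "a \<otimes>\<^bsub>F\<^esub> b \<in> relator_kernel r"
      using a b c d by (auto simp: relator_kernel_def fox_deriv_mult fox_unit_mult algebra_simps
          intro!: exI[of _ "c + d"] graded_add)
  qed (auto simp: relator_kernel_def)
  fix x h assume x: "x \<in> carrier F" and h: "h \<in> relator_kernel r"
  obtain c where c: "graded S c" "\<forall>j. fox_deriv h j = c * fox_deriv r j"
    using h by (auto simp: relator_kernel_def)
  have u: "fox_unit x * fox_unit (inv\<^bsub>F\<^esub> x) = 1"
    using fox_unit_inv[OF x] by (simp add: mult.commute)
  have "fox_deriv (x \<otimes>\<^bsub>F\<^esub> h \<otimes>\<^bsub>F\<^esub> inv\<^bsub>F\<^esub> x) j = fox_unit x * c * fox_deriv r j" for j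
  proof -
    have "fox_deriv (x \<otimes>\<^bsub>F\<^esub> h \<otimes>\<^bsub>F\<^esub> inv\<^bsub>F\<^esub> x) j = fox_unit x * fox_deriv h j +
        fox_deriv x j - (fox_unit x * fox_unit (inv\<^bsub>F\<^esub> x)) * fox_deriv x j"
      using h x by (simp add: relator_kernel_def fox_deriv_mult fox_unit_mult fox_deriv_inv algebra_simps)
    then show ?thesis using u c by (simp add: mult.assoc)
  qed
  moreover have "graded S (fox_unit x * c)"
    using c x by (intro graded_mult graded_fox) (auto simp: free_group_simps)
  ultimately show "x \<otimes>\<^bsub>F\<^esub> h \<otimes>\<^bsub>F\<^esub> inv\<^bsub>F\<^esub> x \<in> relator_kernel r"
    using x h u by (auto simp: relator_kernel_def fox_unit_mult)
qed

lemma relator_in_kernel: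
  assumes "r \<in> lower_central F 2"
  shows "r \<in> relator_kernel r"
  using assms F.lower_central_in_carrier fox_unit_lower_central[of r 0]
  by (auto simp: relator_kernel_def numeral_2_eq_2 intro!: exI[of _ 1])

text \<open>Both factors U - 1 in the commutator formula vanish on the derived subgroup, so the
  generators of F'' have Fox vector zero and the multiplier 0 serves.\<close>

lemma second_derived_in_kernel: "second_derived F \<subseteq> relator_kernel r"
  unfolding second_derived_def derived_def[of F "derived F (carrier F)"]
proof (rule F.generate_subgroup_incl)
  show "subgroup (relator_kernel r) F"
    using relator_kernel_normal normal_imp_subgroup by blast
  show "(\<Union>h1\<in>derived F (carrier F). \<Union>h2\<in>derived F (carrier F). {h1 \<otimes>\<^bsub>F\<^esub> h2 \<otimes>\<^bsub>F\<^esub> inv\<^bsub>F\<^esub> h1 \<otimes>\<^bsub>F\<^esub> inv\<^bsub>F\<^esub> h2})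
      \<subseteq> relator_kernel r"
  proof clarify
    fix a b assume "a \<in> derived F (carrier F)" "b \<in> derived F (carrier F)"
    then have ab: "a \<in> lower_central F (Suc (Suc 0))" "b \<in> lower_central F (Suc (Suc 0))"
      by (simp_all add: derived_eq_lower_central numeral_2_eq_2)
    then have c: "a \<in> carrier F" "b \<in> carrier F" using F.lower_central_in_carrier by blast+
    have "commutator F a b \<in> relator_kernel r"
      using c ab fox_unit_commutator[OF c] fox_deriv_commutator[OF c] fox_unit_lower_central
      by (auto simp: relator_kernel_def intro!: exI[of _ 0])
    then show "a \<otimes>\<^bsub>F\<^esub> b \<otimes>\<^bsub>F\<^esub> inv\<^bsub>F\<^esub> a \<otimes>\<^bsub>F\<^esub> inv\<^bsub>F\<^esub> b \<in> relator_kernel r"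
      by (simp add: commutator_def)
  qed
qed

end

section \<open>The free metabelian Lie ring\<close>

text \<open>The linear part of a Lie element as a linear form; it corresponds to the coefficient of
  U at X.\<close>

primrec fox_lin :: "(int, nat) lie_term \<Rightarrow> mpoly" where
  "fox_lin (Gen i) = mvar i"
| "fox_lin Zero = 0"
| "fox_lin (Add s t) = fox_lin s + fox_lin t"
| "fox_lin (Smult c s) = of_int c * fox_lin s"
| "fox_lin (Bracket s t) = 0"

text \<open>The Lie ring analogue of the Fox derivatives; the coefficient at \<open>X\<^sup>k\<close> is the part of
  bracket length \<open>k + 1\<close>.\<close>

primrec fox_vec :: "(int, nat) lie_term \<Rightarrow> nat \<Rightarrow> mpoly poly" where
  "fox_vec (Gen i) j = (if j = i then 1 else 0)"
| "fox_vec Zero j = 0"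
| "fox_vec (Add s t) j = fox_vec s j + fox_vec t j"
| "fox_vec (Smult c s) j = smult (of_int c) (fox_vec s j)"
| "fox_vec (Bracket s t) j =
    pCons 0 (smult (fox_lin s) (fox_vec t j) - smult (fox_lin t) (fox_vec s j))"

text \<open>L' is spanned by brackets, so these relations present L/L''.\<close>

definition metab :: "((int, nat) lie_term \<times> (int, nat) lie_term) set" where
  "metab = {(Bracket (Bracket a b) (Bracket c d), Zero) | a b c d. True}"

text \<open>The bracket rule of \<open>fox_vec\<close> is that of a derivation into a module on
  which L acts through its linear part. A bracket has no linear part, so double brackets are sent to
  zero.\<close>

lemma fox_cong:
  "lie_cong S metab s t \<Longrightarrow> fox_lin s = fox_lin t \<and> (\<forall>j. fox_vec s j = fox_vec t j)"
  by (induction rule: lie_cong.induct)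
    (auto simp: metab_def algebra_simps smult_add_right smult_add_left smult_diff_right)

\<comment> \<open>All natural numbers serve as generators, which makes the ring a type;
  \<open>retract_term\<close> later returns to the letters of S.\<close>
quotient_type free_metab = "(int, nat) lie_term" / "lie_cong UNIV metab"
proof (rule equivpI)
  show "reflp (lie_cong UNIV metab)" by (auto simp: reflp_def lie_terms_def intro: lie_cong.refl)
  show "symp (lie_cong UNIV metab)" by (auto simp: symp_def intro: lie_cong.sym)
  show "transp (lie_cong UNIV metab)" by (auto simp: transp_def intro: lie_cong.trans)
qed

lemma lie_terms_UNIV [simp]: "s \<in> lie_terms UNIV"
  by (simp add: lie_terms_def)

instantiation free_metab :: ab_group_add
begin

lift_definition zero_free_metab :: free_metab is Zero .
lift_definition plus_free_metab :: "free_metab \<Rightarrow> free_metab \<Rightarrow> free_metab" is Add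
  by (rule lie_cong.cong_Add)
lift_definition uminus_free_metab :: "free_metab \<Rightarrow> free_metab" is "Smult (- 1)"
  by (rule lie_cong.cong_Smult)
definition minus_free_metab :: "free_metab \<Rightarrow> free_metab \<Rightarrow> free_metab" where
  "minus_free_metab x y = x + - y"

instance
proof
  fix a b c :: free_metab
  show "a + b + c = a + (b + c)" by transfer (simp add: lie_cong.Add_assoc)
  show "a + b = b + a" by transfer (simp add: lie_cong.Add_comm)
  show "0 + a = a"
    by transfer (meson lie_cong.Add_Zero lie_cong.Add_comm lie_cong.trans lie_terms_UNIV)
  show "- a + a = 0"
  proof transfer
    fix a :: "(int, nat) lie_term"
    note [trans] = lie_cong.trans
    have "lie_cong UNIV metab (Add (Smult (- 1) a) a) (Add (Smult (- 1) a) (Smult 1 a))"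
      by (intro lie_cong.cong_Add lie_cong.refl lie_cong.sym[OF lie_cong.Smult_one]) auto
    also have "lie_cong UNIV metab \<dots> (Smult (- 1 + 1) a)"
      by (intro lie_cong.sym[OF lie_cong.Smult_add]) auto
    also have "lie_cong UNIV metab (Smult (- 1 + 1) a) Zero"
      using lie_cong.Smult_zero[of a UNIV metab] by simp
    finally show "lie_cong UNIV metab (Add (Smult (- 1) a) a) Zero" .
  qed
  show "a - b = a + - b" by (rule minus_free_metab_def)
qed

end

lift_definition fm_gen :: "nat \<Rightarrow> free_metab" is Gen .
lift_definition fm_scale :: "int \<Rightarrow> free_metab \<Rightarrow> free_metab" is Smult
  by (rule lie_cong.cong_Smult)
lift_definition fm_bracket :: "free_metab \<Rightarrow> free_metab \<Rightarrow> free_metab" is Bracket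
  by (rule lie_cong.cong_Bracket)
lift_definition fm_lin :: "free_metab \<Rightarrow> mpoly" is fox_lin
  using fox_cong by blast
text \<open>Setting X = 1 loses nothing: the degree can be recovered from the size of the monomials,
  as \<open>lookup_fox_vec\<close> shows for terms.\<close>

lift_definition fm_val :: "free_metab \<Rightarrow> nat \<Rightarrow> mpoly" is "\<lambda>t j. poly (fox_vec t j) 1"
  using fox_cong by (metis (no_types))

interpretation fm: Modules.module fm_scale
proof
  fix a b :: int and x y :: free_metab
  show "fm_scale a (x + y) = fm_scale a x + fm_scale a y"
    by transfer (simp add: lie_cong.Smult_Add)
  show "fm_scale (a + b) x = fm_scale a x + fm_scale b x"
    by transfer (simp add: lie_cong.Smult_add)
  show "fm_scale a (fm_scale b x) = fm_scale (a * b) x"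
    by transfer (simp add: lie_cong.sym[OF lie_cong.Smult_mult])
  show "fm_scale 1 x = x" by transfer (simp add: lie_cong.Smult_one)
qed

section \<open>Calculus in the free metabelian Lie ring\<close>

lemma fm_bracket_add:
  "fm_bracket (x + y) z = fm_bracket x z + fm_bracket y z"
  "fm_bracket x (y + z) = fm_bracket x y + fm_bracket x z"
  by (transfer; simp add: lie_cong.Bracket_Add_left lie_cong.Bracket_Add_right)+

lemma fm_bracket_scale:
  "fm_bracket (fm_scale c x) y = fm_scale c (fm_bracket x y)"
  "fm_bracket x (fm_scale c y) = fm_scale c (fm_bracket x y)"
  by (transfer; simp add: lie_cong.Bracket_Smult_left lie_cong.Bracket_Smult_right)+

lemma fm_bracket_self: "fm_bracket x x = 0"
  by transfer (simp add: lie_cong.alternating)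

lemma fm_jacobi:
  "fm_bracket x (fm_bracket y z) + fm_bracket y (fm_bracket z x) + fm_bracket z (fm_bracket x y) = 0"
  by transfer (simp add: lie_cong.jacobi)

lemma fm_metab: "fm_bracket (fm_bracket a b) (fm_bracket c d) = 0"
  by transfer (auto simp: metab_def intro!: lie_cong.rel)

lemma fm_bracket_zero [simp]: "fm_bracket 0 x = 0" "fm_bracket x 0 = 0"
  using fm_bracket_add(1)[of 0 0 x] fm_bracket_add(2)[of x 0 0] by auto

lemma fm_bracket_swap: "fm_bracket x y = - fm_bracket y x"
proof -
  have "fm_bracket (x + y) (x + y) =
      fm_bracket x x + fm_bracket y y + (fm_bracket x y + fm_bracket y x)"
    unfolding fm_bracket_add by (simp add: algebra_simps)
  then show ?thesis by (simp add: fm_bracket_self eq_neg_iff_add_eq_0)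
qed

lemma fm_bracket_uminus: "fm_bracket x (- y) = - fm_bracket x y"
  using fm_bracket_add(2)[of x y "- y"] by (simp add: eq_neg_iff_add_eq_0 add.commute)

lemma fm_val_simps:
  "fm_val (fm_gen i) j = (if j = i then 1 else 0)"
  "fm_val 0 j = 0"
  "fm_val (x + y) j = fm_val x j + fm_val y j"
  "fm_val (fm_scale c x) j = of_int c * fm_val x j"
  "fm_val (fm_bracket x y) j = fm_lin x * fm_val y j - fm_lin y * fm_val x j"
  by (transfer; simp)+

lemma fm_lin_simps: "fm_lin (fm_gen i) = mvar i" "fm_lin (fm_bracket x y) = 0"
  by (transfer; simp)+

text \<open>By Jacobi the two sides differ by the bracket of [u, v] with [a, b], which is zero. Thus
  the adjoint operators commute on the derived ideal and make it a module over the polynomial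
  ring.\<close>

lemma fm_bracket_commute:
  "fm_bracket u (fm_bracket v (fm_bracket a b)) = fm_bracket v (fm_bracket u (fm_bracket a b))"
proof -
  have "fm_bracket u (fm_bracket v (fm_bracket a b)) + fm_bracket v (fm_bracket (fm_bracket a b) u) = 0"
    using fm_jacobi[of u v "fm_bracket a b"] by (simp add: fm_metab)
  then show ?thesis
    by (simp add: fm_bracket_swap[of "fm_bracket a b" u] fm_bracket_uminus)
qed

text \<open>The action of a monomial on the derived ideal. The order of the letters does not matter
  there; sorting merely picks one.\<close>

definition fm_ad :: "nat multiset \<Rightarrow> free_metab \<Rightarrow> free_metab" where
  "fm_ad m x = foldr (\<lambda>k. fm_bracket (fm_gen k)) (sorted_list_of_multiset m) x"

lemma fm_ad_empty [simp]: "fm_ad {#} x = x"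
  by (simp add: fm_ad_def)

lemma fm_ad_bracket: "\<exists>c d. fm_ad m (fm_bracket a b) = fm_bracket c d"
  unfolding fm_ad_def by (cases "sorted_list_of_multiset m") auto

lemma fm_ad_add_mset [simp]:
  "fm_ad (add_mset k m) (fm_bracket a b) = fm_bracket (fm_gen k) (fm_ad m (fm_bracket a b))"
proof -
  have "foldr (\<lambda>k. fm_bracket (fm_gen k)) (insort k ms) (fm_bracket a b) =
    fm_bracket (fm_gen k) (foldr (\<lambda>k. fm_bracket (fm_gen k)) ms (fm_bracket a b))" for ms
  proof (induction ms)
    case (Cons l ms)
    have "\<exists>c d. foldr (\<lambda>k. fm_bracket (fm_gen k)) ms (fm_bracket a b) = fm_bracket c d"
      by (cases ms) auto
    then show ?case using Cons by (auto intro: fm_bracket_commute)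
  qed simp
  then show ?thesis by (simp add: fm_ad_def)
qed

lemma fm_ad_commute: "fm_ad m (fm_bracket x (fm_bracket a b)) = fm_bracket x (fm_ad m (fm_bracket a b))"
proof (induction m)
  case (add k m)
  obtain c d where "fm_ad m (fm_bracket a b) = fm_bracket c d" using fm_ad_bracket by blast
  then show ?case using add fm_bracket_commute by simp
qed simp

lemma fm_ad_add: "fm_ad m (x + y) = fm_ad m x + fm_ad m y"
proof -
  have "foldr (\<lambda>k. fm_bracket (fm_gen k)) ms (x + y) =
    foldr (\<lambda>k. fm_bracket (fm_gen k)) ms x + foldr (\<lambda>k. fm_bracket (fm_gen k)) ms y" for ms
    by (induction ms) (auto simp: fm_bracket_add)
  then show ?thesis by (simp add: fm_ad_def)
qed

lemma fm_ad_uminus: "fm_ad m (- x) = - fm_ad m x"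
proof -
  have "fm_ad m 0 = 0" using fm_ad_add[of m 0 0] by simp
  then show ?thesis using fm_ad_add[of m x "- x"] by (simp add: eq_neg_iff_add_eq_0 add.commute)
qed

text \<open>On the derived ideal the linear part is zero, so bracketing with a generator multiplies
  the Fox vector by the corresponding variable.\<close>

lemma fm_val_ad: "fm_val (fm_ad m (fm_bracket a b)) j = Poly_Mapping.single m 1 * fm_val (fm_bracket a b) j"
proof (induction m)
  case (add k m)
  obtain c d where "fm_ad m (fm_bracket a b) = fm_bracket c d" using fm_ad_bracket by blast
  then have "fm_lin (fm_ad m (fm_bracket a b)) = 0" by (simp add: fm_lin_simps)
  then show ?case
    by (simp add: fm_val_simps(5)[of "fm_gen k"] add fm_lin_simps mvar_def flip: mult.assoc)
      (simp add: mult_single)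
qed (simp flip: single_one)

lemma fm_ad_diff: "fm_ad m (x - y) = fm_ad m x - fm_ad m y"
  using fm_ad_add[of m x "- y"] by (simp add: fm_ad_uminus)

text \<open>The pair \<open>(i, m)\<close> with \<open>j = min m < i\<close> indexes the basic commutator
  \<open>[y\<^sub>i, y\<^sub>j]\<close> bracketed with the remaining letters of \<open>m\<close>.\<close>

definition basic_index :: "nat \<times> nat multiset \<Rightarrow> bool" where
  "basic_index = (\<lambda>(i, m). m \<noteq> {#} \<longrightarrow> Min_mset m < i)"

definition basic :: "nat \<times> nat multiset \<Rightarrow> free_metab" where
  "basic = (\<lambda>(i, m). if m = {#} then fm_gen i
     else fm_ad (m - {#Min_mset m#}) (fm_bracket (fm_gen i) (fm_gen (Min_mset m))))"

section \<open>Basic commutators form a basis, with Fox coefficients as dual coordinates\<close>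

lemma basic_add_mset:
  assumes "\<And>l. l \<in># m \<Longrightarrow> k \<le> l"
  shows "basic (i, add_mset k m) = fm_ad m (fm_bracket (fm_gen i) (fm_gen k))"
proof -
  have "Min_mset (add_mset k m) = k" using assms by (intro Min_eqI) auto
  then show ?thesis by (simp add: basic_def)
qed

lemma basic_index_add_mset:
  assumes "\<And>l. l \<in># m \<Longrightarrow> k \<le> l"
  shows "basic_index (i, add_mset k m) \<longleftrightarrow> k < i"
proof -
  have "Min_mset (add_mset k m) = k" using assms by (intro Min_eqI) auto
  then show ?thesis by (simp add: basic_index_def)
qed

lemma multiset_Min_cases:
  fixes m :: "nat multiset"
  obtains "m = {#}" | j m' where "m = add_mset j m'" "\<And>l. l \<in># m' \<Longrightarrow> j \<le> l"
proof (cases "m = {#}")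
  case False
  then have "Min_mset m \<in># m" by simp
  then have "m = add_mset (Min_mset m) (m - {#Min_mset m#})" by simp
  moreover have "Min_mset m \<le> l" if "l \<in># m - {#Min_mset m#}" for l
    using in_diffD[OF that] by simp
  ultimately show ?thesis using that by blast
qed (use that in blast)

abbreviation "basics \<equiv> basic ` {p. basic_index p}"

text \<open>A letter k not below the minimum j joins the tail. A smaller k must become the new
  minimum: Jacobi rewrites [k, [i, j]] as - [i, [j, k]] + [j, [i, k]], and i, j move to the
  tails.\<close>

lemma bracket_gen_basic:
  assumes "basic_index (i, m)"
  shows "fm_bracket (fm_gen k) (basic (i, m)) \<in> fm.span basics"
proof (cases m rule: multiset_Min_cases)
  case 1
  have base: "fm_bracket (fm_gen a) (fm_gen b) \<in> fm.span basics" if "b < a" for a b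
    using that basic_add_mset[of "{#}" b a] basic_index_add_mset[of "{#}" b a]
    by (intro fm.span_base image_eqI[of _ _ "(a, {#b#})"]) auto
  consider "i < k" | "i = k" | "k < i" by linarith
  then have "fm_bracket (fm_gen k) (fm_gen i) \<in> fm.span basics"
  proof cases
    case 3
    then show ?thesis using base fm.span_neg fm_bracket_swap[of "fm_gen k"] by simp
  qed (use base fm_bracket_self fm.span_zero in auto)
  then show ?thesis using 1 by (simp add: basic_def)
next
  case (2 j m')
  have ji: "j < i" using assms 2 basic_index_add_mset by simp
  have b: "basic (i, m) = fm_ad m' (fm_bracket (fm_gen i) (fm_gen j))"
    using 2 basic_add_mset by simp
  show ?thesis
  proof (cases "j \<le> k")
    case True
    then have l: "\<And>l. l \<in># add_mset k m' \<Longrightarrow> j \<le> l" using 2 by auto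
    have "fm_bracket (fm_gen k) (basic (i, m)) = basic (i, add_mset j (add_mset k m'))"
      using basic_add_mset[of "add_mset k m'" j i, OF l] b by simp
    then show ?thesis
      using basic_index_add_mset[of "add_mset k m'" j i, OF l] ji by (auto intro!: fm.span_base)
  next
    case False
    let ?b = "\<lambda>x y. fm_bracket (fm_gen x) (fm_gen y)"
    have l: "\<And>l. l \<in># add_mset i m' \<Longrightarrow> k \<le> l" "\<And>l. l \<in># add_mset j m' \<Longrightarrow> k \<le> l"
      using 2 False ji by fastforce+
    have J: "fm_bracket (fm_gen k) (?b i j) =
        - fm_bracket (fm_gen i) (?b j k) + fm_bracket (fm_gen j) (?b i k)"
      using fm_jacobi[of "fm_gen k" "fm_gen i" "fm_gen j"]
      by (simp add: fm_bracket_swap[of "fm_gen k" "fm_gen i"] fm_bracket_uminus algebra_simps eq_neg_iff_add_eq_0)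
    have "fm_bracket (fm_gen k) (basic (i, m)) = fm_ad m' (fm_bracket (fm_gen k) (?b i j))"
      unfolding b by (rule fm_ad_commute[symmetric])
    also have "\<dots> = - fm_ad (add_mset i m') (?b j k) + fm_ad (add_mset j m') (?b i k)"
      by (simp add: J fm_ad_diff fm_ad_commute)
    also have "\<dots> = - basic (j, add_mset k (add_mset i m')) + basic (i, add_mset k (add_mset j m'))"
      using basic_add_mset[of "add_mset i m'" k j, OF l(1)] basic_add_mset[of "add_mset j m'" k i, OF l(2)]
      by (simp only:)
    also have "\<dots> \<in> fm.span basics"
      using basic_index_add_mset[of "add_mset i m'" k j, OF l(1)]
        basic_index_add_mset[of "add_mset j m'" k i, OF l(2)] False ji
      by (intro fm.span_add fm.span_neg fm.span_base) auto
    finally show ?thesis .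
  qed
qed

lemma basic_bracket: "m \<noteq> {#} \<Longrightarrow> \<exists>c d. basic (i, m) = fm_bracket c d"
  by (simp add: basic_def fm_ad_bracket)

text \<open>Bilinearity reduces to two basic elements. If both are proper brackets, their product is
  zero; otherwise one is a generator.\<close>

lemma span_basics_bracket:
  assumes "x \<in> fm.span basics" "y \<in> fm.span basics"
  shows "fm_bracket x y \<in> fm.span basics"
proof -
  have 1: "fm_bracket (basic (i, m)) (basic (j, m')) \<in> fm.span basics"
    if "basic_index (i, m)" "basic_index (j, m')" for i m j m'
  proof -
    consider "m = {#}" | "m' = {#}" | "m \<noteq> {#}" "m' \<noteq> {#}" by blast
    then show ?thesis
    proof cases
      case 1
      then have "basic (i, m) = fm_gen i" by (simp add: basic_def)
      then show ?thesis using bracket_gen_basic[OF that(2)] by simp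
    next
      case 2
      then have "basic (j, m') = fm_gen j" by (simp add: basic_def)
      then have "fm_bracket (basic (j, m')) (basic (i, m)) \<in> fm.span basics"
        using bracket_gen_basic[OF that(1)] by simp
      then show ?thesis using fm.span_neg fm_bracket_swap[of "basic (i, m)"] by simp
    next
      case 3
      then show ?thesis using basic_bracket[of m i] basic_bracket[of m' j] fm_metab fm.span_zero by auto
    qed
  qed
  have 2: "fm_bracket (basic (i, m)) y \<in> fm.span basics" if "basic_index (i, m)" for i m
    using assms(2)
  proof (induction y rule: fm.span_induct_alt)
    case (step c x y)
    then show ?case using 1 that by (auto simp: fm_bracket_add fm_bracket_scale intro!: fm.span_add fm.span_scale)
  qed (simp add: fm.span_zero)
  show ?thesis using assms(1)
  proof (induction x rule: fm.span_induct_alt)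
    case (step c x z)
    then show ?case using 2 by (auto simp: fm_bracket_add fm_bracket_scale intro!: fm.span_add fm.span_scale)
  qed (simp add: fm.span_zero)
qed

lemma span_basics: "x \<in> fm.span basics"
proof -
  have "abs_free_metab t \<in> fm.span basics" for t
  proof (induction t)
    case (Gen i)
    have "basic (i, {#}) \<in> fm.span basics"
      by (intro fm.span_base imageI) (simp add: basic_index_def)
    then show ?case by (simp add: basic_def fm_gen.abs_eq)
  next
    case Zero
    then show ?case using fm.span_zero by (simp add: zero_free_metab.abs_eq)
  next
    case (Add s t)
    then show ?case using fm.span_add by (simp flip: plus_free_metab.abs_eq)
  next
    case (Smult c s)
    then show ?case using fm.span_scale by (simp flip: fm_scale.abs_eq)
  next
    case (Bracket s t)
    then show ?case using span_basics_bracket by (simp flip: fm_bracket.abs_eq)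
  qed
  then show ?thesis by (rule free_metab.abs_induct)
qed

text \<open>The sign comes from the i-th Fox component of the bracket of y_i with y_j, which is -
  y_j.\<close>

definition fm_coord :: "nat \<times> nat multiset \<Rightarrow> free_metab \<Rightarrow> int" where
  "fm_coord = (\<lambda>(i, m) x. (if m = {#} then 1 else -1) * Poly_Mapping.lookup (fm_val x i) m)"

lemma lookup_of_int_mult: "Poly_Mapping.lookup (of_int c * p) m = c * Poly_Mapping.lookup (p :: mpoly) m"
proof -
  have "of_int c * p = Poly_Mapping.map ((*) c) p"
    by (simp add: mult_map_scale_conv_mult flip: single_of_int)
  then show ?thesis by (simp add: Poly_Mapping.map.rep_eq when_def)
qed

lemma fm_coord_linear:
  "fm_coord p (x + y) = fm_coord p x + fm_coord p y"
  "fm_coord p (fm_scale c x) = c * fm_coord p x"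
  "fm_coord p 0 = 0"
  by (auto simp: fm_coord_def fm_val_simps lookup_add lookup_of_int_mult split: prod.splits)

lemma fm_coord_sum: "fm_coord p (sum f A) = (\<Sum>a\<in>A. fm_coord p (f a))"
  by (induction A rule: infinite_finite_induct) (simp_all add: fm_coord_linear)

text \<open>A basic commutator on i' > j with tail m'' has two Fox components. The one at i' gives
  the diagonal entry. The one at j has monomial \<open>add_mset i' m''\<close>, whose minimum is not
  below j, so it is at no basic index.\<close>

lemma fm_coord_basic:
  assumes "basic_index p" "basic_index q"
  shows "fm_coord p (basic q) = of_bool (p = q)"
proof -
  obtain i m where p: "p = (i, m)" by (cases p) auto
  obtain i' m' where q: "q = (i', m')" by (cases q) auto
  show ?thesis
  proof (cases m' rule: multiset_Min_cases)
    case 1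
    then show ?thesis
      by (auto simp: p q basic_def fm_coord_def fm_val_simps lookup_one when_def)
  next
    case (2 j m'')
    have ji: "j < i'" using assms(2) 2 basic_index_add_mset by (simp add: q)
    have val: "fm_val (basic (i', add_mset j m'')) i = Poly_Mapping.single m'' 1 * (mvar i' * (if i = j then 1 else 0)
        - mvar j * (if i = i' then 1 else 0))"
      using 2 basic_add_mset[of m'' j i'] by (simp add: fm_val_ad fm_val_simps fm_lin_simps)
    have no: "\<not> (i = j \<and> m = add_mset i' m'')"
    proof
      assume a: "i = j \<and> m = add_mset i' m''"
      then have "Min_mset m < j" using assms(1) by (simp add: p basic_index_def)
      moreover have "j \<le> Min_mset m" using a 2 ji by auto
      ultimately show False by simp
    qed
    show ?thesis
      using 2 ji no
      by (auto simp: p q fm_coord_def val mvar_def mult_single lookup_single when_def lookup_minus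
          right_diff_distrib)
  qed
qed

lemma fm_normal_form:
  assumes "finite K" "\<And>p. p \<in> K \<Longrightarrow> basic_index p" "\<And>p. basic_index p \<Longrightarrow> fm_coord p x \<noteq> 0 \<Longrightarrow> p \<in> K"
  shows "x = (\<Sum>p\<in>K. fm_scale (fm_coord p x) (basic p))"
proof -
  obtain t r where t: "finite t" "t \<subseteq> basics" "x = (\<Sum>a\<in>t. fm_scale (r a) a)"
    using span_basics[of x] unfolding fm.span_explicit by blast
  \<comment> \<open>The span is expressed by values of \<open>basic\<close>; T selects one index for
    each value.\<close>
  obtain T where T: "T \<subseteq> {p. basic_index p}" "inj_on basic T" "t = basic ` T"
    using t(2) unfolding subset_image_inj by blast
  have fT: "finite T" using t T finite_image_iff by metis
  have x: "x = (\<Sum>p\<in>T. fm_scale (r (basic p)) (basic p))"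
    using t(3) T sum.reindex[OF T(2)] by simp
  have coord: "fm_coord p x = (if p \<in> T then r (basic p) else 0)" if "basic_index p" for p
  proof -
    have "fm_coord p x = (\<Sum>q\<in>T. r (basic q) * of_bool (p = q))"
      unfolding x fm_coord_sum using T that
      by (intro sum.cong HOL.refl) (auto simp: fm_coord_linear fm_coord_basic)
    then show ?thesis using fT by simp
  qed
  have "(\<Sum>p\<in>K. fm_scale (fm_coord p x) (basic p)) = (\<Sum>p\<in>K \<inter> T. fm_scale (r (basic p)) (basic p))"
    using assms(1,2) coord by (intro sum.mono_neutral_cong_right) auto
  also have "\<dots> = (\<Sum>p\<in>T. fm_scale (r (basic p)) (basic p))"
  proof (rule sum.mono_neutral_left)
    show "\<forall>i\<in>T - K \<inter> T. fm_scale (r (basic i)) (basic i) = 0"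
    proof
      fix p assume p: "p \<in> T - K \<inter> T"
      then have "basic_index p" using T by auto
      then have "r (basic p) = 0" using p coord[of p] assms(3)[of p] by auto
      then show "fm_scale (r (basic p)) (basic p) = 0" by simp
    qed
  qed (use fT in auto)
  finally show ?thesis using x by simp
qed

text \<open>The Lie counterpart of the Magnus embedding of free metabelian groups: the difference
  has all coordinates zero, so its expansion runs over the empty set.\<close>

lemma fm_eqI:
  assumes "\<And>p. basic_index p \<Longrightarrow> fm_coord p x = fm_coord p y"
  shows "x = y"
proof -
  have "x - y = (\<Sum>p\<in>{}. fm_scale (fm_coord p (x - y)) (basic p))"
  proof (rule fm_normal_form)
    fix p assume "basic_index p" "fm_coord p (x - y) \<noteq> 0"
    moreover have "fm_coord p x = fm_coord p (x - y) + fm_coord p y"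
      by (simp flip: fm_coord_linear)
    ultimately show "p \<in> {}" using assms by auto
  qed auto
  then show ?thesis by simp
qed

text \<open>Killing the letters outside S is a retraction compatible with \<open>metab\<close>.
  Hence a congruence between terms over S that passes through other letters already holds over
  S.\<close>

primrec retract_term :: "nat set \<Rightarrow> (int, nat) lie_term \<Rightarrow> (int, nat) lie_term" where
  "retract_term S (Gen i) = (if i \<in> S then Gen i else Zero)"
| "retract_term S Zero = Zero"
| "retract_term S (Add s t) = Add (retract_term S s) (retract_term S t)"
| "retract_term S (Smult c s) = Smult c (retract_term S s)"
| "retract_term S (Bracket s t) = Bracket (retract_term S s) (retract_term S t)"

lemma retract_term_lie_terms [simp]: "retract_term S t \<in> lie_terms S"
  by (induction t) auto

lemma retract_term_id: "t \<in> lie_terms S \<Longrightarrow> retract_term S t = t"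
  by (induction t) auto

lemma retract_term_cong:
  "lie_cong UNIV metab s t \<Longrightarrow> lie_cong S metab (retract_term S s) (retract_term S t)"
proof (induction rule: lie_cong.induct)
  case (rel s t)
  then show ?case by (intro lie_cong.rel) (auto simp: metab_def)
qed (auto intro: lie_cong.intros)

lemma abs_free_metab_eq_iff:
  "abs_free_metab s = abs_free_metab t \<longleftrightarrow> lie_cong UNIV metab s t"
  by (rule free_metab.abs_eq_iff)

section \<open>Presented Lie algebras\<close>

lemma lie_class_eq_iff:
  assumes "s \<in> lie_terms S"
  shows "lie_class S E s = lie_class S E t \<longleftrightarrow> lie_cong S E s t"
proof
  assume "lie_class S E s = lie_class S E t"
  then have "lie_cong S E t s" using lie_cong.refl[OF assms, of E] by (auto simp: lie_class_def)
  then show "lie_cong S E s t" by (rule lie_cong.sym)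
next
  assume "lie_cong S E s t"
  then show "lie_class S E s = lie_class S E t"
    by (auto simp: lie_class_def intro: lie_cong.sym lie_cong.trans)
qed

lemma lie_class_self: "s \<in> lie_terms S \<Longrightarrow> s \<in> lie_class S E s"
  by (simp add: lie_class_def lie_cong.refl)

lemma mem_lie_class: "t \<in> lie_class S E s \<Longrightarrow> lie_cong S E s t"
  by (simp add: lie_class_def)

lemma presented_lie_simps:
  "carrier (presented_lie S E) = lie_class S E ` lie_terms S"
  "\<zero>\<^bsub>presented_lie S E\<^esub> = lie_class S E Zero"
  by (simp_all add: presented_lie_def)

lemma presented_lie_add:
  assumes "s \<in> lie_terms S" "t \<in> lie_terms S"
  shows "lie_class S E s \<oplus>\<^bsub>presented_lie S E\<^esub> lie_class S E t = lie_class S E (Add s t)"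
proof -
  have "lie_class S E (Add s' t') = lie_class S E (Add s t)"
    if "s' \<in> lie_class S E s" "t' \<in> lie_class S E t" for s' t'
    using lie_cong.cong_Add[OF mem_lie_class[OF that(1)] mem_lie_class[OF that(2)]] assms
      lie_class_eq_iff[of "Add s t" S E "Add s' t'"] by simp
  then have "(\<Union>s'\<in>lie_class S E s. \<Union>t'\<in>lie_class S E t. lie_class S E (Add s' t')) =
      (\<Union>s'\<in>lie_class S E s. \<Union>t'\<in>lie_class S E t. lie_class S E (Add s t))"
    by (intro SUP_cong) auto
  then show ?thesis
    using lie_class_self[OF assms(1), of E] lie_class_self[OF assms(2), of E]
    by (auto simp: presented_lie_def)
qed

lemma presented_lie_mult:
  assumes "s \<in> lie_terms S" "t \<in> lie_terms S"
  shows "lie_class S E s \<otimes>\<^bsub>presented_lie S E\<^esub> lie_class S E t = lie_class S E (Bracket s t)"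
proof -
  have "lie_class S E (Bracket s' t') = lie_class S E (Bracket s t)"
    if "s' \<in> lie_class S E s" "t' \<in> lie_class S E t" for s' t'
    using lie_cong.cong_Bracket[OF mem_lie_class[OF that(1)] mem_lie_class[OF that(2)]] assms
      lie_class_eq_iff[of "Bracket s t" S E "Bracket s' t'"] by simp
  then have "(\<Union>s'\<in>lie_class S E s. \<Union>t'\<in>lie_class S E t. lie_class S E (Bracket s' t')) =
      (\<Union>s'\<in>lie_class S E s. \<Union>t'\<in>lie_class S E t. lie_class S E (Bracket s t))"
    by (intro SUP_cong) auto
  then show ?thesis
    using lie_class_self[OF assms(1), of E] lie_class_self[OF assms(2), of E]
    by (auto simp: presented_lie_def)
qed

lemma presented_lie_smult:
  assumes "s \<in> lie_terms S"
  shows "c \<odot>\<^bsub>presented_lie S E\<^esub> lie_class S E s = lie_class S E (Smult c s)"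
proof -
  have "lie_class S E (Smult c s') = lie_class S E (Smult c s)" if "s' \<in> lie_class S E s" for s'
    using lie_cong.cong_Smult[OF mem_lie_class[OF that], of c] assms
      lie_class_eq_iff[of "Smult c s" S E "Smult c s'"] by simp
  then have "(\<Union>s'\<in>lie_class S E s. lie_class S E (Smult c s')) =
      (\<Union>s'\<in>lie_class S E s. lie_class S E (Smult c s))"
    by (intro SUP_cong) auto
  then show ?thesis
    using lie_class_self[OF assms(1), of E] by (auto simp: presented_lie_def)
qed

lemmas presented_lie_ops = presented_lie_simps presented_lie_add presented_lie_mult presented_lie_smult

lemma presented_lie_algebra:
  fixes E :: "(('r::comm_ring_1, 'v) lie_term \<times> ('r, 'v) lie_term) set"
  shows "lie_algebra (presented_lie S E)"
proof -
  have "module ring_of_type_algebra (presented_lie S E)"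
  proof (rule moduleI)
    show "cring (ring_of_type_algebra :: 'r ring)" by (rule cring_from_type_algebra)
    show "abelian_group (presented_lie S E)"
    proof (rule abelian_groupI)
      fix x assume "x \<in> carrier (presented_lie S E)"
      then obtain s where s: "s \<in> lie_terms S" "x = lie_class S E s" by (auto simp: presented_lie_simps)
      note [trans] = lie_cong.trans
      have "lie_cong S E (Add (Smult (- 1) s) s) (Add (Smult (- 1) s) (Smult 1 s))"
        using s by (intro lie_cong.cong_Add lie_cong.refl lie_cong.sym[OF lie_cong.Smult_one]) auto
      also have "lie_cong S E \<dots> (Smult (- 1 + 1) s)"
        using s by (intro lie_cong.sym[OF lie_cong.Smult_add]) auto
      also have "lie_cong S E (Smult (- 1 + 1) s) Zero"
        using lie_cong.Smult_zero[of s S E] s by simp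
      finally have "lie_class S E (Smult (- 1) s) \<oplus>\<^bsub>presented_lie S E\<^esub> x = \<zero>\<^bsub>presented_lie S E\<^esub>"
        using s by (simp add: presented_lie_ops lie_class_eq_iff)
      then show "\<exists>y\<in>carrier (presented_lie S E). y \<oplus>\<^bsub>presented_lie S E\<^esub> x = \<zero>\<^bsub>presented_lie S E\<^esub>"
        using s by (intro bexI[of _ "lie_class S E (Smult (- 1) s)"]) (auto simp: presented_lie_simps)
    next
      fix x assume "x \<in> carrier (presented_lie S E)"
      then obtain s where s: "s \<in> lie_terms S" "x = lie_class S E s" by (auto simp: presented_lie_simps)
      have "lie_cong S E (Add Zero s) s"
        using s lie_cong.trans[OF lie_cong.Add_comm[of Zero S s E] lie_cong.Add_Zero[of s S E]] by simp
      then show "\<zero>\<^bsub>presented_lie S E\<^esub> \<oplus>\<^bsub>presented_lie S E\<^esub> x = x"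
        using s by (simp add: presented_lie_ops lie_class_eq_iff)
    qed (simp only: presented_lie_simps, (elim imageE)?,
        simp add: imageI presented_lie_add lie_class_eq_iff lie_cong.Add_assoc lie_cong.Add_comm)+
  qed (simp only: presented_lie_simps, (elim imageE)?,
      simp add: imageI presented_lie_add presented_lie_smult lie_class_eq_iff
        lie_cong.Smult_add lie_cong.Smult_Add lie_cong.Smult_mult lie_cong.Smult_one)+
  then show ?thesis
    by (rule lie_algebra.intro, unfold_locales)
      (simp only: presented_lie_simps, (elim imageE)?,
        simp add: imageI presented_lie_add presented_lie_smult presented_lie_mult lie_class_eq_iff
          lie_cong.Bracket_Add_left lie_cong.Bracket_Add_right lie_cong.Bracket_Smult_left
          lie_cong.Bracket_Smult_right lie_cong.alternating lie_cong.jacobi)+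
qed

lemma lie_eval_presented:
  "t \<in> lie_terms S \<Longrightarrow> lie_eval (presented_lie S E) (\<lambda>i. lie_class S E (Gen i)) t = lie_class S E t"
  by (induction t) (auto simp: presented_lie_ops)

section \<open>Ideals and generation by bracket length\<close>

context lie_algebra
begin

lemma bracket_zero [simp]: "x \<in> carrier L \<Longrightarrow> x \<otimes> \<zero> = \<zero>" "x \<in> carrier L \<Longrightarrow> \<zero> \<otimes> x = \<zero>"
  using bracket_smult_right[of x \<zero> 0] bracket_smult_left[of \<zero> x 0] by simp_all

lemma bracket_swap: "x \<in> carrier L \<Longrightarrow> y \<in> carrier L \<Longrightarrow> x \<otimes> y = \<ominus> (y \<otimes> x)"
proof -
  assume xy: "x \<in> carrier L" "y \<in> carrier L"
  have "(x \<oplus> y) \<otimes> (x \<oplus> y) = (x \<otimes> x \<oplus> y \<otimes> x) \<oplus> (x \<otimes> y \<oplus> y \<otimes> y)"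
    using xy by (simp add: bracket_add_left bracket_add_right)
  then have "(x \<oplus> y) \<otimes> (x \<oplus> y) = y \<otimes> x \<oplus> x \<otimes> y"
    using xy by (simp only: bracket_alternating M.l_zero M.r_zero bracket_closed)
  then have "(x \<oplus> y) \<otimes> (x \<oplus> y) = x \<otimes> y \<oplus> y \<otimes> x"
    using xy by (simp only: M.a_comm bracket_closed)
  then have "x \<otimes> y \<oplus> y \<otimes> x = \<zero>" using xy bracket_alternating[of "x \<oplus> y"] by simp
  then show ?thesis using xy M.minus_equality[of "x \<otimes> y" "y \<otimes> x"] by simp
qed

definition lie_ideal :: "'a set \<Rightarrow> bool" where
  "lie_ideal I \<longleftrightarrow> submodule I ring_of_type_algebra L \<and> (\<forall>x\<in>carrier L. \<forall>u\<in>I. x \<otimes> u \<in> I)"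

lemma lie_idealD:
  assumes "lie_ideal I"
  shows "I \<subseteq> carrier L" "\<zero> \<in> I" "a \<in> I \<Longrightarrow> b \<in> I \<Longrightarrow> a \<oplus> b \<in> I" "a \<in> I \<Longrightarrow> c \<odot> a \<in> I"
    "a \<in> I \<Longrightarrow> \<ominus> a \<in> I" "x \<in> carrier L \<Longrightarrow> a \<in> I \<Longrightarrow> x \<otimes> a \<in> I"
    "x \<in> carrier L \<Longrightarrow> a \<in> I \<Longrightarrow> a \<otimes> x \<in> I"
proof -
  have s: "submodule I ring_of_type_algebra L" using assms by (simp add: lie_ideal_def)
  note D = type_submoduleD[OF s]
  show "I \<subseteq> carrier L" "\<zero> \<in> I" "a \<in> I \<Longrightarrow> b \<in> I \<Longrightarrow> a \<oplus> b \<in> I" "a \<in> I \<Longrightarrow> c \<odot> a \<in> I"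
    "a \<in> I \<Longrightarrow> \<ominus> a \<in> I" by (fact D)+
  show *: "x \<in> carrier L \<Longrightarrow> a \<in> I \<Longrightarrow> x \<otimes> a \<in> I" using assms by (simp add: lie_ideal_def)
  assume xa: "x \<in> carrier L" "a \<in> I"
  then have "a \<otimes> x = \<ominus> (x \<otimes> a)" using bracket_swap D(1) by blast
  then show "a \<otimes> x \<in> I" using * xa D(5) by simp
qed

lemma alg_ideal_least:
  assumes "lie_ideal I" "B \<subseteq> I"
  shows "alg_ideal L B \<subseteq> I"
  unfolding alg_ideal_def using lie_idealD[OF assms(1)] assms by (auto simp: lie_ideal_def)

lemma alg_ideal_lie_ideal:
  assumes "B \<subseteq> carrier L"
  shows "lie_ideal (alg_ideal L B)"
  unfolding lie_ideal_def
proof (intro conjI type_submoduleI ballI)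
  have "lie_ideal (carrier L)" using carrier_is_submodule by (simp add: lie_ideal_def)
  then show "alg_ideal L B \<subseteq> carrier L" using alg_ideal_least assms by blast
qed (auto simp: alg_ideal_def intro: type_submoduleD)

lemma alg_ideal_incl: "B \<subseteq> alg_ideal L B"
  by (auto simp: alg_ideal_def)

lemma lie_ideal_carrier: "lie_ideal (carrier L)"
  using carrier_is_submodule by (simp add: lie_ideal_def)

text \<open>Each x acts as a derivation by the Jacobi identity, so it maps a product of two elements
  of I to a sum of such products.\<close>

lemma alg_derived_lie_ideal:
  assumes I: "lie_ideal I"
  shows "lie_ideal (alg_derived L I)"
proof -
  note D = lie_idealD[OF I]
  have gens: "{a \<otimes> b | a b. a \<in> I \<and> b \<in> I} \<subseteq> carrier L"
    using D(1) by (blast intro: bracket_closed)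
  have sub: "submodule (alg_derived L I) ring_of_type_algebra L"
    unfolding alg_derived_def by (rule lin_span_submodule[OF gens])
  note E = type_submoduleD[OF sub]
  have incl: "a \<otimes> b \<in> alg_derived L I" if "a \<in> I" "b \<in> I" for a b
    unfolding alg_derived_def using that lin_span_incl[of "{a \<otimes> b | a b. a \<in> I \<and> b \<in> I}"] by auto
  have "alg_derived L I \<subseteq> {u \<in> carrier L. x \<otimes> u \<in> alg_derived L I}" if x: "x \<in> carrier L" for x
  proof -
    have "lin_span L {a \<otimes> b | a b. a \<in> I \<and> b \<in> I} \<subseteq> {u \<in> carrier L. x \<otimes> u \<in> alg_derived L I}"
    proof (rule lin_span_least)
    show "submodule {u \<in> carrier L. x \<otimes> u \<in> alg_derived L I} ring_of_type_algebra L"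
      by (rule type_submoduleI) (use x E in \<open>auto simp: bracket_add_right bracket_smult_right\<close>)
    show "{a \<otimes> b | a b. a \<in> I \<and> b \<in> I} \<subseteq> {u \<in> carrier L. x \<otimes> u \<in> alg_derived L I}"
    proof clarify
      fix a b assume ab: "a \<in> I" "b \<in> I"
      then have c: "a \<in> carrier L" "b \<in> carrier L" using D(1) by auto
      have "x \<otimes> (a \<otimes> b) \<oplus> (a \<otimes> (b \<otimes> x) \<oplus> b \<otimes> (x \<otimes> a)) = \<zero>"
        using bracket_jacobi[of x a b] x c by (simp add: M.a_assoc)
      then have "x \<otimes> (a \<otimes> b) = \<ominus> (a \<otimes> (b \<otimes> x) \<oplus> b \<otimes> (x \<otimes> a))"
        using x c by (intro M.minus_equality[symmetric]) auto
      moreover have "a \<otimes> (b \<otimes> x) \<oplus> b \<otimes> (x \<otimes> a) \<in> alg_derived L I"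
        using ab x D by (intro E incl) auto
      ultimately show "a \<otimes> b \<in> carrier L \<and> x \<otimes> (a \<otimes> b) \<in> alg_derived L I"
        using E(5) c by simp
    qed
    qed
    then show ?thesis by (simp add: alg_derived_def[of L I])
  qed
  then show ?thesis using sub by (auto simp: lie_ideal_def)
qed

lemma bracket_diff_mem:
  assumes I: "lie_ideal I" and "x \<in> carrier L" "x' \<in> carrier L" "y \<in> carrier L" "y' \<in> carrier L"
    "x \<ominus> x' \<in> I" "y \<ominus> y' \<in> I"
  shows "(x \<otimes> y) \<ominus> (x' \<otimes> y') \<in> I"
proof -
  have m: "u \<otimes> (\<ominus> v) = \<ominus> (u \<otimes> v)" "(\<ominus> u) \<otimes> v = \<ominus> (u \<otimes> v)" if "u \<in> carrier L" "v \<in> carrier L" for u v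
    using that bracket_smult_right[of u v "-1"] bracket_smult_left[of u v "-1"] by (simp_all add: type_minus_smult)
  have "(x \<otimes> y) \<ominus> (x' \<otimes> y') = (x \<ominus> x') \<otimes> y \<oplus> x' \<otimes> (y \<ominus> y')"
    using assms(2-5)
    by (simp add: a_minus_def bracket_add_left bracket_add_right m M.a_assoc M.r_neg1 M.r_neg2)
  then show ?thesis using assms lie_idealD[OF I] by auto
qed

text \<open>The universal property for the quotient by I, phrased with differences in I instead of
  cosets. With \<open>metab\<close> and I = L'' it compares L/L'' to the term congruence.\<close>

lemma lie_eval_cong_mod:
  assumes cong: "lie_cong S E s t" and g: "g ` S \<subseteq> carrier L" and I: "lie_ideal I"
    and E: "\<And>s t. (s, t) \<in> E \<Longrightarrow> s \<in> lie_terms S \<Longrightarrow> t \<in> lie_terms S \<Longrightarrow>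
      lie_eval L g s \<ominus> lie_eval L g t \<in> I"
  shows "lie_eval L g s \<ominus> lie_eval L g t \<in> I"
proof -
  note D = lie_idealD[OF I]
  \<comment> \<open>The rules that are Lie axioms hold exactly by \<open>lie_eval_cong\<close> for
    the empty set of relations; only the closure rules and \<open>rel\<close> need the
    ideal.\<close>
  have step: "lie_eval L g s \<ominus> lie_eval L g t \<in> I" if "lie_cong S {} s t" for s t
    using lie_eval_cong[OF that g] lie_cong_terms[OF that] g D(2) by (simp add: a_minus_def M.r_neg)
  show ?thesis
    using cong
  proof (induction rule: lie_cong.induct)
    case (rel s t)
    then show ?case using E by simp
  next
    case (refl s) then show ?case by (intro step lie_cong.refl)
  next
    case (sym s t)
    have c: "lie_eval L g s \<in> carrier L" "lie_eval L g t \<in> carrier L"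
      using lie_cong_terms[OF sym.hyps] g by auto
    have "\<ominus> (lie_eval L g s \<ominus> lie_eval L g t) = lie_eval L g t \<ominus> lie_eval L g s"
      using c by (simp add: a_minus_def M.minus_add M.a_comm)
    then show ?case using D(5)[OF sym.IH] by simp
  next
    case (trans s t u)
    have c: "lie_eval L g s \<in> carrier L" "lie_eval L g t \<in> carrier L" "lie_eval L g u \<in> carrier L"
      using lie_cong_terms[OF trans.hyps(1)] lie_cong_terms[OF trans.hyps(2)] g by auto
    have "lie_eval L g s \<ominus> lie_eval L g u =
        (lie_eval L g s \<ominus> lie_eval L g t) \<oplus> (lie_eval L g t \<ominus> lie_eval L g u)"
      using c by (simp add: a_minus_def M.a_assoc M.r_neg1)
    then show ?case using D(3)[OF trans.IH] by simp
  next
    case (cong_Add s s' t t')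
    have c: "lie_eval L g s \<in> carrier L" "lie_eval L g s' \<in> carrier L"
        "lie_eval L g t \<in> carrier L" "lie_eval L g t' \<in> carrier L"
      using lie_cong_terms[OF cong_Add.hyps(1)] lie_cong_terms[OF cong_Add.hyps(2)] g by auto
    have "lie_eval L g (Add s t) \<ominus> lie_eval L g (Add s' t') =
        (lie_eval L g s \<ominus> lie_eval L g s') \<oplus> (lie_eval L g t \<ominus> lie_eval L g t')"
      using c by (simp add: a_minus_def M.minus_add M.a_ac)
    then show ?case using D(3)[OF cong_Add.IH] by simp
  next
    case (cong_Smult s s' c)
    have cl: "lie_eval L g s \<in> carrier L" "lie_eval L g s' \<in> carrier L"
      using lie_cong_terms[OF cong_Smult.hyps(1)] g by auto
    have "lie_eval L g (Smult c s) \<ominus> lie_eval L g (Smult c s') = c \<odot> (lie_eval L g s \<ominus> lie_eval L g s')"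
      using cl smult_r_minus[of c "lie_eval L g s'"] by (simp add: a_minus_def type_smult_simps)
    then show ?case using D(4)[OF cong_Smult.IH] by simp
  next
    case (cong_Bracket s s' t t')
    have c: "lie_eval L g s \<in> carrier L" "lie_eval L g s' \<in> carrier L"
        "lie_eval L g t \<in> carrier L" "lie_eval L g t' \<in> carrier L"
      using lie_cong_terms[OF cong_Bracket.hyps(1)] lie_cong_terms[OF cong_Bracket.hyps(2)] g by auto
    then show ?case using bracket_diff_mem[OF I c cong_Bracket.IH] by simp
  qed (rule step, rule lie_cong.Add_assoc lie_cong.Add_comm lie_cong.Add_Zero lie_cong.Smult_zero
    lie_cong.Smult_one lie_cong.Smult_mult lie_cong.Smult_add lie_cong.Smult_Add
    lie_cong.Bracket_Add_left lie_cong.Bracket_Add_right lie_cong.Bracket_Smult_left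
    lie_cong.Bracket_Smult_right lie_cong.alternating lie_cong.jacobi, assumption+)+
qed

lemma lie_eval_bracket_closed_submodule:
  assumes "g ` S \<subseteq> carrier L"
  shows "submodule (lie_eval L g ` lie_terms S) ring_of_type_algebra L"
proof (rule type_submoduleI)
  show "\<zero> \<in> lie_eval L g ` lie_terms S" by (rule image_eqI[of _ _ Zero]) auto
  show "a \<oplus> b \<in> lie_eval L g ` lie_terms S" if "a \<in> lie_eval L g ` lie_terms S" "b \<in> lie_eval L g ` lie_terms S" for a b
    using that by (auto intro!: image_eqI[of _ _ "Add _ _"])
  show "c \<odot> a \<in> lie_eval L g ` lie_terms S" if "a \<in> lie_eval L g ` lie_terms S" for a c
    using that by (auto intro!: image_eqI[of _ _ "Smult _ _"])
qed (use assms in auto)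

lemma monomials_lie_eval:
  assumes "(k, a) \<in> monomials L (g ` S)"
  shows "1 \<le> k \<and> a \<in> lie_eval L g ` lie_terms S"
  using assms
proof (induction rule: monomials.induct)
  case (gen y)
  then show ?case by (auto intro!: image_eqI[of _ _ "Gen _"])
next
  case (mult i a j b)
  then show ?case by (auto intro!: image_eqI[of _ _ "Bracket _ _"])
qed

lemma monomials_closed: "(k, a) \<in> monomials L Y \<Longrightarrow> Y \<subseteq> carrier L \<Longrightarrow> a \<in> carrier L"
  by (induction rule: monomials.induct) auto

lemma monomials_length_part: "(k, a) \<in> monomials L Y \<Longrightarrow> a \<in> length_part L Y k"
  unfolding length_part_def by (rule subsetD[OF lin_span_incl]) simp

lemma length_part_bracket:
  assumes Y: "Y \<subseteq> carrier L" and "a \<in> length_part L Y i" "b \<in> length_part L Y j"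
  shows "a \<otimes> b \<in> length_part L Y (i + j)"
proof -
  have sub: "submodule (length_part L Y k) ring_of_type_algebra L" for k
    unfolding length_part_def using monomials_closed Y by (intro lin_span_submodule) auto
  note D = type_submoduleD[OF sub]
  have gen: "x \<otimes> y \<in> length_part L Y (i + j)"
    if "(i, x) \<in> monomials L Y" "(j, y) \<in> monomials L Y" for x y
    by (intro monomials_length_part monomials.mult that)
  have 1: "length_part L Y j \<subseteq> {y \<in> carrier L. x \<otimes> y \<in> length_part L Y (i + j)}"
    if x: "(i, x) \<in> monomials L Y" for x
    unfolding length_part_def[of L Y j]
  proof (rule lin_span_least)
    have "x \<in> carrier L" using monomials_closed[OF x Y] .
    then show "submodule {y \<in> carrier L. x \<otimes> y \<in> length_part L Y (i + j)} ring_of_type_algebra L"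
      by (intro type_submoduleI) (use D in \<open>auto simp: bracket_add_right bracket_smult_right\<close>)
  qed (use gen x monomials_closed Y in auto)
  have b: "b \<in> carrier L" using D(1) assms by auto
  have "length_part L Y i \<subseteq> {x \<in> carrier L. x \<otimes> b \<in> length_part L Y (i + j)}"
    unfolding length_part_def[of L Y i]
  proof (rule lin_span_least)
    show "submodule {x \<in> carrier L. x \<otimes> b \<in> length_part L Y (i + j)} ring_of_type_algebra L"
      by (intro type_submoduleI) (use D b in \<open>auto simp: bracket_add_left bracket_smult_left\<close>)
  qed (use 1 assms(3) monomials_closed Y in auto)
  then show ?thesis using assms by auto
qed

end

section \<open>Generation in degree one\<close>

context group
begin

lemma gr_degree_submodule: "submodule (gr_degree G k) ring_of_type_algebra (gr G)"
proof -
  interpret gr: lie_algebra "gr G" by (rule gr_lie_algebra)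
  show ?thesis
  proof (rule gr.type_submoduleI)
    show "a \<oplus>\<^bsub>gr G\<^esub> b \<in> gr_degree G k" if ab: "a \<in> gr_degree G k" "b \<in> gr_degree G k" for a b
    proof -
      have "(a \<oplus>\<^bsub>gr G\<^esub> b) i = \<one>\<^bsub>gr_part G i\<^esub>" if "1 \<le> i" "i \<noteq> k" for i
      proof -
        interpret A: comm_group "gr_part G i" by (rule gr_part_comm_group[OF that(1)])
        show ?thesis using ab that by (simp add: gr_degree_def gr_add)
      qed
      then show ?thesis using ab by (simp add: gr_degree_def)
    qed
    show "c \<odot>\<^bsub>gr G\<^esub> a \<in> gr_degree G k" if a: "a \<in> gr_degree G k" for a c
    proof -
      have "(c \<odot>\<^bsub>gr G\<^esub> a) i = \<one>\<^bsub>gr_part G i\<^esub>" if "1 \<le> i" "i \<noteq> k" for i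
      proof -
        interpret A: comm_group "gr_part G i" by (rule gr_part_comm_group[OF that(1)])
        show ?thesis using a that by (simp add: gr_degree_def gr_smult_nth)
      qed
      then show ?thesis using a by (simp add: gr_degree_def)
    qed
    have "\<zero>\<^bsub>gr G\<^esub> i = \<one>\<^bsub>gr_part G i\<^esub>" if "1 \<le> i" for i
      using that by (simp add: gr_zero)
    then show "\<zero>\<^bsub>gr G\<^esub> \<in> gr_degree G k" by (simp add: gr_degree_def)
  qed (simp add: gr_degree_def)
qed

lemma gr_class_degree:
  assumes "1 \<le> k" "x \<in> lower_central G k"
  shows "gr_class G k x \<in> gr_degree G k"
  using assms gr_class_closed by (auto simp: gr_degree_def gr_class_nth one_gr_part)

lemma gr_degreeD:
  assumes "s \<in> gr_degree G k" "1 \<le> k"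
  shows "\<exists>x\<in>lower_central G k. s = gr_class G k x"
proof -
  have s: "s \<in> carrier (gr G)" using assms by (simp add: gr_degree_def)
  obtain x where x: "x \<in> lower_central G k" "s k = coset_class G k x"
    using gr_carrierD[OF s assms(2)] by blast
  have "s = gr_class G k x"
    by (rule gr_eqI) (use s x assms gr_class_closed in \<open>auto simp: gr_class_nth gr_degree_def one_gr_part\<close>)
  then show ?thesis using x by blast
qed

text \<open>Gamma_(k+1) is generated by commutators with one entry in the whole group. Their classes
  are brackets of a degree k class with a degree one class, and degree one is spanned by the
  generators Y.\<close>

lemma gr_class_length_part:
  assumes Y: "Y \<subseteq> carrier G" "generate G Y = carrier G" and "1 \<le> k" "x \<in> lower_central G k"
  shows "gr_class G k x \<in> length_part (gr G) (gr_class G 1 ` Y) k"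
proof -
  interpret gr: lie_algebra "gr G" by (rule gr_lie_algebra)
  let ?Y = "gr_class G 1 ` Y"
  have YY: "?Y \<subseteq> carrier (gr G)" using Y gr_class_closed[of 1] by auto
  have sub: "submodule (length_part (gr G) ?Y k) ring_of_type_algebra (gr G)" for k
    unfolding length_part_def using gr.monomials_closed YY by (intro gr.lin_span_submodule) auto
  note D = gr.type_submoduleD[OF sub]
  have 1: "gr_class G 1 x \<in> length_part (gr G) ?Y 1" if "x \<in> carrier G" for x
  proof -
    have "x \<in> generate G Y" using that Y by simp
    then show ?thesis
    proof (induction rule: generate.induct)
      case one
      then show ?case using D(2) by (simp add: gr_class_one)
    next
      case (incl h)
      then show ?case by (intro gr.monomials_length_part monomials.gen imageI)
    next
      case (inv h)
      then have "gr_class G 1 h \<in> length_part (gr G) ?Y 1"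
        by (intro gr.monomials_length_part monomials.gen imageI)
      then show ?case using D(5) gr_class_inv[of 1 h] inv Y by auto
    next
      case (eng h1 h2)
      then show ?case using D(3) gr_class_mult[of 1 h1 h2] generate_in_carrier[OF Y(1)] by simp
    qed
  qed
  show ?thesis using assms(3,4)
  proof (induction k arbitrary: x rule: dec_induct)
    case base
    then show ?case using 1 by simp
  next
    case (step k)
    have comm: "gr_class G (Suc k) (commutator G a b) \<in> length_part (gr G) ?Y (Suc k)"
      if "a \<in> lower_central G k" "b \<in> carrier G" for a b
      using gr.length_part_bracket[OF YY step.IH[OF that(1)] 1[OF that(2)]]
        gr_class_commutator[of k 1 a b] step.hyps that by simp
    obtain l where k: "k = Suc l" using step by (cases k) auto
    have inc: "{commutator G a b | a b. a \<in> lower_central G k \<and> b \<in> carrier G} \<subseteq> lower_central G (Suc k)"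
      using commutator_carrier_lower_central step.hyps by auto
    have "x \<in> generate G {commutator G a b | a b. a \<in> lower_central G k \<and> b \<in> carrier G}"
      using step.prems by (simp add: k lower_central.simps(3))
    then show ?case
    proof (induction rule: generate.induct)
      case one
      then show ?case using D(2) by (simp add: gr_class_one)
    next
      case (incl h)
      then show ?case using comm by auto
    next
      case (inv h)
      have "gr_class G (Suc k) h \<in> length_part (gr G) ?Y (Suc k)" using inv comm by auto
      moreover have "h \<in> lower_central G (Suc k)" using inv inc by blast
      ultimately show ?case using D(5) gr_class_inv[of "Suc k" h] by simp
    next
      case (eng h1 h2)
      then have "h1 \<in> lower_central G (Suc k)" "h2 \<in> lower_central G (Suc k)"
        using generate_subgroup_incl[OF inc lower_central_subgroup] by auto
      then show ?case using D(3) eng gr_class_mult[of "Suc k" h1 h2] by simp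
    qed
  qed
qed

lemma gr_degree_eq_length_part:
  assumes Y: "Y \<subseteq> carrier G" "generate G Y = carrier G" and k: "1 \<le> k"
  shows "gr_degree G k = length_part (gr G) (gr_class G 1 ` Y) k"
proof
  interpret gr: lie_algebra "gr G" by (rule gr_lie_algebra)
  show "gr_degree G k \<subseteq> length_part (gr G) (gr_class G 1 ` Y) k"
    using gr_class_length_part[OF Y k] gr_degreeD[OF _ k] by blast
  have "1 \<le> k \<and> a \<in> gr_degree G k" if "(k, a) \<in> monomials (gr G) (gr_class G 1 ` Y)" for k a
    using that
  proof (induction rule: monomials.induct)
    case (gen y)
    then show ?case using gr_class_degree[of 1] Y by auto
  next
    case (mult i a j b)
    then obtain x y where "x \<in> lower_central G i" "a = gr_class G i x" "y \<in> lower_central G j" "b = gr_class G j y"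
      using gr_degreeD by blast
    then show ?case
      using mult gr_class_degree[of "i + j"] commutator_lower_central by (simp add: gr_class_commutator)
  qed
  then show "length_part (gr G) (gr_class G 1 ` Y) k \<subseteq> gr_degree G k"
    unfolding length_part_def by (intro gr.lin_span_least gr_degree_submodule) auto
qed

lemma lie_eval_gr_surj:
  assumes Y: "x ` S \<subseteq> carrier G" "generate G (x ` S) = carrier G"
  shows "lie_eval (gr G) (\<lambda>i. gr_class G 1 (x i)) ` lie_terms S = carrier (gr G)"
proof
  interpret gr: lie_algebra "gr G" by (rule gr_lie_algebra)
  let ?g = "\<lambda>i. gr_class G 1 (x i)"
  have g: "?g ` S \<subseteq> carrier (gr G)" using Y gr_class_closed[of 1] by auto
  then show "lie_eval (gr G) ?g ` lie_terms S \<subseteq> carrier (gr G)" by auto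
  have sub: "submodule (lie_eval (gr G) ?g ` lie_terms S) ring_of_type_algebra (gr G)"
    by (rule gr.lie_eval_bracket_closed_submodule[OF g])
  note D = gr.type_submoduleD[OF sub]
  show "carrier (gr G) \<subseteq> lie_eval (gr G) ?g ` lie_terms S"
  proof
    fix s assume "s \<in> carrier (gr G)"
    then show "s \<in> lie_eval (gr G) ?g ` lie_terms S"
    proof (induction s rule: gr_induct)
      case zero
      then show ?case by (rule D(2))
    next
      case (hom k y)
      have "gr_class G k y \<in> length_part (gr G) (?g ` S) k"
        using gr_class_length_part[OF Y hom] by (simp add: image_image)
      also have "\<dots> \<subseteq> lie_eval (gr G) ?g ` lie_terms S"
        unfolding length_part_def by (intro gr.lin_span_least sub) (use gr.monomials_lie_eval in blast)
      finally show ?case .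
    next
      case (add s t)
      then show ?case using D(3) by simp
    qed
  qed
qed

end

section \<open>One-relator metabelian groups\<close>

lemma group_hom_commutator:
  assumes "group_hom G H h" "x \<in> carrier G" "y \<in> carrier G"
  shows "h (commutator G x y) = commutator H (h x) (h y)"
proof -
  interpret group_hom G H h by fact
  show ?thesis using assms by (simp add: commutator_def)
qed

lemma group_hom_lower_central:
  assumes h: "group_hom G H h" and surj: "h ` carrier G = carrier H"
  shows "h ` lower_central G k = lower_central H k"
proof -
  interpret h: group_hom G H h by (rule h)
  have "h ` lower_central G (Suc k) = lower_central H (Suc k)" for k
  proof (induction k)
    case (Suc k)
    have c: "x \<in> lower_central G (Suc k) \<Longrightarrow> x \<in> carrier G" for x
      by (rule h.G.lower_central_in_carrier)
    let ?C = "{commutator G x y | x y. x \<in> lower_central G (Suc k) \<and> y \<in> carrier G}"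
    have "h ` ?C = {commutator H x y | x y. x \<in> lower_central H (Suc k) \<and> y \<in> carrier H}"
    proof
      show "h ` ?C \<subseteq> {commutator H x y | x y. x \<in> lower_central H (Suc k) \<and> y \<in> carrier H}"
        using group_hom_commutator[OF h] c Suc by fastforce
      show "{commutator H x y | x y. x \<in> lower_central H (Suc k) \<and> y \<in> carrier H} \<subseteq> h ` ?C"
      proof clarify
        fix x y assume xy: "x \<in> lower_central H (Suc k)" "y \<in> carrier H"
        obtain a where a: "a \<in> lower_central G (Suc k)" "x = h a" using xy(1) Suc by blast
        obtain b where b: "b \<in> carrier G" "y = h b" using xy(2) surj by blast
        have "commutator H x y = h (commutator G a b)"
          using group_hom_commutator[OF h c[OF a(1)] b(1)] a b by simp
        then show "commutator H x y \<in> h ` ?C" using a b by blast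
      qed
    qed
    moreover have "?C \<subseteq> carrier G" using c by auto
    ultimately show ?case
      using h.generate_img[of ?C] by (simp add: lower_central.simps(3))
  qed (simp add: surj)
  then show ?thesis using surj by (cases k) auto
qed

context group
begin

lemma gr_mult_nth_1: "(s \<otimes>\<^bsub>gr G\<^esub> t) 1 = \<one>\<^bsub>gr_part G 1\<^esub>"
proof -
  interpret A: comm_group "gr_part G 1" by (rule gr_part_comm_group) simp
  show ?thesis using A.finprod_empty by (simp add: gr_mult del: A.finprod_empty)
qed

text \<open>Without degree one parts, the bracket involves only commutators of two elements of
  Gamma_2; splittings with i = 1 or k - i = 1 have a trivial entry.\<close>

lemma gr_mult_metabelian:
  assumes metab: "\<And>a b. a \<in> lower_central G 2 \<Longrightarrow> b \<in> lower_central G 2 \<Longrightarrow> commutator G a b = \<one>"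
    and st: "s \<in> carrier (gr G)" "t \<in> carrier (gr G)" "s 1 = \<one>\<^bsub>gr_part G 1\<^esub>" "t 1 = \<one>\<^bsub>gr_part G 1\<^esub>"
  shows "s \<otimes>\<^bsub>gr G\<^esub> t = \<zero>\<^bsub>gr G\<^esub>"
proof -
  have "(s \<otimes>\<^bsub>gr G\<^esub> t) k = \<one>\<^bsub>gr_part G k\<^esub>" if k: "1 \<le> k" for k
  proof -
    interpret A: comm_group "gr_part G k" by (rule gr_part_comm_group[OF k])
    have "gr_bracket G i (k - i) (s i) (t (k - i)) = \<one>\<^bsub>gr_part G k\<^esub>" if i: "i \<in> {1..<k}" for i
    proof -
      have ik: "1 \<le> i" "1 \<le> k - i" "i + (k - i) = k" using i by auto
      consider "i = 1" | "k - i = 1" | "2 \<le> i" "2 \<le> k - i" using ik by linarith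
      then show ?thesis
      proof cases
        case 1
        then show ?thesis
          using gr_bracket_one(2)[OF ik(1,2) gr_nth_closed[OF st(2) ik(2)]] st(3) ik(3) by simp
      next
        case 2
        then show ?thesis
          using gr_bracket_one(1)[OF ik(1,2) gr_nth_closed[OF st(1) ik(1)]] st(4) ik(3) by simp
      next
        case 3
        obtain x where x: "x \<in> lower_central G i" "s i = coset_class G i x"
          using gr_carrierD[OF st(1) ik(1)] by blast
        obtain y where y: "y \<in> lower_central G (k - i)" "t (k - i) = coset_class G (k - i) y"
          using gr_carrierD[OF st(2) ik(2)] by blast
        have "commutator G x y = \<one>"
          using x y lower_central_mono[OF 3(1)] lower_central_mono[OF 3(2)] by (intro metab) auto
        then show ?thesis
          using gr_bracket_coset_class[OF ik(1,2) x(1) y(1)] x y ik(3) by (simp add: one_gr_part)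
      qed
    qed
    then have "finprod (gr_part G k) (\<lambda>i. gr_bracket G i (k - i) (s i) (t (k - i))) {1..<k} = \<one>\<^bsub>gr_part G k\<^esub>"
      by (rule A.finprod_one_eqI)
    then show ?thesis using k by (simp add: gr_mult)
  qed
  moreover have "\<zero>\<^bsub>gr G\<^esub> \<in> carrier (gr G)"
    using gr_class_closed[of 1 \<one>] by (simp add: gr_class_one)
  ultimately show ?thesis
    by (intro gr_eqI gr_mult_closed st) (auto simp: gr_zero)
qed

end

context fox
begin

lemma fox_lead_inv:
  assumes "g \<in> lower_central F (Suc k)"
  shows "fox_deriv (inv\<^bsub>F\<^esub> g) j $ k = - fox_deriv g j $ k"
proof -
  have "g \<in> carrier F" using assms F.lower_central_in_carrier by blast
  then show ?thesis
    using fox_lead_mult[OF assms, of "inv\<^bsub>F\<^esub> g" j] by (simp add: eq_neg_iff_add_eq_0)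
qed

lemma fox_lead_nat_pow:
  assumes "g \<in> lower_central F (Suc k)"
  shows "g [^]\<^bsub>F\<^esub> (m::nat) \<in> lower_central F (Suc k)"
    "fox_deriv (g [^]\<^bsub>F\<^esub> m) j $ k = of_nat m * fox_deriv g j $ k"
proof -
  show *: "g [^]\<^bsub>F\<^esub> m \<in> lower_central F (Suc k)" for m :: nat
    by (induction m) (use assms in auto)
  show "fox_deriv (g [^]\<^bsub>F\<^esub> m) j $ k = of_nat m * fox_deriv g j $ k"
    by (induction m) (use fox_lead_mult[OF assms] * in \<open>auto simp: algebra_simps\<close>)
qed

lemma fox_lead_int_pow:
  assumes "g \<in> lower_central F (Suc k)"
  shows "fox_deriv (g [^]\<^bsub>F\<^esub> (c::int)) j $ k = of_int c * fox_deriv g j $ k"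
proof (cases "c < 0")
  case True
  then show ?thesis
    unfolding int_pow_def2 if_P[OF True] fox_lead_inv[OF fox_lead_nat_pow(1)[OF assms]] fps_neg_nth
      fox_lead_nat_pow(2)[OF assms]
    by (simp add: of_nat_nat)
next
  case False
  then show ?thesis
    unfolding int_pow_def2 if_not_P[OF False] fox_lead_nat_pow(2)[OF assms] by simp
qed

lemma fox_unit_lead_inv: "g \<in> carrier F \<Longrightarrow> fox_unit (inv\<^bsub>F\<^esub> g) $ 1 = - fox_unit g $ 1"
  using fox_unit_lead_mult[of "inv\<^bsub>F\<^esub> g" g] by (simp add: eq_neg_iff_add_eq_0)

lemma fox_unit_lead_int_pow:
  assumes "g \<in> carrier F"
  shows "fox_unit (g [^]\<^bsub>F\<^esub> (c::int)) $ 1 = of_int c * fox_unit g $ 1"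
proof -
  have *: "fox_unit (g [^]\<^bsub>F\<^esub> m) $ 1 = of_nat m * fox_unit g $ 1" for m :: nat
    by (induction m) (simp_all del: One_nat_def add: fox_unit_lead_mult algebra_simps)
  show ?thesis
  proof (cases "c < 0")
    case True
    then show ?thesis
      unfolding int_pow_def2 if_P[OF True] fox_unit_lead_inv[OF F.nat_pow_closed[OF assms]] fps_neg_nth *
      by (simp add: of_nat_nat)
  next
    case False
    then show ?thesis unfolding int_pow_def2 if_not_P[OF False] * by simp
  qed
qed

end

text \<open>The properties of F -> G/G'' on which the comparison rests. \<open>proj_kernel\<close>
  bounds the kernel from above, while \<open>relator\<close> and \<open>metabelian\<close> say that
  it is large enough. The term t0 stands for the class of r in gr F.\<close>

locale metab_presentation = fox S + M: group M
  for S :: "nat set" and M :: "'m monoid" +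
  fixes proj :: "(nat \<times> bool) list \<Rightarrow> 'm" and r :: "(nat \<times> bool) list" and t0 :: "(int, nat) lie_term"
  assumes proj_hom: "proj \<in> hom F M" and proj_surj: "proj ` carrier F = carrier M"
    and relator: "r \<in> lower_central F 2" "proj r = \<one>\<^bsub>M\<^esub>"
    and proj_kernel: "g \<in> carrier F \<Longrightarrow> proj g = \<one>\<^bsub>M\<^esub> \<Longrightarrow> g \<in> relator_kernel r"
    and metabelian: "a \<in> lower_central M 2 \<Longrightarrow> b \<in> lower_central M 2 \<Longrightarrow> commutator M a b = \<one>\<^bsub>M\<^esub>"
    and t0: "t0 \<in> lie_terms S"
      "lie_eval (gr F) (\<lambda>i. gr_class F (Suc 0) (free_gen i)) t0 = gr_class F 2 r"
begin

abbreviation "evF \<equiv> lie_eval (gr F) (\<lambda>i. gr_class F (Suc 0) (free_gen i))"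
abbreviation "evM \<equiv> lie_eval (gr M) (\<lambda>i. gr_class M (Suc 0) (proj (free_gen i)))"
abbreviation "rho j \<equiv> fox_deriv r j $ 1"
abbreviation "L \<equiv> free_lie S :: (int, (int, nat) lie_term set) module"
abbreviation "cls \<equiv> lie_class S ({} :: ((int, nat) lie_term \<times> (int, nat) lie_term) set)"
abbreviation "L'' \<equiv> alg_derived L (alg_derived L (carrier L))"
abbreviation "J \<equiv> alg_ideal L {cls t0} <+>\<^bsub>L\<^esub> L''"

sublocale proj: group_hom F M proj
  using proj_hom by (intro group_hom.intro group_hom_axioms.intro) (auto intro: F.group_axioms M.group_axioms)

sublocale grF: lie_algebra "gr F" by (rule F.gr_lie_algebra)
sublocale grM: lie_algebra "gr M" by (rule M.gr_lie_algebra)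
sublocale L: lie_algebra L unfolding free_lie_def by (rule presented_lie_algebra)

lemma proj_lower_central: "proj ` lower_central F k = lower_central M k"
  by (rule group_hom_lower_central[OF proj.group_hom_axioms proj_surj])

lemma proj_lower_central_mem: "g \<in> lower_central F k \<Longrightarrow> proj g \<in> lower_central M k"
  using proj_lower_central by blast

lemma gens_closed:
  "(\<lambda>i. gr_class F (Suc 0) (free_gen i)) ` S \<subseteq> carrier (gr F)"
  "(\<lambda>i. gr_class M (Suc 0) (proj (free_gen i))) ` S \<subseteq> carrier (gr M)"
  using F.gr_class_closed[of "Suc 0"] M.gr_class_closed[of "Suc 0"] by auto

lemma evF_closed [simp]: "t \<in> lie_terms S \<Longrightarrow> evF t \<in> carrier (gr F)"
  by (rule grF.lie_eval_closed[OF gens_closed(1)])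

lemma evM_closed [simp]: "t \<in> lie_terms S \<Longrightarrow> evM t \<in> carrier (gr M)"
  by (rule grM.lie_eval_closed[OF gens_closed(2)])

lemma generate_gens:
  "generate F (free_gen ` S) = carrier F"
  "generate M ((\<lambda>i. proj (free_gen i)) ` S) = carrier M"
proof -
  show *: "generate F (free_gen ` S) = carrier F" by (rule free_group_generate)
  show "generate M ((\<lambda>i. proj (free_gen i)) ` S) = carrier M"
    using proj.generate_img[of "free_gen ` S"] * proj_surj by (simp add: image_image image_subset_iff)
qed

lemma evF_surj: "evF ` lie_terms S = carrier (gr F)"
proof -
  have "free_gen ` S \<subseteq> carrier F" by auto
  then show ?thesis using F.lie_eval_gr_surj[of free_gen S] generate_gens by simp
qed

lemma evM_surj: "evM ` lie_terms S = carrier (gr M)"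
proof -
  have "(\<lambda>i. proj (free_gen i)) ` S \<subseteq> carrier M" by auto
  then show ?thesis using M.lie_eval_gr_surj[of "\<lambda>i. proj (free_gen i)" S] generate_gens by simp
qed

text \<open>The bridge between terms and words: w realizes the degree k part of t in gr F, in gr M
  and among the leading Fox vectors. The indices \<open>k - 1\<close> reflect that Gamma_k starts at
  X^(k-1). The linear part is recorded for k = 1, where it governs brackets.\<close>

definition represents :: "nat \<Rightarrow> (int, nat) lie_term \<Rightarrow> (nat \<times> bool) list \<Rightarrow> bool" where
  "represents k t w \<longleftrightarrow> w \<in> lower_central F k \<and> evF t k = coset_class F k w \<and>
    evM t k = coset_class M k (proj w) \<and>
    (\<forall>j. fox_deriv w j $ (k - 1) = coeff (fox_vec t j) (k - 1)) \<and>
    (k = 1 \<longrightarrow> fox_unit w $ 1 = fox_lin t)"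

text \<open>A component of a bracket in gr is a product over splittings; multiplying the words
  chosen for the splittings gives one word serving both groups, and leading vectors add.\<close>

lemma finprod_lift:
  assumes "finite I" "\<And>i. i \<in> I \<Longrightarrow> g i \<in> lower_central F (Suc k)"
  shows "\<exists>w\<in>lower_central F (Suc k).
    finprod (gr_part F (Suc k)) (\<lambda>i. coset_class F (Suc k) (g i)) I = coset_class F (Suc k) w \<and>
    finprod (gr_part M (Suc k)) (\<lambda>i. coset_class M (Suc k) (proj (g i))) I = coset_class M (Suc k) (proj w) \<and>
    (\<forall>j. fox_deriv w j $ k = (\<Sum>i\<in>I. fox_deriv (g i) j $ k))"
  using assms
proof (induction I rule: finite_induct)
  case empty
  interpret A: comm_group "gr_part F (Suc k)" by (rule F.gr_part_comm_group) simp
  interpret B: comm_group "gr_part M (Suc k)" by (rule M.gr_part_comm_group) simp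
  show ?case by (rule bexI[of _ "\<one>\<^bsub>F\<^esub>"]) (simp_all add: F.one_gr_part M.one_gr_part)
next
  case (insert i I)
  interpret A: comm_group "gr_part F (Suc k)" by (rule F.gr_part_comm_group) simp
  interpret B: comm_group "gr_part M (Suc k)" by (rule M.gr_part_comm_group) simp
  obtain w where w: "w \<in> lower_central F (Suc k)"
    "finprod (gr_part F (Suc k)) (\<lambda>i. coset_class F (Suc k) (g i)) I = coset_class F (Suc k) w"
    "finprod (gr_part M (Suc k)) (\<lambda>i. coset_class M (Suc k) (proj (g i))) I = coset_class M (Suc k) (proj w)"
    "\<forall>j. fox_deriv w j $ k = (\<Sum>i\<in>I. fox_deriv (g i) j $ k)"
    using insert by blast
  have g: "g i \<in> lower_central F (Suc k)" "\<And>i. i \<in> I \<Longrightarrow> g i \<in> lower_central F (Suc k)"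
    using insert by auto
  have c: "g i \<in> carrier F" "w \<in> carrier F" using g w F.lower_central_in_carrier by blast+
  have "finprod (gr_part F (Suc k)) (\<lambda>i. coset_class F (Suc k) (g i)) (insert i I) =
      coset_class F (Suc k) (g i \<otimes>\<^bsub>F\<^esub> w)"
    using insert.hyps g w by (subst A.finprod_insert) (auto simp: F.carrier_gr_part F.mult_gr_part)
  moreover have "finprod (gr_part M (Suc k)) (\<lambda>i. coset_class M (Suc k) (proj (g i))) (insert i I) =
      coset_class M (Suc k) (proj (g i \<otimes>\<^bsub>F\<^esub> w))"
    using insert.hyps g w c
    by (subst B.finprod_insert) (auto simp: M.carrier_gr_part M.mult_gr_part proj_lower_central_mem)
  moreover have "fox_deriv (g i \<otimes>\<^bsub>F\<^esub> w) j $ k = (\<Sum>i\<in>insert i I. fox_deriv (g i) j $ k)" for j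
    using insert.hyps w fox_lead_mult[OF w(1)] by simp
  ultimately show ?case using g(1) w(1) by (intro bexI[of _ "g i \<otimes>\<^bsub>F\<^esub> w"]) auto
qed

lemma represents_bracket:
  assumes st: "s \<in> lie_terms S" "t \<in> lie_terms S"
    and ws: "\<And>k. 1 \<le> k \<Longrightarrow> represents k s (ws k)" and wt: "\<And>k. 1 \<le> k \<Longrightarrow> represents k t (wt k)"
    and k: "1 \<le> k"
  shows "\<exists>w. represents k (Bracket s t) w"
proof (cases "k = 1")
  case True
  have "represents k (Bracket s t) \<one>\<^bsub>F\<^esub>"
    using F.gr_mult_nth_1[of "evF s" "evF t"] M.gr_mult_nth_1[of "evM s" "evM t"]
    by (simp add: represents_def True F.one_gr_part M.one_gr_part)
  then show ?thesis by blast
next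
  case False
  then obtain l where l: "k = Suc (Suc l)" using k by (metis One_nat_def Suc_le_D not_less_eq_eq Suc_leI le_neq_implies_less)
  have lc: "ws i \<in> lower_central F i" "wt i \<in> lower_central F i" if "1 \<le> i" for i
    using ws[OF that] wt[OF that] by (auto simp: represents_def)
  have lcM: "proj (ws i) \<in> lower_central M i" "proj (wt i) \<in> lower_central M i" if "1 \<le> i" for i
    using lc[OF that] proj_lower_central_mem by auto
  define g where "g i = commutator F (ws i) (wt (k - i))" for i
  have ik: "1 \<le> i" "1 \<le> k - i" "i + (k - i) = k" if "i \<in> {1..<k}" for i using that by auto
  have g: "g i \<in> lower_central F k" if "i \<in> {1..<k}" for i
    using F.commutator_lower_central[OF ik(1,2)[OF that] lc(1)[OF ik(1)[OF that]] lc(2)[OF ik(2)[OF that]]]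
      ik(3)[OF that] by (simp add: g_def)
  have eqF: "gr_bracket F i (k - i) (evF s i) (evF t (k - i)) = coset_class F k (g i)" if i: "i \<in> {1..<k}" for i
    using F.gr_bracket_coset_class[OF ik(1,2)[OF i] lc(1)[OF ik(1)[OF i]] lc(2)[OF ik(2)[OF i]]]
      ws[OF ik(1)[OF i]] wt[OF ik(2)[OF i]] ik(3)[OF i] by (simp add: represents_def g_def)
  have eqM: "gr_bracket M i (k - i) (evM s i) (evM t (k - i)) = coset_class M k (proj (g i))" if i: "i \<in> {1..<k}" for i
    using M.gr_bracket_coset_class[OF ik(1,2)[OF i] lcM(1)[OF ik(1)[OF i]] lcM(2)[OF ik(2)[OF i]]]
      ws[OF ik(1)[OF i]] wt[OF ik(2)[OF i]] ik(3)[OF i]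
      group_hom_commutator[OF proj.group_hom_axioms F.lower_central_in_carrier[OF lc(1)[OF ik(1)[OF i]]]
        F.lower_central_in_carrier[OF lc(2)[OF ik(2)[OF i]]]]
    by (simp add: represents_def g_def)
  obtain w where w: "w \<in> lower_central F k"
    "finprod (gr_part F k) (\<lambda>i. coset_class F k (g i)) {1..<k} = coset_class F k w"
    "finprod (gr_part M k) (\<lambda>i. coset_class M k (proj (g i))) {1..<k} = coset_class M k (proj w)"
    "\<And>j. fox_deriv w j $ (Suc l) = (\<Sum>i\<in>{1..<k}. fox_deriv (g i) j $ (Suc l))"
    using finprod_lift[of "{1..<k}" g "Suc l"] g l by auto
  interpret A: comm_group "gr_part F k" by (rule F.gr_part_comm_group[OF k])
  interpret B: comm_group "gr_part M k" by (rule M.gr_part_comm_group[OF k])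
  have "finprod (gr_part F k) (\<lambda>i. gr_bracket F i (k - i) (evF s i) (evF t (k - i))) {1..<k} = coset_class F k w"
    unfolding w(2)[symmetric] by (rule A.finprod_cong'[OF HOL.refl _ eqF]) (use g in \<open>auto simp: F.carrier_gr_part\<close>)
  then have 1: "evF (Bracket s t) k = coset_class F k w"
    using k by (simp add: F.gr_mult)
  have "finprod (gr_part M k) (\<lambda>i. gr_bracket M i (k - i) (evM s i) (evM t (k - i))) {1..<k} = coset_class M k (proj w)"
    unfolding w(3)[symmetric]
    by (rule B.finprod_cong'[OF HOL.refl _ eqM]) (use g proj_lower_central_mem in \<open>auto simp: M.carrier_gr_part\<close>)
  then have 2: "evM (Bracket s t) k = coset_class M k (proj w)"
    using k by (simp add: M.gr_mult)
  \<comment> \<open>A commutator has a nonzero leading vector only if one entry has degree one, so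
    only i = 1 and i = k - 1 count. For k = 2 these coincide and both terms are present.\<close>
  have lead: "fox_deriv (g i) j $ (Suc l) =
      (if i = 1 then fox_lin s * coeff (fox_vec t j) l else 0) -
      (if i = k - 1 then fox_lin t * coeff (fox_vec s j) l else 0)" if i: "i \<in> {1..<k}" for i j
  proof -
    obtain a where a: "i = Suc a" using ik(1)[OF i] by (cases i) auto
    obtain b where b: "k - i = Suc b" using ik(2)[OF i] by (cases "k - i") auto
    have ab: "a + b = l" using a b l i by auto
    have "fox_deriv (g i) j $ (Suc l) =
      fox_unit (ws i) $ 1 * fox_deriv (wt (k - i)) j $ b * of_bool (a = 0) -
      fox_unit (wt (k - i)) $ 1 * fox_deriv (ws i) j $ a * of_bool (b = 0)"
      using fox_lead_commutator[of "ws i" a "wt (k - i)" b j] lc(1)[OF ik(1)[OF i]] lc(2)[OF ik(2)[OF i]] a b ab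
      by (simp add: g_def)
    moreover have "fox_deriv (wt (k - i)) j $ b = coeff (fox_vec t j) b"
      using wt[OF ik(2)[OF i]] b by (simp add: represents_def)
    moreover have "fox_deriv (ws i) j $ a = coeff (fox_vec s j) a"
      using ws[OF ik(1)[OF i]] a by (simp add: represents_def)
    moreover have "a = 0 \<Longrightarrow> fox_unit (ws i) $ 1 = fox_lin s"
      using ws[OF ik(1)[OF i]] a by (simp add: represents_def)
    moreover have "b = 0 \<Longrightarrow> fox_unit (wt (k - i)) $ 1 = fox_lin t"
      using wt[OF ik(2)[OF i]] b by (simp add: represents_def)
    moreover have "i = 1 \<longleftrightarrow> a = 0" "i = k - 1 \<longleftrightarrow> b = 0" using a b l by auto
    ultimately show ?thesis using ab by auto
  qed
  have "fox_deriv w j $ (Suc l) = coeff (fox_vec (Bracket s t) j) (Suc l)" for j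
  proof -
    have "fox_deriv w j $ (Suc l) = (\<Sum>i\<in>{1..<k}. (if i = 1 then fox_lin s * coeff (fox_vec t j) l else 0) -
      (if i = k - 1 then fox_lin t * coeff (fox_vec s j) l else 0))"
      unfolding w(4) using lead by (intro sum.cong) auto
    also have "\<dots> = fox_lin s * coeff (fox_vec t j) l - fox_lin t * coeff (fox_vec s j) l"
      unfolding sum_subtractf using l by (subst (1 2) sum.delta) auto
    finally show ?thesis by simp
  qed
  then have "represents k (Bracket s t) w"
    using w(1) 1 2 l by (simp add: represents_def)
  then show ?thesis by blast
qed

text \<open>Stated for all degrees at once, because degree k of a bracket draws on all lower degrees
  of its two entries.\<close>

lemma ex_represents:
  assumes "t \<in> lie_terms S" "1 \<le> k"
  shows "\<exists>w. represents k t w"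
  using assms
proof (induction t arbitrary: k)
  case (Gen i)
  let ?w = "if k = 1 then free_gen i else \<one>\<^bsub>F\<^esub>"
  have "represents k (Gen i) ?w"
    using Gen by (auto simp: represents_def F.gr_class_nth M.gr_class_nth free_gen_def magnus_def free_group_simps(1))
  then show ?case by blast
next
  case Zero
  then have "represents k Zero \<one>\<^bsub>F\<^esub>"
    by (simp add: represents_def F.gr_zero M.gr_zero F.one_gr_part M.one_gr_part)
  then show ?case by blast
next
  case (Add s t)
  then obtain u v where uv: "represents k s u" "represents k t v" by fastforce
  then have lc: "u \<in> lower_central F k" "v \<in> lower_central F k" by (simp_all add: represents_def)
  then have c: "u \<in> carrier F" "v \<in> carrier F" using F.lower_central_in_carrier by blast+
  have "represents k (Add s t) (u \<otimes>\<^bsub>F\<^esub> v)"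
    using uv lc c Add.prems F.gr_add_nth[of k u v "evF s" "evF t"]
      M.gr_add_nth[of k "proj u" "proj v" "evM s" "evM t"] proj_lower_central_mem
      fox_lead_mult[of v "k - 1" u] fox_unit_lead_mult[of u v]
    by (simp add: represents_def)
  then show ?case by blast
next
  case (Smult c t)
  then obtain u where u: "represents k t u" by fastforce
  then have lc: "u \<in> lower_central F k" by (simp add: represents_def)
  then have cu: "u \<in> carrier F" using F.lower_central_in_carrier by blast
  have t: "t \<in> lie_terms S" using Smult by simp
  have "represents k (Smult c t) (u [^]\<^bsub>F\<^esub> c)"
    using u lc cu Smult.prems F.gr_smult_nth[of "evF t" k c] M.gr_smult_nth[of "evM t" k c] t
      F.int_pow_gr_part[of k u c] M.int_pow_gr_part[of k "proj u" c] proj_lower_central_mem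
      fox_lead_int_pow[of u "k - 1" c] fox_unit_lead_int_pow[of u c] proj.hom_int_pow[of u c]
    by (simp add: represents_def coeff_smult)
  then show ?case by blast
next
  case (Bracket s t)
  obtain ws where ws: "\<And>k. 1 \<le> k \<Longrightarrow> represents k s (ws k)"
    using Bracket.IH(1) Bracket.prems by (metis lie_terms_simps(5))
  obtain wt where wt: "\<And>k. 1 \<le> k \<Longrightarrow> represents k t (wt k)"
    using Bracket.IH(2) Bracket.prems by (metis lie_terms_simps(5))
  show ?case using represents_bracket[OF _ _ ws wt Bracket.prems(2)] Bracket.prems by simp
qed

end

section \<open>Divisibility of polynomials, terms of the ideal, and the Fox vector of the
  relator\<close>

lemma mpoly_eq_sum_single:
  "p = (\<Sum>m\<in>Poly_Mapping.keys p. Poly_Mapping.single m (Poly_Mapping.lookup p m))" for p :: mpoly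
proof (rule poly_mapping_eqI)
  fix k
  have "(\<Sum>m\<in>Poly_Mapping.keys p. if m = k then Poly_Mapping.lookup p m else 0) = Poly_Mapping.lookup p k"
    by (simp add: in_keys_iff)
  then show "Poly_Mapping.lookup p k =
      Poly_Mapping.lookup (\<Sum>m\<in>Poly_Mapping.keys p. Poly_Mapping.single m (Poly_Mapping.lookup p m)) k"
    by (simp add: lookup_sum lookup_single when_def)
qed

lemma mpoly_induct [case_names zero single add]:
  fixes p :: mpoly
  assumes "P 0" "\<And>m c. P (Poly_Mapping.single m c)" "\<And>p q. P p \<Longrightarrow> P q \<Longrightarrow> P (p + q)"
  shows "P p"
proof -
  have "finite K \<Longrightarrow> P (\<Sum>m\<in>K. Poly_Mapping.single m (Poly_Mapping.lookup p m))" for K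
    by (induction K rule: finite_induct) (auto intro: assms)
  then show ?thesis by (metis finite_keys mpoly_eq_sum_single)
qed

lemma of_int_dvd_mpoly_iff: "of_int p dvd (q :: mpoly) \<longleftrightarrow> (\<forall>m. p dvd Poly_Mapping.lookup q m)"
proof
  assume "of_int p dvd q"
  then show "\<forall>m. p dvd Poly_Mapping.lookup q m" by (auto simp: lookup_of_int_mult elim!: dvdE)
next
  assume p: "\<forall>m. p dvd Poly_Mapping.lookup q m"
  have "q = of_int p * Poly_Mapping.map (\<lambda>c. c div p) q"
  proof (rule poly_mapping_eqI)
    fix k
    show "Poly_Mapping.lookup q k = Poly_Mapping.lookup (of_int p * Poly_Mapping.map (\<lambda>c. c div p) q) k"
      using p by (simp add: lookup_of_int_mult Poly_Mapping.map.rep_eq when_def)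
  qed
  then show "of_int p dvd q" by (rule dvdI)
qed

lemma lie_cong_mono: "lie_cong S E s t \<Longrightarrow> E \<subseteq> E' \<Longrightarrow> lie_cong S E' s t"
  by (induction rule: lie_cong.induct) (auto intro: lie_cong.intros)

text \<open>The ideal of t0 at the level of terms, with brackets by arbitrary letters; retraction to
  S sends it into \<open>alg_ideal L {cls t0}\<close>.\<close>

inductive_set ideal_terms :: "(int, nat) lie_term \<Rightarrow> (int, nat) lie_term set" for t0 where
  base: "t0 \<in> ideal_terms t0"
| zero: "Zero \<in> ideal_terms t0"
| add: "s \<in> ideal_terms t0 \<Longrightarrow> t \<in> ideal_terms t0 \<Longrightarrow> Add s t \<in> ideal_terms t0"
| smult: "s \<in> ideal_terms t0 \<Longrightarrow> Smult c s \<in> ideal_terms t0"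
| bracket: "s \<in> ideal_terms t0 \<Longrightarrow> Bracket u s \<in> ideal_terms t0"

text \<open>The bound is uniform in j, so that the components can be summed over a common range of
  degrees with one multiplier for all j.\<close>

lemma degree_fox_vec: "\<exists>N. \<forall>j. degree (fox_vec t j) \<le> N"
proof (induction t)
  case (Add s t)
  then obtain M N where "\<forall>j. degree (fox_vec s j) \<le> M" "\<forall>j. degree (fox_vec t j) \<le> N" by blast
  then have "degree (fox_vec s j) \<le> max M N" "degree (fox_vec t j) \<le> max M N" for j
    by (auto simp: le_max_iff_disj)
  then have "\<forall>j. degree (fox_vec (Add s t) j) \<le> max M N"
    by (auto intro: degree_add_le)
  then show ?case by blast
next
  case (Bracket s t)
  then obtain M N where MN: "\<forall>j. degree (fox_vec s j) \<le> M" "\<forall>j. degree (fox_vec t j) \<le> N" by blast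
  have "\<forall>j. degree (fox_vec (Bracket s t) j) \<le> Suc (max M N)"
  proof
    fix j
    have "degree (smult (fox_lin s) (fox_vec t j) - smult (fox_lin t) (fox_vec s j)) \<le> max M N"
      using MN by (intro degree_diff_le)
        (meson degree_smult_le le_max_iff_disj order_trans)+
    then show "degree (fox_vec (Bracket s t) j) \<le> Suc (max M N)"
      by (simp only: fox_vec.simps) (meson degree_pCons_le le_trans Suc_le_mono)
  qed
  then show ?case by blast
qed (auto intro: order_trans[OF degree_smult_le])

lemma fm_val_abs: "fm_val (abs_free_metab t) j = poly (fox_vec t j) 1"
  by (simp add: fm_val.abs_eq)

context fox
begin

text \<open>Gamma_(k+2) has no coefficient at X^k, so the leading vector depends only on the class
  in gr F.\<close>

lemma fox_lead_cong:
  assumes "u \<in> lower_central F (Suc k)" "v \<in> lower_central F (Suc k)"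
    "coset_class F (Suc k) u = coset_class F (Suc k) v"
  shows "fox_deriv u j $ k = fox_deriv v j $ k"
proof -
  have c: "u \<in> carrier F" "v \<in> carrier F" using assms F.lower_central_in_carrier by blast+
  have "u \<otimes>\<^bsub>F\<^esub> inv\<^bsub>F\<^esub> v \<in> lower_central F (Suc (Suc k))"
    using assms c by (simp add: F.coset_class_eq_iff)
  then have "fox_deriv (u \<otimes>\<^bsub>F\<^esub> inv\<^bsub>F\<^esub> v) j $ k = 0"
    using vanishes_fox_deriv[of _ "Suc k"] by (auto simp: vanishes_def)
  then show ?thesis
    using fox_lead_mult[of "inv\<^bsub>F\<^esub> v" k u j] fox_lead_inv[OF assms(2)] assms(2) by simp
qed

end

context metab_presentation
begin

text \<open>A term with trivial degree k part in gr F is represented by a word of Gamma_(k+1). Such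
  a word has zero Fox coefficient in that degree, and its image in M is equally deep.\<close>

lemma represents_one:
  assumes "represents k t w" "1 \<le> k" "evF t k = coset_class F k \<one>\<^bsub>F\<^esub>"
  shows "coeff (fox_vec t j) (k - 1) = 0" "k = 1 \<Longrightarrow> fox_lin t = 0" "evM t k = coset_class M k \<one>\<^bsub>M\<^esub>"
proof -
  have w: "w \<in> lower_central F k" "w \<in> carrier F"
    using assms F.lower_central_in_carrier by (auto simp: represents_def)
  have w': "w \<in> lower_central F (Suc k)"
    using assms F.coset_class_eq_one_iff[OF w(2), of k] by (simp add: represents_def)
  then show "coeff (fox_vec t j) (k - 1) = 0"
  proof -
    have "fox_deriv w j $ (k - 1) = 0"
      using assms(2) vanishes_fox_deriv[OF w', of j] by (simp add: vanishes_def)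
    then show ?thesis using assms(1) by (simp add: represents_def)
  qed
  show "fox_lin t = 0" if "k = 1"
    using assms fox_unit_lower_central[of w 0] w' that by (simp add: represents_def)
  show "evM t k = coset_class M k \<one>\<^bsub>M\<^esub>"
    using assms proj_lower_central_mem[OF w'] w by (simp add: represents_def M.coset_class_eq_one_iff)
qed

text \<open>The hypothesis on t0 concerns gr F; it is carried to the Fox vector and to gr M by
  comparing a word representing t0 in degree 2 with r, which agree modulo Gamma_3, while the other
  degrees are trivial.\<close>

lemma relator_term:
  "fox_lin t0 = 0" "fox_vec t0 j = [:0, rho j:]" "evM t0 = \<zero>\<^bsub>gr M\<^esub>"
proof -
  have r2: "r \<in> lower_central F (Suc (Suc 0))" "r \<in> carrier F"
    using relator F.lower_central_in_carrier by (auto simp: numeral_2_eq_2)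
  have other: "evF t0 k = coset_class F k \<one>\<^bsub>F\<^esub>" if "1 \<le> k" "k \<noteq> 2" for k
    using that by (simp add: t0(2) F.gr_class_nth)
  show "fox_lin t0 = 0"
    using ex_represents[OF t0(1), of 1] represents_one(2) other[of 1] by auto
  obtain w where w: "represents (Suc (Suc 0)) t0 w" using ex_represents[OF t0(1), of "Suc (Suc 0)"] by auto
  have w2: "w \<in> lower_central F (Suc (Suc 0))" "coset_class F (Suc (Suc 0)) w = coset_class F (Suc (Suc 0)) r"
    using w by (auto simp: represents_def t0(2) F.gr_class_nth numeral_2_eq_2)
  have c1: "coeff (fox_vec t0 j) 1 = rho j" for j
    using fox_lead_cong[OF w2(1) r2(1) w2(2), of j] w by (simp add: represents_def)
  have "coeff (fox_vec t0 j) k = coeff [:0, rho j:] k" for k j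
  proof (cases "k = 1")
    case False
    obtain v where "represents (Suc k) t0 v" using ex_represents[OF t0(1), of "Suc k"] by auto
    then have "coeff (fox_vec t0 j) (Suc k - 1) = 0"
      using represents_one(1)[of "Suc k" t0 v j] other[of "Suc k"] False by simp
    then show ?thesis using False by (auto simp: coeff_pCons split: nat.splits)
  qed (use c1 in simp)
  then show "fox_vec t0 j = [:0, rho j:]" by (simp add: poly_eq_iff)
  show "evM t0 = \<zero>\<^bsub>gr M\<^esub>"
  proof (rule M.gr_eqI)
    fix k :: nat assume k: "1 \<le> k"
    have "evM t0 k = coset_class M k \<one>\<^bsub>M\<^esub>"
    proof (cases "k = 2")
      case True
      have "w \<otimes>\<^bsub>F\<^esub> inv\<^bsub>F\<^esub> r \<in> lower_central F 3"
        using w2 r2 F.lower_central_in_carrier[OF w2(1)] by (simp add: F.coset_class_eq_iff numeral_3_eq_3)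
      then have "proj (w \<otimes>\<^bsub>F\<^esub> inv\<^bsub>F\<^esub> r) \<in> lower_central M 3" by (rule proj_lower_central_mem)
      then show ?thesis
        using True w relator r2 F.lower_central_in_carrier[OF w2(1)]
        by (simp add: represents_def M.coset_class_eq_one_iff numeral_2_eq_2 numeral_3_eq_3)
    next
      case False
      then show ?thesis using ex_represents[OF t0(1) k] represents_one(3) other k by auto
    qed
    then show "evM t0 k = \<zero>\<^bsub>gr M\<^esub> k" using k by (simp add: M.gr_zero M.one_gr_part)
  qed (use t0 in auto)
qed

section \<open>The quadratic part of L and divisibility of the relator\<close>

lemma L_ops:
  "carrier L = cls ` lie_terms S" "\<zero>\<^bsub>L\<^esub> = cls Zero"
  "s \<in> lie_terms S \<Longrightarrow> t \<in> lie_terms S \<Longrightarrow> cls s \<oplus>\<^bsub>L\<^esub> cls t = cls (Add s t)"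
  "s \<in> lie_terms S \<Longrightarrow> t \<in> lie_terms S \<Longrightarrow> cls s \<otimes>\<^bsub>L\<^esub> cls t = cls (Bracket s t)"
  "s \<in> lie_terms S \<Longrightarrow> c \<odot>\<^bsub>L\<^esub> cls s = cls (Smult c s)"
  by (simp_all add: free_lie_def presented_lie_ops)

lemma cls_closed [simp]: "t \<in> lie_terms S \<Longrightarrow> cls t \<in> carrier L"
  by (simp add: L_ops)

text \<open>A list of pairs, since a term fixes the order of its summands. The coefficients vary
  while the list stays the same, which makes the class linear in c.\<close>

primrec quadratic_term :: "(nat \<times> nat) list \<Rightarrow> (nat \<times> nat \<Rightarrow> int) \<Rightarrow> (int, nat) lie_term" where
  "quadratic_term [] c = Zero"
| "quadratic_term (p # ps) c =
    Add (Smult (c p) (Bracket (Gen (fst p)) (Gen (snd p)))) (quadratic_term ps c)"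

lemma quadratic_term_closed [simp]: "set ps \<subseteq> S \<times> S \<Longrightarrow> quadratic_term ps c \<in> lie_terms S"
  by (induction ps) auto

lemma cls_quadratic_Cons:
  assumes "fst p \<in> S" "snd p \<in> S" "set ps \<subseteq> S \<times> S"
  shows "cls (quadratic_term (p # ps) c) =
    c p \<odot>\<^bsub>L\<^esub> cls (Bracket (Gen (fst p)) (Gen (snd p))) \<oplus>\<^bsub>L\<^esub> cls (quadratic_term ps c)"
  using assms by (simp add: L_ops(3,5))

lemma cls_quadratic_add:
  "set ps \<subseteq> S \<times> S \<Longrightarrow> cls (quadratic_term ps c) \<oplus>\<^bsub>L\<^esub> cls (quadratic_term ps d) =
    cls (quadratic_term ps (\<lambda>p. c p + d p))"
proof (induction ps)
  case Nil
  have "cls Zero \<in> carrier L" by simp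
  then show ?case using L.M.l_zero[of "cls Zero"] by (simp add: L_ops(2) del: cls_closed)
next
  case (Cons p ps)
  let ?b = "cls (Bracket (Gen (fst p)) (Gen (snd p)))"
  have m: "fst p \<in> S" "snd p \<in> S" "set ps \<subseteq> S \<times> S" using Cons.prems by auto
  have cl: "?b \<in> carrier L" "cls (quadratic_term ps c) \<in> carrier L" "cls (quadratic_term ps d) \<in> carrier L"
    using m by simp_all
  have "cls (quadratic_term (p # ps) c) \<oplus>\<^bsub>L\<^esub> cls (quadratic_term (p # ps) d) =
    (c p \<odot>\<^bsub>L\<^esub> ?b \<oplus>\<^bsub>L\<^esub> d p \<odot>\<^bsub>L\<^esub> ?b) \<oplus>\<^bsub>L\<^esub> (cls (quadratic_term ps c) \<oplus>\<^bsub>L\<^esub> cls (quadratic_term ps d))"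
    unfolding cls_quadratic_Cons[OF m] using cl by (simp add: L.M.a_ac)
  also have "\<dots> = cls (quadratic_term (p # ps) (\<lambda>p. c p + d p))"
    unfolding cls_quadratic_Cons[OF m] using cl Cons.IH[OF m(3)] by (simp add: L.type_smult_simps)
  finally show ?case .
qed

lemma cls_quadratic_smult:
  "set ps \<subseteq> S \<times> S \<Longrightarrow> a \<odot>\<^bsub>L\<^esub> cls (quadratic_term ps c) = cls (quadratic_term ps (\<lambda>p. a * c p))"
proof (induction ps)
  case Nil
  then show ?case using L.type_smult_zero[of a] by (simp add: L_ops(2))
next
  case (Cons p ps)
  let ?b = "cls (Bracket (Gen (fst p)) (Gen (snd p)))"
  have m: "fst p \<in> S" "snd p \<in> S" "set ps \<subseteq> S \<times> S" using Cons.prems by auto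
  have cl: "?b \<in> carrier L" "cls (quadratic_term ps c) \<in> carrier L" using m by simp_all
  then show ?case
    unfolding cls_quadratic_Cons[OF m] using Cons.IH[OF m(3)] by (simp add: L.type_smult_simps)
qed

lemma cls_quadratic_single:
  "set ps \<subseteq> S \<times> S \<Longrightarrow> distinct ps \<Longrightarrow> cls (quadratic_term ps (\<lambda>p. if p = q then a else 0)) =
    (if q \<in> set ps then a \<odot>\<^bsub>L\<^esub> cls (Bracket (Gen (fst q)) (Gen (snd q))) else \<zero>\<^bsub>L\<^esub>)"
proof (induction ps)
  case (Cons p ps)
  let ?b = "cls (Bracket (Gen (fst p)) (Gen (snd p)))"
  have m: "fst p \<in> S" "snd p \<in> S" "set ps \<subseteq> S \<times> S" using Cons.prems by auto
  have cl: "?b \<in> carrier L" using m by simp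
  show ?case
  proof (cases "p = q")
    case True
    then show ?thesis
      unfolding cls_quadratic_Cons[OF m] using cl Cons.IH[OF m(3)] Cons.prems by simp
  next
    case False
    have "(if q \<in> set ps then a \<odot>\<^bsub>L\<^esub> cls (Bracket (Gen (fst q)) (Gen (snd q))) else \<zero>\<^bsub>L\<^esub>) \<in> carrier L"
      using m by auto
    then show ?thesis
      unfolding cls_quadratic_Cons[OF m] using cl Cons.IH[OF m(3)] Cons.prems False by auto
  qed
qed (simp add: L_ops(2))

text \<open>[y_i, y_j] has Fox components - y_j at i and y_i at j. With j < i, only the former has a
  variable below its component index, so c can be read off.\<close>

lemma lookup_quadratic:
  "b < a \<Longrightarrow> \<forall>(i, j)\<in>set ps. j < i \<Longrightarrow> distinct ps \<Longrightarrow>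
    Poly_Mapping.lookup (poly (fox_vec (quadratic_term ps c) a) 1) {#b#} =
      (if (a, b) \<in> set ps then - c (a, b) else 0)"
  by (induction ps)
    (auto simp: lookup_add lookup_of_int_mult lookup_minus mvar_def lookup_single when_def)

text \<open>Antisymmetry and the alternating law reduce every bracket of two generators to the pairs
  with j < i. Positivity of bracket lengths splits 2 as 1 + 1.\<close>

lemma length_two_quadratic:
  assumes ps: "set ps = {(i, j). i \<in> S \<and> j \<in> S \<and> j < i}" "distinct ps"
    and x: "x \<in> length_part L ((\<lambda>i. cls (Gen i)) ` S) 2"
  shows "\<exists>c. x = cls (quadratic_term ps c)"
proof -
  let ?Y = "(\<lambda>i. cls (Gen i)) ` S"
  have sub: "set ps \<subseteq> S \<times> S" using ps by auto
  define H where "H = {cls (quadratic_term ps c) | c. True}"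
  have zero: "\<zero>\<^bsub>L\<^esub> = cls (quadratic_term ps (\<lambda>_. 0))"
    using cls_quadratic_smult[OF sub, of 0 "\<lambda>_. 0"] L.type_zero_smult[of "cls (quadratic_term ps (\<lambda>_. 0))"] sub
    by simp
  have H: "submodule H ring_of_type_algebra L"
  proof (rule L.type_submoduleI)
    show "H \<subseteq> carrier L" using sub by (auto simp: H_def)
    show "\<zero>\<^bsub>L\<^esub> \<in> H" using zero by (auto simp: H_def)
    show "a \<oplus>\<^bsub>L\<^esub> b \<in> H" if "a \<in> H" "b \<in> H" for a b
      using that cls_quadratic_add[OF sub] by (auto simp: H_def)
    show "k \<odot>\<^bsub>L\<^esub> a \<in> H" if "a \<in> H" for k a
      using that cls_quadratic_smult[OF sub] by (auto simp: H_def)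
  qed
  have one: "a \<in> ?Y" if "(1, a) \<in> monomials L ?Y" for a
    using that
  proof cases
    case (mult i a j b)
    then have "1 \<le> i" "1 \<le> j"
      using L.monomials_lie_eval[of _ _ "\<lambda>i. cls (Gen i)" S] by blast+
    then show ?thesis using mult by simp
  qed auto
  have single: "a \<odot>\<^bsub>L\<^esub> cls (Bracket (Gen i) (Gen j)) \<in> H" if "i \<in> S" "j \<in> S" "j < i" for i j a
    unfolding H_def using cls_quadratic_single[OF sub ps(2), of "(i, j)" a] that ps(1)
    by (auto intro!: exI[of _ "\<lambda>p. if p = (i, j) then a else 0"])
  have "a \<in> H" if "(2, a) \<in> monomials L ?Y" for a
    using that
  proof cases
    case (mult i a' j b')
    then have "1 \<le> i" "1 \<le> j"
      using L.monomials_lie_eval[of _ _ "\<lambda>i. cls (Gen i)" S] by blast+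
    then have "i = 1" "j = 1" using mult by auto
    then obtain k l where kl: "k \<in> S" "l \<in> S" "a' = cls (Gen k)" "b' = cls (Gen l)" using one mult by blast
    have a: "a = cls (Gen k) \<otimes>\<^bsub>L\<^esub> cls (Gen l)" using mult kl by simp
    consider "l < k" | "k = l" | "k < l" by linarith
    then show ?thesis
    proof cases
      case 1
      have "1 \<odot>\<^bsub>L\<^esub> a \<in> H" using single[OF kl(1,2) 1, of 1] kl a by (simp add: L_ops(4))
      then show ?thesis using a kl L.type_smult_simps(1)[of a] by simp
    next
      case 2
      then have "a = \<zero>\<^bsub>L\<^esub>" using a kl L.bracket_alternating[of "cls (Gen k)"] by simp
      then show ?thesis using L.type_submoduleD(2)[OF H] by simp
    next
      case 3
      have "a = \<ominus>\<^bsub>L\<^esub> (cls (Gen l) \<otimes>\<^bsub>L\<^esub> cls (Gen k))"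
        unfolding a using kl by (intro L.bracket_swap) auto
      also have "\<dots> = (- 1) \<odot>\<^bsub>L\<^esub> cls (Bracket (Gen l) (Gen k))"
        using kl L.type_minus_smult[of "cls (Bracket (Gen l) (Gen k))"] by (simp add: L_ops(4))
      finally show ?thesis using single[OF kl(2,1) 3] by simp
    qed
  qed auto
  then have "length_part L ?Y 2 \<subseteq> H"
    unfolding length_part_def by (intro L.lin_span_least H) blast
  then show ?thesis using x by (auto simp: H_def)
qed

text \<open>The contrapositive turns the hypothesis on the class of r modulo p into primitivity of
  \<open>rho\<close>: the coefficients on the brackets of generators are, up to sign, coefficients
  of \<open>rho\<close>.\<close>

lemma relator_divisible:
  assumes S: "finite S" and len: "cls t0 \<in> length_part L ((\<lambda>i. cls (Gen i)) ` S) 2"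
    and dvd: "\<And>j. of_nat p dvd rho j"
  shows "cls t0 \<in> (\<lambda>u. int p \<odot>\<^bsub>L\<^esub> u) ` length_part L ((\<lambda>i. cls (Gen i)) ` S) 2"
proof -
  let ?Y = "(\<lambda>i. cls (Gen i)) ` S"
  have "finite {(i, j). i \<in> S \<and> j \<in> S \<and> j < i}"
    by (rule finite_subset[of _ "S \<times> S"]) (use S in auto)
  then obtain ps where ps: "set ps = {(i, j). i \<in> S \<and> j \<in> S \<and> j < i}" "distinct ps"
    using finite_distinct_list by blast
  have sub: "set ps \<subseteq> S \<times> S" using ps by auto
  obtain c where c: "cls t0 = cls (quadratic_term ps c)" using length_two_quadratic[OF ps len] by blast
  then have "lie_cong S {} t0 (quadratic_term ps c)" using t0(1) by (simp add: lie_class_eq_iff)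
  then have "lie_cong S metab t0 (quadratic_term ps c)" by (rule lie_cong_mono) simp
  then have vec: "fox_vec (quadratic_term ps c) j = [:0, rho j:]" for j
    using fox_cong relator_term(2)[of j] by metis
  have "int p dvd c (a, b)" if ab: "(a, b) \<in> set ps" for a b
  proof -
    have ba: "b < a" "\<forall>(i, j)\<in>set ps. j < i" using ps ab by auto
    have "int p dvd Poly_Mapping.lookup (rho a) {#b#}"
      using dvd[of a] of_int_dvd_mpoly_iff[of "int p" "rho a"] by simp
    moreover have "Poly_Mapping.lookup (rho a) {#b#} = - c (a, b)"
      using lookup_quadratic[OF ba ps(2), of c] ab by (simp add: vec)
    ultimately show ?thesis by simp
  qed
  then have eq: "int p * (c q div int p) = c q" if "q \<in> set ps" for q
    using that by (cases q) simp
  have "quadratic_term ps c = quadratic_term ps (\<lambda>q. int p * (c q div int p))"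
  proof -
    have "set qs \<subseteq> set ps \<Longrightarrow> quadratic_term qs c = quadratic_term qs (\<lambda>q. int p * (c q div int p))" for qs
      by (induction qs) (use eq in auto)
    then show ?thesis by blast
  qed
  then have "cls t0 = int p \<odot>\<^bsub>L\<^esub> cls (quadratic_term ps (\<lambda>q. c q div int p))"
    unfolding c using cls_quadratic_smult[OF sub] by simp
  moreover have "cls (quadratic_term ps d) \<in> length_part L ?Y 2" for d
  proof -
    have Y: "?Y \<subseteq> carrier L" by auto
    have "{a. (2, a) \<in> monomials L ?Y} \<subseteq> carrier L" using L.monomials_closed[OF _ Y] by blast
    then have D: "submodule (length_part L ?Y 2) ring_of_type_algebra L"
      unfolding length_part_def by (rule L.lin_span_submodule)
    have "set qs \<subseteq> S \<times> S \<Longrightarrow> cls (quadratic_term qs d) \<in> length_part L ?Y 2" for qs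
    proof (induction qs)
      case Nil
      then show ?case using L.type_submoduleD(2)[OF D] by (simp add: L_ops(2))
    next
      case (Cons q qs)
      have m: "fst q \<in> S" "snd q \<in> S" "set qs \<subseteq> S \<times> S" using Cons.prems by auto
      have "(1 + 1, cls (Gen (fst q)) \<otimes>\<^bsub>L\<^esub> cls (Gen (snd q))) \<in> monomials L ?Y"
        using m by (intro monomials.mult monomials.gen imageI)
      then have "cls (Bracket (Gen (fst q)) (Gen (snd q))) \<in> length_part L ?Y 2"
        using L.monomials_length_part m by (simp add: L_ops(4) numeral_2_eq_2)
      then show ?case
        unfolding cls_quadratic_Cons[OF m] using L.type_submoduleD(3,4)[OF D] Cons.IH[OF m(3)] by blast
    qed
    then show ?thesis using sub by blast
  qed
  ultimately show ?thesis by blast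
qed

end

locale primitive_presentation = metab_presentation S M proj r t0
  for S and M :: "'m monoid" and proj r t0 +
  assumes primitive: "\<And>p::nat. Factorial_Ring.prime p \<Longrightarrow> \<exists>j. \<not> of_nat p dvd fox_deriv r j $ 1"
begin

text \<open>The prime 2 stands for any prime: zero would be divisible by it.\<close>

lemma nonzero: "\<exists>j. rho j \<noteq> 0"
  using primitive[of 2] by (metis dvd_0_right two_is_prime_nat)

text \<open>Dividing g by a word h of the next term with the same image gives an element of the
  kernel without changing the leading vector. Its Fox vector is d times that of r, and the latter
  starts with \<open>rho\<close> in degree one, so c is the coefficient of d in degree k - 1. For k
  = 0 the subtraction truncates, and c = 0.\<close>

lemma lead_in_relator_ideal:
  assumes g: "g \<in> lower_central F (Suc k)" and pg: "proj g \<in> lower_central M (Suc (Suc k))"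
  shows "\<exists>c. (\<forall>j. fox_deriv g j $ k = c * rho j) \<and> homogeneous S (k - 1) c \<and> (k = 0 \<longrightarrow> c = 0)"
proof -
  obtain h where h: "h \<in> lower_central F (Suc (Suc k))" "proj h = proj g"
    using pg proj_lower_central by (metis imageE)
  have c: "g \<in> carrier F" "h \<in> carrier F" using g h F.lower_central_in_carrier by blast+
  have h': "h \<in> lower_central F (Suc k)" using h F.lower_central_Suc by blast
  let ?u = "g \<otimes>\<^bsub>F\<^esub> inv\<^bsub>F\<^esub> h"
  have u: "?u \<in> lower_central F (Suc k)" "?u \<in> carrier F" using g h' c by auto
  have "proj ?u = \<one>\<^bsub>M\<^esub>" using c h(2) by simp
  then obtain d where d: "graded S d" "\<And>j. fox_deriv ?u j = d * fox_deriv r j"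
    using proj_kernel[OF u(2)] by (auto simp: relator_kernel_def)
  have "fox_deriv h j $ k = 0" for j
    using vanishes_fox_deriv[OF h(1), of j] by (simp add: vanishes_def)
  then have lead: "fox_deriv g j $ k = (d * fox_deriv r j) $ k" for j
    using fox_lead_mult[of "inv\<^bsub>F\<^esub> h" k g j] h' fox_lead_inv[OF h', of j] d(2)[of j] by simp
  have vr: "vanishes (Suc 0) (fox_deriv r j)" for j
    using vanishes_fox_deriv[of r "Suc 0" j] relator by (simp add: numeral_2_eq_2)
  show ?thesis
  proof (cases k)
    case 0
    have "fox_deriv g j $ k = 0" for j using lead vr[of j] 0 by (simp add: vanishes_def)
    then show ?thesis by (intro exI[of _ 0]) simp
  next
    case (Suc l)
    obtain j where j: "rho j \<noteq> 0" using nonzero by blast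
    \<comment> \<open>If d starts in degree m < l, its product with the Fox vector of r has
      coefficient \<open>d $ m * rho j\<close> in degree m + 1, which is below the order k; a
      nonzero \<open>rho j\<close> can be cancelled.\<close>
    have "d $ m = 0" if "m < l" for m
      using that
    proof (induction m rule: less_induct)
      case (less m)
      then have "vanishes m d" by (auto simp: vanishes_def)
      then have "(d * fox_deriv r j) $ (m + Suc 0) = d $ m * rho j"
        using vanishes_mult(2)[OF _ vr] by simp
      moreover have "(d * fox_deriv r j) $ (m + Suc 0) = 0"
        using vanishes_fox_deriv[OF u(1), of j] less.prems Suc by (simp add: vanishes_def d(2))
      ultimately show ?case using j by simp
    qed
    then have "vanishes l d" by (auto simp: vanishes_def)
    then have "fox_deriv g j $ k = d $ l * rho j" for j
      using vanishes_mult(2)[OF _ vr] lead Suc by simp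
    then show ?thesis using d(1) Suc by (intro exI[of _ "d $ l"]) (auto simp: graded_def)
  qed
qed

section \<open>The kernel of L -> gr M\<close>

lemma evM_cong: "s \<in> lie_terms S \<Longrightarrow> cls s = cls t \<Longrightarrow> evM s = evM t"
  using grM.lie_eval_cong[OF _ gens_closed(2), of "{}" s t] by (simp add: lie_class_eq_iff)

lemma ideals:
  "L.lie_ideal (alg_ideal L {cls t0})" "L.lie_ideal (alg_derived L (carrier L))" "L.lie_ideal L''"
  using t0(1) by (auto intro!: L.alg_ideal_lie_ideal L.alg_derived_lie_ideal L.lie_ideal_carrier)

lemma alg_derived_incl: "a \<in> A \<Longrightarrow> b \<in> A \<Longrightarrow> a \<otimes>\<^bsub>L\<^esub> b \<in> alg_derived L A"
  unfolding alg_derived_def using L.lin_span_incl[of "{a \<otimes>\<^bsub>L\<^esub> b | a b. a \<in> A \<and> b \<in> A}"] by blast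

lemma metab_cong_mod:
  assumes "lie_cong S metab s t"
  shows "cls s \<ominus>\<^bsub>L\<^esub> cls t \<in> L''"
proof -
  have st: "s \<in> lie_terms S" "t \<in> lie_terms S" using lie_cong_terms[OF assms] by auto
  have ev: "lie_eval L (\<lambda>i. cls (Gen i)) t = cls t" if "t \<in> lie_terms S" for t
    unfolding free_lie_def by (rule lie_eval_presented[OF that])
  note I = L.lie_idealD[OF ideals(3)]
  have "lie_eval L (\<lambda>i. cls (Gen i)) s \<ominus>\<^bsub>L\<^esub> lie_eval L (\<lambda>i. cls (Gen i)) t \<in> L''"
  proof (rule L.lie_eval_cong_mod[OF assms _ ideals(3)])
    fix s t assume st: "(s, t) \<in> metab" "s \<in> lie_terms S" "t \<in> lie_terms S"
    then obtain a b c d where s: "s = Bracket (Bracket a b) (Bracket c d)" "t = Zero"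
      by (auto simp: metab_def)
    then have abcd: "a \<in> lie_terms S" "b \<in> lie_terms S" "c \<in> lie_terms S" "d \<in> lie_terms S"
      using st by auto
    have "(cls a \<otimes>\<^bsub>L\<^esub> cls b) \<otimes>\<^bsub>L\<^esub> (cls c \<otimes>\<^bsub>L\<^esub> cls d) \<in> L''"
      using abcd by (intro alg_derived_incl) auto
    then have "(cls a \<otimes>\<^bsub>L\<^esub> cls b) \<otimes>\<^bsub>L\<^esub> (cls c \<otimes>\<^bsub>L\<^esub> cls d) \<ominus>\<^bsub>L\<^esub> \<zero>\<^bsub>L\<^esub> \<in> L''"
      unfolding a_minus_def by (rule I(3)) (rule I(5)[OF I(2)])
    then show "lie_eval L (\<lambda>i. cls (Gen i)) s \<ominus>\<^bsub>L\<^esub> lie_eval L (\<lambda>i. cls (Gen i)) t \<in> L''"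
      using abcd by (simp add: s ev)
  qed auto
  then show ?thesis using ev st by simp
qed

lemma ideal_terms_alg_ideal:
  assumes "z \<in> ideal_terms t0"
  shows "cls (retract_term S z) \<in> alg_ideal L {cls t0}"
  using assms
proof (induction rule: ideal_terms.induct)
  note I = L.lie_idealD[OF ideals(1)]
  {
    case base
    then show ?case using L.alg_ideal_incl[of "{cls t0}"] t0(1) by (simp add: retract_term_id)
  next
    case zero
    then show ?case using I(2) by (simp add: L_ops)
  next
    case (add s t)
    then show ?case using I(3)[OF add.IH] by (simp add: L_ops)
  next
    case (smult s c)
    then show ?case using I(4)[OF smult.IH, of c] by (simp add: L_ops)
  next
    case (bracket s u)
    then show ?case using I(6)[OF _ bracket.IH, of "cls (retract_term S u)"] by (simp add: L_ops)
  }
qed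

text \<open>Bracketing with y_k multiplies the Fox vector by y_k provided the linear part is zero;
  this is why \<open>fox_lin z = 0\<close> is carried through the induction.\<close>

lemma ex_ideal_term:
  "\<exists>z\<in>ideal_terms t0. fox_lin z = 0 \<and> (\<forall>j. poly (fox_vec z j) 1 = p * rho j)"
proof (induction p rule: mpoly_induct)
  case zero
  show ?case by (rule bexI[of _ Zero]) (auto intro: ideal_terms.zero)
next
  case (single m c)
  show ?case
  proof (induction m)
    case empty
    have "Poly_Mapping.single {#} c = (of_int c :: mpoly)"
      using single_of_int[where 'a = "nat multiset" and 'b = int, of c] by simp
    then show ?case
      using relator_term by (intro bexI[of _ "Smult c t0"]) (auto intro!: ideal_terms.intros)
  next
    case (add k m)
    then obtain z where "z \<in> ideal_terms t0" "fox_lin z = 0"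
      "\<forall>j. poly (fox_vec z j) 1 = Poly_Mapping.single m c * rho j" by blast
    moreover have "Poly_Mapping.single (add_mset k m) c = mvar k * Poly_Mapping.single m c"
      by (simp add: mvar_def mult_single)
    ultimately show ?case
      by (intro bexI[of _ "Bracket (Gen k) z"]) (auto intro: ideal_terms.intros simp: mult.assoc)
  qed
next
  case (add p q)
  then obtain y z where "y \<in> ideal_terms t0" "fox_lin y = 0" "\<forall>j. poly (fox_vec y j) 1 = p * rho j"
    "z \<in> ideal_terms t0" "fox_lin z = 0" "\<forall>j. poly (fox_vec z j) 1 = q * rho j" by blast
  then show ?case
    by (intro bexI[of _ "Add y z"]) (auto intro: ideal_terms.intros simp: algebra_simps)
qed

lemma J_iff: "x \<in> J \<longleftrightarrow> (\<exists>a\<in>alg_ideal L {cls t0}. \<exists>b\<in>L''. x = a \<oplus>\<^bsub>L\<^esub> b)"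
  by (auto simp: set_add_defs)

text \<open>Some z in the ideal of t0 has the same Fox vector, so t and z agree in the free
  metabelian ring by \<open>fm_eqI\<close>. Retracted to S, they differ by an element of
  L''.\<close>

lemma cls_in_J:
  assumes t: "t \<in> lie_terms S" and val: "\<And>j. poly (fox_vec t j) 1 = p * rho j"
  shows "cls t \<in> J"
proof -
  obtain z where z: "z \<in> ideal_terms t0" "\<And>j. poly (fox_vec z j) 1 = p * rho j"
    using ex_ideal_term by blast
  have "abs_free_metab t = abs_free_metab z"
  proof (rule fm_eqI)
    fix q show "fm_coord q (abs_free_metab t) = fm_coord q (abs_free_metab z)"
      using val z(2) by (simp add: fm_coord_def fm_val_abs split: prod.split)
  qed
  then have "lie_cong S metab (retract_term S t) (retract_term S z)"
    by (intro retract_term_cong) (simp add: abs_free_metab_eq_iff)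
  then have 1: "cls t \<ominus>\<^bsub>L\<^esub> cls (retract_term S z) \<in> L''"
    using metab_cong_mod t by (simp add: retract_term_id)
  have 2: "cls (retract_term S z) \<in> alg_ideal L {cls t0}"
    by (rule ideal_terms_alg_ideal[OF z(1)])
  have "cls t = cls (retract_term S z) \<oplus>\<^bsub>L\<^esub> (cls t \<ominus>\<^bsub>L\<^esub> cls (retract_term S z))"
    using t by (simp add: a_minus_def L.M.a_lcomm L.M.r_neg)
  then show ?thesis using 1 2 J_iff by blast
qed

definition ker_classes :: "(int, nat) lie_term set set" where
  "ker_classes = cls ` {t \<in> lie_terms S. evM t = \<zero>\<^bsub>gr M\<^esub>}"

lemma cls_image_iff:
  assumes "t \<in> lie_terms S"
  shows "cls t \<in> cls ` {t \<in> lie_terms S. P (evM t)} \<longleftrightarrow> P (evM t)"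
proof
  assume "cls t \<in> cls ` {t \<in> lie_terms S. P (evM t)}"
  then obtain s where "cls t = cls s" "P (evM s)" by blast
  then show "P (evM t)" using evM_cong[OF assms] by metis
qed (use assms in blast)

lemma ker_classes_iff: "t \<in> lie_terms S \<Longrightarrow> cls t \<in> ker_classes \<longleftrightarrow> evM t = \<zero>\<^bsub>gr M\<^esub>"
  unfolding ker_classes_def by (rule cls_image_iff)

lemma ker_classesE:
  assumes "a \<in> ker_classes"
  obtains t where "t \<in> lie_terms S" "a = cls t" "evM t = \<zero>\<^bsub>gr M\<^esub>"
  using assms by (auto simp: ker_classes_def)

lemma ker_classes_ideal: "L.lie_ideal ker_classes"
  unfolding L.lie_ideal_def
proof (intro conjI L.type_submoduleI ballI)
  show "ker_classes \<subseteq> carrier L" by (auto simp: ker_classes_def)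
  show "\<zero>\<^bsub>L\<^esub> \<in> ker_classes" by (simp add: L_ops ker_classes_iff)
  show "a \<oplus>\<^bsub>L\<^esub> b \<in> ker_classes" if ab: "a \<in> ker_classes" "b \<in> ker_classes" for a b
  proof -
    obtain s where s: "s \<in> lie_terms S" "a = cls s" "evM s = \<zero>\<^bsub>gr M\<^esub>" using ab(1) by (rule ker_classesE)
    obtain t where t: "t \<in> lie_terms S" "b = cls t" "evM t = \<zero>\<^bsub>gr M\<^esub>" using ab(2) by (rule ker_classesE)
    have "evM (Add s t) = \<zero>\<^bsub>gr M\<^esub>" using s t by simp
    then show ?thesis using s t ker_classes_iff[of "Add s t"] by (simp only: L_ops(3) lie_terms_simps)
  qed
  show "c \<odot>\<^bsub>L\<^esub> a \<in> ker_classes" if a: "a \<in> ker_classes" for c a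
  proof -
    obtain s where s: "s \<in> lie_terms S" "a = cls s" "evM s = \<zero>\<^bsub>gr M\<^esub>" using a by (rule ker_classesE)
    have "evM (Smult c s) = \<zero>\<^bsub>gr M\<^esub>" using s by simp
    then show ?thesis using s ker_classes_iff[of "Smult c s"] by (simp only: L_ops(5) lie_terms_simps)
  qed
  show "x \<otimes>\<^bsub>L\<^esub> u \<in> ker_classes" if x: "x \<in> carrier L" and u: "u \<in> ker_classes" for x u
  proof -
    obtain s where s: "s \<in> lie_terms S" "x = cls s" using x by (auto simp: L_ops)
    obtain t where t: "t \<in> lie_terms S" "u = cls t" "evM t = \<zero>\<^bsub>gr M\<^esub>" using u by (rule ker_classesE)
    have "evM (Bracket s t) = \<zero>\<^bsub>gr M\<^esub>" using s t by simp
    then show ?thesis using s t ker_classes_iff[of "Bracket s t"] by (simp only: L_ops(4) lie_terms_simps)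
  qed
qed

lemma second_derived_ker: "L'' \<subseteq> ker_classes"
proof -
  \<comment> \<open>Classes whose image in gr M has no degree one part. They contain L', and
    products of two of them die because M is metabelian.\<close>
  define D where "D = cls ` {t \<in> lie_terms S. evM t 1 = \<one>\<^bsub>gr_part M 1\<^esub>}"
  have D_iff: "cls t \<in> D \<longleftrightarrow> evM t 1 = \<one>\<^bsub>gr_part M 1\<^esub>" if "t \<in> lie_terms S" for t
    unfolding D_def by (rule cls_image_iff[OF that])
  have "alg_derived L (carrier L) \<subseteq> D"
    unfolding alg_derived_def
  proof (rule L.lin_span_least[OF L.type_submoduleI])
    interpret A: comm_group "gr_part M 1" by (rule M.gr_part_comm_group) simp
    show "D \<subseteq> carrier L" by (auto simp: D_def)
    show "\<zero>\<^bsub>L\<^esub> \<in> D" using D_iff[of Zero] by (simp add: L_ops M.gr_zero)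
    show "a \<oplus>\<^bsub>L\<^esub> b \<in> D" if ab: "a \<in> D" "b \<in> D" for a b
    proof -
      obtain s t where "s \<in> lie_terms S" "t \<in> lie_terms S" "a = cls s" "b = cls t"
          "evM s 1 = \<one>\<^bsub>gr_part M 1\<^esub>" "evM t 1 = \<one>\<^bsub>gr_part M 1\<^esub>"
        using ab unfolding D_def by blast
      moreover from this have "evM (Add s t) 1 = \<one>\<^bsub>gr_part M 1\<^esub>"
        using A.r_one[OF A.one_closed] by (simp add: M.gr_add del: A.r_one)
      ultimately show ?thesis using D_iff[of "Add s t"] by (simp only: L_ops(3) lie_terms_simps)
    qed
    show "c \<odot>\<^bsub>L\<^esub> a \<in> D" if a: "a \<in> D" for c a
    proof -
      obtain s where "s \<in> lie_terms S" "a = cls s" "evM s 1 = \<one>\<^bsub>gr_part M 1\<^esub>"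
        using a unfolding D_def by blast
      moreover from this have "evM (Smult c s) 1 = \<one>\<^bsub>gr_part M 1\<^esub>"
        using M.gr_smult_nth[OF evM_closed, of s 1 c] A.int_pow_one[of c] by (simp del: A.int_pow_one)
      ultimately show ?thesis using D_iff[of "Smult c s"] by (simp only: L_ops(5) lie_terms_simps)
    qed
    show "{a \<otimes>\<^bsub>L\<^esub> b | a b. a \<in> carrier L \<and> b \<in> carrier L} \<subseteq> D"
    proof clarify
      fix a b assume "a \<in> carrier L" "b \<in> carrier L"
      then obtain s t where "s \<in> lie_terms S" "t \<in> lie_terms S" "a = cls s" "b = cls t"
        by (auto simp: L_ops)
      then show "a \<otimes>\<^bsub>L\<^esub> b \<in> D"
        using D_iff[of "Bracket s t"] M.gr_mult_nth_1[of "evM s" "evM t"] by (simp add: L_ops)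
    qed
  qed
  then have "alg_derived L (alg_derived L (carrier L)) \<subseteq>
      lin_span L {a \<otimes>\<^bsub>L\<^esub> b | a b. a \<in> D \<and> b \<in> D}"
    unfolding alg_derived_def[of L "alg_derived L (carrier L)"] by (intro L.lin_span_mono) blast
  also have "\<dots> \<subseteq> ker_classes"
  proof (rule L.lin_span_least)
    show "submodule ker_classes ring_of_type_algebra L"
      using ker_classes_ideal by (simp add: L.lie_ideal_def)
    show "{a \<otimes>\<^bsub>L\<^esub> b | a b. a \<in> D \<and> b \<in> D} \<subseteq> ker_classes"
    proof clarify
      fix a b assume "a \<in> D" "b \<in> D"
      then obtain s t where st: "s \<in> lie_terms S" "t \<in> lie_terms S" "a = cls s" "b = cls t"
          "evM s 1 = \<one>\<^bsub>gr_part M 1\<^esub>" "evM t 1 = \<one>\<^bsub>gr_part M 1\<^esub>"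
        unfolding D_def by blast
      have "evM s \<otimes>\<^bsub>gr M\<^esub> evM t = \<zero>\<^bsub>gr M\<^esub>"
        using st by (intro M.gr_mult_metabelian metabelian) auto
      then show "a \<otimes>\<^bsub>L\<^esub> b \<in> ker_classes"
        using ker_classes_iff[of "Bracket s t"] st by (simp add: L_ops)
    qed
  qed
  finally show ?thesis .
qed

text \<open>J is exactly the kernel of L -> gr M. One inclusion holds since t0 and L'' die in gr M.
  For the other, triviality in each degree makes each coefficient of the Fox vector a multiple of
  \<open>rho\<close>.\<close>

lemma cls_in_J_iff:
  assumes t: "t \<in> lie_terms S"
  shows "cls t \<in> J \<longleftrightarrow> evM t = \<zero>\<^bsub>gr M\<^esub>"
proof
  assume "cls t \<in> J"
  then obtain a b where ab: "a \<in> alg_ideal L {cls t0}" "b \<in> L''" "cls t = a \<oplus>\<^bsub>L\<^esub> b"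
    using J_iff by blast
  have "alg_ideal L {cls t0} \<subseteq> ker_classes"
    using relator_term(3) ker_classes_iff t0(1) by (intro L.alg_ideal_least ker_classes_ideal) auto
  then have "cls t \<in> ker_classes"
    unfolding ab(3) using ab(1,2) second_derived_ker
    by (intro L.lie_idealD(3)[OF ker_classes_ideal]) blast+
  then show "evM t = \<zero>\<^bsub>gr M\<^esub>" using ker_classes_iff t by simp
next
  assume ev: "evM t = \<zero>\<^bsub>gr M\<^esub>"
  have "\<exists>c. \<forall>j. coeff (fox_vec t j) k = c * rho j" for k
  proof -
    obtain w where w: "represents (Suc k) t w" using ex_represents[OF t, of "Suc k"] by auto
    then have wc: "w \<in> lower_central F (Suc k)" by (simp add: represents_def)
    have "coset_class M (Suc k) (proj w) = coset_class M (Suc k) \<one>\<^bsub>M\<^esub>"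
      using w ev by (simp add: represents_def M.gr_zero M.one_gr_part)
    then have "proj w \<in> lower_central M (Suc (Suc k))"
      using F.lower_central_in_carrier[OF wc] by (simp add: M.coset_class_eq_one_iff)
    then show ?thesis
      using lead_in_relator_ideal[OF wc] w by (auto simp: represents_def)
  qed
  then obtain c where c: "\<And>k j. coeff (fox_vec t j) k = c k * rho j" by metis
  obtain N where N: "\<And>j. degree (fox_vec t j) \<le> N" using degree_fox_vec by blast
  \<comment> \<open>Setting X = 1 adds the multipliers of the separate degrees into one multiplier
    valid for all j.\<close>
  have "poly (fox_vec t j) 1 = (\<Sum>k\<le>N. c k) * rho j" for j
  proof -
    have "poly (fox_vec t j) 1 = (\<Sum>k\<le>N. coeff (fox_vec t j) k)"
      unfolding poly_altdef using N[of j] coeff_eq_0[of "fox_vec t j"]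
      by simp (intro sum.mono_neutral_left, auto)
    then show ?thesis by (simp add: c sum_distrib_right)
  qed
  then show "cls t \<in> J" by (rule cls_in_J[OF t])
qed

text \<open>The converse of \<open>lead_in_relator_ideal\<close>, by way of the Lie side: a term t
  for the class of g has Fox vector c \<open>rho\<close>, so its class is in J and t vanishes in gr
  M.\<close>

lemma proj_in_lower_central:
  assumes g: "g \<in> lower_central F (Suc k)" and lead: "\<And>j. fox_deriv g j $ k = c * rho j"
  shows "proj g \<in> lower_central M (Suc (Suc k))"
proof -
  have gc: "g \<in> carrier F" using g F.lower_central_in_carrier by blast
  have "gr_class F (Suc k) g \<in> evF ` lie_terms S"
    unfolding evF_surj using g by (intro F.gr_class_closed) auto
  then obtain t where t': "gr_class F (Suc k) g = evF t" "t \<in> lie_terms S" by (rule imageE)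
  note t = t'(2) t'(1)[symmetric]
  have coeff: "coeff (fox_vec t j) l = (if l = k then c * rho j else 0)" for j l
  proof -
    obtain w where w: "represents (Suc l) t w" using ex_represents[OF t(1), of "Suc l"] by auto
    show ?thesis
    proof (cases "l = k")
      case True
      then have "fox_deriv w j $ k = fox_deriv g j $ k"
        using w g t(2) by (intro fox_lead_cong) (auto simp: represents_def F.gr_class_nth)
      then show ?thesis using w lead True by (simp add: represents_def)
    next
      case False
      then show ?thesis using represents_one(1)[OF w] t(2) by (simp add: F.gr_class_nth)
    qed
  qed
  have "poly (fox_vec t j) 1 = c * rho j" for j
  proof -
    have "fox_vec t j = monom (c * rho j) k" by (rule poly_eqI) (simp add: coeff)
    then show ?thesis by (simp add: poly_monom)
  qed
  then have ev: "evM t = \<zero>\<^bsub>gr M\<^esub>" using cls_in_J[OF t(1)] cls_in_J_iff[OF t(1)] by blast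
  obtain w where w: "represents (Suc k) t w" using ex_represents[OF t(1), of "Suc k"] by auto
  have wc: "w \<in> lower_central F (Suc k)" "w \<in> carrier F"
    using w F.lower_central_in_carrier by (auto simp: represents_def)
  have "g \<otimes>\<^bsub>F\<^esub> inv\<^bsub>F\<^esub> w \<in> lower_central F (Suc (Suc k))"
    using w t(2) gc wc by (simp add: represents_def F.gr_class_nth F.coset_class_eq_iff)
  then have "proj (g \<otimes>\<^bsub>F\<^esub> inv\<^bsub>F\<^esub> w) \<in> lower_central M (Suc (Suc k))" by (rule proj_lower_central_mem)
  moreover have "coset_class M (Suc k) (proj w) = coset_class M (Suc k) \<one>\<^bsub>M\<^esub>"
    using w ev by (simp add: represents_def M.gr_zero M.one_gr_part)
  then have "proj w \<in> lower_central M (Suc (Suc k))"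
    using M.coset_class_eq_one_iff[of "proj w" "Suc k"] wc by simp
  ultimately have "proj (g \<otimes>\<^bsub>F\<^esub> inv\<^bsub>F\<^esub> w) \<otimes>\<^bsub>M\<^esub> proj w \<in> lower_central M (Suc (Suc k))" by simp
  then show ?thesis using gc wc by (simp add: M.m_assoc)
qed

end

section \<open>The graded isomorphism\<close>

lemma alg_quot_simps:
  "carrier (alg_quot A I) = a_rcosets\<^bsub>A\<^esub> I"
  "\<zero>\<^bsub>alg_quot A I\<^esub> = I"
  "x \<oplus>\<^bsub>alg_quot A I\<^esub> y = x <+>\<^bsub>A\<^esub> y"
  "x \<otimes>\<^bsub>alg_quot A I\<^esub> y = (\<Union>a\<in>x. \<Union>b\<in>y. I +>\<^bsub>A\<^esub> (a \<otimes>\<^bsub>A\<^esub> b))"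
  "c \<odot>\<^bsub>alg_quot A I\<^esub> y = (\<Union>b\<in>y. I +>\<^bsub>A\<^esub> (c \<odot>\<^bsub>A\<^esub> b))"
  by (simp_all add: alg_quot_def FactRing_def ring.defs module.defs rcoset_mult_def)

lemma alg_hom_length_part:
  assumes A: "lie_algebra A" and B: "lie_algebra B" and f: "f \<in> alg_hom A B" and Y: "Y \<subseteq> carrier A"
  shows "f ` length_part A Y k = length_part B (f ` Y) k"
proof
  interpret A: lie_algebra A by (rule A)
  interpret B: lie_algebra B by (rule B)
  have fc: "f x \<in> carrier B" if "x \<in> carrier A" for x using f that by (auto simp: alg_hom_def)
  have fadd: "f (x \<oplus>\<^bsub>A\<^esub> y) = f x \<oplus>\<^bsub>B\<^esub> f y" if "x \<in> carrier A" "y \<in> carrier A" for x y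
    using f that by (simp add: alg_hom_def)
  have fmult: "f (x \<otimes>\<^bsub>A\<^esub> y) = f x \<otimes>\<^bsub>B\<^esub> f y" if "x \<in> carrier A" "y \<in> carrier A" for x y
    using f that by (simp add: alg_hom_def)
  have fsmult: "f (c \<odot>\<^bsub>A\<^esub> x) = c \<odot>\<^bsub>B\<^esub> f x" if "x \<in> carrier A" for c x
    using f that by (simp add: alg_hom_def)
  have fzero: "f \<zero>\<^bsub>A\<^esub> = \<zero>\<^bsub>B\<^esub>"
    using fsmult[of "\<zero>\<^bsub>A\<^esub>" 0] fc[of "\<zero>\<^bsub>A\<^esub>"] by simp
  have YB: "f ` Y \<subseteq> carrier B" using Y fc by auto
  have mA: "{a. (k, a) \<in> monomials A Y} \<subseteq> carrier A" using A.monomials_closed Y by auto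
  have mB: "{b. (k, b) \<in> monomials B (f ` Y)} \<subseteq> carrier B" using B.monomials_closed YB by auto
  have subA: "submodule (length_part A Y k) ring_of_type_algebra A"
    unfolding length_part_def by (rule A.lin_span_submodule[OF mA])
  have subB: "submodule (length_part B (f ` Y) k) ring_of_type_algebra B"
    unfolding length_part_def by (rule B.lin_span_submodule[OF mB])
  have 1: "(k, f a) \<in> monomials B (f ` Y)" if "(k, a) \<in> monomials A Y" for k a
    using that
  proof (induction rule: monomials.induct)
    case (gen y)
    then show ?case by (intro monomials.gen imageI)
  next
    case (mult i a j b)
    then show ?case
      using fmult[OF A.monomials_closed[OF mult.hyps(1) Y] A.monomials_closed[OF mult.hyps(2) Y]]
        monomials.mult[OF mult.IH] by simp
  qed
  have 2: "\<exists>a. (k, a) \<in> monomials A Y \<and> b = f a" if "(k, b) \<in> monomials B (f ` Y)" for k b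
    using that
  proof (induction rule: monomials.induct)
    case (gen y)
    then obtain x where "x \<in> Y" "y = f x" by blast
    then show ?case using monomials.gen[of x Y A] by blast
  next
    case (mult i a j b)
    then obtain a' b' where "(i, a') \<in> monomials A Y" "(j, b') \<in> monomials A Y" "a = f a'" "b = f b'" by blast
    then show ?case
      using fmult A.monomials_closed[OF _ Y] monomials.mult[of i a' A Y j b'] by metis
  qed
  have "length_part A Y k \<subseteq> {x \<in> carrier A. f x \<in> length_part B (f ` Y) k}"
    unfolding length_part_def[of A]
  proof (rule A.lin_span_least[OF A.type_submoduleI])
    note D = B.type_submoduleD[OF subB]
    show "{a. (k, a) \<in> monomials A Y} \<subseteq> {x \<in> carrier A. f x \<in> length_part B (f ` Y) k}"
      using mA 1 B.monomials_length_part by blast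
  qed (use B.type_submoduleD[OF subB] in \<open>auto simp: fzero fadd fsmult\<close>)
  then show "f ` length_part A Y k \<subseteq> length_part B (f ` Y) k" by blast
  note D = A.type_submoduleD[OF subA]
  have Dc: "x \<in> carrier A" if "x \<in> length_part A Y k" for x using D(1) that by blast
  show "length_part B (f ` Y) k \<subseteq> f ` length_part A Y k"
    unfolding length_part_def[of B]
  proof (rule B.lin_span_least[OF B.type_submoduleI])
    show "f ` length_part A Y k \<subseteq> carrier B" using Dc fc by blast
    show "\<zero>\<^bsub>B\<^esub> \<in> f ` length_part A Y k" using fzero D(2) by (metis imageI)
    show "a \<oplus>\<^bsub>B\<^esub> b \<in> f ` length_part A Y k"
      if "a \<in> f ` length_part A Y k" "b \<in> f ` length_part A Y k" for a b
    proof -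
      obtain x y where "x \<in> length_part A Y k" "y \<in> length_part A Y k" "a = f x" "b = f y"
        using \<open>a \<in> f ` length_part A Y k\<close> \<open>b \<in> f ` length_part A Y k\<close> by blast
      then show ?thesis using fadd[OF Dc Dc, of x y] D(3) by (metis imageI)
    qed
    show "c \<odot>\<^bsub>B\<^esub> a \<in> f ` length_part A Y k" if "a \<in> f ` length_part A Y k" for c a
    proof -
      obtain x where "x \<in> length_part A Y k" "a = f x" using \<open>a \<in> f ` length_part A Y k\<close> by blast
      then show ?thesis using fsmult[OF Dc, of x c] D(4) by (metis imageI)
    qed
    show "{b. (k, b) \<in> monomials B (f ` Y)} \<subseteq> f ` length_part A Y k"
      using 2 A.monomials_length_part by blast
  qed
qed

context primitive_presentation
begin

abbreviation "Q \<equiv> alg_quot L J"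

text \<open>Since J is the kernel of the evaluation, its cosets are the fibres of
  \<open>evM\<close>. In this form the operations of L/J and the isomorphism can be read off from gr
  M.\<close>

definition fiber :: "(int, nat) lie_term \<Rightarrow> (int, nat) lie_term set set" where
  "fiber s = cls ` {t \<in> lie_terms S. evM t = evM s}"

lemma fiber_cong: "evM s = evM t \<Longrightarrow> fiber s = fiber t"
  by (simp add: fiber_def)

lemma cls_in_fiber: "t \<in> lie_terms S \<Longrightarrow> cls t \<in> fiber s \<longleftrightarrow> evM t = evM s"
  unfolding fiber_def by (rule cls_image_iff)

lemma fiber_eq_iff: "s \<in> lie_terms S \<Longrightarrow> fiber s = fiber t \<longleftrightarrow> evM s = evM t"
  using cls_in_fiber[of s s] cls_in_fiber[of s t] fiber_cong by metis

lemma fiberE: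
  assumes "a \<in> fiber s"
  obtains t where "t \<in> lie_terms S" "a = cls t" "evM t = evM s"
  using assms unfolding fiber_def by blast

lemma J_eq_fiber: "J = fiber Zero"
proof
  show "J \<subseteq> fiber Zero"
  proof
    fix x assume x: "x \<in> J"
    then obtain a b where "a \<in> alg_ideal L {cls t0}" "b \<in> L''" "x = a \<oplus>\<^bsub>L\<^esub> b" using J_iff by blast
    then have "x \<in> carrier L" using L.lie_idealD(1)[OF ideals(1)] L.lie_idealD(1)[OF ideals(3)] by blast
    then obtain t where "t \<in> lie_terms S" "x = cls t" unfolding L_ops by blast
    then show "x \<in> fiber Zero" using x cls_in_J_iff cls_in_fiber by simp
  qed
  show "fiber Zero \<subseteq> J"
  proof
    fix x assume "x \<in> fiber Zero"
    then obtain t where "t \<in> lie_terms S" "x = cls t" "evM t = evM Zero" by (rule fiberE)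
    then show "x \<in> J" using cls_in_J_iff by simp
  qed
qed

lemma cls_shift:
  assumes "s \<in> lie_terms S" "u \<in> lie_terms S"
  shows "cls u = cls (Add u (Smult (- 1) s)) \<oplus>\<^bsub>L\<^esub> cls s"
    "evM (Add u (Smult (- 1) s)) = evM u \<ominus>\<^bsub>gr M\<^esub> evM s"
proof -
  have "cls (Smult (- 1) s) = \<ominus>\<^bsub>L\<^esub> cls s"
    using L.type_minus_smult[of "cls s"] assms by (simp add: L_ops(5))
  then have "cls (Add u (Smult (- 1) s)) = cls u \<oplus>\<^bsub>L\<^esub> \<ominus>\<^bsub>L\<^esub> cls s"
    using assms L_ops(3)[of u "Smult (- 1) s"] by simp
  then show "cls u = cls (Add u (Smult (- 1) s)) \<oplus>\<^bsub>L\<^esub> cls s"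
    using assms cls_closed[of u] cls_closed[of s] by (simp add: L.M.a_assoc L.M.l_neg del: cls_closed)
  show "evM (Add u (Smult (- 1) s)) = evM u \<ominus>\<^bsub>gr M\<^esub> evM s"
    using assms grM.type_minus_smult[of "evM s"] by (simp add: a_minus_def)
qed

lemma fiber_add:
  assumes "s \<in> lie_terms S" "t \<in> lie_terms S"
  shows "fiber s <+>\<^bsub>L\<^esub> fiber t = fiber (Add s t)"
proof
  show "fiber s <+>\<^bsub>L\<^esub> fiber t \<subseteq> fiber (Add s t)"
  proof
    fix x assume "x \<in> fiber s <+>\<^bsub>L\<^esub> fiber t"
    then obtain a b where ab: "a \<in> fiber s" "b \<in> fiber t" "x = a \<oplus>\<^bsub>L\<^esub> b" by (auto simp: set_add_defs)
    obtain s' where s': "s' \<in> lie_terms S" "a = cls s'" "evM s' = evM s" using ab(1) by (rule fiberE)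
    obtain t' where t': "t' \<in> lie_terms S" "b = cls t'" "evM t' = evM t" using ab(2) by (rule fiberE)
    have "x = cls (Add s' t')" using ab s' t' by (simp add: L_ops(3))
    then show "x \<in> fiber (Add s t)" using cls_in_fiber[of "Add s' t'" "Add s t"] s' t' by simp
  qed
  show "fiber (Add s t) \<subseteq> fiber s <+>\<^bsub>L\<^esub> fiber t"
  proof
    fix x assume "x \<in> fiber (Add s t)"
    then obtain u where u: "u \<in> lie_terms S" "x = cls u" "evM u = evM (Add s t)" by (rule fiberE)
    have "evM (Add u (Smult (- 1) t)) = evM s"
      unfolding cls_shift(2)[OF assms(2) u(1)] u(3)
      using evM_closed[OF assms(1)] evM_closed[OF assms(2)]
      by (simp add: a_minus_def grM.M.a_assoc grM.M.r_neg del: evM_closed)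
    then have "cls (Add u (Smult (- 1) t)) \<in> fiber s"
      using cls_in_fiber[of "Add u (Smult (- 1) t)" s] u assms by simp
    moreover have "cls t \<in> fiber t" using cls_in_fiber assms by simp
    ultimately show "x \<in> fiber s <+>\<^bsub>L\<^esub> fiber t"
      unfolding u(2) set_add_defs by (subst cls_shift(1)[OF assms(2) u(1)]) auto
  qed
qed

lemma coset_J:
  assumes "s \<in> lie_terms S"
  shows "J +>\<^bsub>L\<^esub> cls s = fiber s"
proof
  show "J +>\<^bsub>L\<^esub> cls s \<subseteq> fiber s"
  proof
    fix x assume "x \<in> J +>\<^bsub>L\<^esub> cls s"
    then obtain a where a: "a \<in> fiber Zero" "x = a \<oplus>\<^bsub>L\<^esub> cls s"
      unfolding J_eq_fiber by (auto simp: a_r_coset_def')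
    then have "x \<in> fiber Zero <+>\<^bsub>L\<^esub> fiber s"
      using cls_in_fiber[OF assms, of s] by (auto simp: set_add_defs)
    then have "x \<in> fiber (Add Zero s)" using fiber_add[of Zero s] assms by simp
    moreover have "fiber (Add Zero s) = fiber s"
      using assms evM_closed[OF assms] by (intro fiber_cong) (simp del: evM_closed)
    ultimately show "x \<in> fiber s" by simp
  qed
  show "fiber s \<subseteq> J +>\<^bsub>L\<^esub> cls s"
  proof
    fix x assume "x \<in> fiber s"
    then obtain u where u: "u \<in> lie_terms S" "x = cls u" "evM u = evM s" by (rule fiberE)
    have "evM (Add u (Smult (- 1) s)) = evM Zero"
      unfolding cls_shift(2)[OF assms u(1)] u(3)
      using evM_closed[OF assms] by (simp add: a_minus_def grM.M.r_neg del: evM_closed)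
    then have "cls (Add u (Smult (- 1) s)) \<in> J"
      unfolding J_eq_fiber using cls_in_fiber[of "Add u (Smult (- 1) s)" Zero] u assms by simp
    then show "x \<in> J +>\<^bsub>L\<^esub> cls s"
      unfolding u(2) a_r_coset_def' using cls_shift(1)[OF assms u(1)] by blast
  qed
qed

lemma fiber_nonempty: "s \<in> lie_terms S \<Longrightarrow> fiber s \<noteq> {}"
  using cls_in_fiber by blast

lemma Q_ops:
  "carrier Q = fiber ` lie_terms S"
  "\<zero>\<^bsub>Q\<^esub> = fiber Zero"
  "s \<in> lie_terms S \<Longrightarrow> t \<in> lie_terms S \<Longrightarrow> fiber s \<oplus>\<^bsub>Q\<^esub> fiber t = fiber (Add s t)"
  "s \<in> lie_terms S \<Longrightarrow> t \<in> lie_terms S \<Longrightarrow> fiber s \<otimes>\<^bsub>Q\<^esub> fiber t = fiber (Bracket s t)"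
  "s \<in> lie_terms S \<Longrightarrow> c \<odot>\<^bsub>Q\<^esub> fiber s = fiber (Smult c s)"
proof -
  have "carrier Q = (\<lambda>s. J +>\<^bsub>L\<^esub> cls s) ` lie_terms S"
    unfolding alg_quot_simps A_RCOSETS_def' L_ops(1) by auto
  also have "\<dots> = fiber ` lie_terms S" using coset_J by (intro image_cong) auto
  finally show "carrier Q = fiber ` lie_terms S" .
  show "\<zero>\<^bsub>Q\<^esub> = fiber Zero" unfolding alg_quot_simps by (rule J_eq_fiber)
  show "fiber s \<oplus>\<^bsub>Q\<^esub> fiber t = fiber (Add s t)" if "s \<in> lie_terms S" "t \<in> lie_terms S"
    unfolding alg_quot_simps by (rule fiber_add[OF that])
  show "fiber s \<otimes>\<^bsub>Q\<^esub> fiber t = fiber (Bracket s t)" if st: "s \<in> lie_terms S" "t \<in> lie_terms S"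
  proof -
    have "J +>\<^bsub>L\<^esub> (a \<otimes>\<^bsub>L\<^esub> b) = fiber (Bracket s t)" if ab: "a \<in> fiber s" "b \<in> fiber t" for a b
    proof -
      obtain s' where s': "s' \<in> lie_terms S" "a = cls s'" "evM s' = evM s" using ab(1) by (rule fiberE)
      obtain t' where t': "t' \<in> lie_terms S" "b = cls t'" "evM t' = evM t" using ab(2) by (rule fiberE)
      have "J +>\<^bsub>L\<^esub> (a \<otimes>\<^bsub>L\<^esub> b) = fiber (Bracket s' t')"
        using s' t' coset_J[of "Bracket s' t'"] by (simp add: L_ops(4))
      also have "\<dots> = fiber (Bracket s t)" using s' t' by (intro fiber_cong) simp
      finally show ?thesis .
    qed
    then have "fiber s \<otimes>\<^bsub>Q\<^esub> fiber t = (\<Union>a\<in>fiber s. \<Union>b\<in>fiber t. fiber (Bracket s t))"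
      unfolding alg_quot_simps by (intro SUP_cong) simp_all
    then show ?thesis using fiber_nonempty st by simp
  qed
  show "c \<odot>\<^bsub>Q\<^esub> fiber s = fiber (Smult c s)" if s: "s \<in> lie_terms S"
  proof -
    have "J +>\<^bsub>L\<^esub> (c \<odot>\<^bsub>L\<^esub> a) = fiber (Smult c s)" if a: "a \<in> fiber s" for a
    proof -
      obtain s' where s': "s' \<in> lie_terms S" "a = cls s'" "evM s' = evM s" using a by (rule fiberE)
      have "J +>\<^bsub>L\<^esub> (c \<odot>\<^bsub>L\<^esub> a) = fiber (Smult c s')"
        using s' coset_J[of "Smult c s'"] by (simp add: L_ops(5))
      also have "\<dots> = fiber (Smult c s)" using s' by (intro fiber_cong) simp
      finally show ?thesis .
    qed
    then have "c \<odot>\<^bsub>Q\<^esub> fiber s = (\<Union>a\<in>fiber s. fiber (Smult c s))"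
      unfolding alg_quot_simps by (intro SUP_cong) simp_all
    then show ?thesis using fiber_nonempty s by simp
  qed
qed

text \<open>Equality of fibres is equality in gr M, so every axiom is inherited from there.\<close>

lemma Q_lie_algebra: "lie_algebra Q"
proof -
  have "module ring_of_type_algebra Q"
  proof (rule moduleI)
    show "cring (ring_of_type_algebra :: int ring)" by (rule cring_from_type_algebra)
    show "abelian_group Q"
    proof (rule abelian_groupI)
      fix x assume "x \<in> carrier Q"
      then obtain s where s: "s \<in> lie_terms S" "x = fiber s" unfolding Q_ops by blast
      have "evM (Add (Smult (- 1) s) s) = evM Zero"
        using s grM.type_minus_smult[of "evM s"] evM_closed[OF s(1)] by (simp add: grM.M.l_neg del: evM_closed)
      then have "fiber (Smult (- 1) s) \<oplus>\<^bsub>Q\<^esub> x = \<zero>\<^bsub>Q\<^esub>"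
        using s Q_ops(3)[of "Smult (- 1) s" s] by (simp add: Q_ops(2) fiber_eq_iff)
      then show "\<exists>y\<in>carrier Q. y \<oplus>\<^bsub>Q\<^esub> x = \<zero>\<^bsub>Q\<^esub>"
        using s by (intro bexI[of _ "fiber (Smult (- 1) s)"]) (auto simp: Q_ops(1))
    qed (simp only: Q_ops(1,2), (elim imageE)?, simp add: imageI Q_ops(3) fiber_eq_iff grM.M.a_ac)+
  qed (simp only: Q_ops(1,2), (elim imageE)?,
      simp add: imageI Q_ops(3,5) fiber_eq_iff grM.type_smult_simps)+
  then show ?thesis
    by (rule lie_algebra.intro, unfold_locales)
      (simp only: Q_ops(1,2), (elim imageE)?,
        simp add: imageI Q_ops(3-5) fiber_eq_iff grM.bracket_add_left grM.bracket_add_right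
          grM.bracket_smult_left grM.bracket_smult_right grM.bracket_alternating grM.bracket_jacobi)+
qed

definition quot_map :: "(int, nat) lie_term set set \<Rightarrow> nat \<Rightarrow> 'm set" where
  "quot_map x = evM (SOME t. t \<in> lie_terms S \<and> cls t \<in> x)"

lemma quot_map_fiber:
  assumes "s \<in> lie_terms S"
  shows "quot_map (fiber s) = evM s"
proof -
  have "\<exists>t. t \<in> lie_terms S \<and> cls t \<in> fiber s" using assms cls_in_fiber by blast
  then have "(SOME t. t \<in> lie_terms S \<and> cls t \<in> fiber s) \<in> lie_terms S \<and>
      cls (SOME t. t \<in> lie_terms S \<and> cls t \<in> fiber s) \<in> fiber s" by (rule someI_ex)
  then show ?thesis unfolding quot_map_def using cls_in_fiber by blast
qed

lemma quot_map_iso: "quot_map \<in> alg_iso Q (gr M)"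
proof -
  have "quot_map \<in> alg_hom Q (gr M)"
    unfolding alg_hom_def Q_ops(1)
    by (auto simp: quot_map_fiber Q_ops(3-5))
  moreover have "bij_betw quot_map (carrier Q) (carrier (gr M))"
  proof (rule bij_betw_imageI)
    show "inj_on quot_map (carrier Q)"
      unfolding Q_ops(1) by (rule inj_onI) (elim imageE, simp add: quot_map_fiber fiber_eq_iff)
    have "quot_map ` carrier Q = evM ` lie_terms S"
      unfolding Q_ops(1) image_image using quot_map_fiber by (rule image_cong[OF HOL.refl])
    then show "quot_map ` carrier Q = carrier (gr M)" using evM_surj by simp
  qed
  ultimately show ?thesis by (simp add: alg_iso_def)
qed

lemma quot_map_gen: "i \<in> S \<Longrightarrow> quot_map (J +>\<^bsub>L\<^esub> cls (Gen i)) = gr_class M 1 (proj (free_gen i))"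
  by (simp add: coset_J quot_map_fiber)

lemma quot_map_length_part:
  assumes k: "1 \<le> k"
  shows "quot_map ` length_part Q ((\<lambda>i. J +>\<^bsub>L\<^esub> cls (Gen i)) ` S) k = gr_degree M k"
proof -
  have "quot_map ` length_part Q ((\<lambda>i. J +>\<^bsub>L\<^esub> cls (Gen i)) ` S) k =
      length_part (gr M) (quot_map ` (\<lambda>i. J +>\<^bsub>L\<^esub> cls (Gen i)) ` S) k"
    using quot_map_iso coset_J
    by (intro alg_hom_length_part Q_lie_algebra M.gr_lie_algebra) (auto simp: alg_iso_def Q_ops(1))
  also have "quot_map ` (\<lambda>i. J +>\<^bsub>L\<^esub> cls (Gen i)) ` S = gr_class M 1 ` (\<lambda>i. proj (free_gen i)) ` S"
    unfolding image_image by (rule image_cong[OF HOL.refl quot_map_gen])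
  also have "length_part (gr M) \<dots> k = gr_degree M k"
    by (rule M.gr_degree_eq_length_part[symmetric, OF _ generate_gens(2) k]) auto
  finally show ?thesis .
qed

end

section \<open>Torsion\<close>

lemma lookup_times:
  fixes f g :: mpoly
  shows "Poly_Mapping.lookup (f * g) k = (\<Sum>(l, q)\<in>Poly_Mapping.keys f \<times> Poly_Mapping.keys g.
    if l + q = k then Poly_Mapping.lookup f l * Poly_Mapping.lookup g q else 0)"
proof -
  have "f * g = (\<Sum>l\<in>Poly_Mapping.keys f. \<Sum>q\<in>Poly_Mapping.keys g.
      Poly_Mapping.single (l + q) (Poly_Mapping.lookup f l * Poly_Mapping.lookup g q))"
    by (subst mpoly_eq_sum_single[of f], subst mpoly_eq_sum_single[of g]) (simp add: sum_product mult_single)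
  then show ?thesis
    by (simp add: lookup_sum lookup_single when_def sum.cartesian_product case_prod_beta)
qed

text \<open>Gauss's lemma: compare the largest monomials whose coefficients are not divisible by \<open>p\<close>.\<close>

lemma of_int_prime_dvd_mult:
  fixes f g :: mpoly
  assumes p: "Factorial_Ring.prime (p :: int)" and dvd: "of_int p dvd f * g"
  shows "of_int p dvd f \<or> of_int p dvd g"
proof (rule ccontr)
  assume "\<not> (of_int p dvd f \<or> of_int p dvd g)"
  then have fg: "\<exists>m. \<not> p dvd Poly_Mapping.lookup f m" "\<exists>m. \<not> p dvd Poly_Mapping.lookup g m"
    by (auto simp: of_int_dvd_mpoly_iff)
  have max: "\<exists>a. \<not> p dvd Poly_Mapping.lookup h a \<and> (\<forall>m. a < m \<longrightarrow> p dvd Poly_Mapping.lookup h m)"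
    if h: "\<exists>m. \<not> p dvd Poly_Mapping.lookup h m" for h :: mpoly
  proof -
    let ?K = "{m \<in> Poly_Mapping.keys h. \<not> p dvd Poly_Mapping.lookup h m}"
    obtain m where m: "\<not> p dvd Poly_Mapping.lookup h m" using h by blast
    then have "m \<in> Poly_Mapping.keys h" by (metis dvd_0_right in_keys_iff)
    then have K: "finite ?K" "?K \<noteq> {}" using m by auto
    have "\<not> p dvd Poly_Mapping.lookup h (Max ?K)" using Max_in[OF K] by blast
    moreover have "p dvd Poly_Mapping.lookup h m" if "Max ?K < m" for m
    proof (rule ccontr)
      assume n: "\<not> p dvd Poly_Mapping.lookup h m"
      then have "m \<in> ?K" by (auto simp: in_keys_iff)
      then show False using Max_ge[OF K(1)] that by (meson leD)
    qed
    ultimately show ?thesis by blast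
  qed
  obtain a where a: "\<not> p dvd Poly_Mapping.lookup f a" "\<And>m. a < m \<Longrightarrow> p dvd Poly_Mapping.lookup f m"
    using max[OF fg(1)] by blast
  obtain b where b: "\<not> p dvd Poly_Mapping.lookup g b" "\<And>m. b < m \<Longrightarrow> p dvd Poly_Mapping.lookup g m"
    using max[OF fg(2)] by blast
  let ?t = "\<lambda>(l, q). if l + q = a + b then Poly_Mapping.lookup f l * Poly_Mapping.lookup g q else 0"
  let ?K = "Poly_Mapping.keys f \<times> Poly_Mapping.keys g"
  have ab: "(a, b) \<in> ?K" using a(1) b(1) by (auto simp: in_keys_iff)
  have e1: "Poly_Mapping.lookup (f * g) (a + b) = ?t (a, b) + (\<Sum>x\<in>?K - {(a, b)}. ?t x)"
    unfolding lookup_times using ab by (subst sum.remove[of _ "(a, b)"]) auto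
  have e2: "p dvd (\<Sum>x\<in>?K - {(a, b)}. ?t x)"
  proof (rule dvd_sum)
    fix x assume "x \<in> ?K - {(a, b)}"
    then obtain l q where x: "x = (l, q)" "(l, q) \<noteq> (a, b)" by (cases x) auto
    have "p dvd (if l + q = a + b then Poly_Mapping.lookup f l * Poly_Mapping.lookup g q else 0)"
    proof (cases "l + q = a + b")
      case True
      \<comment> \<open>The multiset order is strictly compatible with union: if neither entry
        exceeds its maximum, equality of the sums forces (l, q) = (a, b).\<close>
      have "a < l \<or> b < q"
      proof (rule ccontr)
        assume n: "\<not> (a < l \<or> b < q)"
        then consider "l < a" | "q < b" | "l = a \<and> q = b" by (meson linorder_neqE)
        then show False
        proof cases
          case 1
          then have "l + q < a + b" using n by (intro add_less_le_mono) auto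
          then show False using True by simp
        next
          case 2
          then have "l + q < a + b" using n by (intro add_le_less_mono) auto
          then show False using True by simp
        qed (use x in simp)
      qed
      then show ?thesis using a(2) b(2) by auto
    qed simp
    then show "p dvd ?t x" using x by simp
  qed
  have "p dvd Poly_Mapping.lookup (f * g) (a + b)"
    using dvd by (simp add: of_int_dvd_mpoly_iff)
  then have "p dvd Poly_Mapping.lookup f a * Poly_Mapping.lookup g b"
    unfolding e1 dvd_add_left_iff[OF e2] by simp
  then show False using a(1) b(1) p prime_dvd_mult_iff by blast
qed

text \<open>A primitive vector spans a saturated submodule. One prime factor p of m is removed at a
  time: p divides every c v_j but not every v_j, hence it divides c, and p cancels.\<close>

lemma of_nat_dvd_mult_vector:
  fixes v w :: "nat \<Rightarrow> mpoly"
  assumes prim: "\<And>p::nat. Factorial_Ring.prime p \<Longrightarrow> \<exists>j. \<not> of_nat p dvd v j"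
    and "0 < m" "\<And>j. of_nat m * w j = c * v j"
  shows "\<exists>d. c = of_nat m * d"
  using assms(2,3)
proof (induction m arbitrary: c rule: less_induct)
  case (less m)
  show ?case
  proof (cases "m = 1")
    case False
    then obtain p where p: "Factorial_Ring.prime p" "p dvd m" using prime_factor_nat by blast
    then obtain m' where m: "m = p * m'" by (auto elim: dvdE)
    have pm: "0 < m'" "m' < m" using m less.prems(1) prime_gt_1_nat[OF p(1)] by auto
    obtain j where j: "\<not> of_nat p dvd v j" using prim[OF p(1)] by blast
    have "(of_nat p :: mpoly) dvd c * v j"
      unfolding less.prems(2)[symmetric] m by (simp add: mult.assoc)
    then have "(of_nat p :: mpoly) dvd c"
      using j of_int_prime_dvd_mult[of "int p" c "v j"] p(1) by simp
    then obtain c' where c': "c = of_nat p * c'" by (rule dvdE)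
    have "of_nat m' * w j = c' * v j" for j
    proof -
      have "of_nat p * (of_nat m' * w j) = of_nat p * (c' * v j)"
        using less.prems(2)[of j] by (simp add: m c' mult.assoc)
      then show ?thesis using prime_gt_0_nat[OF p(1)] by simp
    qed
    then obtain d where "c' = of_nat m' * d" using less.IH[OF pm(2) pm(1)] by blast
    then show ?thesis using c' m by (intro exI[of _ d]) (simp add: mult.assoc)
  qed (intro exI[of _ c], simp)
qed

context primitive_presentation
begin

text \<open>If m kills the class of g, then m times its leading vector is c \<open>rho\<close>.
  Saturation gives c = m d, so the leading vector itself is d \<open>rho\<close>, and g already maps
  to the next term.\<close>

lemma gr_part_torsion_free:
  assumes k: "1 \<le> k"
  shows "torsion_free_group (gr_part M k)"
  unfolding torsion_free_group_def
proof (intro ballI allI impI)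
  fix a and m :: nat
  assume a: "a \<in> carrier (gr_part M k)" and m: "0 < m" "a [^]\<^bsub>gr_part M k\<^esub> m = \<one>\<^bsub>gr_part M k\<^esub>"
  obtain l where l: "k = Suc l" using k by (cases k) auto
  obtain x where x: "x \<in> lower_central M k" "a = coset_class M k x"
    using a by (auto simp: M.carrier_gr_part)
  obtain g where g: "g \<in> lower_central F (Suc l)" "x = proj g"
    using x(1) proj_lower_central l by blast
  have gc: "g \<in> carrier F" using g F.lower_central_in_carrier by blast
  have "coset_class M k (x [^]\<^bsub>M\<^esub> m) = coset_class M k \<one>\<^bsub>M\<^esub>"
    using m(2) x M.nat_pow_gr_part[OF k x(1)] by (simp add: M.one_gr_part)
  then have "x [^]\<^bsub>M\<^esub> m \<in> lower_central M (Suc k)"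
    using M.coset_class_eq_one_iff[of "x [^]\<^bsub>M\<^esub> m" k] M.lower_central_in_carrier[OF x(1)] by simp
  then have "proj (g [^]\<^bsub>F\<^esub> m) \<in> lower_central M (Suc (Suc l))"
    using g gc l proj.hom_nat_pow[of g m] by simp
  then obtain c where c: "\<And>j. fox_deriv (g [^]\<^bsub>F\<^esub> m) j $ l = c * rho j"
    using lead_in_relator_ideal[OF fox_lead_nat_pow(1)[OF g(1)]] by blast
  have eq: "of_nat m * fox_deriv g j $ l = c * rho j" for j
    using c[of j] fox_lead_nat_pow(2)[OF g(1)] by simp
  then obtain d where d: "c = of_nat m * d" 
    using of_nat_dvd_mult_vector[of rho m "\<lambda>j. fox_deriv g j $ l" c] primitive m(1) by blast
  have "fox_deriv g j $ l = d * rho j" for j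
  proof -
    have "of_nat m * fox_deriv g j $ l = of_nat m * (d * rho j)" using eq[of j] d by (simp add: mult.assoc)
    then show ?thesis using m(1) by simp
  qed
  then have "proj g \<in> lower_central M (Suc (Suc l))" by (rule proj_in_lower_central[OF g(1)])
  then have "x \<in> lower_central M (Suc k)" using g(2) l by simp
  then show "a = \<one>\<^bsub>gr_part M k\<^esub>"
    using x M.coset_class_eq_one_iff[of x k] M.lower_central_in_carrier[OF x(1)] by (simp add: M.one_gr_part)
qed

end

section \<open>Ranks\<close>

text \<open>More integer vectors than coordinates are linearly dependent over the integers.
  Elimination is fraction free, as the coefficients will serve as exponents of group
  elements.\<close>

lemma integer_relation:
  fixes v :: "'k \<Rightarrow> 'i \<Rightarrow> int"
  assumes "finite I" "finite K" "card I < card K"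
  shows "\<exists>e. (\<exists>k\<in>K. e k \<noteq> 0) \<and> (\<forall>i\<in>I. (\<Sum>k\<in>K. e k * v k i) = 0)"
  using assms
proof (induction I arbitrary: K v rule: finite_induct)
  case empty
  then show ?case by (intro exI[of _ "\<lambda>_. 1"]) (auto simp: card_gt_0_iff)
next
  case (insert i I)
  show ?case
  proof (cases "\<forall>k\<in>K. v k i = 0")
    case True
    have "card I < card K" using insert by simp
    then obtain e where "\<exists>k\<in>K. e k \<noteq> 0" "\<forall>i\<in>I. (\<Sum>k\<in>K. e k * v k i) = 0"
      using insert.IH[OF insert.prems(1), of v] by blast
    then show ?thesis using True by (intro exI[of _ e]) auto
  next
    case False
    then obtain k0 where k0: "k0 \<in> K" "v k0 i \<noteq> 0" by blast
    define K' where "K' = K - {k0}"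
    have K': "finite K'" "k0 \<notin> K'" "K = insert k0 K'" using insert.prems k0 by (auto simp: K'_def)
    have "card I < card K'" using insert K' by simp
    then obtain e where e: "\<exists>k\<in>K'. e k \<noteq> 0"
        "\<forall>j\<in>I. (\<Sum>k\<in>K'. e k * (v k0 i * v k j - v k i * v k0 j)) = 0"
      using insert.IH[OF K'(1), of "\<lambda>k j. v k0 i * v k j - v k i * v k0 j"] by blast
    \<comment> \<open>A relation between the vectors after elimination with pivot
      \<open>v k0 i\<close> is scaled by the pivot; the coefficient of k0 is chosen to cancel
      coordinate i.\<close>
    define f where "f k = (if k = k0 then - (\<Sum>k\<in>K'. e k * v k i) else v k0 i * e k)" for k
    have sum: "(\<Sum>k\<in>K. f k * v k j) = (\<Sum>k\<in>K'. e k * (v k0 i * v k j - v k i * v k0 j))" for j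
    proof -
      have "(\<Sum>k\<in>K'. f k * v k j) = (\<Sum>k\<in>K'. v k0 i * e k * v k j)"
        using K' by (intro sum.cong) (auto simp: f_def)
      then have "(\<Sum>k\<in>K. f k * v k j) = (\<Sum>k\<in>K'. v k0 i * e k * v k j) - (\<Sum>k\<in>K'. e k * v k i) * v k0 j"
        using K' by (simp add: f_def)
      then show ?thesis
        by (simp add: sum_distrib_left sum_distrib_right sum_subtractf algebra_simps)
    qed
    have "(\<Sum>k\<in>K. f k * v k i) = 0" unfolding sum by simp
    moreover have "\<exists>k\<in>K. f k \<noteq> 0" using e(1) k0 K' by (auto simp: f_def)
    ultimately show ?thesis using e(2) sum by (intro exI[of _ f]) auto
  qed
qed

text \<open>Integer form of choosing a maximal nonzero minor: independence of U can be detected on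
  at most \<open>card U\<close> coordinates.\<close>

lemma independent_coordinates:
  fixes u :: "'m \<Rightarrow> 'i \<Rightarrow> int"
  assumes "finite U" "\<And>c. \<forall>i\<in>I. (\<Sum>m\<in>U. c m * u m i) = 0 \<Longrightarrow> \<forall>m\<in>U. c m = 0"
  shows "\<exists>N. finite N \<and> N \<subseteq> I \<and> card N \<le> card U \<and>
    (\<forall>c. (\<forall>i\<in>N. (\<Sum>m\<in>U. c m * u m i) = 0) \<longrightarrow> (\<forall>m\<in>U. c m = 0))"
  using assms
proof (induction U rule: finite_induct)
  case empty
  then show ?case by (intro exI[of _ "{}"]) auto
next
  case (insert m0 U)
  have "\<forall>m\<in>U. c m = 0" if c: "\<forall>i\<in>I. (\<Sum>m\<in>U. c m * u m i) = 0" for c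
  proof -
    have "\<forall>m\<in>insert m0 U. (c(m0 := 0)) m = 0"
    proof (rule insert.prems, rule ballI)
      fix i assume "i \<in> I"
      then have "(\<Sum>m\<in>U. (c(m0 := 0)) m * u m i) = 0"
        using c insert.hyps by (subst sum.cong[OF HOL.refl, of _ _ "\<lambda>m. c m * u m i"]) auto
      then show "(\<Sum>m\<in>insert m0 U. (c(m0 := 0)) m * u m i) = 0" using insert.hyps by simp
    qed
    then show ?thesis using insert.hyps by (metis fun_upd_apply insertI2)
  qed
  then obtain N where N: "finite N" "N \<subseteq> I" "card N \<le> card U"
    "\<And>c. \<forall>i\<in>N. (\<Sum>m\<in>U. c m * u m i) = 0 \<Longrightarrow> \<forall>m\<in>U. c m = 0"
    using insert.IH by blast
  obtain e where e: "\<exists>m\<in>insert m0 U. e m \<noteq> 0" "\<forall>i\<in>N. (\<Sum>m\<in>insert m0 U. e m * u m i) = 0"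
    using integer_relation[of N "insert m0 U" u] N insert.hyps by auto
  have e0: "e m0 \<noteq> 0"
  proof
    assume "e m0 = 0"
    then have "\<forall>m\<in>U. e m = 0" using e(2) insert.hyps by (intro N(4)) simp
    then show False using e(1) \<open>e m0 = 0\<close> by auto
  qed
  \<comment> \<open>Restricted to N there is a relation e involving m0; independence on I provides a
    coordinate that breaks it, and this one is added to N.\<close>
  obtain i0 where i0: "i0 \<in> I" "(\<Sum>m\<in>insert m0 U. e m * u m i0) \<noteq> 0"
    using insert.prems[of e] e(1) by blast
  show ?case
  proof (intro exI conjI allI impI)
    show "finite (insert i0 N)" "insert i0 N \<subseteq> I" using N i0 by auto
    show "card (insert i0 N) \<le> card (insert m0 U)"
      using N insert.hyps card_insert_le_m1[of "Suc (card U)" N i0] by simp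
    fix c assume c: "\<forall>i\<in>insert i0 N. (\<Sum>m\<in>insert m0 U. c m * u m i) = 0"
    \<comment> \<open>The combination cancels at m0, so independence of U on N makes c proportional
      to e, and coordinate i0 then forces c to vanish.\<close>
    have lin: "(\<Sum>m\<in>insert m0 U. (c m0 * e m - e m0 * c m) * u m i) =
        c m0 * (\<Sum>m\<in>insert m0 U. e m * u m i) - e m0 * (\<Sum>m\<in>insert m0 U. c m * u m i)" for i
      unfolding sum_distrib_left sum_subtractf[symmetric] by (intro sum.cong) (auto simp: algebra_simps)
    have "\<forall>m\<in>U. c m0 * e m - e m0 * c m = 0"
    proof (rule N(4), rule ballI)
      fix i assume "i \<in> N"
      then have "(\<Sum>m\<in>insert m0 U. (c m0 * e m - e m0 * c m) * u m i) = 0"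
        unfolding lin using c e(2) by simp
      then show "(\<Sum>m\<in>U. (c m0 * e m - e m0 * c m) * u m i) = 0" using insert.hyps by simp
    qed
    then have rel: "\<forall>m\<in>insert m0 U. c m0 * e m - e m0 * c m = 0" by simp
    then have "(\<Sum>m\<in>insert m0 U. (c m0 * e m - e m0 * c m) * u m i0) = 0" by (intro sum.neutral) auto
    then have "c m0 = 0" unfolding lin using c i0 by simp
    then show "\<forall>m\<in>insert m0 U. c m = 0" using rel e0 by auto
  qed
qed

text \<open>A is presented as the integer vectors on I modulo the span of the independent family u.
  The conclusion is additive in form to avoid truncated subtraction.\<close>

lemma ab_rank_quotient:
  fixes A :: "('a, 'b) monoid_scheme" and h :: "('i \<Rightarrow> int) \<Rightarrow> 'a" and u :: "'m \<Rightarrow> 'i \<Rightarrow> int"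
  defines "V I \<equiv> {x :: 'i \<Rightarrow> int. \<forall>i. i \<notin> I \<longrightarrow> x i = 0}"
  assumes A: "comm_group A" and fin: "finite I" "finite U"
    and closed: "\<And>x. x \<in> V I \<Longrightarrow> h x \<in> carrier A"
    and add: "\<And>x y. x \<in> V I \<Longrightarrow> y \<in> V I \<Longrightarrow> h (\<lambda>i. x i + y i) = h x \<otimes>\<^bsub>A\<^esub> h y"
    and surj: "\<And>a. a \<in> carrier A \<Longrightarrow> \<exists>x\<in>V I. h x = a"
    and u: "\<And>m. m \<in> U \<Longrightarrow> u m \<in> V I"
    and ker: "\<And>x. x \<in> V I \<Longrightarrow> h x = \<one>\<^bsub>A\<^esub> \<longleftrightarrow> (\<exists>c. \<forall>i. x i = (\<Sum>m\<in>U. c m * u m i))"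
    and indep: "\<And>c. \<forall>i\<in>I. (\<Sum>m\<in>U. c m * u m i) = 0 \<Longrightarrow> \<forall>m\<in>U. c m = 0"
  shows "ab_rank A + card U = card I"
proof -
  interpret A: comm_group A by (rule A)
  have V0: "(\<lambda>_. 0) \<in> V I" by (simp add: V_def)
  have Vadd: "(\<lambda>i. x i + y i) \<in> V I" if "x \<in> V I" "y \<in> V I" for x y using that by (simp add: V_def)
  have Vmult: "(\<lambda>i. c * x i) \<in> V I" if "x \<in> V I" for x c using that by (simp add: V_def)
  have h0: "h (\<lambda>_. 0) = \<one>\<^bsub>A\<^esub>"
    using add[OF V0 V0] closed[OF V0] A.r_cancel_one' by auto
  have hnat: "h (\<lambda>i. int n * x i) = h x [^]\<^bsub>A\<^esub> n" if x: "x \<in> V I" for n x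
  proof (induction n)
    case (Suc n)
    have "h (\<lambda>i. int (Suc n) * x i) = h (\<lambda>i. int n * x i + x i)" by (simp add: algebra_simps)
    also have "\<dots> = h (\<lambda>i. int n * x i) \<otimes>\<^bsub>A\<^esub> h x" by (rule add[OF Vmult[OF x] x])
    finally show ?case using Suc by simp
  qed (simp add: h0)
  have hneg: "h (\<lambda>i. - x i) = inv\<^bsub>A\<^esub> h x" if x: "x \<in> V I" for x
  proof -
    have "h (\<lambda>i. - x i) \<otimes>\<^bsub>A\<^esub> h x = \<one>\<^bsub>A\<^esub>"
      using add[OF _ x, of "\<lambda>i. - x i"] Vmult[OF x, of "-1"] h0 by simp
    then show ?thesis
      using closed[OF x] closed[of "\<lambda>i. - x i"] Vmult[OF x, of "-1"] by (simp add: A.inv_equality)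
  qed
  have hint: "h (\<lambda>i. c * x i) = h x [^]\<^bsub>A\<^esub> c" if x: "x \<in> V I" for c :: int and x
  proof (cases "c < 0")
    case True
    then have "h (\<lambda>i. c * x i) = h (\<lambda>i. - (int (nat (- c)) * x i))" by simp
    then show ?thesis
      unfolding int_pow_def2 if_P[OF True] hneg[OF Vmult[OF x]] hnat[OF x] .
  next
    case False
    then have "h (\<lambda>i. c * x i) = h (\<lambda>i. int (nat c) * x i)" by simp
    then show ?thesis unfolding int_pow_def2 if_not_P[OF False] hnat[OF x] .
  qed
  have Vsum: "(\<lambda>i. \<Sum>b\<in>B. c b * x b i) \<in> V I" if "\<And>b. b \<in> B \<Longrightarrow> x b \<in> V I" for B :: "'a set" and c x
    using that by (auto simp: V_def)
  have hprod: "finprod A (\<lambda>b. h (x b) [^]\<^bsub>A\<^esub> c b) B = h (\<lambda>i. \<Sum>b\<in>B. c b * x b i)"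
    if "finite B" "\<And>b. b \<in> B \<Longrightarrow> x b \<in> V I" for B :: "'a set" and c :: "'a \<Rightarrow> int" and x
    using that
  proof (induction B rule: finite_induct)
    case (insert b B)
    have xb: "x b \<in> V I" and xB: "\<And>b. b \<in> B \<Longrightarrow> x b \<in> V I" using insert.prems by auto
    have "finprod A (\<lambda>b. h (x b) [^]\<^bsub>A\<^esub> c b) (insert b B) =
        h (x b) [^]\<^bsub>A\<^esub> c b \<otimes>\<^bsub>A\<^esub> h (\<lambda>i. \<Sum>b\<in>B. c b * x b i)"
      using insert closed xb xB by (subst A.finprod_insert) auto
    also have "\<dots> = h (\<lambda>i. c b * x b i + (\<Sum>b\<in>B. c b * x b i))"
      using add[OF Vmult[OF xb, of "c b"] Vsum[where B = B and x = x and c = c, OF xB]] hint[OF xb, of "c b"] by simp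
    finally show ?case using insert.hyps by simp
  qed (simp add: h0)
  have indep_iff: "int_independent A B \<longleftrightarrow>
      (\<forall>c d. (\<forall>i. (\<Sum>b\<in>B. c b * x b i) = (\<Sum>m\<in>U. d m * u m i)) \<longrightarrow> (\<forall>b\<in>B. c b = 0))"
    if B: "finite B" "B \<subseteq> carrier A" and x: "\<And>b. b \<in> B \<Longrightarrow> x b \<in> V I" "\<And>b. b \<in> B \<Longrightarrow> h (x b) = b" for B x
  proof -
    have "finprod A (\<lambda>b. b [^]\<^bsub>A\<^esub> c b) B = h (\<lambda>i. \<Sum>b\<in>B. c b * x b i)" for c :: "'a \<Rightarrow> int"
    proof -
      have "finprod A (\<lambda>b. b [^]\<^bsub>A\<^esub> c b) B = finprod A (\<lambda>b. h (x b) [^]\<^bsub>A\<^esub> c b) B"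
        using x B by (intro A.finprod_cong') auto
      then show ?thesis using hprod[where B = B and x = x and c = c] x B by simp
    qed
    then show ?thesis
      unfolding int_independent_def using B ker[OF Vsum[where B = B and x = x]] x by auto
  qed
  have upper: "card B \<le> card I - card U" if ind: "int_independent A B" for B
  proof -
    have B: "finite B" "B \<subseteq> carrier A" using ind by (auto simp: int_independent_def)
    have "\<forall>b\<in>B. \<exists>x. x \<in> V I \<and> h x = b"
    proof
      fix b assume "b \<in> B"
      then have "\<exists>x\<in>V I. h x = b" using B(2) by (intro surj) blast
      then show "\<exists>x. x \<in> V I \<and> h x = b" by blast
    qed
    from bchoice[OF this] obtain x where "\<forall>b\<in>B. x b \<in> V I \<and> h (x b) = b" ..
    then have x: "\<And>b. b \<in> B \<Longrightarrow> x b \<in> V I" "\<And>b. b \<in> B \<Longrightarrow> h (x b) = b" by auto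
    have all: "\<forall>c d. (\<forall>i. (\<Sum>b\<in>B. c b * x b i) = (\<Sum>m\<in>U. d m * u m i)) \<longrightarrow> (\<forall>b\<in>B. c b = 0)"
      by (rule iffD1[OF indep_iff[where B = B and x = x, OF B x] ind])
    have imp: "\<forall>b\<in>B. c b = 0" if "\<forall>i. (\<Sum>b\<in>B. c b * x b i) = (\<Sum>m\<in>U. d m * u m i)" for c d
      by (rule mp[OF spec[OF spec[OF all, of c], of d] that])
    \<comment> \<open>Lifts of an independent set together with the relations u stay independent, so
      there are at most \<open>card I\<close> of them; the disjoint sum keeps the two families
      apart.\<close>
    have "card (B <+> U) \<le> card I"
    proof (rule ccontr)
      assume "\<not> card (B <+> U) \<le> card I"
      then obtain e where e: "\<exists>k\<in>B <+> U. e k \<noteq> 0"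
        "\<forall>i\<in>I. (\<Sum>k\<in>B <+> U. e k * case_sum x u k i) = 0"
        using integer_relation[of I "B <+> U" "case_sum x u"] fin B by auto
      have "(\<Sum>b\<in>B. e (Inl b) * x b i) = (\<Sum>m\<in>U. - e (Inr m) * u m i)" for i
      proof (cases "i \<in> I")
        case True
        then have "(\<Sum>b\<in>B. e (Inl b) * x b i) + (\<Sum>m\<in>U. e (Inr m) * u m i) = 0"
          using e(2) B fin by (simp add: sum.Plus)
        then show ?thesis by (simp add: sum_negf)
      next
        case False
        then show ?thesis using x(1) u by (auto simp: V_def)
      qed
      then have 1: "\<forall>b\<in>B. e (Inl b) = 0"
        by (intro imp[of "\<lambda>b. e (Inl b)" "\<lambda>m. - e (Inr m)"] allI)
      then have "\<forall>i\<in>I. (\<Sum>m\<in>U. e (Inr m) * u m i) = 0"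
        using e(2) B fin by (simp add: sum.Plus)
      then have "\<forall>m\<in>U. e (Inr m) = 0" by (rule indep)
      then show False using e(1) 1 by auto
    qed
    then show ?thesis using B fin by (simp add: card_Plus)
  qed
  from independent_coordinates[OF fin(2) indep] obtain N
    where "finite N \<and> N \<subseteq> I \<and> card N \<le> card U \<and>
      (\<forall>c. (\<forall>i\<in>N. (\<Sum>m\<in>U. c m * u m i) = 0) \<longrightarrow> (\<forall>m\<in>U. c m = 0))" ..
  then have N: "finite N" "N \<subseteq> I" "card N \<le> card U"
    "\<And>c. \<forall>i\<in>N. (\<Sum>m\<in>U. c m * u m i) = 0 \<Longrightarrow> \<forall>m\<in>U. c m = 0" by simp_all
  define unit :: "'i \<Rightarrow> 'i \<Rightarrow> int" where "unit j i = (if i = j then 1 else 0)" for j i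
  have unitV: "unit j \<in> V I" if "j \<in> I" for j using that by (auto simp: V_def unit_def)
  \<comment> \<open>A vector in the span of u that vanishes on N is zero. Hence the unit vectors
    outside N are independent in A, which gives the lower bound.\<close>
  have zero: "x = (\<lambda>_. 0)" if "\<And>i. x i = (\<Sum>m\<in>U. d m * u m i)" "\<And>i. i \<in> N \<Longrightarrow> x i = 0" for x d
  proof -
    have "\<forall>m\<in>U. d m = 0" using that by (intro N(4)) auto
    then show ?thesis using that(1) by auto
  qed
  have inj: "inj_on (h \<circ> unit) (I - N)"
  proof (rule inj_onI)
    fix s t assume st: "s \<in> I - N" "t \<in> I - N" "(h \<circ> unit) s = (h \<circ> unit) t"
    have V: "unit s \<in> V I" "unit t \<in> V I" using unitV st by auto
    then have Vn: "(\<lambda>i. - unit t i) \<in> V I" by (simp add: V_def)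
    have "h (\<lambda>i. unit s i + - unit t i) = \<one>\<^bsub>A\<^esub>"
      unfolding add[OF V(1) Vn] hneg[OF V(2)] using st(3) closed[OF V(2)] by simp
    then obtain d where "\<And>i. unit s i + - unit t i = (\<Sum>m\<in>U. d m * u m i)"
      using ker[OF Vadd[OF V(1) Vn]] by blast
    then have "(\<lambda>i. unit s i + - unit t i) = (\<lambda>_. 0)"
      by (rule zero) (use st in \<open>auto simp: unit_def\<close>)
    then have "unit s s + - unit t s = 0" by metis
    then show "s = t" by (auto simp: unit_def split: if_splits)
  qed
  define B where "B = (h \<circ> unit) ` (I - N)"
  define x where "x b = unit (inv_into (I - N) (h \<circ> unit) b)" for b
  have B: "finite B" "B \<subseteq> carrier A" using fin closed unitV by (auto simp: B_def)
  have xt: "x (h (unit t)) = unit t" if "t \<in> I - N" for t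
    using inv_into_f_f[OF inj that] by (simp add: x_def)
  have x: "b \<in> B \<Longrightarrow> x b \<in> V I" "b \<in> B \<Longrightarrow> h (x b) = b" for b
    using xt unitV by (auto simp: B_def)
  have "int_independent A B"
  proof (rule iffD2[OF indep_iff[where B = B and x = x, OF B x]], simp_all only:, intro allI impI)
    fix c :: "'a \<Rightarrow> int" and d assume cd: "\<forall>i. (\<Sum>b\<in>B. c b * x b i) = (\<Sum>m\<in>U. d m * u m i)"
    have val: "(\<Sum>b\<in>B. c b * x b i) = (if i \<in> I - N then c (h (unit i)) else 0)" for i
    proof -
      have "(\<Sum>b\<in>B. c b * x b i) = (\<Sum>t\<in>I - N. c (h (unit t)) * unit t i)"
        unfolding B_def sum.reindex[OF inj] using xt by (intro sum.cong) auto
      also have "\<dots> = (\<Sum>t\<in>I - N. if i = t then c (h (unit t)) else 0)"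
        by (intro sum.cong) (auto simp: unit_def)
      finally show ?thesis using fin by simp
    qed
    have z: "(\<lambda>i. \<Sum>b\<in>B. c b * x b i) = (\<lambda>_. 0)"
    proof (rule zero[of _ d])
      show "(\<Sum>b\<in>B. c b * x b i) = (\<Sum>m\<in>U. d m * u m i)" for i using cd by blast
      show "(\<Sum>b\<in>B. c b * x b i) = 0" if "i \<in> N" for i unfolding val using that by simp
    qed
    have "c (h (unit i)) = 0" if "i \<in> I - N" for i
      using fun_cong[OF z, of i] that unfolding val by simp
    then show "\<forall>b\<in>B. c b = 0" by (simp add: B_def)
  qed
  moreover have "card I - card U \<le> card B"
    unfolding B_def card_image[OF inj] using N card_Diff_subset[OF N(1,2)] by simp
  ultimately have B2: "int_independent A B" "card B = card I - card U"
    using upper[of B] by auto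
  have "ab_rank A = card I - card U"
    unfolding ab_rank_def
  proof (rule cSup_eq_maximum)
    show "card I - card U \<in> card ` {B. int_independent A B}"
      unfolding B2(2)[symmetric] using B2(1) by simp
  qed (use upper in blast)
  moreover have "card U \<le> card I"
  proof (rule ccontr)
    assume "\<not> card U \<le> card I"
    then obtain e where e: "\<exists>m\<in>U. e m \<noteq> 0" "\<forall>i\<in>I. (\<Sum>m\<in>U. e m * u m i) = 0"
      using integer_relation[of I U u] fin by auto
    show False using indep[OF e(2)] e(1) by blast
  qed
  ultimately show ?thesis by simp
qed

section \<open>The Hilbert series\<close>

lemma homogeneous_iff: "homogeneous S d p \<longleftrightarrow> Poly_Mapping.keys p \<subseteq> multisets_of_size S d"
  by (auto simp: homogeneous_def multisets_of_size_def)

lemma homogeneous_lookup: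
  "homogeneous S d p \<Longrightarrow> m \<notin> multisets_of_size S d \<Longrightarrow> Poly_Mapping.lookup p m = 0"
  unfolding homogeneous_iff by (meson in_keys_iff subsetD)

lemma homogeneous_fox:
  assumes "t \<in> lie_terms S"
  shows "homogeneous S (Suc 0) (fox_lin t)" "homogeneous S d (coeff (fox_vec t j) d)"
proof -
  have *: "homogeneous S e (of_int c * p)" if "homogeneous S e p" for e c p
    using that by (auto simp: homogeneous_def in_keys_iff lookup_of_int_mult)
  have "homogeneous S (Suc 0) (fox_lin t) \<and> (\<forall>d. homogeneous S d (coeff (fox_vec t j) d))"
    using assms
  proof (induction t)
    case (Gen i)
    then show ?case by (auto simp: coeff_1)
  next
    case (Bracket s t)
    have "homogeneous S d (coeff (fox_vec (Bracket s t) j) d)" for d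
    proof (cases d)
      case (Suc e)
      have "homogeneous S (Suc 0 + e) (fox_lin s * coeff (fox_vec t j) e)"
        "homogeneous S (Suc 0 + e) (fox_lin t * coeff (fox_vec s j) e)"
        using Bracket by (auto simp del: plus_nat.simps add_Suc add_Suc_right intro!: homogeneous_mult)
      then show ?thesis using Suc by (simp add: homogeneous_diff)
    qed simp
    then show ?case by simp
  qed (auto simp: * homogeneous_add)
  then show "homogeneous S (Suc 0) (fox_lin t)" "homogeneous S d (coeff (fox_vec t j) d)" by auto
qed

text \<open>The coefficient at X^k is homogeneous of degree k, so after X = 1 a monomial can come
  only from the degree equal to its size.\<close>

lemma lookup_fox_vec:
  assumes "t \<in> lie_terms S"
  shows "Poly_Mapping.lookup (poly (fox_vec t j) 1) m = Poly_Mapping.lookup (coeff (fox_vec t j) (size m)) m"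
proof -
  let ?p = "fox_vec t j"
  have "Poly_Mapping.lookup (poly ?p 1) m = (\<Sum>k\<le>degree ?p. Poly_Mapping.lookup (coeff ?p k) m)"
    by (simp add: poly_altdef lookup_sum)
  also have "\<dots> = (\<Sum>k\<le>degree ?p. if k = size m then Poly_Mapping.lookup (coeff ?p (size m)) m else 0)"
  proof (rule sum.cong[OF HOL.refl])
    fix k
    show "Poly_Mapping.lookup (coeff ?p k) m = (if k = size m then Poly_Mapping.lookup (coeff ?p (size m)) m else 0)"
      using homogeneous_lookup[OF homogeneous_fox(2)[OF assms, of k j], of m]
      by (auto simp: multisets_of_size_def)
  qed
  also have "\<dots> = Poly_Mapping.lookup (coeff ?p (size m)) m"
    by (auto simp: coeff_eq_0)
  finally show ?thesis .
qed

definition basic_term :: "nat \<times> nat multiset \<Rightarrow> (int, nat) lie_term" where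
  "basic_term = (\<lambda>(i, m). if m = {#} then Gen i
     else foldr (\<lambda>k. Bracket (Gen k)) (sorted_list_of_multiset (m - {#Min_mset m#}))
       (Bracket (Gen i) (Gen (Min_mset m))))"

lemma abs_basic_term: "abs_free_metab (basic_term p) = basic p"
proof -
  have "abs_free_metab (foldr (\<lambda>k. Bracket (Gen k)) ms t) =
      foldr (\<lambda>k. fm_bracket (fm_gen k)) ms (abs_free_metab t)" for ms t
    by (induction ms) (simp_all add: fm_gen.abs_eq flip: fm_bracket.abs_eq)
  then show ?thesis
    by (simp add: basic_term_def basic_def fm_ad_def fm_gen.abs_eq fm_bracket.abs_eq split: prod.split)
qed

lemma basic_term_closed:
  assumes "i \<in> S" "set_mset m \<subseteq> S"
  shows "basic_term (i, m) \<in> lie_terms S"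
proof -
  have fold: "foldr (\<lambda>k. Bracket (Gen k)) ms t \<in> lie_terms S"
    if "set ms \<subseteq> S" "t \<in> lie_terms S" for ms and t :: "(int, nat) lie_term"
    using that by (induction ms) auto
  have "Min_mset m \<in> S" if "m \<noteq> {#}" using that assms Min_in[of "set_mset m"] by auto
  moreover have "set_mset (m - {#Min_mset m#}) \<subseteq> S" using assms(2) by (meson in_diffD subset_iff)
  ultimately show ?thesis using assms by (auto simp: basic_term_def intro!: fold)
qed

definition coord :: "nat \<times> nat multiset \<Rightarrow> (nat \<Rightarrow> mpoly) \<Rightarrow> int" where
  "coord = (\<lambda>(i, m) w. (if m = {#} then 1 else -1) * Poly_Mapping.lookup (w i) m)"

lemma fm_coord_eq: "fm_coord p x = coord p (fm_val x)"
  by (simp add: fm_coord_def coord_def split: prod.split)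

lemma coord_linear:
  "coord p (\<lambda>j. v j + w j) = coord p v + coord p w"
  "coord p (\<lambda>j. - w j) = - coord p w"
  "coord p (\<lambda>j. of_int c * w j) = c * coord p w"
  "coord p (\<lambda>j. 0) = 0"
  by (auto simp: coord_def lookup_add lookup_of_int_mult split: prod.split)

lemma coord_sum: "coord p (\<lambda>j. \<Sum>a\<in>A. w a j) = (\<Sum>a\<in>A. coord p (w a))"
  by (induction A rule: infinite_finite_induct) (auto simp: coord_linear)

context primitive_presentation
begin

text \<open>Indices of the basic commutators over S of bracket length l + 1, the degree in which
  leading vectors have polynomial degree l.\<close>

definition index :: "nat \<Rightarrow> (nat \<times> nat multiset) set" where
  "index l = {p. basic_index p \<and> fst p \<in> S \<and> snd p \<in> multisets_of_size S l}"

text \<open>Monomials m for which \<open>m * rho\<close> has polynomial degree l; there are none for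
  l = 0, as \<open>rho\<close> is linear.\<close>

definition relator_index :: "nat \<Rightarrow> nat multiset set" where
  "relator_index l = (case l of 0 \<Rightarrow> {} | Suc k \<Rightarrow> multisets_of_size S k)"

definition supported :: "nat \<Rightarrow> (nat \<Rightarrow> mpoly) \<Rightarrow> bool" where
  "supported l w \<longleftrightarrow> (\<forall>j. homogeneous S l (w j)) \<and> (\<forall>j. j \<notin> S \<longrightarrow> w j = 0)"

abbreviation "lead l g \<equiv> (\<lambda>j. fox_deriv g j $ l)"

lemma coord_outside:
  assumes "supported l w" "basic_index p" "p \<notin> index l"
  shows "coord p w = 0"
proof -
  have "fst p \<notin> S \<or> snd p \<notin> multisets_of_size S l" using assms by (auto simp: index_def)
  then have "Poly_Mapping.lookup (w (fst p)) (snd p) = 0"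
    using assms(1) homogeneous_lookup[of S l "w (fst p)" "snd p"] by (auto simp: supported_def)
  then show ?thesis by (simp add: coord_def case_prod_beta)
qed

lemma supported_lead:
  assumes "g \<in> carrier F"
  shows "supported l (lead l g)"
proof -
  have "fst ` set g \<subseteq> S" using assms by (simp add: free_group_simps)
  then show ?thesis
    using graded_fox(2)[of g] fox_deriv_outside[of g] by (auto simp: supported_def graded_def)
qed

lemma supported_relator:
  assumes "homogeneous S (l - 1) c" "l = 0 \<Longrightarrow> c = 0"
  shows "supported l (\<lambda>j. c * rho j)"
proof (cases l)
  case 0
  then show ?thesis using assms by (simp add: supported_def)
next
  case (Suc k)
  have "supported (Suc 0) (\<lambda>j. rho j)"
    using supported_lead[of r 1] relator(1) F.lower_central_in_carrier by auto
  then show ?thesis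
    using assms Suc homogeneous_mult[of S k c "Suc 0"] by (auto simp: supported_def)
qed

text \<open>Leading vectors are Fox vectors of free metabelian Lie elements, which makes them
  accessible to \<open>supported_eqI\<close>.\<close>

lemma ex_fm_lead:
  assumes g: "g \<in> lower_central F (Suc k)"
  shows "\<exists>x. \<forall>j. fm_val x j = lead k g j"
proof -
  have "gr_class F (Suc k) g \<in> evF ` lie_terms S"
    unfolding evF_surj using g by (intro F.gr_class_closed) auto
  then obtain t where t: "gr_class F (Suc k) g = evF t" "t \<in> lie_terms S" by (rule imageE)
  have coeff: "coeff (fox_vec t j) l = (if l = k then lead k g j else 0)" for j l
  proof -
    obtain w where w: "represents (Suc l) t w" using ex_represents[OF t(2), of "Suc l"] by auto
    show ?thesis
    proof (cases "l = k")
      case True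
      then have "fox_deriv w j $ k = fox_deriv g j $ k"
        using w g t(1)[symmetric] by (intro fox_lead_cong) (auto simp: represents_def F.gr_class_nth)
      then show ?thesis using w True by (simp add: represents_def)
    next
      case False
      then show ?thesis using represents_one(1)[OF w] t(1)[symmetric] by (simp add: F.gr_class_nth)
    qed
  qed
  have "fox_vec t j = monom (lead k g j) k" for j by (rule poly_eqI) (simp add: coeff)
  then show ?thesis by (intro exI[of _ "abs_free_metab t"]) (simp add: fm_val_abs poly_monom)
qed

lemma ex_fm_relator: "\<exists>x. \<forall>j. fm_val x j = c * rho j"
proof -
  obtain z where "\<forall>j. poly (fox_vec z j) 1 = c * rho j" using ex_ideal_term by blast
  then show ?thesis by (intro exI[of _ "abs_free_metab z"]) (simp add: fm_val_abs)
qed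

text \<open>The coordinates at basic indices do not determine an arbitrary vector, but they do
  determine the Fox vector of a Lie element; x and y certify this for v and w.\<close>

lemma supported_eqI:
  assumes "supported l v" "supported l w" "\<forall>j. fm_val x j = v j" "\<forall>j. fm_val y j = w j"
    "\<And>p. p \<in> index l \<Longrightarrow> coord p v = coord p w"
  shows "v j = w j"
proof -
  have xy: "fm_val x = v" "fm_val y = w" using assms(3,4) by auto
  have "x = y"
  proof (rule fm_eqI)
    fix p assume p: "basic_index p"
    show "fm_coord p x = fm_coord p y"
      unfolding fm_coord_eq xy using assms(5) coord_outside[OF assms(1) p] coord_outside[OF assms(2) p]
      by (cases "p \<in> index l") auto
  qed
  then show ?thesis using xy by simp
qed

lemma coord_relator:
  assumes "finite U"
  shows "coord p (\<lambda>j. (\<Sum>m\<in>U. Poly_Mapping.single m (c m)) * rho j) =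
    (\<Sum>m\<in>U. c m * coord p (\<lambda>j. Poly_Mapping.single m 1 * rho j))"
proof -
  have "Poly_Mapping.single m (c m) = of_int (c m) * (Poly_Mapping.single m 1 :: mpoly)" for m
    by (rule poly_mapping_eqI) (simp add: lookup_of_int_mult lookup_single when_def)
  then have "(\<lambda>j. (\<Sum>m\<in>U. Poly_Mapping.single m (c m)) * rho j) =
      (\<lambda>j. \<Sum>m\<in>U. of_int (c m) * (Poly_Mapping.single m 1 * rho j))"
    by (simp add: sum_distrib_right mult.assoc)
  then show ?thesis by (simp only: coord_sum coord_linear)
qed

lemma finite_index:
  assumes "finite S"
  shows "finite (index l)" "finite (relator_index l)"
proof -
  have "index l \<subseteq> S \<times> multisets_of_size S l" by (auto simp: index_def)
  then show "finite (index l)"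
    by (rule finite_subset) (use assms finite_multisets_of_size in auto)
  show "finite (relator_index l)" using assms finite_multisets_of_size by (auto simp: relator_index_def split: nat.split)
qed

lemma relator_sum:
  assumes "finite S"
  shows "homogeneous S (l - 1) (\<Sum>m\<in>relator_index l. Poly_Mapping.single m (c m))"
    "l = 0 \<Longrightarrow> (\<Sum>m\<in>relator_index l. Poly_Mapping.single m (c m)) = 0"
proof -
  show "homogeneous S (l - 1) (\<Sum>m\<in>relator_index l. Poly_Mapping.single m (c m))"
    by (intro homogeneous_sum)
      (auto simp: homogeneous_def relator_index_def multisets_of_size_def split: nat.splits if_splits)
qed (simp add: relator_index_def)

text \<open>The condition that the leading vector is a multiple c \<open>rho\<close>, written
  linearly: the unknowns are the coefficients of c at the monomials of the right degree.\<close>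

lemma proj_lower_central_iff:
  assumes S: "finite S" and g: "g \<in> lower_central F (Suc l)"
  shows "proj g \<in> lower_central M (Suc (Suc l)) \<longleftrightarrow>
    (\<exists>c. \<forall>p\<in>index l. coord p (lead l g) =
      (\<Sum>m\<in>relator_index l. c m * coord p (\<lambda>j. Poly_Mapping.single m 1 * rho j)))"
proof
  note fin = finite_index(2)[OF S, of l]
  have gc: "g \<in> carrier F" using g F.lower_central_in_carrier by blast
  {
    assume "proj g \<in> lower_central M (Suc (Suc l))"
    then obtain c where c: "\<And>j. lead l g j = c * rho j" "homogeneous S (l - 1) c" "l = 0 \<longrightarrow> c = 0"
      using lead_in_relator_ideal[OF g] by blast
    have "c = (\<Sum>m\<in>relator_index l. Poly_Mapping.single m (Poly_Mapping.lookup c m))"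
    proof (rule poly_mapping_eqI)
      fix k
      have "Poly_Mapping.lookup c k = (if k \<in> relator_index l then Poly_Mapping.lookup c k else 0)"
        using c(2,3) homogeneous_lookup[of S "l - 1" c k] by (auto simp: relator_index_def split: nat.splits)
      then show "Poly_Mapping.lookup c k =
          Poly_Mapping.lookup (\<Sum>m\<in>relator_index l. Poly_Mapping.single m (Poly_Mapping.lookup c m)) k"
        using fin by (simp add: lookup_sum lookup_single when_def)
    qed
    then have "(\<lambda>j. lead l g j) = (\<lambda>j. (\<Sum>m\<in>relator_index l. Poly_Mapping.single m (Poly_Mapping.lookup c m)) * rho j)"
      using c(1) by metis
    then have "coord p (lead l g) =
      (\<Sum>m\<in>relator_index l. Poly_Mapping.lookup c m * coord p (\<lambda>j. Poly_Mapping.single m 1 * rho j))" for p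
      using coord_relator[OF fin, of p "Poly_Mapping.lookup c"] by simp
    then show "\<exists>c. \<forall>p\<in>index l. coord p (lead l g) =
      (\<Sum>m\<in>relator_index l. c m * coord p (\<lambda>j. Poly_Mapping.single m 1 * rho j))" by blast
  }
  assume "\<exists>c. \<forall>p\<in>index l. coord p (lead l g) =
      (\<Sum>m\<in>relator_index l. c m * coord p (\<lambda>j. Poly_Mapping.single m 1 * rho j))"
  then obtain c where c: "\<And>p. p \<in> index l \<Longrightarrow> coord p (lead l g) =
      coord p (\<lambda>j. (\<Sum>m\<in>relator_index l. Poly_Mapping.single m (c m)) * rho j)"
    using coord_relator[OF fin] by auto
  obtain x where x: "\<forall>j. fm_val x j = lead l g j" using ex_fm_lead[OF g] by blast
  obtain y where y: "\<forall>j. fm_val y j = (\<Sum>m\<in>relator_index l. Poly_Mapping.single m (c m)) * rho j"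
    using ex_fm_relator by blast
  have "lead l g j = (\<Sum>m\<in>relator_index l. Poly_Mapping.single m (c m)) * rho j" for j
    by (rule supported_eqI[OF supported_lead[OF gc] supported_relator x y c]) (use relator_sum[OF S] in auto)
  then show "proj g \<in> lower_central M (Suc (Suc l))" by (rule proj_in_lower_central[OF g])
qed

lemma coord_lead_mult:
  assumes "g \<in> lower_central F (Suc l)" "h \<in> lower_central F (Suc l)"
  shows "coord p (lead l (g \<otimes>\<^bsub>F\<^esub> h)) = coord p (lead l g) + coord p (lead l h)"
  using fox_lead_mult[OF assms(2)] by (simp add: coord_linear)

lemma coord_lead_inv:
  assumes "g \<in> lower_central F (Suc l)"
  shows "coord p (lead l (inv\<^bsub>F\<^esub> g)) = - coord p (lead l g)"
  using fox_lead_inv[OF assms] by (simp add: coord_linear)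

text \<open>Words representing basic terms have unit coordinate vectors by duality; products of
  their powers realize every integer vector.\<close>

lemma ex_lead_coord:
  assumes S: "finite S"
  shows "\<exists>g\<in>lower_central F (Suc l). \<forall>p\<in>index l. coord p (lead l g) = x p"
proof -
  have basis: "\<exists>g\<in>lower_central F (Suc l). \<forall>p\<in>index l. coord p (lead l g) = of_bool (p = q)"
    if q: "q \<in> index l" for q
  proof -
    have t: "basic_term q \<in> lie_terms S"
      using q basic_term_closed[of "fst q" S "snd q"] by (auto simp: index_def multisets_of_size_def)
    obtain w where w: "represents (Suc l) (basic_term q) w" using ex_represents[OF t, of "Suc l"] by auto
    have "coord p (lead l w) = of_bool (p = q)" if p: "p \<in> index l" for p
    proof -
      have "lead l w = (\<lambda>j. coeff (fox_vec (basic_term q) j) l)" using w by (auto simp: represents_def)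
      moreover have "size (snd p) = l" using p by (simp add: index_def multisets_of_size_def)
      ultimately have "coord p (lead l w) = fm_coord p (basic q)"
        unfolding fm_coord_eq coord_def using lookup_fox_vec[OF t, of "fst p" "snd p"]
        by (simp add: fm_val_abs case_prod_beta flip: abs_basic_term)
      also have "\<dots> = of_bool (p = q)" using p q by (intro fm_coord_basic) (auto simp: index_def)
      finally show ?thesis .
    qed
    moreover have "w \<in> lower_central F (Suc l)" using w by (simp add: represents_def)
    ultimately show ?thesis by blast
  qed
  have "\<exists>g\<in>lower_central F (Suc l). \<forall>p\<in>index l. coord p (lead l g) = (if p \<in> T then x p else 0)"
    if "finite T" "T \<subseteq> index l" for T
    using that
  proof (induction T rule: finite_induct)
    case empty
    show ?case by (rule bexI[of _ "\<one>\<^bsub>F\<^esub>"]) (simp_all add: coord_linear)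
  next
    case (insert q T)
    then obtain g where g: "g \<in> lower_central F (Suc l)"
      "\<forall>p\<in>index l. coord p (lead l g) = (if p \<in> T then x p else 0)" by auto
    obtain h where h: "h \<in> lower_central F (Suc l)" "\<forall>p\<in>index l. coord p (lead l h) = of_bool (p = q)"
      using basis[of q] insert.prems by blast
    have hx: "h [^]\<^bsub>F\<^esub> x q \<in> lower_central F (Suc l)" using h by simp
    have "coord p (lead l (h [^]\<^bsub>F\<^esub> x q)) = x q * of_bool (p = q)" if "p \<in> index l" for p
      using fox_lead_int_pow[OF h(1), of "x q"] h(2) that by (simp add: coord_linear)
    then have "\<forall>p\<in>index l. coord p (lead l (h [^]\<^bsub>F\<^esub> x q \<otimes>\<^bsub>F\<^esub> g)) = (if p \<in> insert q T then x p else 0)"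
      using g h insert.hyps coord_lead_mult[OF hx g(1)] by auto
    then show ?case using hx g(1) by (intro bexI[of _ "h [^]\<^bsub>F\<^esub> x q \<otimes>\<^bsub>F\<^esub> g"]) auto
  qed
  from this[OF finite_index(1)[OF S] subset_refl] show ?thesis by auto
qed

lemma coset_class_proj_cong:
  assumes S: "finite S" and g: "g \<in> lower_central F (Suc l)" "h \<in> lower_central F (Suc l)"
    and eq: "\<And>p. p \<in> index l \<Longrightarrow> coord p (lead l g) = coord p (lead l h)"
  shows "coset_class M (Suc l) (proj g) = coset_class M (Suc l) (proj h)"
proof -
  have c: "g \<in> carrier F" "h \<in> carrier F" using g F.lower_central_in_carrier by blast+
  have hi: "inv\<^bsub>F\<^esub> h \<in> lower_central F (Suc l)" using g by simp
  have "proj (g \<otimes>\<^bsub>F\<^esub> inv\<^bsub>F\<^esub> h) \<in> lower_central M (Suc (Suc l))"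
    using proj_lower_central_iff[OF S, of "g \<otimes>\<^bsub>F\<^esub> inv\<^bsub>F\<^esub> h" l] g hi eq
    by (auto simp: coord_lead_mult[OF g(1) hi] coord_lead_inv[OF g(2)] intro!: exI[of _ "\<lambda>_. 0"])
  then show ?thesis using c by (simp add: M.coset_class_eq_iff)
qed

text \<open>\<open>ab_rank_quotient\<close> with basic commutators as coordinates and the vectors
  \<open>m * rho\<close> as relations. The choice in \<open>lift\<close> is harmless, since by
  \<open>coset_class_proj_cong\<close> the class depends only on the coordinates.\<close>

lemma ab_rank_gr_part:
  assumes S: "finite S"
  shows "ab_rank (gr_part M (Suc l)) + card (relator_index l) = card (index l)"
proof -
  define lift where "lift x = (SOME g. g \<in> lower_central F (Suc l) \<and> (\<forall>p\<in>index l. coord p (lead l g) = x p))" for x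
  have lift: "lift x \<in> lower_central F (Suc l)" "\<And>p. p \<in> index l \<Longrightarrow> coord p (lead l (lift x)) = x p" for x
  proof -
    have "\<exists>g. g \<in> lower_central F (Suc l) \<and> (\<forall>p\<in>index l. coord p (lead l g) = x p)"
      using ex_lead_coord[OF S, of l x] by blast
    from someI_ex[OF this] show "lift x \<in> lower_central F (Suc l)"
      "\<And>p. p \<in> index l \<Longrightarrow> coord p (lead l (lift x)) = x p" by (auto simp: lift_def)
  qed
  define h where "h x = coset_class M (Suc l) (proj (lift x))" for x
  define u where "u m p = (if p \<in> index l then coord p (\<lambda>j. Poly_Mapping.single m 1 * rho j) else 0)" for m p
  have pl: "proj (lift x) \<in> lower_central M (Suc l)" for x using lift proj_lower_central_mem by blast
  have u_sum: "(\<Sum>m\<in>relator_index l. c m * u m p) = (if p \<in> index l then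
      (\<Sum>m\<in>relator_index l. c m * coord p (\<lambda>j. Poly_Mapping.single m 1 * rho j)) else 0)" for c p
    by (auto simp: u_def)
  show ?thesis
  proof (rule ab_rank_quotient[where h = h and u = u])
    show "comm_group (gr_part M (Suc l))" by (rule M.gr_part_comm_group) simp
    show "finite (index l)" "finite (relator_index l)" using finite_index[OF S] by auto
    show "h x \<in> carrier (gr_part M (Suc l))" for x
      using pl by (auto simp: h_def M.carrier_gr_part)
    show "h (\<lambda>i. x i + y i) = h x \<otimes>\<^bsub>gr_part M (Suc l)\<^esub> h y" for x y
    proof -
      have "coset_class M (Suc l) (proj (lift (\<lambda>i. x i + y i))) =
          coset_class M (Suc l) (proj (lift x \<otimes>\<^bsub>F\<^esub> lift y))"
        by (rule coset_class_proj_cong[OF S]) (use lift coord_lead_mult in auto)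
      then show ?thesis
        using pl F.lower_central_in_carrier[OF lift(1)] by (simp add: h_def M.mult_gr_part)
    qed
    show "\<exists>x\<in>{x. \<forall>i. i \<notin> index l \<longrightarrow> x i = 0}. h x = a" if a: "a \<in> carrier (gr_part M (Suc l))" for a
    proof -
      obtain y where y: "y \<in> lower_central M (Suc l)" "a = coset_class M (Suc l) y"
        using a by (auto simp: M.carrier_gr_part)
      obtain g where g: "g \<in> lower_central F (Suc l)" "y = proj g"
        using y(1) proj_lower_central by blast
      define x where "x p = (if p \<in> index l then coord p (lead l g) else 0)" for p
      have "h x = a"
        unfolding h_def y(2) g(2) by (rule coset_class_proj_cong[OF S lift(1) g(1)]) (simp add: lift x_def)
      then show ?thesis by (intro bexI[of _ x]) (auto simp: x_def)
    qed
    show "u m \<in> {x. \<forall>i. i \<notin> index l \<longrightarrow> x i = 0}" for m by (simp add: u_def)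
    show "h x = \<one>\<^bsub>gr_part M (Suc l)\<^esub> \<longleftrightarrow> (\<exists>c. \<forall>i. x i = (\<Sum>m\<in>relator_index l. c m * u m i))"
      if x: "x \<in> {x. \<forall>i. i \<notin> index l \<longrightarrow> x i = 0}" for x
    proof -
      have "h x = \<one>\<^bsub>gr_part M (Suc l)\<^esub> \<longleftrightarrow> proj (lift x) \<in> lower_central M (Suc (Suc l))"
        using M.coset_class_eq_one_iff[OF M.lower_central_in_carrier[OF pl]] by (simp add: h_def M.one_gr_part)
      also have "\<dots> \<longleftrightarrow> (\<exists>c. \<forall>p\<in>index l. x p =
          (\<Sum>m\<in>relator_index l. c m * coord p (\<lambda>j. Poly_Mapping.single m 1 * rho j)))"
        unfolding proj_lower_central_iff[OF S lift(1)] using lift(2)[of _ x] by (intro ex_cong1 ball_cong) auto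
      also have "\<dots> \<longleftrightarrow> (\<exists>c. \<forall>i. x i = (\<Sum>m\<in>relator_index l. c m * u m i))"
        unfolding u_sum using x by (intro ex_cong1) auto
      finally show ?thesis .
    qed
    \<comment> \<open>The relations are independent because polynomials form a domain and some
      component of \<open>rho\<close> is nonzero.\<close>
    show "\<forall>m\<in>relator_index l. c m = 0" if c: "\<forall>i\<in>index l. (\<Sum>m\<in>relator_index l. c m * u m i) = 0" for c
    proof -
      let ?c = "\<Sum>m\<in>relator_index l. Poly_Mapping.single m (c m)"
      note fin = finite_index(2)[OF S, of l]
      have z: "coord p (\<lambda>j. ?c * rho j) = coord p (\<lambda>j. 0)" if "p \<in> index l" for p
        using c that coord_relator[OF fin, of p c] by (simp add: u_sum coord_linear)
      obtain y where y: "\<forall>j. fm_val y j = ?c * rho j" using ex_fm_relator by blast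
      have "?c * rho j = 0" for j
        by (rule supported_eqI[where l = l and w = "\<lambda>j. 0" and y = 0, OF supported_relator _ y _ z])
          (use relator_sum[OF S] in \<open>auto simp: supported_def fm_val_simps\<close>)
      moreover obtain j where "rho j \<noteq> 0" using nonzero by blast
      ultimately have "?c = 0" by (metis mult_eq_0_iff)
      then have "Poly_Mapping.lookup ?c m = 0" for m by simp
      then have "(if m \<in> relator_index l then c m else 0) = 0" for m
        using fin by (simp add: lookup_sum lookup_single when_def)
      then show ?thesis by metis
    qed
  qed
qed

text \<open>For l > 0 the pairs (i, m) that fail to be basic have i at most the minimum of m. Adding
  i to m identifies them with the multisets of size l + 1, and i is recovered as the
  minimum.\<close>

lemma card_index:
  assumes S: "finite S"
  shows "card (index 0) = card S"
    and "0 < l \<Longrightarrow> card (index l) + card (multisets_of_size S (Suc l)) = card S * card (multisets_of_size S l)"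
proof -
  have "index 0 = (\<lambda>i. (i, {#})) ` S" by (auto simp: index_def basic_index_def)
  then show "card (index 0) = card S" by (simp add: card_image inj_on_def)
next
  assume l: "0 < l"
  let ?A = "S \<times> multisets_of_size S l"
  let ?B = "{(i, m). i \<in> S \<and> m \<in> multisets_of_size S l \<and> \<not> Min_mset m < i}"
  have ne: "m \<noteq> {#}" if "m \<in> multisets_of_size S l" for m using that l by (auto simp: multisets_of_size_def)
  have "index l = ?A - ?B"
    using ne by (auto simp: index_def basic_index_def)
  moreover have fB: "finite ?B" "?B \<subseteq> ?A"
    using S finite_multisets_of_size by (auto intro: finite_subset[of _ ?A])
  moreover have "card ?B = card (multisets_of_size S (Suc l))"
  proof (rule bij_betw_same_card[of "\<lambda>(i, m). add_mset i m"], rule bij_betw_imageI)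
    have min: "Min_mset (add_mset i m) = i" if "(i, m) \<in> ?B" for i m
      using that ne[of m] by (intro Min_eqI) (auto simp: not_less)
    show "inj_on (\<lambda>(i, m). add_mset i m) ?B"
    proof (rule inj_onI, clarify)
      fix i m j k assume a: "i \<in> S" "m \<in> multisets_of_size S l" "\<not> Min_mset m < i"
        "j \<in> S" "k \<in> multisets_of_size S l" "\<not> Min_mset k < j" "add_mset i m = add_mset j k"
      then have "i = j" using min[of i m] min[of j k] by simp
      then show "i = j \<and> m = k" using a by simp
    qed
    show "(\<lambda>(i, m). add_mset i m) ` ?B = multisets_of_size S (Suc l)"
    proof
      show "(\<lambda>(i, m). add_mset i m) ` ?B \<subseteq> multisets_of_size S (Suc l)"
        by (auto simp: multisets_of_size_def)
      show "multisets_of_size S (Suc l) \<subseteq> (\<lambda>(i, m). add_mset i m) ` ?B"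
      proof
        fix m assume m: "m \<in> multisets_of_size S (Suc l)"
        show "m \<in> (\<lambda>(i, m). add_mset i m) ` ?B"
        proof (cases m rule: multiset_Min_cases)
          case 1
          then show ?thesis using m by (simp add: multisets_of_size_def)
        next
          case (2 j m')
          then have "m' \<in> multisets_of_size S l" "j \<in> S" using m by (auto simp: multisets_of_size_def)
          moreover have "\<not> Min_mset m' < j" using 2(2) ne[OF calculation(1)] by (simp add: not_less)
          ultimately show ?thesis using 2(1) by (intro image_eqI[of _ _ "(j, m')"]) auto
        qed
      qed
    qed
  qed
  ultimately show "card (index l) + card (multisets_of_size S (Suc l)) = card S * card (multisets_of_size S l)"
    using card_mono[OF finite_cartesian_product fB(2)] S finite_multisets_of_size[of S l]
    by (simp add: card_Diff_subset card_cartesian_product)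
qed

text \<open>With h_l the number of monomials of degree l, the rank in degree l + 1 > 1 is n h_l -
  h_(l+1) from the basic commutators, less h_(l-1) for the relator. These are the coefficients of
  -(1 - n X + X^2) times the sum of h_l X^l, and the summand 1 + n X corrects degrees 0 and
  1.\<close>

lemma hilbert_series_metab:
  assumes S: "finite S"
  shows "hilbert_series M = 1 + of_nat (card S) * fps_X -
    (1 - of_nat (card S) * fps_X + fps_X ^ 2) / (1 - fps_X) ^ card S"
proof -
  let ?n = "card S"
  define h where "h l = (of_nat (card (multisets_of_size S l)) :: rat)" for l
  \<comment> \<open>A nonzero component of \<open>rho\<close> has its index in S, so n > 0, as the
    expansion of (1 - X)^(-n) used below requires.\<close>
  obtain j where "rho j \<noteq> 0" using nonzero by blast
  then have "j \<in> S"
    using fox_deriv_outside[of r j] relator(1) F.lower_central_in_carrier[of r 2]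
    by (fastforce simp: free_group_simps)
  then have n: "0 < ?n" using S by (auto simp: card_gt_0_iff)
  have hn: "h l = of_nat ((?n + l - 1) choose l)" for l
    using S by (simp add: h_def card_multisets_of_size)
  have h0: "h 0 = 1" and h1: "h (Suc 0) = of_nat ?n" by (simp_all add: hn)
  have inv: "inverse ((1 - fps_X) ^ ?n) = Abs_fps h"
    using one_minus_const_fps_X_neg_power'[OF n, of "1 :: rat"] by (simp add: hn[abs_def])
  have rank: "of_nat (ab_rank (gr_part M (Suc l))) =
      (if l = 0 then of_nat ?n else of_nat ?n * h l - h (Suc l) - h (l - 1))" for l
  proof (cases l)
    case 0
    then show ?thesis using ab_rank_gr_part[OF S, of 0] card_index(1)[OF S] by (simp add: relator_index_def)
  next
    case (Suc k)
    have "ab_rank (gr_part M (Suc l)) + card (multisets_of_size S k) + card (multisets_of_size S (Suc l)) =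
        ?n * card (multisets_of_size S l)"
      using ab_rank_gr_part[OF S, of l] card_index(2)[OF S, of l] Suc by (simp add: relator_index_def)
    from arg_cong[OF this, of "of_nat :: nat \<Rightarrow> rat"] show ?thesis using Suc by (simp add: h_def)
  qed
  have "hilbert_series M $ k =
      (1 + of_nat ?n * fps_X - (1 - of_nat ?n * fps_X + fps_X ^ 2) * Abs_fps h) $ k" for k
  proof (cases k)
    case 0
    then show ?thesis by (simp add: hilbert_series_def h0)
  next
    case (Suc l)
    have "hilbert_series M $ k = (if l = 0 then of_nat ?n else of_nat ?n * h l - h (Suc l) - h (l - 1))"
      using Suc rank[of l] by (simp add: hilbert_series_def)
    moreover have "(of_nat ?n * fps_X :: rat fps) $ Suc l = (if l = 0 then of_nat ?n else 0)"
      "(of_nat ?n * fps_X * Abs_fps h) $ Suc l = of_nat ?n * h l"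
      "(fps_X ^ 2 * Abs_fps h) $ Suc l = (if l = 0 then 0 else h (l - 1))"
      by (auto simp: fps_of_nat[symmetric] mult.assoc fps_X_power_mult_nth numeral_2_eq_2 fps_X_nth simp del: fps_of_nat)
    ultimately show ?thesis using Suc by (simp add: ring_distribs h0 h1)
  qed
  then show ?thesis unfolding fps_eq_iff by (simp add: fps_divide_unit inv)
qed

end

section \<open>The quotient by the second derived subgroup\<close>

lemma (in group) normal_closure_normal:
  assumes "A \<subseteq> carrier G"
  shows "normal_closure G A \<lhd> G" "A \<subseteq> normal_closure G A"
proof -
  let ?N = "{N. N \<lhd> G \<and> A \<subseteq> N}"
  have ne: "carrier G \<in> ?N" using assms normal_self by simp
  show "A \<subseteq> normal_closure G A" by (auto simp: normal_closure_def)
  show "normal_closure G A \<lhd> G"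
    unfolding normal_closure_def
  proof (rule normal_invI)
    show "subgroup (\<Inter>?N) G"
      using ne by (intro subgroups_Inter) (auto dest: normal_imp_subgroup)
    fix x h assume x: "x \<in> carrier G" "h \<in> \<Inter>?N"
    show "x \<otimes> h \<otimes> inv x \<in> \<Inter>?N"
    proof
      fix N assume N: "N \<in> ?N"
      then show "x \<otimes> h \<otimes> inv x \<in> N" using x normal.inv_op_closed2[of N G x h] by simp
    qed
  qed
qed

lemma normal_closure_least: "N \<lhd> G \<Longrightarrow> A \<subseteq> N \<Longrightarrow> normal_closure G A \<subseteq> N"
  by (auto simp: normal_closure_def)

lemma (in group) second_derived_normal: "second_derived G \<lhd> G"
  unfolding second_derived_def by (intro derived_is_normal normal_self)

lemma (in group_hom) second_derived_img:
  assumes "h ` carrier G = carrier H"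
  shows "h ` second_derived G = second_derived H"
  unfolding second_derived_def
  using derived_img[of "carrier G"] derived_img[of "derived G (carrier G)"] G.derived_in_carrier[of "carrier G"]
  by (simp add: assms)

lemma (in normal) quotient_hom:
  "group_hom G (G Mod H) ((#>) H)" "(#>) H ` carrier G = carrier (G Mod H)"
  by (auto intro!: group_hom.intro group_hom_axioms.intro r_coset_hom_Mod factorgroup_is_group is_group
      simp: carrier_FactGroup)

context group
begin

text \<open>The commutator lies in the second derived subgroup of the quotient, which is the image
  of that of G and hence trivial.\<close>

lemma mod_second_derived_metabelian:
  defines "M \<equiv> G Mod second_derived G"
  assumes "a \<in> lower_central M 2" "b \<in> lower_central M 2"
  shows "commutator M a b = \<one>\<^bsub>M\<^esub>"
proof -
  interpret D: normal "second_derived G" G by (rule second_derived_normal)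
  interpret q: group_hom G M "(#>) (second_derived G)" unfolding M_def by (rule D.quotient_hom)
  have "commutator M a b \<in> second_derived M"
    unfolding second_derived_def derived_eq_lower_central derived_def[of M "lower_central M 2"] commutator_def
    using assms(2,3) by (intro generate.incl) blast
  also have "second_derived M = (#>) (second_derived G) ` second_derived G"
    using q.second_derived_img D.quotient_hom(2) by (simp add: M_def)
  finally obtain x where "x \<in> second_derived G" "commutator M a b = second_derived G #> x" by blast
  then show ?thesis using D.rcos_const[OF is_group] by (simp add: M_def)
qed

end

context fox
begin

text \<open>G'' is the image of F'', so an element mapping into it is a product of an element of the
  normal closure of r and one of F''. Both factors lie in the normal subgroup
  \<open>relator_kernel r\<close>.\<close>

lemma mod_relator_kernel:
  assumes r: "r \<in> lower_central F 2"
  defines "N \<equiv> normal_closure F {r}"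
  defines "G \<equiv> F Mod N"
  assumes g: "g \<in> carrier F" "N #>\<^bsub>F\<^esub> g \<in> second_derived G"
  shows "g \<in> relator_kernel r"
proof -
  have rF: "{r} \<subseteq> carrier F" using r F.lower_central_in_carrier by blast
  interpret N: normal N F unfolding N_def by (rule F.normal_closure_normal[OF rF])
  interpret q: group_hom F G "(#>\<^bsub>F\<^esub>) N" unfolding G_def by (rule N.quotient_hom)
  have K: "subgroup (relator_kernel r) F" using relator_kernel_normal normal_imp_subgroup by blast
  have NK: "N \<subseteq> relator_kernel r"
    unfolding N_def using relator_kernel_normal relator_in_kernel[OF r] by (intro normal_closure_least) auto
  have "N #>\<^bsub>F\<^esub> g \<in> (#>\<^bsub>F\<^esub>) N ` second_derived F"
    using g(2) q.second_derived_img N.quotient_hom(2) by (simp add: G_def)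
  then obtain d where d: "d \<in> second_derived F" "N #>\<^bsub>F\<^esub> g = N #>\<^bsub>F\<^esub> d" by blast
  have "g \<in> N #>\<^bsub>F\<^esub> d" using F.rcos_self[OF g(1) N.is_subgroup] d(2) by simp
  then obtain x where "x \<in> N" "g = x \<otimes>\<^bsub>F\<^esub> d" by (auto simp: r_coset_def)
  then show ?thesis using subgroup.m_closed[OF K] NK d(1) second_derived_in_kernel by blast
qed

lemma one_relator_metab_presentation:
  assumes r: "r \<in> lower_central F 2"
    and t0: "t0 \<in> lie_terms S" "lie_eval (gr F) (\<lambda>i. gr_class F (Suc 0) (free_gen i)) t0 = gr_class F 2 r"
  defines "N \<equiv> normal_closure F {r}"
  defines "G \<equiv> F Mod N"
  shows "metab_presentation S (G Mod second_derived G)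
    (\<lambda>w. second_derived G #>\<^bsub>G\<^esub> (N #>\<^bsub>F\<^esub> w)) r t0"
proof -
  have rF: "{r} \<subseteq> carrier F" using r F.lower_central_in_carrier by blast
  interpret N: normal N F unfolding N_def by (rule F.normal_closure_normal[OF rF])
  interpret q: group_hom F G "(#>\<^bsub>F\<^esub>) N" unfolding G_def by (rule N.quotient_hom)
  interpret D: normal "second_derived G" G by (rule q.H.second_derived_normal)
  interpret p: group_hom G "G Mod second_derived G" "(#>\<^bsub>G\<^esub>) (second_derived G)" by (rule D.quotient_hom)
  have q_surj: "(#>\<^bsub>F\<^esub>) N ` carrier F = carrier G" unfolding G_def by (rule N.quotient_hom(2))
  have "N #>\<^bsub>F\<^esub> r = \<one>\<^bsub>G\<^esub>"
    using F.normal_closure_normal(2)[OF rF] N.rcos_const[OF F.is_group, of r] by (simp add: N_def G_def)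
  then have rel: "second_derived G #>\<^bsub>G\<^esub> (N #>\<^bsub>F\<^esub> r) = \<one>\<^bsub>G Mod second_derived G\<^esub>" by simp
  show ?thesis
  proof (intro metab_presentation.intro metab_presentation_axioms.intro)
    show "group (G Mod second_derived G)" by (rule p.H.is_group)
    show "(\<lambda>w. second_derived G #>\<^bsub>G\<^esub> (N #>\<^bsub>F\<^esub> w)) \<in> hom F (G Mod second_derived G)"
      using hom_compose[OF q.homh p.homh] by (simp add: comp_def)
    show "(\<lambda>w. second_derived G #>\<^bsub>G\<^esub> (N #>\<^bsub>F\<^esub> w)) ` carrier F = carrier (G Mod second_derived G)"
      using D.quotient_hom(2) unfolding q_surj[symmetric] image_image .
    show "g \<in> relator_kernel r"
      if g: "g \<in> carrier F" "second_derived G #>\<^bsub>G\<^esub> (N #>\<^bsub>F\<^esub> g) = \<one>\<^bsub>G Mod second_derived G\<^esub>" for g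
    proof -
      have "N #>\<^bsub>F\<^esub> g \<in> second_derived G"
        by (rule q.H.coset_join1[OF g(2)[unfolded one_FactGroup] q.hom_closed[OF g(1)] D.is_subgroup])
      then show ?thesis unfolding G_def N_def by (rule mod_relator_kernel[OF r g(1)])
    qed
    show "commutator (G Mod second_derived G) a b = \<one>\<^bsub>G Mod second_derived G\<^esub>"
      if "a \<in> lower_central (G Mod second_derived G) 2" "b \<in> lower_central (G Mod second_derived G) 2" for a b
      using that by (rule q.H.mod_second_derived_metabelian)
  qed (use r rel t0 in auto)
qed

end

theorem theorem7p3:
  fixes n :: nat and r :: "(nat \<times> bool) list"
    and F :: "(nat \<times> bool) list monoid"
    and G :: "(nat \<times> bool) list set monoid"
    and M :: "(nat \<times> bool) list set set monoid"
    and L :: "(int, (int, nat) lie_term set) module"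
    and y :: "nat \<Rightarrow> (int, nat) lie_term set"
    and rbar :: "(int, nat) lie_term set"
    and J :: "(int, nat) lie_term set set"
  assumes F_def: "F = free_group {1..n}"
    and G_def: "G = one_relator_group n r"
    and M_def: "M = G Mod second_derived G"
    and L_def: "L = free_lie {1..n}"
    and y_def: "y = free_lie_gen {1..n}"
    and r: "r \<in> lower_central F 2"
    and rbar: "rbar \<in> length_part L (y ` {1..n}) 2"
      "free_lie_lift (gr F) (\<lambda>i. gr_class F 1 (free_gen i)) rbar = gr_class F 2 r"
    and nonzero_mod_p: "\<And>p::nat. Factorial_Ring.prime p \<Longrightarrow>
      rbar \<notin> (\<lambda>u. int p \<odot>\<^bsub>L\<^esub> u) ` length_part L (y ` {1..n}) 2"
    and formal: "one_formal G"
    and J_def: "J = alg_ideal L {rbar} <+>\<^bsub>L\<^esub> alg_derived L (alg_derived L (carrier L))"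
  shows "(\<exists>f \<in> alg_iso (alg_quot L J) (gr M).
      (\<forall>i\<in>{1..n}. f (J +>\<^bsub>L\<^esub> y i) = gr_class M 1 (second_derived G #>\<^bsub>G\<^esub> one_relator_gen n r i)) \<and>
      (\<forall>k\<ge>1. f ` length_part (alg_quot L J) ((\<lambda>i. J +>\<^bsub>L\<^esub> y i) ` {1..n}) k = gr_degree M k)) \<and>
    (\<forall>k\<ge>1. torsion_free_group (gr_part M k)) \<and>
    hilbert_series M =
      1 + of_nat n * fps_X - (1 - of_nat n * fps_X + fps_X ^ 2) / (1 - fps_X) ^ n"
proof -
  interpret fox "{1..n}" .
  interpret L0: lie_algebra L unfolding L_def free_lie_def by (rule presented_lie_algebra)
  have yL: "y ` {1..n} \<subseteq> carrier L"
    by (auto simp: y_def free_lie_gen_def L_def free_lie_def presented_lie_simps)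
  have sub: "submodule (length_part L (y ` {1..n}) 2) ring_of_type_algebra L"
    unfolding length_part_def
    by (rule L0.lin_span_submodule) (use L0.monomials_closed[OF _ yL] in blast)
  have "rbar \<in> carrier L" by (rule subsetD[OF L0.type_submoduleD(1)[OF sub] rbar(1)])
  then obtain s where s: "s \<in> lie_terms {1..n}" "rbar = lie_class {1..n} {} s"
    by (auto simp: L_def free_lie_def presented_lie_simps)
  \<comment> \<open>The same choice as in \<open>free_lie_lift\<close>, so that the hypothesis on
    rbar becomes a statement about evaluating t0.\<close>
  define t0 where "t0 = (SOME t. t \<in> rbar)"
  have "s \<in> rbar" unfolding s(2) by (rule lie_class_self[OF s(1)])
  then have "t0 \<in> rbar" unfolding t0_def by (rule someI)
  then have st: "lie_cong {1..n} {} s t0" unfolding s(2) by (rule mem_lie_class)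
  then have t0: "t0 \<in> lie_terms {1..n}" using lie_cong_terms by blast
  have rbar_eq: "rbar = lie_class {1..n} {} t0" unfolding s(2) using st s(1) by (simp add: lie_class_eq_iff)
  interpret metab_presentation "{1..n}" M "\<lambda>w. second_derived G #>\<^bsub>G\<^esub> (normal_closure F {r} #>\<^bsub>F\<^esub> w)" r t0
    unfolding M_def G_def one_relator_group_def F_def
    using r rbar(2) t0 by (intro one_relator_metab_presentation) (auto simp: F_def free_lie_lift_def t0_def)
  have y: "y = (\<lambda>i. lie_class {1..n} {} (Gen i))" by (simp add: y_def free_lie_gen_def fun_eq_iff)
  interpret primitive_presentation "{1..n}" M "\<lambda>w. second_derived G #>\<^bsub>G\<^esub> (normal_closure F {r} #>\<^bsub>F\<^esub> w)" r t0
  proof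
    fix p :: nat assume p: "Factorial_Ring.prime p"
    show "\<exists>j. \<not> of_nat p dvd fox_deriv r j $ 1"
    proof (rule ccontr)
      assume "\<not> (\<exists>j. \<not> of_nat p dvd fox_deriv r j $ 1)"
      \<comment> \<open>If p divided all components of \<open>rho\<close>, then rbar would be p
        times an element of the quadratic part of L.\<close>
      then show False
        using relator_divisible[of p] nonzero_mod_p[OF p] rbar(1)
        unfolding rbar_eq y L_def by simp
    qed
  qed
  have J: "J = alg_ideal L {lie_class {1..n} {} t0} <+>\<^bsub>L\<^esub> alg_derived L (alg_derived L (carrier L))"
    unfolding J_def rbar_eq ..
  have gen: "normal_closure F {r} #>\<^bsub>F\<^esub> free_gen i = one_relator_gen n r i" for i
    by (simp add: one_relator_gen_def F_def)
  show ?thesis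
  proof (intro conjI allI impI)
    show "\<exists>f \<in> alg_iso (alg_quot L J) (gr M).
      (\<forall>i\<in>{1..n}. f (J +>\<^bsub>L\<^esub> y i) = gr_class M 1 (second_derived G #>\<^bsub>G\<^esub> one_relator_gen n r i)) \<and>
      (\<forall>k\<ge>1. f ` length_part (alg_quot L J) ((\<lambda>i. J +>\<^bsub>L\<^esub> y i) ` {1..n}) k = gr_degree M k)"
      using quot_map_iso quot_map_gen quot_map_length_part
      unfolding J y L_def gen by blast
    show "torsion_free_group (gr_part M k)" if "1 \<le> k" for k by (rule gr_part_torsion_free[OF that])
    show "hilbert_series M = 1 + of_nat n * fps_X - (1 - of_nat n * fps_X + fps_X ^ 2) / (1 - fps_X) ^ n"
      using hilbert_series_metab by simp
  qed
qed

end
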